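(* Let $\Omega$, $p_i$, $q_i$, $f_i$ ($i=1,2$) and $X$ be as in the context. Assume the following two conditions. (i) There exist constants $C_i>0$ and functions $\sigma_i\in L^{(p_i^* )'}(\Omega)$, $i=1,2$, such that $$|f_1(x,s,t,\xi,\nu)|\le C_1\left[|s|^{p_1^*-1}+|t|^{\frac{p_2^*}{(p_1^* )'}}+|\xi|^{\frac{p_1}{(p_1^* )'}}+|\nu|^{\frac{p_2}{(p_1^* )'}}\right]+\sigma_1(x),$$ $$|f_2(x,s,t,\xi,\nu)|\le C_2\left[|s|^{\frac{p_1^*}{(p_2^* )'}}+|t|^{p_2^*-1}+|\xi|^{\frac{p_1}{(p_2^* )'}}+|\nu|^{\frac{p_2}{(p_2^* )'}}\right]+\sigma_2(x)$$ for a.e. $x\in\Omega$ and all $s,t\in\mathbb{R}$, $\xi,\nu\in\mathbb{R}^N$. (ii) There are constants $c_i,d_i>0$, $i=1,2$, with $$c_1+c_2+(d_1+d_2)\frac{1}{\min\{\lambda_{1,p_1},\lambda_{1,p_2}\}}<1,$$ and functions $\gamma_i\in L^1(\Omega)$, $i=1,2$, satisfying $$f_1(x,s,t,\xi,\nu)\,s\le c_1\left(|\xi|^{p_1}+|\nu|^{p_2}\right)+d_1\left(|s|^{p_1}+|t|^{p_2}\right)+\gamma_1(x),$$ $$f_2(x,s,t,\xi,\nu)\,t\le c_2\left(|\xi|^{p_1}+|\nu|^{p_2}\right)+d_2\left(|s|^{p_1}+|t|^{p_2}\right)+\gamma_2(x)$$ for a.e. $x\in\Omega$ and all $s,t\in\mathbb{R}$,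 $\xi,\nu\in\mathbb{R}^N$. Then for every $(\mu_1,\mu_2)\in\mathbb{R}^2$ the Dirichlet system $$-\Delta_{p_1}u+\mu_1\Delta_{q_1}u=f_1(x,u,v,\nabla u,\nabla v)\ \text{in }\Omega,\qquad -\Delta_{p_2}v+\mu_2\Delta_{q_2}v=f_2(x,u,v,\nabla u,\nabla v)\ \text{in }\Omega,\qquad u=v=0\ \text{on }\partial\Omega$$ possesses a generalized solution $(u,v)\in X$.
   Context: Standing assumptions: $\Omega\subseteq\mathbb{R}^N$, $N\ge 2$, is a bounded domain with Lipschitz boundary; $1<q_i<p_i<N$ for $i=1,2$; $f_i:\Omega\times\mathbb{R}^2\times\mathbb{R}^{2N}\to\mathbb{R}$, $i=1,2$, written $f_i(x,s,t,\xi,\nu)$ with $s,t\in\mathbb{R}$, $\xi,\nu\in\mathbb{R}^N$, are Carathéodory functions (measurable in $x$, continuous in $(s,t,\xi,\nu)$ for a.e. $x$). Notation: for $1<r<\infty$, $r':=r/(r-1)$, and for $r<N$, $r^*:=Nr/(N-r)$. $\Delta_r u:=\mathrm{div}(|\nabla u|^{r-2}\nabla u)$. $W^{1,r}_0(\Omega)$ has norm $\|u\|_{1,r}:=\|\nabla u\|_{L^r(\Omega)}$. $\lambda_{1,r}:=\inf_{u\in W_0^{1,r}(\Omega)\setminus\{0\}}\|u\|_{1,r}^r/\|u\|_{L^r(\Omega)}^r>0$ is the first eigenvalue of $-\Delta_r$ in $W^{1,r}_0(\Omega)$. $X:=W^{1,p_1}_0(\Omega)\times W^{1,p_2}_0(\Omega)$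 with norm $\|(u,v)\|:=\|u\|_{1,p_1}+\|v\|_{1,p_2}$, and $X^*$ is its dual. Define $\mathcal{A}_{\mu_1,\mu_2}:X\to X^*$ by $$\langle\mathcal{A}_{\mu_1,\mu_2}(u,v),(\varphi,\psi)\rangle=\int_\Omega\big(|\nabla u|^{p_1-2}\nabla u-\mu_1|\nabla u|^{q_1-2}\nabla u\big)\cdot\nabla\varphi\,dx+\int_\Omega\big(|\nabla v|^{p_2-2}\nabla v-\mu_2|\nabla v|^{q_2-2}\nabla v\big)\cdot\nabla\psi\,dx$$ $$-\int_\Omega f_1(x,u,v,\nabla u,\nabla v)\varphi\,dx-\int_\Omega f_2(x,u,v,\nabla u,\nabla v)\psi\,dx\qquad\text{for all }(u,v),(\varphi,\psi)\in X$$ (well defined under condition (i) of the claim). A pair $(u,v)\in X$ is a generalized solution of the system if there exists a sequence $\{(u_n,v_n)\}\subseteq X$ such that (a) $(u_n,v_n)\rightharpoonup(u,v)$ weakly in $X$; (b) $\mathcal{A}_{\mu_1,\mu_2}(u_n,v_n)\rightharpoonup 0$ weakly in $X^*$; (c) $\lim_{n\to\infty}\langle\mathcal{A}_{\mu_1,\mu_2}(u_n,v_n),(u_n-u,v_n-v)\rangle=0$. *)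

theory Defs
  imports "HOL-Analysis.Analysis" "HOL-Library.Function_Algebras"
begin

section \<open>Functions as a real vector space\<close>

text \<open>
  Addition on functions is the pointwise one of \<^theory>\<open>HOL-Library.Function_Algebras\<close>;
  scalar multiplication is added here. Pairs of functions and functionals on them thereby become
  real vector spaces as well.
\<close>

instantiation "fun" :: (type, real_vector) real_vector
begin

definition scaleR_fun_def: "c *\<^sub>R f = (\<lambda>x. c *\<^sub>R f x)"

instance
  by standard (auto simp: scaleR_fun_def fun_eq_iff algebra_simps)

end


section \<open>Dual spaces and weak convergence\<close>

text \<open>
  A normed space is given by a linear subspace \<open>V\<close> of an ambient real vector space together with a
  seminorm \<open>nrm\<close> on \<open>V\<close>, and stands for the quotient of \<open>V\<close> by the null space of \<open>nrm\<close>. A bounded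
  functional vanishes on that null space, so the dual is unaffected by working with representatives.
  Likewise two functionals that agree on \<open>V\<close> represent the same element of the dual: their difference
  has dual norm zero.
\<close>

definition dual_space :: "'v::real_vector set \<Rightarrow> ('v \<Rightarrow> real) \<Rightarrow> ('v \<Rightarrow> real) set" where
  "dual_space V nrm =
     {L. (\<forall>x\<in>V. \<forall>y\<in>V. L (x + y) = L x + L y) \<and>
         (\<forall>c. \<forall>x\<in>V. L (c *\<^sub>R x) = c * L x) \<and>
         (\<exists>C. \<forall>x\<in>V. \<bar>L x\<bar> \<le> C * nrm x)}"

definition dual_norm :: "'v::real_vector set \<Rightarrow> ('v \<Rightarrow> real) \<Rightarrow> ('v \<Rightarrow> real) \<Rightarrow> real" where
  "dual_norm V nrm L = Sup {\<bar>L x\<bar> | x. x \<in> V \<and> nrm x \<le> 1}"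

definition weakly_converges ::
  "'v::real_vector set \<Rightarrow> ('v \<Rightarrow> real) \<Rightarrow> (nat \<Rightarrow> 'v) \<Rightarrow> 'v \<Rightarrow> bool" where
  "weakly_converges V nrm x l \<longleftrightarrow>
     (\<forall>n. x n \<in> V) \<and> l \<in> V \<and> (\<forall>L\<in>dual_space V nrm. (\<lambda>n. L (x n)) \<longlonglongrightarrow> L l)"


section \<open>Domains\<close>

definition bounded_domain :: "'a::euclidean_space set \<Rightarrow> bool" where
  "bounded_domain \<Omega> \<longleftrightarrow> open \<Omega> \<and> bounded \<Omega> \<and> connected \<Omega> \<and> \<Omega> \<noteq> {}"

text \<open>
  Near each boundary point, \<open>\<Omega>\<close> is the region strictly above a Lipschitz graph over the hyperplane
  orthogonal to some unit vector \<open>e\<close>; choosing \<open>e\<close> amounts to rotating the coordinate axes.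
\<close>

definition lipschitz_boundary :: "'a::euclidean_space set \<Rightarrow> bool" where
  "lipschitz_boundary \<Omega> \<longleftrightarrow>
     (\<forall>x\<in>frontier \<Omega>. \<exists>r>0. \<exists>e. \<exists>g :: 'a \<Rightarrow> real.
        norm e = 1 \<and> (\<exists>K. K-lipschitz_on {y. y \<bullet> e = 0} g) \<and>
        (\<forall>y\<in>ball x r. y \<in> \<Omega> \<longleftrightarrow> g (y - (y \<bullet> e) *\<^sub>R e) < y \<bullet> e))"


section \<open>Lebesgue and Sobolev spaces\<close>

definition Lp_space :: "'a measure \<Rightarrow> real \<Rightarrow> ('a \<Rightarrow> 'b::euclidean_space) set" where
  "Lp_space M r = {g \<in> borel_measurable M. integrable M (\<lambda>x. norm (g x) powr r)}"

definition Lp_norm :: "'a measure \<Rightarrow> real \<Rightarrow> ('a \<Rightarrow> 'b::euclidean_space) \<Rightarrow> real" where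
  "Lp_norm M r g = (\<integral>x. norm (g x) powr r \<partial>M) powr (1 / r)"

primrec times_cont_diff :: "nat \<Rightarrow> ('a::euclidean_space \<Rightarrow> real) \<Rightarrow> bool" where
  "times_cont_diff 0 g \<longleftrightarrow> continuous_on UNIV g"
| "times_cont_diff (Suc k) g \<longleftrightarrow>
     (\<forall>x. g differentiable (at x)) \<and>
     (\<forall>h. times_cont_diff k (\<lambda>x. frechet_derivative g (at x) h))"

definition test_functions :: "'a::euclidean_space set \<Rightarrow> ('a \<Rightarrow> real) set" where
  "test_functions \<Omega> =
     {\<phi>. (\<forall>k. times_cont_diff k \<phi>) \<and>
          compact (closure {x. \<phi> x \<noteq> 0}) \<and> closure {x. \<phi> x \<noteq> 0} \<subseteq> \<Omega>}"

definition locally_integrable ::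
  "'a::euclidean_space set \<Rightarrow> ('a \<Rightarrow> 'b::euclidean_space) \<Rightarrow> bool" where
  "locally_integrable \<Omega> g \<longleftrightarrow> (\<forall>K. compact K \<and> K \<subseteq> \<Omega> \<longrightarrow> integrable (lebesgue_on K) g)"

definition is_weak_gradient ::
  "'a::euclidean_space set \<Rightarrow> ('a \<Rightarrow> real) \<Rightarrow> ('a \<Rightarrow> 'a) \<Rightarrow> bool" where
  "is_weak_gradient \<Omega> u G \<longleftrightarrow>
     locally_integrable \<Omega> u \<and> locally_integrable \<Omega> G \<and>
     (\<forall>\<phi>\<in>test_functions \<Omega>. \<forall>i\<in>Basis.
        (\<integral>x. u x * frechet_derivative \<phi> (at x) i \<partial>lebesgue_on \<Omega>) =
        - (\<integral>x. (G x \<bullet> i) * \<phi> x \<partial>lebesgue_on \<Omega>))"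

text \<open>
  A weak gradient is unique almost everywhere in \<open>\<Omega>\<close>; \<open>grad\<close> selects a representative. Sobolev
  functions are representatives too: only their values in \<open>\<Omega>\<close>, up to null sets, are relevant.
\<close>

definition grad :: "'a::euclidean_space set \<Rightarrow> ('a \<Rightarrow> real) \<Rightarrow> 'a \<Rightarrow> 'a" where
  "grad \<Omega> u = (SOME G. is_weak_gradient \<Omega> u G)"

definition W1 :: "'a::euclidean_space set \<Rightarrow> real \<Rightarrow> ('a \<Rightarrow> real) set" where
  "W1 \<Omega> r = {u \<in> Lp_space (lebesgue_on \<Omega>) r.
                \<exists>G\<in>Lp_space (lebesgue_on \<Omega>) r. is_weak_gradient \<Omega> u G}"

text \<open>The closure of the test functions in the full Sobolev norm.\<close>

definition W10 :: "'a::euclidean_space set \<Rightarrow> real \<Rightarrow> ('a \<Rightarrow> real) set" where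
  "W10 \<Omega> r = {u \<in> W1 \<Omega> r. \<exists>\<phi>. (\<forall>n. \<phi> n \<in> test_functions \<Omega>) \<and>
      (\<lambda>n. Lp_norm (lebesgue_on \<Omega>) r (\<lambda>x. u x - \<phi> n x)) \<longlonglongrightarrow> 0 \<and>
      (\<lambda>n. Lp_norm (lebesgue_on \<Omega>) r (\<lambda>x. grad \<Omega> u x - grad \<Omega> (\<phi> n) x)) \<longlonglongrightarrow> 0}"

definition W10_norm :: "'a::euclidean_space set \<Rightarrow> real \<Rightarrow> ('a \<Rightarrow> real) \<Rightarrow> real" where
  "W10_norm \<Omega> r u = Lp_norm (lebesgue_on \<Omega>) r (grad \<Omega> u)"

definition first_eigenvalue :: "'a::euclidean_space set \<Rightarrow> real \<Rightarrow> real" where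
  "first_eigenvalue \<Omega> r =
     Inf {W10_norm \<Omega> r u powr r / Lp_norm (lebesgue_on \<Omega>) r u powr r | u.
            u \<in> W10 \<Omega> r \<and> \<not> (AE x in lebesgue_on \<Omega>. u x = 0)}"

definition conj_exp :: "real \<Rightarrow> real" where
  "conj_exp r = r / (r - 1)"

definition sobolev_exp :: "nat \<Rightarrow> real \<Rightarrow> real" where
  "sobolev_exp N r = real N * r / (real N - r)"


section \<open>The Dirichlet system\<close>

definition caratheodory ::
  "'a::euclidean_space set \<Rightarrow> ('a \<Rightarrow> real \<Rightarrow> real \<Rightarrow> 'a \<Rightarrow> 'a \<Rightarrow> real) \<Rightarrow> bool" where
  "caratheodory \<Omega> f \<longleftrightarrow>
     (\<forall>s t \<xi> \<nu>. (\<lambda>x. f x s t \<xi> \<nu>) \<in> borel_measurable (lebesgue_on \<Omega>)) \<and>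
     (AE x in lebesgue_on \<Omega>. continuous_on UNIV (\<lambda>(s, t, \<xi>, \<nu>). f x s t \<xi> \<nu>))"

definition X_space ::
  "'a::euclidean_space set \<Rightarrow> real \<Rightarrow> real \<Rightarrow> (('a \<Rightarrow> real) \<times> ('a \<Rightarrow> real)) set" where
  "X_space \<Omega> p1 p2 = W10 \<Omega> p1 \<times> W10 \<Omega> p2"

definition X_norm ::
  "'a::euclidean_space set \<Rightarrow> real \<Rightarrow> real \<Rightarrow> ('a \<Rightarrow> real) \<times> ('a \<Rightarrow> real) \<Rightarrow> real" where
  "X_norm \<Omega> p1 p2 = (\<lambda>(u, v). W10_norm \<Omega> p1 u + W10_norm \<Omega> p2 v)"

text \<open>The value \<open>0\<close> at \<open>\<xi> = 0\<close> is correct also for \<open>r < 2\<close>, as \<open>0 powr a = 0\<close>.\<close>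

definition flux :: "real \<Rightarrow> 'a::euclidean_space \<Rightarrow> 'a" where
  "flux r \<xi> = norm \<xi> powr (r - 2) *\<^sub>R \<xi>"

definition system_operator ::
  "'a::euclidean_space set \<Rightarrow> real \<Rightarrow> real \<Rightarrow> real \<Rightarrow> real \<Rightarrow>
   ('a \<Rightarrow> real \<Rightarrow> real \<Rightarrow> 'a \<Rightarrow> 'a \<Rightarrow> real) \<Rightarrow> ('a \<Rightarrow> real \<Rightarrow> real \<Rightarrow> 'a \<Rightarrow> 'a \<Rightarrow> real) \<Rightarrow>
   real \<Rightarrow> real \<Rightarrow> ('a \<Rightarrow> real) \<times> ('a \<Rightarrow> real) \<Rightarrow> ('a \<Rightarrow> real) \<times> ('a \<Rightarrow> real) \<Rightarrow> real" where
  "system_operator \<Omega> p1 p2 q1 q2 f1 f2 \<mu>1 \<mu>2 = (\<lambda>(u, v) (\<phi>, \<psi>).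
       (\<integral>x. (flux p1 (grad \<Omega> u x) - \<mu>1 *\<^sub>R flux q1 (grad \<Omega> u x)) \<bullet> grad \<Omega> \<phi> x \<partial>lebesgue_on \<Omega>)
     + (\<integral>x. (flux p2 (grad \<Omega> v x) - \<mu>2 *\<^sub>R flux q2 (grad \<Omega> v x)) \<bullet> grad \<Omega> \<psi> x \<partial>lebesgue_on \<Omega>)
     - (\<integral>x. f1 x (u x) (v x) (grad \<Omega> u x) (grad \<Omega> v x) * \<phi> x \<partial>lebesgue_on \<Omega>)
     - (\<integral>x. f2 x (u x) (v x) (grad \<Omega> u x) (grad \<Omega> v x) * \<psi> x \<partial>lebesgue_on \<Omega>))"

definition generalized_solution ::
  "'a::euclidean_space set \<Rightarrow> real \<Rightarrow> real \<Rightarrow> real \<Rightarrow> real \<Rightarrow>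
   ('a \<Rightarrow> real \<Rightarrow> real \<Rightarrow> 'a \<Rightarrow> 'a \<Rightarrow> real) \<Rightarrow> ('a \<Rightarrow> real \<Rightarrow> real \<Rightarrow> 'a \<Rightarrow> 'a \<Rightarrow> real) \<Rightarrow>
   real \<Rightarrow> real \<Rightarrow> ('a \<Rightarrow> real) \<times> ('a \<Rightarrow> real) \<Rightarrow> bool" where
  "generalized_solution \<Omega> p1 p2 q1 q2 f1 f2 \<mu>1 \<mu>2 w \<longleftrightarrow>
     (let X = X_space \<Omega> p1 p2; nX = X_norm \<Omega> p1 p2;
          A = system_operator \<Omega> p1 p2 q1 q2 f1 f2 \<mu>1 \<mu>2
      in w \<in> X \<and> (\<exists>W. (\<forall>n. W n \<in> X) \<and>
           weakly_converges X nX W w \<and>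
           weakly_converges (dual_space X nX) (dual_norm X nX) (\<lambda>n. A (W n)) 0 \<and>
           (\<lambda>n. A (W n) (W n - w)) \<longlonglongrightarrow> 0))"

end

theory Submission
  imports Defs "HOL-Library.Diagonal_Subsequence" "HOL-Homology.Homology"
begin

text \<open>The solution is a weak limit of Galerkin approximations. There is a countable set of test functions whose
  gradients are uniformly dense among all gradients of test functions (\<open>countable_dense_gradients\<close>); an
  independent set with the same span is exhausted by finite sets \<open>F n\<close>. On pairs from the span of \<open>F n\<close> the operator \<open>A\<close>
  of the system is a continuous vector field in the coordinates. Tested with its own argument it is coercive
  (\<open>coercive\<close>): the terms with \<open>\<mu>1\<close>, \<open>\<mu>2\<close> are of lower order since \<open>q1 < p1\<close> and \<open>q2 < p2\<close>, and the sign conditions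
  cost at most the fraction \<open>c1 + c2 + (d1 + d2) / l < 1\<close> of the leading terms, \<open>l\<close> being the smaller first
  eigenvalue. So the field points outwards on large spheres and has a zero, as spheres are not
  contractible (\<open>finite_dim_zero\<close>). This gives a bounded sequence \<open>w n = (u n, v n)\<close> such that the functional \<open>A (w n)\<close>
  vanishes on all pairs from the span of \<open>F n\<close> (\<open>Galerkin_step\<close>).

  By Sobolev's inequality the growth conditions make \<open>A\<close> bounded on bounded sets (\<open>A_bounded\<close>). Bounded functionals
  that vanish on increasing subspaces with dense union converge to zero at every point. The space \<open>X\<close> is reflexive
  (\<open>reflexive_X\<close>), so this is weak convergence of \<open>A (w n)\<close> to \<open>0\<close> in the dual. A subsequence of \<open>w n\<close> converges weakly to
  some \<open>w\<close> (\<open>weak_compactness_X\<close>). Finally \<open>A (w n)\<close> vanishes at \<open>w n\<close>, so its value at \<open>w n - w\<close> is minus its value at \<open>w\<close>,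
  which tends to zero.

  Reflexivity and weak compactness rest on one variational fact (\<open>minimiser_Euler_Lagrange\<close>): on a closed
  subspace of a Lebesgue space a convex functional of \<open>p\<close>-Laplace type attains its minimum, because uniform convexity
  makes minimising sequences Cauchy. Its Euler-Lagrange equation represents bounded functionals and provides
  projections; representing an element of the bidual in the dual exponent and projecting it back onto the subspace
  gives reflexivity.

  The spaces themselves need four facts. Weak gradients are unique by the fundamental lemma of the calculus of
  variations, so \<open>grad\<close> is linear almost everywhere. Sobolev's inequality is proved for test functions by Gagliardo's
  method of integrating along coordinate lines (\<open>Sobolev_test\<close>), and Fatou's lemma extends it to the closure. On
  bounded sets it implies Poincare's inequality, hence completeness in the gradient norm
  (\<open>W10_complete\<close>) and positivity of the first eigenvalue (\<open>eigenvalue\<close>).\<close>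

section \<open>Modulars of Lebesgue spaces\<close>

text \<open>The \<open>p\<close>-th power of the norm. It is the integral of a pointwise expression and,
  up to the factor \<open>2 powr p\<close>, subadditive for every \<open>p \<ge> 0\<close>; since convergence to \<open>0\<close> and boundedness are the same for both, most
  estimates are carried out for the modular.\<close>

definition pmod :: "'a measure \<Rightarrow> real \<Rightarrow> ('a \<Rightarrow> 'b::euclidean_space) \<Rightarrow> real" where
  "pmod M p f = (\<integral>x. norm (f x) powr p \<partial>M)"

lemma Lp_norm_pmod: "Lp_norm M p f = pmod M p f powr (1 / p)"
  by (simp add: Lp_norm_def pmod_def)

lemma pmod_nonneg [simp]: "0 \<le> pmod M p f"
  by (simp add: pmod_def)

lemma Lp_norm_powr: "p > 0 \<Longrightarrow> Lp_norm M p f powr p = pmod M p f"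
  by (simp add: Lp_norm_pmod powr_powr)

lemma Lp_norm_nonneg [simp]: "0 \<le> Lp_norm M p f"
  by (simp add: Lp_norm_pmod)

lemma Lp_measurable: "f \<in> Lp_space M p \<Longrightarrow> f \<in> borel_measurable M"
  and Lp_integrable: "f \<in> Lp_space M p \<Longrightarrow> integrable M (\<lambda>x. norm (f x) powr p)"
  by (auto simp: Lp_space_def)

text \<open>The form in which pointwise estimates of one function by another enter membership proofs.\<close>

lemma Lp_bound:
  assumes "g \<in> borel_measurable M" "integrable M h" "AE x in M. norm (g x) powr p \<le> h x"
  shows "g \<in> Lp_space M p" "pmod M p g \<le> (\<integral>x. h x \<partial>M)"
proof -
  note [measurable] = assms(1)
  have i: "integrable M (\<lambda>x. norm (g x) powr p)"
    by (rule Bochner_Integration.integrable_bound[OF assms(2)])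
       (use assms(3) in \<open>auto elim!: eventually_mono\<close>)
  then show "g \<in> Lp_space M p" using assms by (simp add: Lp_space_def)
  show "pmod M p g \<le> (\<integral>x. h x \<partial>M)" unfolding pmod_def by (rule integral_mono_AE[OF i assms(2,3)])
qed

lemma Lp_cong_AE:
  assumes "f \<in> Lp_space M p" "g \<in> borel_measurable M" "AE x in M. f x = g x"
  shows "g \<in> Lp_space M p"
  by (rule Lp_bound[OF assms(2) Lp_integrable[OF assms(1)]]) (use assms(3) in \<open>auto elim!: eventually_mono\<close>)

lemma pmod_cong_AE:
  assumes "f \<in> borel_measurable M" "g \<in> borel_measurable M" "AE x in M. f x = g x"
  shows "pmod M p f = pmod M p g"
proof -
  note [measurable] = assms(1,2)
  show ?thesis unfolding pmod_def
    by (rule integral_cong_AE) (use assms(3) in \<open>auto elim!: eventually_mono\<close>)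
qed

lemma powr_sum_le:
  assumes "a \<ge> 0" "b \<ge> 0" "(p::real) \<ge> 0"
  shows "(a + b) powr p \<le> 2 powr p * (a powr p + b powr p)"
proof -
  have "(a + b) powr p \<le> (2 * max a b) powr p" by (rule powr_mono2) (use assms in auto)
  also have "\<dots> = 2 powr p * (max a b) powr p" using assms by (simp add: powr_mult)
  also have "\<dots> \<le> 2 powr p * (a powr p + b powr p)" by (intro mult_left_mono) (auto simp: max_def)
  finally show ?thesis .
qed

lemma norm_add_powr:
  assumes "(p::real) \<ge> 0"
  shows "norm (a + b) powr p \<le> 2 powr p * (norm a powr p + norm b powr p)"
  by (rule order_trans[OF powr_mono2[OF assms _ norm_triangle_ineq] powr_sum_le]) (use assms in auto)

lemma Lp_scaleR:
  assumes "f \<in> Lp_space M p"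
  shows "(\<lambda>x. c *\<^sub>R f x) \<in> Lp_space M p" "pmod M p (\<lambda>x. c *\<^sub>R f x) = \<bar>c\<bar> powr p * pmod M p f"
  using assms by (auto simp: Lp_space_def pmod_def powr_mult)

lemma Lp_zero: "(\<lambda>x. 0) \<in> Lp_space M p"
  by (simp add: Lp_space_def)

lemma Lp_add:
  assumes "f \<in> Lp_space M p" "g \<in> Lp_space M p" "p \<ge> 0"
  shows "(\<lambda>x. f x + g x) \<in> Lp_space M p"
    and "pmod M p (\<lambda>x. f x + g x) \<le> 2 powr p * (pmod M p f + pmod M p g)"
proof -
  note [measurable] = Lp_measurable[OF assms(1)] Lp_measurable[OF assms(2)]
  have i: "integrable M (\<lambda>x. 2 powr p * (norm (f x) powr p + norm (g x) powr p))"
    by (intro integrable_mult_right Bochner_Integration.integrable_add Lp_integrable assms)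
  have ae: "AE x in M. norm (f x + g x) powr p \<le> 2 powr p * (norm (f x) powr p + norm (g x) powr p)"
    using norm_add_powr[OF assms(3)] by auto
  show "(\<lambda>x. f x + g x) \<in> Lp_space M p" by (rule Lp_bound[OF _ i ae]) measurable
  have "pmod M p (\<lambda>x. f x + g x) \<le> (\<integral>x. 2 powr p * (norm (f x) powr p + norm (g x) powr p) \<partial>M)"
    by (rule Lp_bound[OF _ i ae]) measurable
  also have "\<dots> = 2 powr p * (pmod M p f + pmod M p g)"
    by (simp add: pmod_def Bochner_Integration.integral_add[OF Lp_integrable[OF assms(1)] Lp_integrable[OF assms(2)]])
  finally show "pmod M p (\<lambda>x. f x + g x) \<le> 2 powr p * (pmod M p f + pmod M p g)" .
qed

lemma pmod_uminus: "pmod M p (\<lambda>x. - f x) = pmod M p f"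
  by (simp add: pmod_def)

lemma pmod_minus_commute: "pmod M p (\<lambda>x. f x - g x) = pmod M p (\<lambda>x. g x - f x)"
  by (simp add: pmod_def norm_minus_commute)

lemma Lp_uminus: "f \<in> Lp_space M p \<Longrightarrow> (\<lambda>x. - f x) \<in> Lp_space M p"
  by (auto simp: Lp_space_def)

lemma Lp_diff:
  assumes "f \<in> Lp_space M p" "g \<in> Lp_space M p" "p \<ge> 0"
  shows "(\<lambda>x. f x - g x) \<in> Lp_space M p"
    and "pmod M p (\<lambda>x. f x - g x) \<le> 2 powr p * (pmod M p f + pmod M p g)"
  using Lp_add[OF assms(1) Lp_uminus[OF assms(2)] assms(3)] by (simp_all add: pmod_uminus)

lemma nn_integral_pmod:
  assumes "f \<in> Lp_space M p"
  shows "(\<integral>\<^sup>+x. ennreal (norm (f x) powr p) \<partial>M) = ennreal (pmod M p f)"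
  unfolding pmod_def by (rule nn_integral_eq_integral[OF Lp_integrable[OF assms]]) auto

lemma pmod_eq_0:
  assumes "f \<in> Lp_space M p" "pmod M p f = 0"
  shows "AE x in M. f x = 0"
  using assms integral_nonneg_eq_0_iff_AE[OF Lp_integrable[OF assms(1)]] by (auto simp: pmod_def)

text \<open>Fatou's lemma with a varying bound \<open>b n\<close>: this is how inequalities proved for test functions are passed to
  limits, and how norms are seen to be lower semicontinuous.\<close>

lemma pmod_Fatou:
  assumes f: "\<And>n. f n \<in> Lp_space M p" and g: "g \<in> borel_measurable M"
    and ae: "AE x in M. (\<lambda>n. f n x) \<longlonglongrightarrow> g x"
    and b: "\<And>n. pmod M p (f n) \<le> b n" and l: "b \<longlonglongrightarrow> l" and p: "p > 0"
  shows "g \<in> Lp_space M p" "pmod M p g \<le> l"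
proof -
  note [measurable] = Lp_measurable[OF f] g
  have l0: "0 \<le> l" by (rule LIMSEQ_le_const[OF l]) (use b order_trans[OF pmod_nonneg] in blast)
  have "(\<integral>\<^sup>+x. ennreal (norm (g x) powr p) \<partial>M) = (\<integral>\<^sup>+x. liminf (\<lambda>n. ennreal (norm (f n x) powr p)) \<partial>M)"
  proof (rule nn_integral_cong_AE, use ae in eventually_elim)
    fix x assume "(\<lambda>n. f n x) \<longlonglongrightarrow> g x"
    then have "(\<lambda>n. ennreal (norm (f n x) powr p)) \<longlonglongrightarrow> ennreal (norm (g x) powr p)"
      using p by (intro tendsto_ennrealI tendsto_powr2 tendsto_norm tendsto_const) auto
    then show "ennreal (norm (g x) powr p) = liminf (\<lambda>n. ennreal (norm (f n x) powr p))"
      by (rule lim_imp_Liminf[symmetric, rotated]) simp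
  qed
  also have "\<dots> \<le> liminf (\<lambda>n. \<integral>\<^sup>+x. ennreal (norm (f n x) powr p) \<partial>M)"
    by (rule nn_integral_liminf) measurable
  also have "\<dots> \<le> liminf (\<lambda>n. ennreal (b n))"
    by (rule Liminf_mono) (auto simp: nn_integral_pmod[OF f] b intro!: ennreal_leI always_eventually)
  also have "\<dots> = ennreal l"
    by (rule lim_imp_Liminf) (auto intro: tendsto_ennrealI l)
  finally have le: "(\<integral>\<^sup>+x. ennreal (norm (g x) powr p) \<partial>M) \<le> ennreal l" .
  have "integrable M (\<lambda>x. norm (g x) powr p)"
    by (rule integrableI_bounded) (use le_less_trans[OF le ennreal_less_top] in auto)
  then show *: "g \<in> Lp_space M p" using g by (simp add: Lp_space_def)
  show "pmod M p g \<le> l" using le l0 by (simp add: nn_integral_pmod[OF *])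
qed

text \<open>The \<open>p\<close>-th powers of the differences converge to zero in \<open>L\<^sup>1\<close>, hence almost everywhere along a subsequence.\<close>

lemma pmod_tendsto_AE_subseq:
  assumes "\<And>n. f n \<in> Lp_space M p" "g \<in> Lp_space M p" "(\<lambda>n. pmod M p (\<lambda>x. f n x - g x)) \<longlonglongrightarrow> 0" "p > 0"
  shows "\<exists>r. strict_mono r \<and> (AE x in M. (\<lambda>n. f (r n) x) \<longlonglongrightarrow> g x)"
proof -
  have "(\<lambda>n. \<integral>x. norm (norm (f n x - g x) powr p) \<partial>M) \<longlonglongrightarrow> 0" using assms(3) by (simp add: pmod_def)
  from tendsto_L1_AE_subseq[OF _ this] obtain r where r: "strict_mono r"
    and ae: "AE x in M. (\<lambda>n. norm (f (r n) x - g x) powr p) \<longlonglongrightarrow> 0"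
    using Lp_integrable[OF Lp_diff(1)[OF assms(1,2)]] assms(4) by auto
  have "AE x in M. (\<lambda>n. f (r n) x) \<longlonglongrightarrow> g x" using ae
  proof eventually_elim
    fix x assume "(\<lambda>n. norm (f (r n) x - g x) powr p) \<longlonglongrightarrow> 0"
    then have "(\<lambda>n. (norm (f (r n) x - g x) powr p) powr (1/p)) \<longlonglongrightarrow> 0 powr (1/p)"
      using assms(4) by (intro tendsto_powr2 tendsto_const) auto
    then show "(\<lambda>n. f (r n) x) \<longlonglongrightarrow> g x" using assms(4)
      by (simp add: powr_powr tendsto_norm_zero_iff LIM_zero_iff)
  qed
  with r show ?thesis by blast
qed

subsection \<open>Completeness\<close>

text \<open>With this rate the integrals of \<open>(2\<^sup>n |f (n + 1) - f n|)\<^sup>p\<close> are summable, hence so are the integrands at almost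
  every point. There the increments are eventually at most \<open>2\<^sup>-\<^sup>n\<close>, and the sequence converges geometrically.\<close>

lemma rapid_Cauchy_AE_convergent:
  fixes f :: "nat \<Rightarrow> 'a \<Rightarrow> 'b::euclidean_space"
  assumes f: "\<And>n. f n \<in> Lp_space M p" and p: "p > 0"
    and d: "\<And>n. pmod M p (\<lambda>x. f (Suc n) x - f n x) \<le> (1/2) ^ n * (1/2) powr (p * n)"
  shows "AE x in M. convergent (\<lambda>n. f n x)"
proof -
  note [measurable] = Lp_measurable[OF f]
  define w where "w = (\<lambda>n x. 2 powr (p * real n) * norm (f (Suc n) x - f n x) powr p)"
  have dL: "(\<lambda>x. f (Suc n) x - f n x) \<in> Lp_space M p" for n using Lp_diff(1) f p by (metis less_imp_le)
  have wi: "(\<integral>\<^sup>+x. ennreal (w n x) \<partial>M) \<le> ennreal ((1/2)^n)" for n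
  proof -
    have "(\<integral>\<^sup>+x. ennreal (w n x) \<partial>M) = ennreal (2 powr (p * n)) * ennreal (pmod M p (\<lambda>x. f (Suc n) x - f n x))"
      by (simp add: w_def ennreal_mult nn_integral_cmult nn_integral_pmod[OF dL, symmetric])
    also have "\<dots> \<le> ennreal (2 powr (p * n)) * ennreal ((1/2) ^ n * (1/2) powr (p * n))"
      by (intro mult_left_mono ennreal_leI d) auto
    also have "\<dots> = ennreal ((1/2)^n)"
      by (simp add: ennreal_mult[symmetric] powr_divide)
    finally show ?thesis .
  qed
  have "(\<integral>\<^sup>+x. suminf (\<lambda>n. ennreal (w n x)) \<partial>M) = suminf (\<lambda>n. \<integral>\<^sup>+x. ennreal (w n x) \<partial>M)"
    by (rule nn_integral_suminf) (simp add: w_def)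
  also have "\<dots> \<le> suminf (\<lambda>n. ennreal ((1/2)^n))" by (intro suminf_le wi) auto
  also have "\<dots> < \<infinity>" by (subst suminf_ennreal2) auto
  finally have "AE x in M. suminf (\<lambda>n. ennreal (w n x)) \<noteq> \<infinity>"
    by (intro nn_integral_PInf_AE) (auto simp: w_def)
  then show ?thesis
  proof eventually_elim
    fix x assume s: "suminf (\<lambda>n. ennreal (w n x)) \<noteq> \<infinity>"
    have w0: "0 \<le> w n x" for n by (simp add: w_def)
    have "summable (\<lambda>n. w n x)" using s w0 by (simp add: summable_suminf_not_top)
    then have "eventually (\<lambda>n. w n x < 1) sequentially"
      by (intro order_tendstoD(2)[OF summable_LIMSEQ_zero]) auto
    then have "eventually (\<lambda>n. norm (f (Suc n) x - f n x) \<le> (1/2)^n) sequentially"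
    proof eventually_elim
      fix n assume "w n x < 1"
      have "(2 ^ n * norm (f (Suc n) x - f n x)) powr p = w n x"
        by (simp add: w_def powr_mult powr_powr powr_realpow[symmetric] mult.commute)
      also have "\<dots> \<le> 1 powr p" using \<open>w n x < 1\<close> by simp
      finally have "2 ^ n * norm (f (Suc n) x - f n x) \<le> 1"
        using powr_less_mono2[OF p, of 1] by (meson not_le zero_le_one)
      then show "norm (f (Suc n) x - f n x) \<le> (1/2)^n" by (simp add: field_simps power_divide)
    qed
    then have "summable (\<lambda>n. f (Suc n) x - f n x)"
      by (intro summable_norm_cancel[OF summable_comparison_test_ev[OF _ summable_geometric[of "1/2::real"]]]) auto
    then have "convergent (\<lambda>n. \<Sum>i<n. f (Suc i) x - f i x)" by (simp add: summable_iff_convergent)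
    then have "convergent (\<lambda>n. f n x - f 0 x)" by (simp add: sum_lessThan_telescope[of "\<lambda>n. f n x"])
    then show "convergent (\<lambda>n. f n x)" using convergent_add[OF _ convergent_const[of "f 0 x"]] by fastforce
  qed
qed

lemma Cauchy_rapid_subseq:
  fixes c :: "nat \<Rightarrow> nat \<Rightarrow> real"
  assumes "\<And>e. e > 0 \<Longrightarrow> \<exists>N. \<forall>m\<ge>N. \<forall>n\<ge>N. c m n < e" and "\<And>k. (0::real) < d k"
  shows "\<exists>r. strict_mono r \<and> (\<forall>k. c (r (Suc k)) (r k) < d k)"
proof -
  obtain N where N: "\<And>k m n. m \<ge> N k \<Longrightarrow> n \<ge> N k \<Longrightarrow> c m n < d k"
    using choice[of "\<lambda>k N. \<forall>m\<ge>N. \<forall>n\<ge>N. c m n < d k"] assms by blast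
  define r where "r = rec_nat (N 0) (\<lambda>k v. max (Suc v) (N (Suc k)))"
  have r0: "r 0 = N 0" and rS: "r (Suc k) = max (Suc (r k)) (N (Suc k))" for k by (simp_all add: r_def)
  have "strict_mono r" by (rule strict_monoI_Suc) (simp add: rS)
  moreover have "r k \<ge> N k" for k by (cases k) (auto simp: r0 rS)
  moreover have "r (Suc k) \<ge> N k" for k using calculation by (metis le_trans less_imp_le lessI strict_monoD)
  ultimately show ?thesis using N by blast
qed

text \<open>The candidate limit is the pointwise limit of a rapidly converging subsequence; Fatou's lemma turns the Cauchy
  condition into convergence of the whole sequence to it.\<close>

lemma Lp_complete:
  fixes f :: "nat \<Rightarrow> 'a \<Rightarrow> 'b::euclidean_space"
  assumes f: "\<And>n. f n \<in> Lp_space M p" and p: "p > 0"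
    and c: "\<And>e. e > 0 \<Longrightarrow> \<exists>N. \<forall>m\<ge>N. \<forall>n\<ge>N. pmod M p (\<lambda>x. f m x - f n x) < e"
  shows "\<exists>g\<in>Lp_space M p. (\<lambda>n. pmod M p (\<lambda>x. f n x - g x)) \<longlonglongrightarrow> 0"
proof -
  note [measurable] = Lp_measurable[OF f]
  obtain r where r: "strict_mono r"
    and rd: "\<And>k. pmod M p (\<lambda>x. f (r (Suc k)) x - f (r k) x) < (1/2) ^ k * (1/2) powr (p * k)"
    using Cauchy_rapid_subseq[of "\<lambda>m n. pmod M p (\<lambda>x. f m x - f n x)" "\<lambda>k. (1/2) ^ k * (1/2) powr (p * real k)"] c
    by auto
  have conv: "AE x in M. convergent (\<lambda>n. f (r n) x)"
    by (rule rapid_Cauchy_AE_convergent[OF f p]) (use rd less_imp_le in blast)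
  define g where "g = (\<lambda>x. lim (\<lambda>n. f (r n) x))"
  have [measurable]: "g \<in> borel_measurable M"
    unfolding g_def by measurable
  have lim: "AE x in M. (\<lambda>n. f (r n) x) \<longlonglongrightarrow> g x"
    using conv by eventually_elim (simp add: g_def convergent_LIMSEQ_iff)
  have rn: "r k \<ge> k" for k using r by (rule seq_suble)
  have dL: "(\<lambda>x. f m x - f n x) \<in> Lp_space M p" for m n using Lp_diff(1) f p by (metis less_imp_le)
  have est: "\<exists>N. \<forall>n\<ge>N. (\<lambda>x. f n x - g x) \<in> Lp_space M p \<and> pmod M p (\<lambda>x. f n x - g x) \<le> e" if "e > 0" for e
  proof -
    obtain N where N: "\<And>m n. m \<ge> N \<Longrightarrow> n \<ge> N \<Longrightarrow> pmod M p (\<lambda>x. f m x - f n x) < e" using c[OF \<open>e > 0\<close>] by blast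
    show ?thesis
    proof (intro exI[of _ N] allI impI)
      fix n assume n: "n \<ge> N"
      have ae: "AE x in M. (\<lambda>k. f n x - f (r (k + N)) x) \<longlonglongrightarrow> f n x - g x"
        using lim by eventually_elim (intro tendsto_intros LIMSEQ_ignore_initial_segment)
      have b: "pmod M p (\<lambda>x. f n x - f (r (k + N)) x) \<le> e" for k
        using N[OF n, of "r (k + N)"] rn[of "k + N"] by simp
      show "(\<lambda>x. f n x - g x) \<in> Lp_space M p \<and> pmod M p (\<lambda>x. f n x - g x) \<le> e"
        using pmod_Fatou[OF dL _ ae b tendsto_const p] by simp
    qed
  qed
  have "g \<in> Lp_space M p"
  proof -
    obtain N where "(\<lambda>x. f N x - g x) \<in> Lp_space M p" using est[of 1] by auto
    from Lp_diff(1)[OF f[of N] this] p show ?thesis by simp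
  qed
  moreover have "(\<lambda>n. pmod M p (\<lambda>x. f n x - g x)) \<longlonglongrightarrow> 0"
  proof (rule LIMSEQ_I)
    fix e :: real assume "e > 0"
    then obtain N where "\<forall>n\<ge>N. pmod M p (\<lambda>x. f n x - g x) \<le> e/2" using est[of "e/2"] by auto
    then show "\<exists>N. \<forall>n\<ge>N. norm (pmod M p (\<lambda>x. f n x - g x) - 0) < e" using \<open>e > 0\<close>
      by (intro exI[of _ N]) fastforce
  qed
  ultimately show ?thesis by blast
qed

subsection \<open>Conjugate exponents and Hoelder's inequality\<close>

lemma conj_exp_props:
  assumes "p > 1"
  shows "conj_exp p > 1" "1 / p + 1 / conj_exp p = 1" "(p - 1) * conj_exp p = p" "conj_exp (conj_exp p) = p"
  using assms by (auto simp: conj_exp_def field_simps)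

text \<open>Young's inequality for the two functions normalised to norm one.\<close>

lemma Hoelder:
  fixes f :: "'a \<Rightarrow> 'b::euclidean_space" and g :: "'a \<Rightarrow> 'c::euclidean_space"
  assumes p: "p > 1" and f: "f \<in> Lp_space M p" and g: "g \<in> Lp_space M (conj_exp p)"
  shows "integrable M (\<lambda>x. norm (f x) * norm (g x))"
    and "(\<integral>x. norm (f x) * norm (g x) \<partial>M) \<le> Lp_norm M p f * Lp_norm M (conj_exp p) g"
proof -
  define q where "q = conj_exp p"
  have q: "q > 1" "1/p + 1/q = 1" using conj_exp_props[OF p] by (auto simp: q_def)
  note [measurable] = Lp_measurable[OF f] Lp_measurable[OF g]
  have gq: "g \<in> Lp_space M q" using g by (simp add: q_def)
  note Y = Youngs_inequality[OF p q]
  show int: "integrable M (\<lambda>x. norm (f x) * norm (g x))"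
    by (rule Bochner_Integration.integrable_bound[where f="\<lambda>x. norm (f x) powr p / p + norm (g x) powr q / q"])
       (use Lp_integrable[OF f] Lp_integrable[OF gq] Y in \<open>auto intro!: AE_I2 order_trans[OF Y abs_ge_self]\<close>)
  define a b where "a = Lp_norm M p f" and "b = Lp_norm M q g"
  show "(\<integral>x. norm (f x) * norm (g x) \<partial>M) \<le> Lp_norm M p f * Lp_norm M (conj_exp p) g"
  proof (cases "a = 0 \<or> b = 0")
    case True
    then have "pmod M p f = 0 \<or> pmod M q g = 0" by (auto simp: a_def b_def Lp_norm_pmod)
    then have "AE x in M. norm (f x) * norm (g x) = 0"
      using pmod_eq_0[OF f] pmod_eq_0[OF gq] by (auto elim!: eventually_mono)
    then have "(\<integral>x. norm (f x) * norm (g x) \<partial>M) = 0"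
      by (subst integral_cong_AE[where g="\<lambda>_. 0"]) auto
    then show ?thesis by simp
  next
    case False
    then have ab: "a > 0" "b > 0" by (auto simp: a_def b_def less_le)
    have "(\<integral>x. norm (f x) / a * (norm (g x) / b) \<partial>M) \<le>
        (\<integral>x. (norm (f x) powr p / a powr p) / p + (norm (g x) powr q / b powr q) / q \<partial>M)"
    proof (rule integral_mono)
      show "integrable M (\<lambda>x. norm (f x) / a * (norm (g x) / b))" using int by simp
      show "integrable M (\<lambda>x. (norm (f x) powr p / a powr p) / p + (norm (g x) powr q / b powr q) / q)"
        using Lp_integrable[OF f] Lp_integrable[OF gq] by simp
      fix x show "norm (f x) / a * (norm (g x) / b) \<le> (norm (f x) powr p / a powr p) / p + (norm (g x) powr q / b powr q) / q"
        using Y[of "norm (f x) / a" "norm (g x) / b"] ab by (simp add: powr_divide)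
    qed
    also have "\<dots> = (pmod M p f / a powr p) / p + (pmod M q g / b powr q) / q"
      using Lp_integrable[OF f] Lp_integrable[OF gq] by (simp add: pmod_def)
    also have "\<dots> = 1 / p + 1 / q"
      using ab p q by (simp add: a_def b_def Lp_norm_powr)
         (simp add: Lp_norm_powr[symmetric])
    also have "\<dots> = 1" by (rule q)
    finally have "(\<integral>x. norm (f x) * norm (g x) \<partial>M) / (a * b) \<le> 1" by simp
    then show ?thesis using ab by (simp add: a_def b_def q_def field_simps)
  qed
qed

lemma Hoelder_inner:
  fixes f g :: "'a \<Rightarrow> 'b::euclidean_space"
  assumes p: "p > 1" and f: "f \<in> Lp_space M p" and g: "g \<in> Lp_space M (conj_exp p)"
  shows "integrable M (\<lambda>x. g x \<bullet> f x)"
    and "\<bar>\<integral>x. g x \<bullet> f x \<partial>M\<bar> \<le> Lp_norm M (conj_exp p) g * Lp_norm M p f"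
proof -
  note [measurable] = Lp_measurable[OF f] Lp_measurable[OF g]
  show i: "integrable M (\<lambda>x. g x \<bullet> f x)"
    by (rule Bochner_Integration.integrable_bound[OF Hoelder(1)[OF assms]])
       (auto simp: mult.commute[of "norm (f _)"] Cauchy_Schwarz_ineq2 intro!: AE_I2)
  have "\<bar>\<integral>x. g x \<bullet> f x \<partial>M\<bar> \<le> (\<integral>x. \<bar>g x \<bullet> f x\<bar> \<partial>M)" by (rule integral_abs_bound)
  also have "\<dots> \<le> (\<integral>x. norm (f x) * norm (g x) \<partial>M)"
    by (rule integral_mono) (use i Hoelder(1)[OF assms] in \<open>auto simp: mult.commute[of "norm (f _)"] Cauchy_Schwarz_ineq2\<close>)
  also have "\<dots> \<le> Lp_norm M p f * Lp_norm M (conj_exp p) g" by (rule Hoelder(2)[OF assms])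
  finally show "\<bar>\<integral>x. g x \<bullet> f x \<partial>M\<bar> \<le> Lp_norm M (conj_exp p) g * Lp_norm M p f" by (simp add: mult.commute)
qed

lemma flux_zero [simp]: "flux p 0 = 0"
  by (simp add: flux_def)

lemma norm_flux: "norm (flux p \<xi>) = norm \<xi> powr (p - 1)"
proof (cases "\<xi> = 0")
  case False
  then have "norm \<xi> powr (p - 2) * norm \<xi> powr 1 = norm \<xi> powr (p - 1)"
    by (simp only: powr_add[symmetric]) (simp add: algebra_simps)
  then show ?thesis using False by (simp add: flux_def)
qed simp

lemma norm_flux_conj: "p > 1 \<Longrightarrow> norm (flux p \<xi>) powr conj_exp p = norm \<xi> powr p"
  by (simp add: norm_flux powr_powr conj_exp_props)

lemma flux_inner_self: "flux p \<xi> \<bullet> \<xi> = norm \<xi> powr p"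
proof (cases "\<xi> = 0")
  case False
  then have "norm \<xi> powr (p - 2) * norm \<xi> powr 2 = norm \<xi> powr p"
    by (simp only: powr_add[symmetric]) simp
  then show ?thesis using False by (simp add: flux_def dot_square_norm)
qed simp

lemma continuous_flux:
  assumes "p > 1" shows "continuous_on UNIV (flux p :: 'b::euclidean_space \<Rightarrow> 'b)"
proof -
  have "isCont (flux p) (\<xi>::'b)" for \<xi>
  proof (cases "\<xi> = 0")
    case True
    have "((\<lambda>y::'b. norm y powr (p - 1)) \<longlongrightarrow> 0) (at 0)"
      using assms by (intro tendsto_eq_intros) auto
    then have "(flux p \<longlongrightarrow> (0::'b)) (at 0)"
      by (subst tendsto_norm_zero_iff[symmetric]) (simp add: norm_flux)
    then show ?thesis using True by (simp add: isCont_def)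
  next
    case False
    then show ?thesis unfolding flux_def by (intro continuous_intros) auto
  qed
  then show ?thesis by (simp add: continuous_at_imp_continuous_on)
qed

lemma flux_measurable [measurable]:
  assumes "p > 1" shows "flux p \<in> borel_measurable borel"
  by (rule borel_measurable_continuous_onI[OF continuous_flux[OF assms]])

text \<open>The duality map: \<open>flux p\<close> carries \<open>L\<^sup>p\<close> into the dual exponent and preserves the modular.\<close>

lemma flux_Lp:
  assumes p: "p > 1" and f: "f \<in> Lp_space M p"
  shows "(\<lambda>x. flux p (f x)) \<in> Lp_space M (conj_exp p)"
    and "pmod M (conj_exp p) (\<lambda>x. flux p (f x)) = pmod M p f"
proof -
  have "(\<lambda>x. flux p (f x)) \<in> borel_measurable M"
    by (rule measurable_compose[OF Lp_measurable[OF f] flux_measurable[OF p]])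
  then show "(\<lambda>x. flux p (f x)) \<in> Lp_space M (conj_exp p)"
    using Lp_integrable[OF f] by (simp add: Lp_space_def norm_flux_conj[OF p])
  show "pmod M (conj_exp p) (\<lambda>x. flux p (f x)) = pmod M p f"
    by (simp add: pmod_def norm_flux_conj[OF p])
qed

text \<open>\<open>flux p\<close> is the gradient of the convex function \<open>norm \<xi> powr p / p\<close>. The inequality that
  it is a subgradient is Young's inequality, and yields the Euler-Lagrange equation of minimisers.\<close>

lemma flux_tangent:
  assumes p: "p > 1"
  shows "norm a powr p / p \<ge> norm b powr p / p + flux p b \<bullet> (a - b)"
proof -
  have "flux p b \<bullet> a \<le> norm a * norm (flux p b)"
    by (metis mult.commute norm_cauchy_schwarz)
  also have "\<dots> \<le> norm a powr p / p + norm (flux p b) powr conj_exp p / conj_exp p"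
    by (rule Youngs_inequality) (use conj_exp_props[OF p] p in auto)
  finally have "flux p b \<bullet> a \<le> norm a powr p / p + norm b powr p / conj_exp p"
    by (simp add: norm_flux_conj[OF p])
  moreover have "norm b powr p / conj_exp p = norm b powr p - norm b powr p / p"
    using p by (simp add: conj_exp_def field_simps)
  ultimately show ?thesis by (simp add: inner_diff_right flux_inner_self)
qed

section \<open>Uniformly convex spaces of Lebesgue type\<close>

lemma continuous_norm_powr:
  fixes f :: "'a::topological_space \<Rightarrow> 'b::real_normed_vector"
  assumes "continuous_on S f" "p > 0"
  shows "continuous_on S (\<lambda>z. norm (f z) powr p)"
  by (rule continuous_on_powr') (use assms in \<open>auto intro: continuous_on_norm\<close>)

text \<open>A compactness argument shared by the two pointwise inequalities below. On the part of the unit sphere where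
  \<open>P\<close> exceeds the small term, \<open>Q\<close> is positive, hence bounded away from \<open>0\<close>, and a large multiple of it dominates
  \<open>P\<close>. Homogeneity of degree \<open>p\<close> extends the estimate from the sphere to all pairs.\<close>

lemma homogeneous_control:
  fixes P Q :: "'b::euclidean_space \<Rightarrow> 'b \<Rightarrow> real"
  assumes p: "p > 0" and e: "e > 0"
    and cP: "continuous_on UNIV (\<lambda>z. P (fst z) (snd z))" and cQ: "continuous_on UNIV (\<lambda>z. Q (fst z) (snd z))"
    and hP: "\<And>t a b. t > 0 \<Longrightarrow> P (t *\<^sub>R a) (t *\<^sub>R b) = t powr p * P a b"
    and hQ: "\<And>t a b. t > 0 \<Longrightarrow> Q (t *\<^sub>R a) (t *\<^sub>R b) = t powr p * Q a b"
    and Q0: "\<And>a b. Q a b \<ge> 0" and PQ: "\<And>a b. Q a b = 0 \<Longrightarrow> P a b \<le> 0"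
  shows "\<exists>C\<ge>0. \<forall>a b. P a b \<le> e * (norm a powr p + norm b powr p) + C * Q a b"
proof -
  define N where "N = (\<lambda>(a::'b) (b::'b). norm a powr p + norm b powr p)"
  have N0: "N a b \<ge> 0" for a b by (simp add: N_def)
  have cN: "continuous_on UNIV (\<lambda>z. N (fst z) (snd z))"
    unfolding N_def using p by (intro continuous_on_add continuous_norm_powr continuous_intros)
  have hN: "N (t *\<^sub>R a) (t *\<^sub>R b) = t powr p * N a b" if "t > 0" for t a b
    using that by (simp add: N_def powr_mult algebra_simps)
  define K where "K = {z :: 'b \<times> 'b. z \<in> sphere 0 1 \<and> e * N (fst z) (snd z) \<le> P (fst z) (snd z)}"
  have "closed {z :: 'b \<times> 'b. e * N (fst z) (snd z) \<le> P (fst z) (snd z)}"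
    by (intro closed_Collect_le continuous_intros cP cN)
  moreover have "K = sphere 0 1 \<inter> {z. e * N (fst z) (snd z) \<le> P (fst z) (snd z)}" by (auto simp: K_def)
  ultimately have K: "compact K" by (simp only: compact_Int_closed[OF compact_sphere])
  have sphere: "P a b \<le> e * N a b + C * Q a b" if C0: "C \<ge> 0" and C: "\<And>z. z \<in> K \<Longrightarrow> P (fst z) (snd z) \<le> C * Q (fst z) (snd z)"
    for C a b
  proof (cases "(a,b) = 0")
    case True
    have "P 0 0 = 2 powr p * P 0 0" using hP[of 2 0 0] by simp
    moreover have "2 powr p > 1" using p by simp
    ultimately have "P 0 0 = 0" by auto
    then show ?thesis using True C0 Q0[of 0 0] N0[of 0 0] e by (simp add: zero_prod_def)
  next
    case False
    define t where "t = norm (a,b)"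
    have t: "t > 0" using False unfolding t_def by simp
    define a' b' where "a' = a /\<^sub>R t" and "b' = b /\<^sub>R t"
    have ab: "a = t *\<^sub>R a'" "b = t *\<^sub>R b'" using t by (auto simp: a'_def b'_def)
    have "(a',b') = (1/t) *\<^sub>R (a,b)" by (simp add: a'_def b'_def divide_inverse)
    then have "norm (a',b') = 1" using t by (simp only: norm_scaleR t_def[symmetric]) simp
    then have "(a',b') \<in> sphere 0 1" by simp
    then have "P a' b' \<le> e * N a' b' + C * Q a' b'"
    proof (cases "(a',b') \<in> K")
      case True
      moreover have "e * N a' b' \<ge> 0" using N0[of a' b'] e by simp
      ultimately show ?thesis using C[OF True] by simp
    next
      case False
      then have "P a' b' < e * N a' b'" using \<open>(a',b') \<in> sphere 0 1\<close> by (simp add: K_def)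
      moreover have "C * Q a' b' \<ge> 0" using Q0[of a' b'] C0 by simp
      ultimately show ?thesis by linarith
    qed
    then have "t powr p * P a' b' \<le> t powr p * (e * N a' b' + C * Q a' b')" by (intro mult_left_mono) auto
    then show ?thesis unfolding ab by (simp add: hP[OF t] hQ[OF t] hN[OF t] algebra_simps)
  qed
  show ?thesis
  proof (cases "K = {}")
    case True
    then show ?thesis using sphere[of 0] by (intro exI[of _ 0]) (auto simp: N_def)
  next
    case False
    obtain z0 where z0: "z0 \<in> K" "\<And>z. z \<in> K \<Longrightarrow> Q (fst z0) (snd z0) \<le> Q (fst z) (snd z)"
      using continuous_attains_inf[OF K False continuous_on_subset[OF cQ]] by auto
    obtain z1 where z1: "z1 \<in> K" "\<And>z. z \<in> K \<Longrightarrow> P (fst z) (snd z) \<le> P (fst z1) (snd z1)"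
      using continuous_attains_sup[OF K False continuous_on_subset[OF cP]] by auto
    have Npos: "N (fst z) (snd z) > 0" if "z \<in> K" for z
    proof -
      have "norm z = 1" using that by (simp add: K_def)
      then have "z \<noteq> 0" by (metis norm_zero zero_neq_one)
      then have "fst z \<noteq> 0 \<or> snd z \<noteq> 0" by (simp add: prod_eq_iff)
      then have "norm (fst z) powr p > 0 \<or> norm (snd z) powr p > 0" by simp
      moreover have "norm (fst z) powr p \<ge> 0" "norm (snd z) powr p \<ge> 0" by simp_all
      ultimately show ?thesis unfolding N_def by linarith
    qed
    have Ppos: "P (fst z) (snd z) > 0" if "z \<in> K" for z
    proof -
      have "0 < e * N (fst z) (snd z)" using Npos[OF that] e by simp
      also have "\<dots> \<le> P (fst z) (snd z)" using that by (simp add: K_def)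
      finally show ?thesis .
    qed
    define m where "m = Q (fst z0) (snd z0)"
    have "m \<noteq> 0" using PQ[of "fst z0" "snd z0"] Ppos[OF z0(1)] by (auto simp: m_def)
    then have m: "m > 0" using Q0[of "fst z0" "snd z0"] by (simp add: m_def)
    define C where "C = P (fst z1) (snd z1) / m"
    have C0: "C \<ge> 0" using m Ppos[OF z1(1)] by (simp add: C_def)
    have "P (fst z) (snd z) \<le> C * Q (fst z) (snd z)" if "z \<in> K" for z
    proof -
      have "P (fst z) (snd z) \<le> C * m" using z1(2)[OF that] m by (simp add: C_def)
      also have "\<dots> \<le> C * Q (fst z) (snd z)" using z0(2)[OF that] C0 by (intro mult_left_mono) (auto simp: m_def)
      finally show ?thesis .
    qed
    then show ?thesis using sphere[OF C0] C0 by (intro exI[of _ C]) (auto simp: N_def)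
  qed
qed

text \<open>The mean value theorem on both halves of the interval; the derivative of \<open>t powr p\<close> is strictly increasing.\<close>

lemma powr_midpoint_strict:
  fixes p s t :: real
  assumes p: "p > 1" and st: "0 \<le> s" "s < t"
  shows "((s + t) / 2) powr p < (s powr p + t powr p) / 2"
proof -
  define c where "c = (s + t) / 2"
  have c: "s < c" "c < t" using st by (auto simp: c_def)
  have mv: "\<exists>z. a < z \<and> z < b \<and> b powr p - a powr p = (b - a) * (p * z powr (p - 1))" if "0 \<le> a" "a < b" for a b :: real
  proof -
    have cont: "continuous_on {a..b} (\<lambda>z. z powr p)"
      using p that by (intro continuous_intros continuous_on_powr') auto
    have der: "((\<lambda>z. z powr p) has_derivative (\<lambda>h. (p * z powr (p - 1)) * h)) (at z)" if "a < z" "z < b" for z :: real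
      using has_real_derivative_powr[of z p] that \<open>0 \<le> a\<close> by (simp add: has_field_derivative_def)
    obtain z where "a < z" "z < b" "b powr p - a powr p = (p * z powr (p - 1)) * (b - a)"
      using mvt[OF \<open>a < b\<close> cont der] by blast
    then show ?thesis by (intro exI[of _ z]) simp
  qed
  obtain z1 where z1: "s < z1" "z1 < c" "c powr p - s powr p = (c - s) * (p * z1 powr (p - 1))"
    using mv[of s c] st c by auto
  obtain z2 where z2: "c < z2" "z2 < t" "t powr p - c powr p = (t - c) * (p * z2 powr (p - 1))"
    using mv[of c t] st c by auto
  have d: "c - s = t - c" by (simp add: c_def field_simps)
  have "z1 powr (p - 1) < z2 powr (p - 1)" using z1 z2 p st by (intro powr_less_mono2) auto
  then have "(t - c) * (p * z1 powr (p - 1)) < (t - c) * (p * z2 powr (p - 1))"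
    using c p by (intro mult_strict_left_mono) auto
  then have "c powr p - s powr p < t powr p - c powr p" using z1(3) z2(3) d by simp
  then show ?thesis by (simp add: c_def)
qed

text \<open>Equality forces first \<open>norm a = norm b\<close>, by strict convexity of the power, and then equality in the triangle
  inequality, so that \<open>a\<close> and \<open>b\<close> are parallel.\<close>

lemma norm_powr_midpoint:
  fixes a b :: "'b::euclidean_space"
  assumes p: "p > 1"
  shows "norm ((a + b) /\<^sub>R 2) powr p \<le> (norm a powr p + norm b powr p) / 2"
    and "norm ((a + b) /\<^sub>R 2) powr p = (norm a powr p + norm b powr p) / 2 \<Longrightarrow> a = b"
proof -
  have 1: "norm ((a + b) /\<^sub>R 2) powr p \<le> ((norm a + norm b) / 2) powr p"
    using p norm_triangle_ineq[of a b] by (intro powr_mono2) auto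
  have 2: "((norm a + norm b) / 2) powr p < (norm a powr p + norm b powr p) / 2" if "norm a \<noteq> norm b"
    using powr_midpoint_strict[OF p, of "norm a" "norm b"] powr_midpoint_strict[OF p, of "norm b" "norm a"] that
    by (cases "norm a < norm b") (auto simp: add.commute)
  show "norm ((a + b) /\<^sub>R 2) powr p \<le> (norm a powr p + norm b powr p) / 2"
    using 1 2 by (cases "norm a = norm b") auto
  assume eq: "norm ((a + b) /\<^sub>R 2) powr p = (norm a powr p + norm b powr p) / 2"
  then have n: "norm a = norm b" using 1 2 by force
  then have "norm ((a + b) /\<^sub>R 2) powr p = norm a powr p" using eq by simp
  then have "norm ((a + b) /\<^sub>R 2) = norm a"
    using powr_less_mono2[of p "norm ((a + b) /\<^sub>R 2)" "norm a"] powr_less_mono2[of p "norm a" "norm ((a + b) /\<^sub>R 2)"] p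
    by (cases "norm ((a + b) /\<^sub>R 2)" "norm a" rule: linorder_cases) (auto simp del: norm_scaleR)
  then have "norm (a + b) = 2 * norm a" by simp
  then have "norm (a + b) = norm a + norm b" using n by simp
  then have "norm a *\<^sub>R b = norm b *\<^sub>R a" by (simp add: norm_triangle_eq)
  then show "a = b" using n by (cases "norm a = 0") auto
qed

text \<open>Uniform convexity of \<open>L\<^sup>p\<close> in a pointwise form that can be integrated: the defect in the midpoint inequality
  vanishes only for \<open>a = b\<close>, so it controls the distance up to an arbitrarily small multiple of the modulars.\<close>

lemma uniform_convexity:
  fixes e p :: real
  assumes p: "p > 1" and e: "e > 0"
  shows "\<exists>C\<ge>0. \<forall>a b :: 'b::euclidean_space. norm (a - b) powr p \<le> e * (norm a powr p + norm b powr p)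
     + C * ((norm a powr p + norm b powr p) / 2 - norm ((a + b) /\<^sub>R 2) powr p)"
proof (rule homogeneous_control)
  show "p > 0" using p by simp
  fix t :: real and a b :: 'b assume t: "t > 0"
  have "norm (t *\<^sub>R a - t *\<^sub>R b) = t * norm (a - b)" using t by (metis scaleR_diff_right norm_scaleR abs_of_pos)
  then show "norm (t *\<^sub>R a - t *\<^sub>R b) powr p = t powr p * norm (a - b) powr p" using t by (simp add: powr_mult)
  have "norm ((t *\<^sub>R a + t *\<^sub>R b) /\<^sub>R 2) = t * norm ((a + b) /\<^sub>R 2)"
    using t by (simp flip: scaleR_add_right)
  then show "(norm (t *\<^sub>R a) powr p + norm (t *\<^sub>R b) powr p) / 2 - norm ((t *\<^sub>R a + t *\<^sub>R b) /\<^sub>R 2) powr p =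
           t powr p * ((norm a powr p + norm b powr p) / 2 - norm ((a + b) /\<^sub>R 2) powr p)"
    using t by (simp add: powr_mult algebra_simps)
next
  fix a b :: 'b assume "(norm a powr p + norm b powr p) / 2 - norm ((a + b) /\<^sub>R 2) powr p = 0"
  then show "norm (a - b) powr p \<le> 0" using norm_powr_midpoint(2)[OF p, of a b] by simp
next
  fix a b :: 'b show "(norm a powr p + norm b powr p) / 2 - norm ((a + b) /\<^sub>R 2) powr p \<ge> 0"
    using norm_powr_midpoint(1)[OF p, of a b] by simp
next
  have p': "p > 0" using p by simp
  show "continuous_on UNIV (\<lambda>z :: 'b \<times> 'b. norm (fst z - snd z) powr p)"
    by (intro continuous_norm_powr continuous_intros p')
  show "continuous_on UNIV (\<lambda>z :: 'b \<times> 'b. (norm (fst z) powr p + norm (snd z) powr p) / 2 - norm ((fst z + snd z) /\<^sub>R 2) powr p)"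
    unfolding divide_inverse
    by (intro continuous_on_diff continuous_on_mult continuous_on_add continuous_norm_powr
        continuous_on_scaleR continuous_on_fst continuous_on_snd continuous_on_id continuous_on_const p')
qed (rule e)

lemma flux_homogeneous: "t > 0 \<Longrightarrow> p > 1 \<Longrightarrow> flux p (t *\<^sub>R a) = t powr (p - 1) *\<^sub>R flux p a"
proof -
  assume t: "t > 0" "p > 1"
  have "t powr (p - 1) = t powr (p - 2) * t powr 1" by (simp only: powr_add[symmetric]) simp
  then show ?thesis using t by (simp add: flux_def powr_mult)
qed

text \<open>The same compactness argument makes the duality map uniformly continuous on bounded sets, for all exponents
  \<open>p > 1\<close> at once.\<close>

lemma flux_uniform_continuity:
  fixes e p :: real
  assumes p: "p > 1" and e: "e > 0"
  shows "\<exists>C\<ge>0. \<forall>a b :: 'b::euclidean_space.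
     norm (flux p a - flux p b) powr conj_exp p \<le> e * (norm a powr p + norm b powr p) + C * norm (a - b) powr p"
proof (rule homogeneous_control)
  show "p > 0" using p by simp
  fix t :: real and a b :: 'b assume t: "t > 0"
  have "norm (t *\<^sub>R a - t *\<^sub>R b) = t * norm (a - b)" using t by (metis scaleR_diff_right norm_scaleR abs_of_pos)
  then show "norm (t *\<^sub>R a - t *\<^sub>R b) powr p = t powr p * norm (a - b) powr p" using t by (simp add: powr_mult)
  have "norm (flux p (t *\<^sub>R a) - flux p (t *\<^sub>R b)) = t powr (p - 1) * norm (flux p a - flux p b)"
    using t p by (simp add: flux_homogeneous flip: scaleR_diff_right)
  then show "norm (flux p (t *\<^sub>R a) - flux p (t *\<^sub>R b)) powr conj_exp p
      = t powr p * norm (flux p a - flux p b) powr conj_exp p"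
    using t p by (simp add: powr_mult powr_powr conj_exp_props)
next
  show "continuous_on UNIV (\<lambda>z :: 'b \<times> 'b. norm (flux p (fst z) - flux p (snd z)) powr conj_exp p)"
    using p conj_exp_props[OF p]
    by (intro continuous_norm_powr continuous_on_diff continuous_on_compose2[OF continuous_flux[OF p]] continuous_on_fst continuous_on_snd continuous_on_id) auto
  show "continuous_on UNIV (\<lambda>z :: 'b \<times> 'b. norm (fst z - snd z) powr p)"
    using p by (intro continuous_norm_powr continuous_intros) auto
qed (use e in auto)

text \<open>What \<open>W10\<close> with its gradient and \<open>L\<^sup>p\<close> itself have in common: a linear space embedded by \<open>D\<close>, up to null sets, as a
  closed subspace of a Lebesgue space. Elements are representatives, so \<open>D\<close> is linear only almost everywhere, and the limits
  in the completeness axiom are not unique.\<close>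

locale Lp_model =
  fixes M :: "'x measure" and p :: real and U :: "'u::real_vector set"
    and D :: "'u \<Rightarrow> 'x \<Rightarrow> 'b::euclidean_space"
  assumes p1: "p > 1" and U0: "0 \<in> U"
    and Uadd: "u \<in> U \<Longrightarrow> v \<in> U \<Longrightarrow> u + v \<in> U" and Uscale: "u \<in> U \<Longrightarrow> c *\<^sub>R u \<in> U"
    and DL: "u \<in> U \<Longrightarrow> D u \<in> Lp_space M p"
    and Dadd: "u \<in> U \<Longrightarrow> v \<in> U \<Longrightarrow> AE x in M. D (u + v) x = D u x + D v x"
    and Dscale: "u \<in> U \<Longrightarrow> AE x in M. D (c *\<^sub>R u) x = c *\<^sub>R D u x"
    and complete: "(\<And>n. s n \<in> U) \<Longrightarrow>
      (\<And>e. e > 0 \<Longrightarrow> \<exists>N. \<forall>m\<ge>N. \<forall>n\<ge>N. pmod M p (\<lambda>x. D (s m) x - D (s n) x) < e) \<Longrightarrow>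
      \<exists>v\<in>U. (\<lambda>n. pmod M p (\<lambda>x. D (s n) x - D v x)) \<longlonglongrightarrow> 0"
begin

definition nrm :: "'u \<Rightarrow> real" where "nrm u = Lp_norm M p (D u)"

lemma p0: "p > 0" "p \<ge> 0" using p1 by auto

lemma q1: "conj_exp p > 1" using conj_exp_props[OF p1] by simp

lemma Dmeas: "u \<in> U \<Longrightarrow> D u \<in> borel_measurable M" by (rule Lp_measurable[OF DL])

lemma Udiff: "u \<in> U \<Longrightarrow> v \<in> U \<Longrightarrow> u - v \<in> U"
  using Uadd[OF _ Uscale[of v "-1"]] by simp

lemma Ddiff:
  assumes "u \<in> U" "v \<in> U" shows "AE x in M. D (u - v) x = D u x - D v x"
  using Dadd[OF assms(1) Uscale[OF assms(2), of "-1"]] Dscale[OF assms(2), of "-1"]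
  by eventually_elim simp

lemma pmod_D_diff: "u \<in> U \<Longrightarrow> v \<in> U \<Longrightarrow> pmod M p (D (u - v)) = pmod M p (\<lambda>x. D u x - D v x)"
  using Dmeas Udiff by (intro pmod_cong_AE Ddiff) (auto intro!: borel_measurable_diff)

lemma nrm_powr: "nrm u powr p = pmod M p (D u)"
  using p0 by (simp add: nrm_def Lp_norm_powr)

lemma nrm_eq: "nrm u = pmod M p (D u) powr (1 / p)"
  by (simp add: nrm_def Lp_norm_pmod)

lemma nrm_nonneg [simp]: "0 \<le> nrm u" by (simp add: nrm_def)

lemma nrm_scale:
  assumes "u \<in> U" shows "nrm (c *\<^sub>R u) = \<bar>c\<bar> * nrm u"
proof -
  have "pmod M p (D (c *\<^sub>R u)) = \<bar>c\<bar> powr p * pmod M p (D u)"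
    using pmod_cong_AE[OF Dmeas[OF Uscale[OF assms]] _ Dscale[OF assms]] Lp_scaleR(2)[OF DL[OF assms]] Dmeas[OF assms]
    by (simp add: borel_measurable_scaleR)
  then show ?thesis using p1 by (simp add: nrm_eq powr_mult powr_powr)
qed

lemma functional_diff:
  assumes "F \<in> dual_space U nrm" "u \<in> U" "v \<in> U"
  shows "F (u - v) = F u - F v"
proof -
  have "F (u + (-1) *\<^sub>R v) = F u + F ((-1) *\<^sub>R v)" "F ((-1) *\<^sub>R v) = (-1) * F v"
    using assms Uscale[OF assms(3), of "-1"] unfolding dual_space_def by blast+
  then show ?thesis by simp
qed

text \<open>The linear part is absorbed by Young's inequality. The factor \<open>4\<close> in \<open>4 * C\<close> pays for the constant \<open>2 powr p\<close> of
  the triangle inequality and still leaves half of the modular.\<close>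

lemma minimising_bounded:
  assumes F: "\<And>u. u \<in> U \<Longrightarrow> \<bar>F u\<bar> \<le> C * nrm u" and C: "C \<ge> 0" and g: "g \<in> Lp_space M p" and u: "u \<in> U"
  shows "pmod M p (\<lambda>x. D u x - g x) / p - F u \<ge> pmod M p (\<lambda>x. D u x - g x) / (2 * p) - ((4 * C) powr conj_exp p / conj_exp p + pmod M p g / (2 * p))"
proof -
  define y where "y = pmod M p (\<lambda>x. D u x - g x)"
  have dL: "(\<lambda>x. D u x - g x) \<in> Lp_space M p" by (rule Lp_diff(1)[OF DL[OF u] g p0(2)])
  have n: "nrm u powr p \<le> 2 powr p * (y + pmod M p g)"
    using Lp_add(2)[OF dL g p0(2)] by (simp add: nrm_powr y_def)
  have "F u \<le> (nrm u / 4) * (4 * C)" using F[OF u] by (simp add: mult.commute)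
  also have "\<dots> \<le> (nrm u / 4) powr p / p + (4 * C) powr conj_exp p / conj_exp p"
    using C by (intro Youngs_inequality conj_exp_props p1) auto
  also have "(nrm u / 4) powr p = nrm u powr p / 4 powr p" by (simp add: powr_divide)
  also have "nrm u powr p / 4 powr p \<le> (2 powr p * (y + pmod M p g)) / 4 powr p" using n by (rule divide_right_mono) auto
  also have "\<dots> = (1/2) powr p * (y + pmod M p g)"
    using powr_mult[of 2 2 p] by (simp add: powr_divide)
  also have "\<dots> \<le> (1/2) * (y + pmod M p g)"
    using powr_mono'[of 1 p "1/2"] p1 by (intro mult_right_mono) (auto simp: y_def)
  finally have "F u \<le> (1/2) * (y + pmod M p g) / p + (4 * C) powr conj_exp p / conj_exp p"
    using p1 by (simp add: divide_right_mono)
  moreover have "(1/2) * (y + pmod M p g) / p = y / p - y / (2 * p) + pmod M p g / (2 * p)"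
    using p1 by (simp add: field_simps)
  ultimately show ?thesis unfolding y_def[symmetric] by linarith
qed

text \<open>The functional \<open>pmod (D u - g) / p - F u\<close> is bounded below, and along a minimising sequence the midpoint defect
  tends to zero because \<open>F\<close> is linear. Uniform convexity makes the sequence Cauchy, so a minimiser exists by
  completeness; the assertion is its Euler-Lagrange equation. For \<open>g = 0\<close> it represents \<open>F\<close> by a function in the
  dual Lebesgue space, for \<open>F = 0\<close> it is the metric projection of \<open>g\<close> onto the space.\<close>

theorem minimiser_Euler_Lagrange:
  assumes F: "F \<in> dual_space U nrm" and g: "g \<in> Lp_space M p"
  shows "\<exists>u\<in>U. \<forall>w\<in>U. (\<integral>x. flux p (D u x - g x) \<bullet> D w x \<partial>M) = F w"
proof -
  obtain C0 where "\<forall>u\<in>U. \<bar>F u\<bar> \<le> C0 * nrm u" using F unfolding dual_space_def by blast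
  then have C0: "\<And>u. u \<in> U \<Longrightarrow> \<bar>F u\<bar> \<le> C0 * nrm u" by blast
  define C where "C = max C0 0"
  have C: "C \<ge> 0" and FC: "\<And>u. u \<in> U \<Longrightarrow> \<bar>F u\<bar> \<le> C * nrm u"
    using C0 by (auto simp: C_def intro: order_trans[OF C0 mult_right_mono])
  have Fadd: "F (u + v) = F u + F v" if "u \<in> U" "v \<in> U" for u v using F that by (auto simp: dual_space_def)
  have Fsc: "F (c *\<^sub>R u) = c * F u" if "u \<in> U" for u c using F that by (auto simp: dual_space_def)
  note [measurable] = Lp_measurable[OF g]
  define Y where "Y = (\<lambda>u. pmod M p (\<lambda>x. D u x - g x))"
  define J where "J = (\<lambda>u. Y u / p - F u)"
  define K where "K = (4 * C) powr conj_exp p / conj_exp p + pmod M p g / (2 * p)"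
  have low: "J u \<ge> Y u / (2 * p) - K" if "u \<in> U" for u
    using minimising_bounded[OF FC C g that] by (simp add: J_def Y_def K_def)
  have Y0: "Y u \<ge> 0" for u by (simp add: Y_def)
  have J_low: "J u \<ge> - K" if "u \<in> U" for u
    using low[OF that] divide_nonneg_pos[OF Y0, of "2 * p" u] p0(1) by linarith
  have aL: "(\<lambda>x. D u x - g x) \<in> Lp_space M p" if "u \<in> U" for u by (rule Lp_diff(1)[OF DL[OF that] g p0(2)])
  define i where "i = Inf (J ` U)"
  have bdd: "bdd_below (J ` U)" by (rule bdd_belowI2[of _ "-K"]) (rule J_low)
  have iJ: "i \<le> J u" if "u \<in> U" for u unfolding i_def by (rule cInf_lower[OF imageI[OF that] bdd])
  have "\<exists>u\<in>U. J u < i + 1 / real (Suc n)" for n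
    using cInf_lessD[of "J ` U" "i + 1 / real (Suc n)"] U0 by (auto simp: i_def)
  then obtain s where sU: "\<And>n. s n \<in> U" and sJ: "\<And>n. J (s n) < i + 1 / real (Suc n)" by metis
  define a where "a = (\<lambda>n x. D (s n) x - g x)"
  have aLp: "a n \<in> Lp_space M p" for n unfolding a_def by (rule aL[OF sU])
  have am [measurable]: "a n \<in> borel_measurable M" for n by (rule Lp_measurable[OF aLp])
  define B where "B = 2 * p * (i + 1 + K)"
  have YB: "pmod M p (a n) \<le> B" for n
  proof -
    have "1 / real (Suc n) \<le> 1" by simp
    then have "Y (s n) / (2 * p) \<le> i + 1 + K" using low[OF sU[of n]] sJ[of n] by linarith
    then show ?thesis using p0 by (simp add: Y_def a_def B_def field_simps)
  qed
  have B0: "B \<ge> 0" using YB[of 0] pmod_nonneg[of M p "a 0"] by linarith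
  define Q where "Q = (\<lambda>m n. (\<integral>x. (norm (a m x) powr p + norm (a n x) powr p) / 2 - norm ((a m x + a n x) /\<^sub>R 2) powr p \<partial>M))"
  have half_split: "G = H + H \<Longrightarrow> A + B - G = A - H + (B - H)" for G H A B :: 'b by simp
  have midL: "(\<lambda>x. (a m x + a n x) /\<^sub>R 2) \<in> Lp_space M p" for m n
    by (intro Lp_scaleR Lp_add(1) aLp p0)
  \<comment> \<open>the linear parts cancel, so almost minimality controls the convexity defect\<close>
  have Qb: "Q m n \<le> p * (1 / real (Suc m) + 1 / real (Suc n)) / 2" for m n
  proof -
    define w where "w = (1/2) *\<^sub>R (s m + s n)"
    have wU: "w \<in> U" unfolding w_def by (intro Uscale Uadd sU)
    have "AE x in M. D w x - g x = (a m x + a n x) /\<^sub>R 2"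
      using Dscale[OF Uadd[OF sU[of m] sU[of n]], of "1/2"] Dadd[OF sU[of m] sU[of n]]
    proof eventually_elim
      fix x assume 1: "D ((1 / 2) *\<^sub>R (s m + s n)) x = (1 / 2) *\<^sub>R D (s m + s n) x"
        and 2: "D (s m + s n) x = D (s m) x + D (s n) x"
      have "g x = (1/2) *\<^sub>R g x + (1/2) *\<^sub>R g x" by (simp flip: scaleR_add_left)
      then show "D w x - g x = (a m x + a n x) /\<^sub>R 2"
        unfolding w_def a_def unfolding 1 2 unfolding scaleR_add_right scaleR_diff_right inverse_eq_divide
        using half_split[of "g x"] by blast
    qed
    then have Yw: "Y w = pmod M p (\<lambda>x. (a m x + a n x) /\<^sub>R 2)"
      unfolding Y_def using Lp_measurable[OF aL[OF wU]] by (intro pmod_cong_AE) auto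
    have "Q m n = (pmod M p (a m) + pmod M p (a n)) / 2 - Y w"
      unfolding Q_def Yw using Lp_integrable[OF aLp[of m]] Lp_integrable[OF aLp[of n]] Lp_integrable[OF midL[of m n]]
      by (simp add: pmod_def)
    also have "\<dots> = p * ((J (s m) + J (s n)) / 2 - J w)"
    proof -
      have "F w = (F (s m) + F (s n)) / 2" by (simp add: w_def Fsc[OF Uadd[OF sU sU]] Fadd[OF sU sU] del: scaleR_add_right)
      moreover have "pmod M p (a m) = p * (J (s m) + F (s m))" "pmod M p (a n) = p * (J (s n) + F (s n))"
        "Y w = p * (J w + F w)" using p1 by (simp_all add: J_def Y_def a_def)
      ultimately show ?thesis by (simp add: algebra_simps)
    qed
    also have "\<dots> \<le> p * ((i + 1 / real (Suc m) + (i + 1 / real (Suc n))) / 2 - i)"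
      using sJ[of m] sJ[of n] iJ[OF wU] p0 by (intro mult_left_mono diff_mono divide_right_mono add_mono) auto
    finally show ?thesis by (simp add: algebra_simps add_divide_distrib)
  qed
  \<comment> \<open>uniform convexity turns the small defect into a small distance\<close>
  have cauchy: "\<exists>N. \<forall>m\<ge>N. \<forall>n\<ge>N. pmod M p (\<lambda>x. D (s m) x - D (s n) x) < e" if e: "e > 0" for e
  proof -
    define e' where "e' = e / (4 * (B + 1))"
    have e': "e' > 0" using e B0 by (simp add: e'_def)
    obtain C' where C': "C' \<ge> 0" and uc: "\<And>a b :: 'b. norm (a - b) powr p \<le> e' * (norm a powr p + norm b powr p)
     + C' * ((norm a powr p + norm b powr p) / 2 - norm ((a + b) /\<^sub>R 2) powr p)"
      using uniform_convexity[OF p1 e'] by blast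
    have est: "pmod M p (\<lambda>x. a m x - a n x) \<le> e' * (2 * B) + C' * Q m n" for m n
    proof -
      have "pmod M p (\<lambda>x. a m x - a n x) \<le> (\<integral>x. e' * (norm (a m x) powr p + norm (a n x) powr p) +
          C' * ((norm (a m x) powr p + norm (a n x) powr p) / 2 - norm ((a m x + a n x) /\<^sub>R 2) powr p) \<partial>M)"
        unfolding pmod_def using Lp_integrable[OF aLp[of m]] Lp_integrable[OF aLp[of n]] Lp_integrable[OF midL[of m n]]
          Lp_integrable[OF Lp_diff(1)[OF aLp[of m] aLp[of n] p0(2)]] uc
        by (intro integral_mono) auto
      also have "\<dots> = e' * (pmod M p (a m) + pmod M p (a n)) + C' * Q m n"
        unfolding Q_def pmod_def using Lp_integrable[OF aLp[of m]] Lp_integrable[OF aLp[of n]] Lp_integrable[OF midL[of m n]]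
        by (subst Bochner_Integration.integral_add) (auto simp del: integral_divide_zero)
      also have "\<dots> \<le> e' * (2 * B) + C' * Q m n"
        using YB[of m] YB[of n] e' by (intro add_right_mono mult_left_mono) auto
      finally show ?thesis .
    qed
    obtain N where N: "real N > 2 * C' * p / e" using reals_Archimedean2 by blast
    show ?thesis
    proof (intro exI[of _ N] allI impI)
      fix m n assume mn: "m \<ge> N" "n \<ge> N"
      have r: "1 / real (Suc k) \<le> 1 / real (Suc N)" if "k \<ge> N" for k using that by (simp add: frac_le)
      have "Q m n \<le> p / real (Suc N)"
      proof -
        have "p * (1 / real (Suc m) + 1 / real (Suc n)) / 2 \<le> p * (1 / real (Suc N) + 1 / real (Suc N)) / 2"
          using r[OF mn(1)] r[OF mn(2)] p0 by (intro divide_right_mono mult_left_mono add_mono) auto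
        also have "\<dots> = p / real (Suc N)" by (simp add: field_simps)
        finally show ?thesis using Qb[of m n] by linarith
      qed
      then have "C' * Q m n \<le> C' * p / real (Suc N)" using C' by (metis mult_left_mono times_divide_eq_right)
      also have "\<dots> < e / 2"
      proof -
        have "2 * C' * p < e * real (Suc N)" using N e by (simp add: field_simps)
        then show ?thesis by (simp add: field_simps)
      qed
      finally have "C' * Q m n < e / 2" .
      moreover have "e' * (2 * B) \<le> e / 2" using e B0 by (simp add: e'_def field_simps)
      moreover have "pmod M p (\<lambda>x. D (s m) x - D (s n) x) = pmod M p (\<lambda>x. a m x - a n x)"
        by (simp add: a_def)
      ultimately show "pmod M p (\<lambda>x. D (s m) x - D (s n) x) < e" using est[of m n] by linarith
    qed
  qed
  obtain v where vU: "v \<in> U" and vlim: "(\<lambda>n. pmod M p (\<lambda>x. D (s n) x - D v x)) \<longlonglongrightarrow> 0"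
    using complete[OF sU cauchy] by blast
  have Fv: "(\<lambda>n. F (s n)) \<longlonglongrightarrow> F v"
  proof -
    have "(\<lambda>n. C * (pmod M p (\<lambda>x. D (s n) x - D v x)) powr (1/p)) \<longlonglongrightarrow> C * 0 powr (1/p)"
      using vlim p0 by (intro tendsto_intros tendsto_powr2) auto
    then have "(\<lambda>n. C * nrm (s n - v)) \<longlonglongrightarrow> 0"
      by (simp add: nrm_eq pmod_D_diff sU vU)
    then have "(\<lambda>n. F (s n - v)) \<longlonglongrightarrow> 0"
      by (rule Lim_null_comparison[rotated]) (use FC Udiff sU vU in auto)
    then show ?thesis by (simp add: functional_diff[OF F] sU vU LIM_zero_iff)
  qed
  have Jlim: "(\<lambda>n. J (s n)) \<longlonglongrightarrow> i"
  proof (rule tendsto_sandwich[of "\<lambda>_. i" _ _ "\<lambda>n. i + 1 / real (Suc n)"])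
    show "(\<lambda>n. i + 1 / real (Suc n)) \<longlonglongrightarrow> i"
      using tendsto_add[OF tendsto_const LIMSEQ_inverse_real_of_nat, of i] by (simp add: divide_inverse)
    show "\<forall>\<^sub>F n in sequentially. i \<le> J (s n)" using iJ[OF sU] by (intro always_eventually allI)
    show "\<forall>\<^sub>F n in sequentially. J (s n) \<le> i + 1 / real (Suc n)"
      by (intro always_eventually allI less_imp_le sJ)
  qed simp
  have Ylim: "(\<lambda>n. pmod M p (a n)) \<longlonglongrightarrow> p * (i + F v)"
  proof -
    have "pmod M p (a n) = p * (J (s n) + F (s n))" for n
      using p1 by (simp add: J_def Y_def a_def)
    then show ?thesis by (simp only:) (intro tendsto_intros Jlim Fv)
  qed
  \<comment> \<open>lower semicontinuity: the modular by Fatou, the linear part by continuity\<close>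
  have Jv: "J v \<le> i"
  proof -
    obtain r where r: "strict_mono r" "AE x in M. (\<lambda>n. D (s (r n)) x) \<longlonglongrightarrow> D v x"
      using pmod_tendsto_AE_subseq[OF DL[OF sU] DL[OF vU] vlim p0(1)] by blast
    have ae: "AE x in M. (\<lambda>n. a (r n) x) \<longlonglongrightarrow> D v x - g x"
      using r(2) by eventually_elim (auto simp: a_def intro: tendsto_intros)
    have "Y v \<le> p * (i + F v)" unfolding Y_def
    proof (rule pmod_Fatou(2)[where f="\<lambda>n. a (r n)" and b="\<lambda>n. pmod M p (a (r n))"])
      show "(\<lambda>n. pmod M p (a (r n))) \<longlonglongrightarrow> p * (i + F v)"
        using LIMSEQ_subseq_LIMSEQ[OF Ylim r(1)] by (simp add: comp_def)
    qed (use aLp Lp_measurable[OF aL[OF vU]] ae p0 in auto)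
    then show ?thesis using p0 by (simp add: J_def field_simps)
  qed
  have min: "J v \<le> J u" if "u \<in> U" for u using Jv iJ[OF that] by linarith
  \<comment> \<open>one half of the Euler-Lagrange equation, from convexity\<close>
  have EL: "F w \<le> (\<integral>x. flux p (D v x - g x) \<bullet> D w x \<partial>M)" if wU: "w \<in> U" for w
  proof -
    define b where "b = (\<lambda>x. D v x - g x)"
    have bL: "b \<in> Lp_space M p" unfolding b_def by (rule aL[OF vU])
    have wL: "D w \<in> Lp_space M p" by (rule DL[OF wU])
    note [measurable] = Lp_measurable[OF bL] Lp_measurable[OF wL] flux_measurable[OF p1]
    \<comment> \<open>the tangent inequality is used at \<open>v + t w\<close>, so that the flux is evaluated there; then \<open>t\<close> tends to \<open>0\<close>\<close>
    have step: "F w \<le> (\<integral>x. flux p (b x + t *\<^sub>R D w x) \<bullet> D w x \<partial>M)" if t: "t > 0" for t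
    proof -
      have tU: "v + t *\<^sub>R w \<in> U" by (intro Uadd Uscale vU wU)
      have tL: "(\<lambda>x. b x + t *\<^sub>R D w x) \<in> Lp_space M p" by (intro Lp_add(1) Lp_scaleR bL wL p0)
      have "AE x in M. D (v + t *\<^sub>R w) x - g x = b x + t *\<^sub>R D w x"
        using Dadd[OF vU Uscale[OF wU, of t]] Dscale[OF wU, of t] by eventually_elim (simp add: b_def)
      then have Yt: "Y (v + t *\<^sub>R w) = pmod M p (\<lambda>x. b x + t *\<^sub>R D w x)"
        unfolding Y_def using Lp_measurable[OF aL[OF tU]] by (intro pmod_cong_AE) auto
      note H = Hoelder_inner(1)[OF p1 wL flux_Lp(1)[OF p1 tL]]
      have "pmod M p (\<lambda>x. b x + t *\<^sub>R D w x) / p - pmod M p b / p =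
         (\<integral>x. norm (b x + t *\<^sub>R D w x) powr p / p - norm (b x) powr p / p \<partial>M)"
        using Lp_integrable[OF tL] Lp_integrable[OF bL] by (simp add: pmod_def)
      also have "\<dots> \<le> (\<integral>x. t * (flux p (b x + t *\<^sub>R D w x) \<bullet> D w x) \<partial>M)"
      proof (rule integral_mono)
        fix x show "norm (b x + t *\<^sub>R D w x) powr p / p - norm (b x) powr p / p \<le> t * (flux p (b x + t *\<^sub>R D w x) \<bullet> D w x)"
          using flux_tangent[OF p1, of "b x + t *\<^sub>R D w x" "b x"] by (simp add: inner_diff_right inner_add_right)
      qed (use Lp_integrable[OF tL] Lp_integrable[OF bL] H in auto)
      finally have "Y (v + t *\<^sub>R w) / p - Y v / p \<le> t * (\<integral>x. flux p (b x + t *\<^sub>R D w x) \<bullet> D w x \<partial>M)"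
        by (simp add: Yt) (simp add: Y_def b_def)
      moreover have "J v \<le> J (v + t *\<^sub>R w)" by (rule min[OF tU])
      ultimately have "t * F w \<le> t * (\<integral>x. flux p (b x + t *\<^sub>R D w x) \<bullet> D w x \<partial>M)"
        by (simp add: J_def Fadd Fsc vU wU Uscale)
      then show ?thesis using t by simp
    qed
    define f where "f = (\<lambda>n x. flux p (b x + (1 / real (Suc n)) *\<^sub>R D w x) \<bullet> D w x)"
    define h where "h = (\<lambda>x. 2 powr p * (norm (b x) powr p + norm (D w x) powr p) / conj_exp p + norm (D w x) powr p / p)"
    have "(\<lambda>n. \<integral>x. f n x \<partial>M) \<longlonglongrightarrow> (\<integral>x. flux p (b x) \<bullet> D w x \<partial>M)"
    proof (rule integral_dominated_convergence[where w=h])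
      show "(\<lambda>x. flux p (b x) \<bullet> D w x) \<in> borel_measurable M" by measurable
      show "f n \<in> borel_measurable M" for n unfolding f_def by measurable
      show "integrable M h" unfolding h_def using Lp_integrable[OF bL] Lp_integrable[OF wL] by simp
      show "AE x in M. (\<lambda>n. f n x) \<longlonglongrightarrow> flux p (b x) \<bullet> D w x"
      proof (rule AE_I2)
        fix x
        have "(\<lambda>n. b x + (1 / real (Suc n)) *\<^sub>R D w x) \<longlonglongrightarrow> b x + 0 *\<^sub>R D w x"
          using LIMSEQ_inverse_real_of_nat by (intro tendsto_intros) (simp add: divide_inverse)
        then have t: "(\<lambda>n. b x + (1 / real (Suc n)) *\<^sub>R D w x) \<longlonglongrightarrow> b x" by simp
        have "isCont (flux p) (b x)" using continuous_flux[OF p1] by (auto simp: continuous_on_eq_continuous_at)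
        then have "(\<lambda>n. flux p (b x + (1 / real (Suc n)) *\<^sub>R D w x)) \<longlonglongrightarrow> flux p (b x)"
          using t by (rule isCont_tendsto_compose)
        then show "(\<lambda>n. f n x) \<longlonglongrightarrow> flux p (b x) \<bullet> D w x" unfolding f_def by (intro tendsto_intros)
      qed
      show "AE x in M. norm (f n x) \<le> h x" for n
      proof (rule AE_I2)
        fix x
        define z where "z = b x + (1 / real (Suc n)) *\<^sub>R D w x"
        have "norm z \<le> norm (b x) + norm (D w x)"
        proof -
          have "1 / real (Suc n) * norm (D w x) \<le> norm (D w x)" by (rule mult_left_le_one_le) auto
          then show ?thesis unfolding z_def using norm_triangle_ineq[of "b x" "(1 / real (Suc n)) *\<^sub>R D w x"] by simp
        qed
        then have zz: "norm z powr p \<le> 2 powr p * (norm (b x) powr p + norm (D w x) powr p)"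
          using powr_mono2[OF p0(2), of "norm z"] powr_sum_le[of "norm (b x)" "norm (D w x)" p] p0 by force
        have "norm (f n x) \<le> norm (D w x) * norm (flux p z)"
          unfolding f_def z_def[symmetric] by (metis Cauchy_Schwarz_ineq2 mult.commute real_norm_def)
        also have "\<dots> \<le> norm (D w x) powr p / p + norm (flux p z) powr conj_exp p / conj_exp p"
          by (rule Youngs_inequality) (use conj_exp_props[OF p1] p1 in auto)
        also have "\<dots> \<le> h x" unfolding h_def norm_flux_conj[OF p1]
          using divide_right_mono[OF zz, of "conj_exp p"] q1 by simp
        finally show "norm (f n x) \<le> h x" .
      qed
    qed
    then have "F w \<le> (\<integral>x. flux p (b x) \<bullet> D w x \<partial>M)"
      by (rule LIMSEQ_le_const) (use step in \<open>auto simp: f_def\<close>)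
    then show ?thesis by (simp add: b_def)
  qed
  \<comment> \<open>the opposite inequality comes from \<open>- w\<close>\<close>
  have "F w = (\<integral>x. flux p (D v x - g x) \<bullet> D w x \<partial>M)" if wU: "w \<in> U" for w
  proof (rule antisym[OF EL[OF wU]])
    have m: "D ((-1) *\<^sub>R w) \<in> borel_measurable M" by (rule Dmeas[OF Uscale[OF wU]])
    note [measurable] = m m[simplified] Dmeas[OF wU] Dmeas[OF vU] flux_measurable[OF p1]
    have "(\<integral>x. flux p (D v x - g x) \<bullet> D ((-1) *\<^sub>R w) x \<partial>M) = (\<integral>x. - (flux p (D v x - g x) \<bullet> D w x) \<partial>M)"
      using Dscale[OF wU, of "-1"] by (intro integral_cong_AE) (auto elim!: eventually_mono)
    then show "(\<integral>x. flux p (D v x - g x) \<bullet> D w x \<partial>M) \<le> F w"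
      using EL[OF Uscale[OF wU, of "-1"]] Fsc[OF wU, of "-1"] by simp
  qed
  then show ?thesis using vU by auto
qed

end

section \<open>Duality, reflexivity and weak compactness\<close>

lemma dual_space_add:
  assumes "F \<in> dual_space V n" "G \<in> dual_space V n"
  shows "F + G \<in> dual_space V n"
proof -
  obtain C1 C2 where "\<forall>x\<in>V. \<bar>F x\<bar> \<le> C1 * n x" "\<forall>x\<in>V. \<bar>G x\<bar> \<le> C2 * n x"
    using assms unfolding dual_space_def by blast
  then have "\<forall>x\<in>V. \<bar>(F + G) x\<bar> \<le> (C1 + C2) * n x"
    by (auto simp: plus_fun_def distrib_right intro!: order_trans[OF abs_triangle_ineq] add_mono)
  moreover have "(F + G) (x + y) = (F + G) x + (F + G) y" if "x \<in> V" "y \<in> V" for x y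
  proof -
    have "F (x + y) = F x + F y" "G (x + y) = G x + G y" using assms that unfolding dual_space_def by blast+
    then show ?thesis by simp
  qed
  moreover have "(F + G) (c *\<^sub>R x) = c * (F + G) x" if "x \<in> V" for x c
  proof -
    have "F (c *\<^sub>R x) = c * F x" "G (c *\<^sub>R x) = c * G x" using assms that unfolding dual_space_def by blast+
    then show ?thesis by (simp add: distrib_left)
  qed
  ultimately show ?thesis unfolding dual_space_def by blast
qed

lemma dual_space_scale:
  assumes "F \<in> dual_space V n"
  shows "c *\<^sub>R F \<in> dual_space V n"
proof -
  obtain C1 where "\<forall>x\<in>V. \<bar>F x\<bar> \<le> C1 * n x" using assms unfolding dual_space_def by blast
  then have "\<forall>x\<in>V. \<bar>(c *\<^sub>R F) x\<bar> \<le> (\<bar>c\<bar> * C1) * n x"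
    by (auto simp: scaleR_fun_def abs_mult mult.assoc intro!: mult_left_mono)
  moreover have "(c *\<^sub>R F) (x + y) = (c *\<^sub>R F) x + (c *\<^sub>R F) y" if "x \<in> V" "y \<in> V" for x y
  proof -
    have "F (x + y) = F x + F y" using assms that unfolding dual_space_def by blast
    then show ?thesis by (simp add: scaleR_fun_def distrib_left)
  qed
  moreover have "(c *\<^sub>R F) (d *\<^sub>R x) = d * (c *\<^sub>R F) x" if "x \<in> V" for x d
  proof -
    have "F (d *\<^sub>R x) = d * F x" using assms that unfolding dual_space_def by blast
    then show ?thesis by (simp add: scaleR_fun_def)
  qed
  ultimately show ?thesis unfolding dual_space_def by blast
qed

lemma dual_spaceI:
  assumes "\<And>x y. x \<in> V \<Longrightarrow> y \<in> V \<Longrightarrow> F (x + y) = F x + F y"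
    "\<And>c x. x \<in> V \<Longrightarrow> F (c *\<^sub>R x) = c * F x" "\<And>x. x \<in> V \<Longrightarrow> \<bar>F x\<bar> \<le> C * n x"
  shows "F \<in> dual_space V n"
  using assms unfolding dual_space_def by blast

lemma dual_spaceD:
  assumes "F \<in> dual_space V n"
  shows "x \<in> V \<Longrightarrow> y \<in> V \<Longrightarrow> F (x + y) = F x + F y" "x \<in> V \<Longrightarrow> F (c *\<^sub>R x) = c * F x"
    "\<exists>C\<ge>0. \<forall>x\<in>V. n x \<ge> 0 \<longrightarrow> \<bar>F x\<bar> \<le> C * n x"
proof -
  obtain C where C: "\<forall>x\<in>V. \<bar>F x\<bar> \<le> C * n x" using assms unfolding dual_space_def by blast
  have "\<bar>F x\<bar> \<le> max C 0 * n x" if "x \<in> V" "n x \<ge> 0" for x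
    using C that mult_right_mono[of C "max C 0" "n x"] by fastforce
  then show "\<exists>C\<ge>0. \<forall>x\<in>V. n x \<ge> 0 \<longrightarrow> \<bar>F x\<bar> \<le> C * n x" by (intro exI[of _ "max C 0"]) auto
qed (use assms in \<open>auto simp: dual_space_def\<close>)

text \<open>The difference of \<open>F\<close> and \<open>G\<close> has dual norm zero, so a bounded functional kills it: elements of the dual may be
  altered freely off \<open>V\<close>.\<close>

lemma bidual_cong:
  assumes L: "L \<in> dual_space (dual_space V n) (dual_norm V n)"
    and F: "F \<in> dual_space V n" and G: "G \<in> dual_space V n"
    and V: "0 \<in> V" "n 0 \<le> 1" and eq: "\<And>x. x \<in> V \<Longrightarrow> F x = G x"
  shows "L F = L G"
proof -
  let ?H = "F + (-1) *\<^sub>R G"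
  have G': "(-1) *\<^sub>R G \<in> dual_space V n" by (rule dual_space_scale[OF G])
  have H: "?H \<in> dual_space V n" by (rule dual_space_add[OF F G'])
  have "{\<bar>?H x\<bar> | x. x \<in> V \<and> n x \<le> 1} = {0}"
    using V eq by (auto simp: scaleR_fun_def intro!: exI[of _ 0])
  then have "dual_norm V n ?H = 0" by (simp add: dual_norm_def)
  moreover obtain C where "\<forall>F\<in>dual_space V n. \<bar>L F\<bar> \<le> C * dual_norm V n F"
    using L unfolding dual_space_def[of "dual_space V n"] by blast
  ultimately have "L ?H = 0" using H by fastforce
  moreover have "L ?H = L F + (-1) * L G"
    by (simp only: dual_spaceD(1)[OF L F G'] dual_spaceD(2)[OF L G])
  ultimately show ?thesis by simp
qed

text \<open>Bolzano-Weierstrass for each \<open>k\<close> in turn, and Cantor's diagonal sequence.\<close>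

lemma diagonal_subsequence:
  fixes a :: "nat \<Rightarrow> nat \<Rightarrow> real"
  assumes "\<And>n k. \<bar>a n k\<bar> \<le> B k"
  shows "\<exists>r. strict_mono r \<and> (\<forall>k. convergent (\<lambda>n. a (r n) k))"
proof -
  interpret subseqs "\<lambda>k r. convergent (\<lambda>n. a (r n) k)"
  proof
    fix k and s :: "nat \<Rightarrow> nat"
    have "bounded (range (\<lambda>n. a (s n) k))" using assms by (auto simp: bounded_iff intro!: exI[of _ "B k"])
    from bounded_imp_convergent_subsequence[OF this]
    show "\<exists>r. strict_mono r \<and> convergent (\<lambda>n. a ((s \<circ> r) n) k)"
      by (auto simp: convergent_def comp_def)
  qed
  have "convergent (\<lambda>n. a (diagseq n) k)" for k
  proof -
    have "convergent (\<lambda>n. a ((diagseq \<circ> (+) (Suc k)) n) k)"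
      by (rule diagseq_holds) (auto simp: comp_def intro: convergent_subseq_convergent[unfolded comp_def])
    then show ?thesis
      using convergent_ignore_initial_segment[of "\<lambda>n. a (diagseq n) k" "Suc k"] by (simp add: comp_def add.commute)
  qed
  then show ?thesis using subseq_diagseq by blast
qed

text \<open>Integration of the pointwise estimate, with its small parameter divided by a bound for the modulars.\<close>

lemma flux_Lp_continuous:
  fixes f :: "'a \<Rightarrow> 'b::euclidean_space"
  assumes p: "p > 1" and f: "f \<in> Lp_space M p" and e: "e > 0"
  shows "\<exists>d>0. \<forall>g\<in>Lp_space M p. pmod M p (\<lambda>x. f x - g x) < d \<longrightarrow>
    pmod M (conj_exp p) (\<lambda>x. flux p (f x) - flux p (g x)) < e"
proof -
  define B where "B = pmod M p f + 2 powr p * (pmod M p f + 1) + 1"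
  have B: "B > 0" unfolding B_def by (intro add_nonneg_pos add_nonneg_nonneg mult_nonneg_nonneg) auto
  obtain C where C: "C \<ge> 0" and uc: "\<And>a b :: 'b. norm (flux p a - flux p b) powr conj_exp p
      \<le> (e / (2 * B)) * (norm a powr p + norm b powr p) + C * norm (a - b) powr p"
    using flux_uniform_continuity[OF p, of "e / (2 * B)"] e B by auto
  define d where "d = min 1 (e / (2 * (C + 1)))"
  have d: "d > 0" using e C by (simp add: d_def)
  show ?thesis
  proof (intro exI[of _ d] conjI d ballI impI)
    fix g assume g: "g \<in> Lp_space M p" and gd: "pmod M p (\<lambda>x. f x - g x) < d"
    have diff: "(\<lambda>x. f x - g x) \<in> Lp_space M p" using p by (intro Lp_diff(1) f g) auto
    have "pmod M p g \<le> 2 powr p * (pmod M p f + pmod M p (\<lambda>x. f x - g x))"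
      using Lp_diff(2)[OF f diff] p by simp
    also have "\<dots> \<le> 2 powr p * (pmod M p f + 1)" using gd by (intro mult_left_mono) (auto simp: d_def)
    finally have gB: "pmod M p f + pmod M p g < B" by (simp add: B_def)
    have "pmod M (conj_exp p) (\<lambda>x. flux p (f x) - flux p (g x)) \<le>
      (\<integral>x. (e / (2 * B)) * (norm (f x) powr p + norm (g x) powr p) + C * norm (f x - g x) powr p \<partial>M)"
      unfolding pmod_def
      using Lp_integrable[OF f] Lp_integrable[OF g] Lp_integrable[OF diff] uc
        Lp_integrable[OF Lp_diff(1)[OF flux_Lp(1)[OF p f] flux_Lp(1)[OF p g]]] conj_exp_props[OF p]
      by (intro integral_mono) auto
    also have "\<dots> = (e / (2 * B)) * (pmod M p f + pmod M p g) + C * pmod M p (\<lambda>x. f x - g x)"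
      using Lp_integrable[OF f] Lp_integrable[OF g] Lp_integrable[OF diff] by (simp add: pmod_def)
    also have "(e / (2 * B)) * (pmod M p f + pmod M p g) < (e / (2 * B)) * B"
      using gB e B by (intro mult_strict_left_mono) auto
    also have "(e / (2 * B)) * B = e / 2" using B by simp
    also have "C * pmod M p (\<lambda>x. f x - g x) \<le> (C + 1) * (e / (2 * (C + 1)))"
      using gd C by (intro mult_mono) (auto simp: d_def)
    also have "(C + 1) * (e / (2 * (C + 1))) = e / 2" using C by (simp add: field_simps)
    finally show "pmod M (conj_exp p) (\<lambda>x. flux p (f x) - flux p (g x)) < e" by simp
  qed
qed

text \<open>The whole Lebesgue space is a model of itself; applied to the dual exponent this is the Riesz representation
  theorem that the proof of reflexivity needs.\<close>

lemma Lp_model_full: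
  fixes M :: "'x measure"
  assumes "p > 1"
  shows "Lp_model M p (Lp_space M p :: ('x \<Rightarrow> 'b::euclidean_space) set) (\<lambda>h. h)"
proof
  fix s :: "nat \<Rightarrow> 'x \<Rightarrow> 'b"
  assume "\<And>n. s n \<in> Lp_space M p"
    "\<And>e. e > 0 \<Longrightarrow> \<exists>N. \<forall>m\<ge>N. \<forall>n\<ge>N. pmod M p (\<lambda>x. s m x - s n x) < e"
  then show "\<exists>v\<in>Lp_space M p. (\<lambda>n. pmod M p (\<lambda>x. s n x - v x)) \<longlonglongrightarrow> 0"
    using assms by (intro Lp_complete) auto
next
  show "p > 1" by (rule assms)
  show "u + v \<in> Lp_space M p" if "u \<in> Lp_space M p" "v \<in> Lp_space M p" for u v :: "'x \<Rightarrow> 'b"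
    using Lp_add(1)[OF that] assms by (simp add: plus_fun_def)
qed (auto simp: scaleR_fun_def zero_fun_def Lp_zero Lp_scaleR)

context Lp_model
begin

lemma nrm_0: "nrm 0 = 0"
  using nrm_scale[OF U0, of 0] by simp

lemma dual_representation:
  assumes "F \<in> dual_space U nrm"
  shows "\<exists>v\<in>U. \<forall>w\<in>U. F w = (\<integral>x. flux p (D v x) \<bullet> D w x \<partial>M)"
  using minimiser_Euler_Lagrange[OF assms Lp_zero] by force

lemma dual_norm_bdd:
  assumes "F \<in> dual_space U nrm"
  shows "bdd_above {\<bar>F x\<bar> | x. x \<in> U \<and> nrm x \<le> 1}"
proof -
  obtain C where C: "C \<ge> 0" "\<forall>x\<in>U. nrm x \<ge> 0 \<longrightarrow> \<bar>F x\<bar> \<le> C * nrm x" using dual_spaceD(3)[OF assms] by blast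
  have "\<bar>F x\<bar> \<le> C" if "x \<in> U" "nrm x \<le> 1" for x
  proof -
    have "\<bar>F x\<bar> \<le> C * nrm x" using C that by simp
    also have "\<dots> \<le> C * 1" using C that by (intro mult_left_mono) auto
    finally show ?thesis by simp
  qed
  then show ?thesis by (intro bdd_aboveI[of _ C]) auto
qed

lemma dual_norm_bound:
  assumes F: "F \<in> dual_space U nrm" and u: "u \<in> U"
  shows "\<bar>F u\<bar> \<le> dual_norm U nrm F * nrm u"
proof (cases "nrm u = 0")
  case True
  obtain C where "\<forall>x\<in>U. nrm x \<ge> 0 \<longrightarrow> \<bar>F x\<bar> \<le> C * nrm x" using dual_spaceD(3)[OF F] by blast
  then have "\<bar>F u\<bar> \<le> C * nrm u" using u by simp
  then show ?thesis using True by simp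
next
  case False
  then have n: "nrm u > 0" using nrm_nonneg[of u] by linarith
  define w where "w = (1 / nrm u) *\<^sub>R u"
  have w: "w \<in> U" "nrm w \<le> 1" using n by (auto simp: w_def Uscale u nrm_scale)
  have "\<bar>F w\<bar> \<le> dual_norm U nrm F" unfolding dual_norm_def
    by (rule cSup_upper[OF _ dual_norm_bdd[OF F]]) (use w in auto)
  moreover have "F w = (1 / nrm u) * F u" unfolding w_def by (rule dual_spaceD(2)[OF F u])
  ultimately show ?thesis using n by (simp add: abs_mult field_simps)
qed

lemma dual_norm_le:
  assumes "\<And>u. u \<in> U \<Longrightarrow> nrm u \<le> 1 \<Longrightarrow> \<bar>F u\<bar> \<le> C"
  shows "dual_norm U nrm F \<le> C"
  unfolding dual_norm_def
  by (rule cSup_least) (use assms U0 nrm_0 in \<open>auto intro!: exI[of _ 0]\<close>)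

text \<open>The value \<open>0\<close> off the space makes \<open>pairing\<close> linear in \<open>h\<close> as an identity between total functions, as
  functionals on the dual require.\<close>

definition pairing :: "('x \<Rightarrow> 'b) \<Rightarrow> 'u \<Rightarrow> real" where
  "pairing h = (\<lambda>u. if u \<in> U then \<integral>x. h x \<bullet> D u x \<partial>M else 0)"

lemma pairing_bound:
  assumes h: "h \<in> Lp_space M (conj_exp p)" and u: "u \<in> U"
  shows "\<bar>pairing h u\<bar> \<le> Lp_norm M (conj_exp p) h * nrm u"
  using Hoelder_inner(2)[OF p1 DL[OF u] h] u by (simp add: pairing_def nrm_def)

lemma pairing_dual:
  assumes h: "h \<in> Lp_space M (conj_exp p)"
  shows "pairing h \<in> dual_space U nrm"
proof (rule dual_spaceI)
  note int = Hoelder_inner(1)[OF p1 DL h]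
  note m [measurable] = Lp_measurable[OF h] Dmeas
  show "pairing h (u + v) = pairing h u + pairing h v" if u: "u \<in> U" and v: "v \<in> U" for u v
  proof -
    have "(\<integral>x. h x \<bullet> D (u + v) x \<partial>M) = (\<integral>x. h x \<bullet> D u x + h x \<bullet> D v x \<partial>M)"
      using Dadd[OF u v] int[OF Uadd[OF u v]] int[OF u] int[OF v]
      by (intro integral_cong_AE) (auto elim!: eventually_mono simp: inner_add_right)
    then show ?thesis using u v Uadd[OF u v] int[OF u] int[OF v] by (simp add: pairing_def)
  qed
  show "pairing h (c *\<^sub>R u) = c * pairing h u" if u: "u \<in> U" for u c
  proof -
    have "(\<integral>x. h x \<bullet> D (c *\<^sub>R u) x \<partial>M) = (\<integral>x. c * (h x \<bullet> D u x) \<partial>M)"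
      using Dscale[OF u, of c] int[OF Uscale[OF u, of c]] int[OF u]
      by (intro integral_cong_AE) (auto elim!: eventually_mono)
    then show ?thesis using u Uscale[OF u] by (simp add: pairing_def)
  qed
  show "\<bar>pairing h u\<bar> \<le> Lp_norm M (conj_exp p) h * nrm u" if "u \<in> U" for u by (rule pairing_bound[OF h that])
qed

text \<open>A functional \<open>L\<close> on the dual restricts along \<open>h \<mapsto> pairing h\<close> to a functional on the Lebesgue space of the dual
  exponent, where it is integration against some \<open>G\<close> in \<open>L\<^sup>p\<close>. Let \<open>D u\<close> be the projection of \<open>G\<close> onto the space.
  The flux \<open>k\<close> of \<open>D u - G\<close> annihilates the space, so \<open>pairing k\<close> is zero and \<open>L\<close> vanishes on it. Hence \<open>k\<close> is
  orthogonal to \<open>D u\<close> and to \<open>G\<close>, and \<open>pmod (D u - G)\<close>, which is the pairing of \<open>k\<close> with \<open>D u - G\<close>, is zero. So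
  \<open>L\<close> is evaluation at \<open>u\<close>.\<close>

theorem reflexive:
  assumes L: "L \<in> dual_space (dual_space U nrm) (dual_norm U nrm)"
  shows "\<exists>u\<in>U. \<forall>F\<in>dual_space U nrm. L F = F u"
proof -
  define q where "q = conj_exp p"
  have q: "q > 1" "conj_exp q = p" using conj_exp_props[OF p1] by (auto simp: q_def)
  interpret E: Lp_model M q "Lp_space M q :: ('x \<Rightarrow> 'b) set" "\<lambda>h. h" by (rule Lp_model_full[OF q(1)])
  note pd = pairing_dual[folded q_def]
  have n01: "nrm 0 \<le> 1" by (simp add: nrm_0)
  have int: "integrable M (\<lambda>x. h x \<bullet> D u x)" if "h \<in> Lp_space M q" "u \<in> U" for h u
    using Hoelder_inner(1)[OF p1 DL] that by (simp add: q_def)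
  obtain C where C: "C \<ge> 0" "\<forall>F\<in>dual_space U nrm. dual_norm U nrm F \<ge> 0 \<longrightarrow> \<bar>L F\<bar> \<le> C * dual_norm U nrm F"
    using dual_spaceD(3)[OF L] by blast
  have dn0: "dual_norm U nrm F \<ge> 0" if "F \<in> dual_space U nrm" for F
    unfolding dual_norm_def
    by (rule cSup_upper2[OF _ _ dual_norm_bdd[OF that]]) (use U0 nrm_0 in \<open>auto intro!: exI[of _ 0]\<close>)
  have "(\<lambda>h. L (pairing h)) \<in> dual_space (Lp_space M q) E.nrm"
  proof (rule dual_spaceI)
    fix h k :: "'x \<Rightarrow> 'b" assume h: "h \<in> Lp_space M q" and k: "k \<in> Lp_space M q"
    have "pairing (h + k) = pairing h + pairing k"
      using int[OF h] int[OF k] by (auto simp: pairing_def fun_eq_iff inner_add_left)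
    then show "L (pairing (h + k)) = L (pairing h) + L (pairing k)"
      by (simp add: dual_spaceD(1)[OF L pd[OF h] pd[OF k]])
  next
    fix c and h :: "'x \<Rightarrow> 'b" assume h: "h \<in> Lp_space M q"
    have "pairing (c *\<^sub>R h) = c *\<^sub>R pairing h"
      by (auto simp: pairing_def fun_eq_iff scaleR_fun_def)
    then show "L (pairing (c *\<^sub>R h)) = c * L (pairing h)"
      by (simp add: dual_spaceD(2)[OF L pd[OF h]])
  next
    fix h :: "'x \<Rightarrow> 'b" assume h: "h \<in> Lp_space M q"
    have "dual_norm U nrm (pairing h) \<le> Lp_norm M q h"
    proof (rule dual_norm_le)
      fix u assume u: "u \<in> U" "nrm u \<le> 1"
      have "\<bar>pairing h u\<bar> \<le> Lp_norm M q h * nrm u" using pairing_bound h u by (simp add: q_def)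
      also have "\<dots> \<le> Lp_norm M q h * 1" using u by (intro mult_left_mono) auto
      finally show "\<bar>pairing h u\<bar> \<le> Lp_norm M q h" by simp
    qed
    then have "C * dual_norm U nrm (pairing h) \<le> C * E.nrm h" using C by (intro mult_left_mono) (auto simp: E.nrm_def)
    then show "\<bar>L (pairing h)\<bar> \<le> C * E.nrm h" using C(2) pd[OF h] dn0[OF pd[OF h]] by force
  qed
  from E.dual_representation[OF this] obtain G0 where G0: "G0 \<in> Lp_space M q"
    and rep: "\<And>h. h \<in> Lp_space M q \<Longrightarrow> L (pairing h) = (\<integral>x. flux q (G0 x) \<bullet> h x \<partial>M)" by blast
  define G where "G = (\<lambda>x. flux q (G0 x))"
  have G: "G \<in> Lp_space M p" using flux_Lp(1)[OF q(1) G0] q by (simp add: G_def)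
  have zero: "(\<lambda>_. 0) \<in> dual_space U nrm" by (rule dual_spaceI[where C=0]) auto
  \<comment> \<open>project the representing function onto the space\<close>
  obtain u where u: "u \<in> U" and orth: "\<And>w. w \<in> U \<Longrightarrow> (\<integral>x. flux p (D u x - G x) \<bullet> D w x \<partial>M) = 0"
    using minimiser_Euler_Lagrange[OF zero G] by blast
  have dL: "(\<lambda>x. D u x - G x) \<in> Lp_space M p" by (rule Lp_diff(1)[OF DL[OF u] G p0(2)])
  define k where "k = (\<lambda>x. flux p (D u x - G x))"
  have k: "k \<in> Lp_space M q" using flux_Lp(1)[OF p1 dL] by (simp add: k_def q_def)
  have "L (pairing k) = L (\<lambda>_. 0)"
    by (rule bidual_cong[OF L pd[OF k] zero U0 n01]) (simp add: pairing_def k_def orth)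
  moreover have "L (\<lambda>_. 0) = 0" using dual_spaceD(2)[OF L zero, of 0] by (simp add: scaleR_fun_def)
  ultimately have Gk: "(\<integral>x. G x \<bullet> k x \<partial>M) = 0" using rep[OF k] by (simp add: G_def)
  have i1: "integrable M (\<lambda>x. k x \<bullet> D u x)" by (rule int[OF k u])
  have i2: "integrable M (\<lambda>x. k x \<bullet> G x)" using Hoelder_inner(1)[OF p1 G] k by (simp add: q_def)
  have "pmod M p (\<lambda>x. D u x - G x) = (\<integral>x. k x \<bullet> D u x - k x \<bullet> G x \<partial>M)"
    unfolding pmod_def k_def by (simp add: inner_diff_right[symmetric] flux_inner_self)
  also have "\<dots> = 0" using i1 i2 Gk orth[OF u] by (simp add: k_def inner_commute)
  finally have DG: "AE x in M. D u x = G x" using pmod_eq_0[OF dL] by auto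
  show ?thesis
  proof (intro bexI[OF _ u] ballI)
    fix F assume F: "F \<in> dual_space U nrm"
    obtain v where v: "v \<in> U" and Fv: "\<And>w. w \<in> U \<Longrightarrow> F w = (\<integral>x. flux p (D v x) \<bullet> D w x \<partial>M)"
      using dual_representation[OF F] by blast
    define h where "h = (\<lambda>x. flux p (D v x))"
    have h: "h \<in> Lp_space M q" using flux_Lp(1)[OF p1 DL[OF v]] by (simp add: h_def q_def)
    note [measurable] = Lp_measurable[OF h] Lp_measurable[OF G] Dmeas[OF u]
    \<comment> \<open>every functional on the space is a pairing, up to values off the space\<close>
    have "L F = L (pairing h)"
      by (rule bidual_cong[OF L F pd[OF h] U0 n01]) (simp add: pairing_def h_def Fv)
    also have "\<dots> = (\<integral>x. G x \<bullet> h x \<partial>M)" using rep[OF h] by (simp add: G_def)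
    also have "\<dots> = (\<integral>x. h x \<bullet> D u x \<partial>M)"
      using DG by (intro integral_cong_AE) (auto simp: inner_commute elim!: eventually_mono)
    also have "\<dots> = F u" using Fv[OF u] by (simp add: h_def)
    finally show "L F = F u" .
  qed
qed

text \<open>Functionals are fluxes of elements, and the flux is continuous, so countably many functionals are dense in the
  dual. A diagonal subsequence converges on these, hence on all functionals because the sequence is bounded; the
  limit is a bounded functional on the dual, and reflexivity identifies it with an element of the space.\<close>

theorem weak_compactness:
  fixes s :: "nat \<Rightarrow> 'u" and R :: real
  assumes S: "countable S" "S \<subseteq> U"
    and dense: "\<And>u e. u \<in> U \<Longrightarrow> e > 0 \<Longrightarrow> \<exists>v\<in>S. pmod M p (\<lambda>x. D u x - D v x) < e"
    and s: "\<And>n. s n \<in> U" and R: "\<And>n. nrm (s n) \<le> R"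
  shows "\<exists>r. strict_mono r \<and> (\<exists>u\<in>U. \<forall>F\<in>dual_space U nrm. (\<lambda>n. F (s (r n))) \<longlonglongrightarrow> F u)"
proof -
  define q where "q = conj_exp p"
  have q: "q > 1" using conj_exp_props[OF p1] by (auto simp: q_def)
  have "S \<noteq> {}" using dense[OF U0, of 1] by auto
  define b where "b = from_nat_into S"
  have b: "b k \<in> U" for k using from_nat_into[OF \<open>S \<noteq> {}\<close>] S by (auto simp: b_def)
  have R0: "R \<ge> 0" using R[of 0] nrm_nonneg[of "s 0"] by linarith
  define h where "h = (\<lambda>v x. flux p (D v x))"
  have h: "h v \<in> Lp_space M (conj_exp p)" if "v \<in> U" for v unfolding h_def by (rule flux_Lp(1)[OF p1 DL[OF that]])
  have "\<bar>pairing (h (b k)) (s n)\<bar> \<le> Lp_norm M (conj_exp p) (h (b k)) * R" for n k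
    by (rule order_trans[OF pairing_bound[OF h[OF b] s] mult_left_mono[OF R]]) simp
  from diagonal_subsequence[of "\<lambda>n k. pairing (h (b k)) (s n)" "\<lambda>k. Lp_norm M (conj_exp p) (h (b k)) * R", OF this] obtain r where r: "strict_mono r"
    and conv: "\<And>k. convergent (\<lambda>n. pairing (h (b k)) (s (r n)))" by blast
  have conv': "convergent (\<lambda>n. F (s (r n)))" if F: "F \<in> dual_space U nrm" for F
  proof -
    obtain v where v: "v \<in> U" and Fv: "\<And>w. w \<in> U \<Longrightarrow> F w = (\<integral>x. flux p (D v x) \<bullet> D w x \<partial>M)"
      using dual_representation[OF F] by blast
    have "Cauchy (\<lambda>n. F (s (r n)))"
    proof (rule metric_CauchyI)
      fix e :: real assume e: "e > 0"
      define e' where "e' = (e / (4 * (R + 1))) powr q"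
      have e': "e' > 0" using e R0 by (simp add: e'_def)
      obtain d where d: "d > 0" and dd: "\<And>g. g \<in> Lp_space M p \<Longrightarrow> pmod M p (\<lambda>x. D v x - g x) < d \<Longrightarrow>
          pmod M q (\<lambda>x. flux p (D v x) - flux p (g x)) < e'"
        using flux_Lp_continuous[OF p1 DL[OF v] e'] unfolding q_def by blast
      obtain v' where "v' \<in> S" and v'd: "pmod M p (\<lambda>x. D v x - D v' x) < d" using dense[OF v d] by blast
      then obtain k where k: "v' = b k" using from_nat_into_surj[OF S(1)] unfolding b_def by metis
      define g where "g = (\<lambda>x. h v x - h (b k) x)"
      have g: "g \<in> Lp_space M (conj_exp p)" unfolding g_def using q by (intro Lp_diff(1) h v b) (auto simp: q_def)
      have "pmod M q g < e'" using dd[OF DL[OF b[of k]]] v'd unfolding k g_def h_def by simp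
      then have "pmod M q g powr (1/q) \<le> e' powr (1/q)" using q by (intro powr_mono2) auto
      also have "\<dots> = e / (4 * (R + 1))" using q e R0 by (simp add: e'_def powr_powr)
      finally have gn: "Lp_norm M (conj_exp p) g \<le> e / (4 * (R + 1))" by (simp add: Lp_norm_pmod q_def)
      have close: "\<bar>F (s n) - pairing (h (b k)) (s n)\<bar> \<le> e / 4" for n
      proof -
        have "F (s n) - pairing (h (b k)) (s n) = pairing g (s n)"
          using Hoelder_inner(1)[OF p1 DL[OF s[of n]] h[OF v]] Hoelder_inner(1)[OF p1 DL[OF s[of n]] h[OF b[of k]]]
          by (simp add: Fv[OF s] pairing_def s g_def inner_diff_left h_def)
        then have "\<bar>F (s n) - pairing (h (b k)) (s n)\<bar> \<le> Lp_norm M (conj_exp p) g * nrm (s n)"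
          using pairing_bound[OF g s] by simp
        also have "\<dots> \<le> (e / (4 * (R + 1))) * (R + 1)"
          using gn R[of n] e R0 by (intro mult_mono) auto
        also have "\<dots> = e / 4" using R0 by (simp add: field_simps)
        finally show ?thesis .
      qed
      obtain N where N: "\<And>m n. m \<ge> N \<Longrightarrow> n \<ge> N \<Longrightarrow> dist (pairing (h (b k)) (s (r m))) (pairing (h (b k)) (s (r n))) < e / 2"
        using metric_CauchyD[OF convergent_Cauchy[OF conv[of k]], of "e/2"] e by auto
      show "\<exists>N. \<forall>m\<ge>N. \<forall>n\<ge>N. dist (F (s (r m))) (F (s (r n))) < e"
      proof (intro exI[of _ N] allI impI)
        fix m n assume "m \<ge> N" "n \<ge> N"
        then show "dist (F (s (r m))) (F (s (r n))) < e"
          using N[of m n] close[of "r m"] close[of "r n"] unfolding dist_real_def abs_less_iff abs_le_iff by linarith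
      qed
    qed
    then show ?thesis by (simp add: Cauchy_convergent_iff)
  qed
  define L where "L = (\<lambda>F. lim (\<lambda>n. F (s (r n))) :: real)"
  have lim: "(\<lambda>n. F (s (r n))) \<longlonglongrightarrow> L F" if "F \<in> dual_space U nrm" for F
    using conv'[OF that] by (simp add: L_def convergent_LIMSEQ_iff)
  have "L \<in> dual_space (dual_space U nrm) (dual_norm U nrm)"
  proof (rule dual_spaceI)
    fix F G assume F: "F \<in> dual_space U nrm" and G: "G \<in> dual_space U nrm"
    show "L (F + G) = L F + L G"
      by (rule LIMSEQ_unique[OF lim[OF dual_space_add[OF F G]]])
         (use tendsto_add[OF lim[OF F] lim[OF G]] in simp)
  next
    fix c F assume F: "F \<in> dual_space U nrm"
    show "L (c *\<^sub>R F) = c * L F"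
      by (rule LIMSEQ_unique[OF lim[OF dual_space_scale[OF F]]])
         (use tendsto_mult[OF tendsto_const lim[OF F]] in \<open>simp add: scaleR_fun_def\<close>)
  next
    fix F assume F: "F \<in> dual_space U nrm"
    have d0: "dual_norm U nrm F \<ge> 0"
      unfolding dual_norm_def
      by (rule cSup_upper2[OF _ _ dual_norm_bdd[OF F]]) (use U0 nrm_0 in \<open>auto intro!: exI[of _ 0]\<close>)
    have "\<bar>F (s (r n))\<bar> \<le> R * dual_norm U nrm F" for n
      using order_trans[OF dual_norm_bound[OF F s] mult_left_mono[OF R d0]] by (simp add: mult.commute)
    then show "\<bar>L F\<bar> \<le> R * dual_norm U nrm F"
      by (intro LIMSEQ_le_const2[OF tendsto_rabs[OF lim[OF F]]]) auto
  qed
  from reflexive[OF this] obtain u where "u \<in> U" "\<forall>F\<in>dual_space U nrm. L F = F u" by blast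
  with lim r show ?thesis by force
qed

end

section \<open>Test functions\<close>

lemma FD_eq: "(f has_derivative f') (at x) \<Longrightarrow> frechet_derivative f (at x) = f'"
  using frechet_derivative_at by metis

lemma tcd_has_derivative: "times_cont_diff (Suc k) g \<Longrightarrow> (g has_derivative frechet_derivative g (at x)) (at x)"
  by (simp add: frechet_derivative_works)

lemma tcd_Suc_imp: "times_cont_diff (Suc k) g \<Longrightarrow> times_cont_diff k g"
proof (induction k arbitrary: g)
  case 0
  then show ?case
    by (auto simp: continuous_on_eq_continuous_at intro: differentiable_imp_continuous_within)
qed auto

lemma tcd_const: "times_cont_diff k (\<lambda>x. c)"
  by (induction k arbitrary: c) auto

lemma tcd_SucI:
  assumes "\<And>x. (g has_derivative g' x) (at x)" "\<And>h. times_cont_diff k (\<lambda>x. g' x h)"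
  shows "times_cont_diff (Suc k) g"
proof -
  have "frechet_derivative g (at x) = g' x" for x by (rule FD_eq[OF assms(1)])
  then show ?thesis using assms by (auto simp: differentiable_def)
qed

lemma tcd_add: "times_cont_diff k f \<Longrightarrow> times_cont_diff k g \<Longrightarrow> times_cont_diff k (\<lambda>x. f x + g x)"
proof (induction k arbitrary: f g)
  case (Suc k)
  show ?case
    by (rule tcd_SucI[OF has_derivative_add[OF tcd_has_derivative[OF Suc.prems(1)] tcd_has_derivative[OF Suc.prems(2)]]])
       (use Suc in auto)
qed (auto intro: continuous_on_add)

lemma tcd_mult: "times_cont_diff k f \<Longrightarrow> times_cont_diff k g \<Longrightarrow> times_cont_diff k (\<lambda>x. f x * g x)"
proof (induction k arbitrary: f g)
  case (Suc k)
  note fg = tcd_Suc_imp[OF Suc.prems(1)] tcd_Suc_imp[OF Suc.prems(2)]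
  show ?case
    by (rule tcd_SucI[OF has_derivative_mult[OF tcd_has_derivative[OF Suc.prems(1)] tcd_has_derivative[OF Suc.prems(2)]]])
       (use Suc.prems in \<open>auto intro!: tcd_add Suc.IH fg\<close>)
qed (auto intro: continuous_on_mult)

lemma tcd_prod: "finite I \<Longrightarrow> (\<And>i. i \<in> I \<Longrightarrow> times_cont_diff k (f i)) \<Longrightarrow> times_cont_diff k (\<lambda>x. \<Prod>i\<in>I. f i x)"
  by (induction I rule: finite_induct) (auto intro: tcd_mult tcd_const)

subsection \<open>Smooth bumps\<close>

text \<open>Smooth with all derivatives \<open>0\<close> at the origin. The extra factor \<open>inverse t ^ k\<close> makes the family closed, up to linear
  combinations, under differentiation, so that smoothness is a single induction.\<close>

definition flat_exp :: "nat \<Rightarrow> real \<Rightarrow> real" where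
  "flat_exp k t = (if t > 0 then inverse t ^ k * exp (- inverse t) else 0)"

lemma flat_exp_tendsto_0: "(flat_exp k \<longlongrightarrow> 0) (at 0)"
proof -
  have "((\<lambda>t. inverse t ^ k / exp (inverse t)) \<longlongrightarrow> 0) (at_right (0::real))"
    by (rule filterlim_compose[OF tendsto_power_div_exp_0 filterlim_inverse_at_top_right])
  then have 1: "(flat_exp k \<longlongrightarrow> 0) (at_right 0)"
    by (rule Lim_transform_eventually)
       (auto simp: flat_exp_def exp_minus divide_inverse eventually_at_filter)
  have 2: "(flat_exp k \<longlongrightarrow> 0) (at_left 0)"
    by (rule Lim_transform_eventually[OF tendsto_const])
       (auto simp: flat_exp_def eventually_at_filter)
  show ?thesis using 1 2 by (simp add: filterlim_at_split)
qed

lemma flat_exp_deriv: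
  "(flat_exp k has_real_derivative (- real k * flat_exp (Suc k) t + flat_exp (Suc (Suc k)) t)) (at t)"
proof -
  consider "t > 0" | "t < 0" | "t = 0" by linarith
  then show ?thesis
  proof cases
    case 1
    have "((\<lambda>t. inverse t ^ k * exp (- inverse t)) has_real_derivative
       (- real k * flat_exp (Suc k) t + flat_exp (Suc (Suc k)) t)) (at t)"
    proof (cases k)
      case 0
      then show ?thesis using 1
        by (auto intro!: derivative_eq_intros simp: flat_exp_def power2_eq_square)
    next
      case (Suc j)
      then show ?thesis using 1
        by (auto intro!: derivative_eq_intros simp: flat_exp_def power2_eq_square algebra_simps) (cases j; simp)
    qed
    then show ?thesis
      by (rule has_field_derivative_transform_within_open[where S="{0<..}"]) (use 1 in \<open>auto simp: flat_exp_def\<close>)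
  next
    case 2
    have "((\<lambda>t. 0) has_real_derivative (- real k * flat_exp (Suc k) t + flat_exp (Suc (Suc k)) t)) (at t)"
      using 2 by (simp add: flat_exp_def)
    then show ?thesis
      by (rule has_field_derivative_transform_within_open[where S="{..<0}"]) (use 2 in \<open>auto simp: flat_exp_def\<close>)
  next
    case 3
    have "((\<lambda>h. (flat_exp k (0 + h) - flat_exp k 0) / h) \<longlongrightarrow> 0) (at 0)"
      by (rule Lim_transform_eventually[OF flat_exp_tendsto_0[of "Suc k"]])
         (auto simp: flat_exp_def divide_inverse intro!: always_eventually)
    then show ?thesis using 3 by (simp add: DERIV_def flat_exp_def)
  qed
qed

lemma tcd_flat_exp: "times_cont_diff m (\<lambda>x::'a::euclidean_space. flat_exp k (c * (x \<bullet> v) + d))"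
proof (induction m arbitrary: k)
  have der: "((\<lambda>x::'a. flat_exp k (c * (x \<bullet> v) + d)) has_derivative
     (\<lambda>h. (- real k * flat_exp (Suc k) (c * (x \<bullet> v) + d) + flat_exp (Suc (Suc k)) (c * (x \<bullet> v) + d)) * (c * (h \<bullet> v)))) (at x)" for x k
    by (rule has_derivative_compose[OF _ flat_exp_deriv[unfolded has_field_derivative_def]])
       (auto intro!: derivative_eq_intros)
  {
    case 0
    show ?case using der has_derivative_continuous by (force simp: continuous_on_eq_continuous_at)
  next
    case (Suc m)
    show ?case
      by (rule tcd_SucI[OF der]) (intro tcd_mult tcd_add tcd_const Suc)
  }
qed

text \<open>Positive exactly on \<open>box a b\<close>, and increasing to its indicator function as \<open>n\<close> grows: the arguments are
  dilated by \<open>n + 1\<close>, and \<open>exp (- 1 / t)\<close> tends to \<open>1\<close> for large \<open>t\<close>.\<close>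

definition bump :: "nat \<Rightarrow> 'a \<Rightarrow> 'a \<Rightarrow> 'a::euclidean_space \<Rightarrow> real" where
  "bump n a b x = (\<Prod>i\<in>Basis. flat_exp 0 (real (Suc n) * (x \<bullet> i - a \<bullet> i)) * flat_exp 0 (real (Suc n) * (b \<bullet> i - x \<bullet> i)))"

lemma flat_exp_0: "0 \<le> flat_exp 0 t" "flat_exp 0 t \<le> 1" "flat_exp 0 t \<noteq> 0 \<longleftrightarrow> t > 0"
  by (auto simp: flat_exp_def)

lemma bump_support: "bump n a b x \<noteq> 0 \<longleftrightarrow> x \<in> box a b"
  by (auto simp: bump_def mem_box flat_exp_0(3) zero_less_mult_iff)

lemma bump_bounds: "0 \<le> bump n a b x" "bump n a b x \<le> 1"
  unfolding bump_def by (auto intro!: prod_nonneg prod_le_1 mult_nonneg_nonneg mult_le_one flat_exp_0)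

lemma tcd_bump: "times_cont_diff k (bump n a b)"
proof -
  have 1: "flat_exp 0 (real (Suc n) * (x \<bullet> i - a \<bullet> i)) = flat_exp 0 (real (Suc n) * (x \<bullet> i) + (- real (Suc n) * (a \<bullet> i)))"
    and 2: "flat_exp 0 (real (Suc n) * (b \<bullet> i - x \<bullet> i)) = flat_exp 0 ((- real (Suc n)) * (x \<bullet> i) + (real (Suc n) * (b \<bullet> i)))"
    for x i :: 'a by (simp_all add: algebra_simps)
  show ?thesis unfolding bump_def 1 2 by (intro tcd_prod tcd_mult tcd_flat_exp) auto
qed

lemma bump_test: "cbox a b \<subseteq> \<Omega> \<Longrightarrow> bump n a b \<in> test_functions \<Omega>"
proof -
  assume *: "cbox a b \<subseteq> \<Omega>"
  have "{x. bump n a b x \<noteq> 0} = box a b" by (simp add: bump_support)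
  moreover have "closure (box a b) \<subseteq> cbox a b" by (rule closure_minimal[OF box_subset_cbox closed_cbox])
  ultimately show ?thesis using * tcd_bump
    by (auto simp: test_functions_def compact_closure bounded_box simp del: times_cont_diff.simps)
qed

lemma bump_tendsto: "x \<in> box a b \<Longrightarrow> (\<lambda>n. bump n a b x) \<longlonglongrightarrow> 1"
proof -
  assume x: "x \<in> box a b"
  have E: "(\<lambda>n. flat_exp 0 (real (Suc n) * t)) \<longlonglongrightarrow> 1" if "t > 0" for t
  proof -
    have "(\<lambda>n. inverse (real (Suc n)) * inverse t) \<longlonglongrightarrow> 0 * inverse t"
      by (intro tendsto_intros LIMSEQ_inverse_real_of_nat)
    then have "(\<lambda>n. exp (- (inverse (real (Suc n)) * inverse t))) \<longlonglongrightarrow> exp (- 0)"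
      by (intro tendsto_intros) simp
    then show ?thesis using that by (simp add: flat_exp_def inverse_mult_distrib del: of_nat_Suc)
  qed
  have "(\<lambda>n. bump n a b x) \<longlonglongrightarrow> (\<Prod>i\<in>(Basis::'a set). 1 * 1)"
    unfolding bump_def using x by (intro tendsto_prod tendsto_mult E) (auto simp: mem_box)
  then show ?thesis by simp
qed

subsection \<open>Basic properties of test functions\<close>

lemma test_functions_tcd: "\<phi> \<in> test_functions \<Omega> \<Longrightarrow> times_cont_diff k \<phi>"
  by (simp add: test_functions_def)

lemma test_functionsI:
  assumes "\<And>k. times_cont_diff k f" "compact K" "K \<subseteq> \<Omega>" "\<And>x. x \<notin> K \<Longrightarrow> f x = 0"
  shows "f \<in> test_functions \<Omega>"
proof -
  have "closure {x. f x \<noteq> 0} \<subseteq> K" using assms by (intro closure_minimal compact_imp_closed) auto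
  moreover have "compact (K \<inter> closure {x. f x \<noteq> 0})" by (rule compact_Int_closed[OF assms(2) closed_closure])
  ultimately show ?thesis using assms
    by (auto simp: test_functions_def Int_absorb1 simp del: times_cont_diff.simps)
qed

lemma test_functions_support:
  assumes "\<phi> \<in> test_functions \<Omega>"
  obtains K where "compact K" "K \<subseteq> \<Omega>" "\<And>x. x \<notin> K \<Longrightarrow> \<phi> x = 0"
  using that[of "closure {x. \<phi> x \<noteq> 0}"] assms closure_subset[of "{x. \<phi> x \<noteq> 0}"] unfolding test_functions_def by blast

lemma test_zero: "(\<lambda>x. 0) \<in> test_functions \<Omega>"
  by (rule test_functionsI[where K="{}"]) (auto intro: tcd_const simp del: times_cont_diff.simps)

lemma test_add:
  assumes "f \<in> test_functions \<Omega>" "g \<in> test_functions \<Omega>"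
  shows "(\<lambda>x. f x + g x) \<in> test_functions \<Omega>"
proof -
  obtain K L where "compact K" "K \<subseteq> \<Omega>" "\<And>x. x \<notin> K \<Longrightarrow> f x = 0" "compact L" "L \<subseteq> \<Omega>" "\<And>x. x \<notin> L \<Longrightarrow> g x = 0"
    using test_functions_support[OF assms(1)] test_functions_support[OF assms(2)] by metis
  then show ?thesis
    by (intro test_functionsI[where K="K \<union> L"] tcd_add test_functions_tcd[OF assms(1)] test_functions_tcd[OF assms(2)]) auto
qed

lemma test_scale:
  assumes "f \<in> test_functions \<Omega>"
  shows "(\<lambda>x. c * f x) \<in> test_functions \<Omega>"
proof -
  obtain K where "compact K" "K \<subseteq> \<Omega>" "\<And>x. x \<notin> K \<Longrightarrow> f x = 0" using test_functions_support[OF assms] by metis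
  then show ?thesis
    by (intro test_functionsI[where K=K] tcd_mult tcd_const test_functions_tcd[OF assms]) auto
qed

text \<open>The classical gradient, as a vector; on test functions it is a version of \<open>grad\<close>.\<close>

definition cgrad :: "('a::euclidean_space \<Rightarrow> real) \<Rightarrow> 'a \<Rightarrow> 'a" where
  "cgrad f x = (\<Sum>i\<in>Basis. frechet_derivative f (at x) i *\<^sub>R i)"

lemma cgrad_inner: "i \<in> Basis \<Longrightarrow> cgrad f x \<bullet> i = frechet_derivative f (at x) i"
  by (simp add: cgrad_def inner_sum_left inner_Basis if_distrib cong: if_cong)

lemma cgrad_derivative:
  assumes "times_cont_diff (Suc 0) f"
  shows "(f has_derivative (\<lambda>v. cgrad f x \<bullet> v)) (at x)"
proof -
  have d: "(f has_derivative frechet_derivative f (at x)) (at x)" by (rule tcd_has_derivative[OF assms])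
  then interpret bounded_linear "frechet_derivative f (at x)" by (rule has_derivative_bounded_linear)
  have "frechet_derivative f (at x) v = cgrad f x \<bullet> v" for v
  proof -
    have "frechet_derivative f (at x) (\<Sum>i\<in>Basis. (v \<bullet> i) *\<^sub>R i) = (\<Sum>i\<in>Basis. (v \<bullet> i) * frechet_derivative f (at x) i)"
      by (simp add: sum scaleR)
    then show ?thesis unfolding euclidean_representation
      by (simp add: cgrad_def inner_sum_right mult.commute inner_commute)
  qed
  then have "frechet_derivative f (at x) = (\<lambda>v. cgrad f x \<bullet> v)" by (rule ext)
  with d show ?thesis by simp
qed

lemma cgrad_unique:
  assumes "(f has_derivative (\<lambda>v. g \<bullet> v)) (at x)"
  shows "cgrad f x = g"
  unfolding cgrad_def FD_eq[OF assms] by (rule euclidean_representation)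

lemma cgrad_add:
  assumes "times_cont_diff (Suc 0) f" "times_cont_diff (Suc 0) g"
  shows "cgrad (\<lambda>x. f x + g x) x = cgrad f x + cgrad g x"
  by (rule cgrad_unique) (use has_derivative_add[OF assms[THEN cgrad_derivative]] in \<open>simp add: inner_add_left\<close>)

lemma cgrad_scale:
  assumes "times_cont_diff (Suc 0) f"
  shows "cgrad (\<lambda>x. c * f x) x = c *\<^sub>R cgrad f x"
  by (rule cgrad_unique) (use has_derivative_mult_right[OF assms[THEN cgrad_derivative]] in simp)

lemma cgrad_continuous:
  assumes "times_cont_diff (Suc 0) f"
  shows "continuous_on UNIV (cgrad f)"
  unfolding cgrad_def using assms by (intro continuous_intros) auto

lemma tcd0_cont: "times_cont_diff k f \<Longrightarrow> continuous_on UNIV f"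
  by (cases k) (auto simp: continuous_on_eq_continuous_at intro: differentiable_imp_continuous_within)

lemma cgrad_support:
  assumes "compact K" "\<And>x. x \<notin> K \<Longrightarrow> f x = 0" "x \<notin> K"
  shows "cgrad f x = 0"
proof (rule cgrad_unique)
  have "((\<lambda>x. 0) has_derivative (\<lambda>v. 0 \<bullet> v)) (at x)" by simp
  then show "(f has_derivative (\<lambda>v. 0 \<bullet> v)) (at x)"
    by (rule has_derivative_transform_within_open[where s="- K"]) (use assms in \<open>auto simp: compact_imp_closed open_Compl\<close>)
qed

lemma bounded_compact_support:
  fixes f :: "'a::euclidean_space \<Rightarrow> 'b::real_normed_vector"
  assumes "continuous_on UNIV f" "compact K" "\<And>x. x \<notin> K \<Longrightarrow> f x = 0"
  shows "\<exists>B>0. \<forall>x. norm (f x) \<le> B"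
proof -
  have "bounded (f ` K)" using assms by (intro compact_imp_bounded compact_continuous_image continuous_on_subset[OF assms(1)]) auto
  then obtain B where "B > 0" "\<forall>y\<in>f ` K. norm y \<le> B" using bounded_pos by blast
  then show ?thesis using assms(3) by (intro exI[of _ B]) (metis imageI less_imp_le norm_zero)
qed

lemma integrable_compact_support:
  fixes f :: "'a::euclidean_space \<Rightarrow> 'b::euclidean_space"
  assumes "continuous_on UNIV f" "compact K" "\<And>x. x \<notin> K \<Longrightarrow> f x = 0"
  shows "integrable lborel f"
proof -
  have "integrable lborel (\<lambda>x. indicator K x *\<^sub>R f x)"
    by (rule borel_integrable_compact[OF assms(2) continuous_on_subset[OF assms(1)]]) simp
  moreover have "(\<lambda>x. indicator K x *\<^sub>R f x) = f" using assms(3) by (auto simp: indicator_def)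
  ultimately show ?thesis by simp
qed

text \<open>Integrals of compactly supported functions are translation invariant; differentiating this
  gives integration by parts.\<close>

lemma integral_translation:
  fixes f :: "'a::euclidean_space \<Rightarrow> real"
  assumes "f \<in> borel_measurable borel"
  shows "(\<integral>x. f (c + x) \<partial>lborel) = (\<integral>x. f x \<partial>lborel)"
proof -
  have "(\<integral>x. f x \<partial>lborel) = (\<integral>x. f x \<partial>distr lborel borel ((+) c))" by (simp add: lborel_distr_plus)
  also have "\<dots> = (\<integral>x. f (c + x) \<partial>lborel)" by (rule integral_distr) (use assms in auto)
  finally show ?thesis by simp
qed

text \<open>The difference quotients all have integral \<open>0\<close>. They are bounded by the Lipschitz constant and supported in
  one ball, so dominated convergence applies.\<close>

lemma integral_partial_derivative:
  fixes f :: "'a::euclidean_space \<Rightarrow> real"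
  assumes f: "times_cont_diff (Suc 0) f" and K: "compact K" "\<And>x. x \<notin> K \<Longrightarrow> f x = 0" and i: "i \<in> Basis"
  shows "(\<integral>x. cgrad f x \<bullet> i \<partial>lborel) = 0"
proof -
  note cont = tcd0_cont[OF f]
  note [measurable] = borel_measurable_continuous_onI[OF cont] borel_measurable_continuous_onI[OF cgrad_continuous[OF f]]
  obtain B where B: "B > 0" "\<And>x. norm (cgrad f x) \<le> B"
    using bounded_compact_support[OF cgrad_continuous[OF f] K(1) cgrad_support[OF K]] by blast
  obtain R where R: "R > 0" "\<And>x. x \<in> K \<Longrightarrow> norm x \<le> R" using compact_imp_bounded[OF K(1)] by (auto simp: bounded_pos)
  have on: "onorm (\<lambda>v. cgrad f x \<bullet> v) \<le> B" for x
    by (rule onorm_bound) (use B in \<open>auto intro!: order_trans[OF Cauchy_Schwarz_ineq2] mult_right_mono\<close>)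
  have lip: "\<bar>f x - f y\<bar> \<le> B * norm (x - y)" for x y
    using differentiable_bound[OF convex_UNIV has_derivative_at_withinI[OF cgrad_derivative[OF f]] on, of x y] by simp
  define t where "t = (\<lambda>n. 1 / real (Suc n))"
  have t: "t n > 0" "t n \<le> 1" for n by (auto simp: t_def)
  define g where "g = (\<lambda>n x. (f (t n *\<^sub>R i + x) - f x) / t n)"
  have "integrable lborel f" by (rule integrable_compact_support[OF cont K])
  then have int: "integrable lborel f" and int2: "integrable lborel (\<lambda>x. f (c + x))" for c
    using integrable_distr[of "(+) c" lborel borel f] by (auto simp: lborel_distr_plus)
  have g0: "(\<integral>x. g n x \<partial>lborel) = 0" for n
    using int int2[of "t n *\<^sub>R i"] by (simp add: g_def integral_translation)
  have "(\<lambda>n. \<integral>x. g n x \<partial>lborel) \<longlonglongrightarrow> (\<integral>x. cgrad f x \<bullet> i \<partial>lborel)"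
  proof (rule integral_dominated_convergence[where w="\<lambda>x. B * indicator (cball 0 (R + 1)) x"])
    show "integrable lborel (\<lambda>x. B * indicator (cball 0 (R + 1)) x :: real)"
      using emeasure_bounded_finite[OF bounded_cball, of 0 "R + 1"]
      by (intro integrable_mult_right integrable_real_indicator) auto
    show "AE x in lborel. (\<lambda>n. g n x) \<longlonglongrightarrow> cgrad f x \<bullet> i"
    proof (rule AE_I2)
      fix x
      have "((\<lambda>s. f (x + s *\<^sub>R i)) has_derivative (\<lambda>s. cgrad f x \<bullet> (s *\<^sub>R i))) (at 0)"
        by (rule has_derivative_compose[of "\<lambda>s. x + s *\<^sub>R i" "\<lambda>s. s *\<^sub>R i" 0 UNIV f])
           (use cgrad_derivative[OF f, of x] in \<open>auto intro!: derivative_eq_intros\<close>)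
      then have "((\<lambda>s. f (x + s *\<^sub>R i)) has_real_derivative (cgrad f x \<bullet> i)) (at 0)"
        unfolding has_field_derivative_def by (rule has_derivative_eq_rhs) (auto simp: fun_eq_iff)
      then have "((\<lambda>h. (f (x + h *\<^sub>R i) - f x) / h) \<longlongrightarrow> cgrad f x \<bullet> i) (at 0)"
        by (simp add: DERIV_def)
      moreover have "filterlim t (at 0) sequentially"
        unfolding filterlim_at using LIMSEQ_inverse_real_of_nat t by (auto simp: t_def divide_inverse less_imp_neq[symmetric] simp del: of_nat_Suc)
      ultimately show "(\<lambda>n. g n x) \<longlonglongrightarrow> cgrad f x \<bullet> i"
        unfolding g_def by (auto dest: filterlim_compose simp: add.commute)
    qed
    show "AE x in lborel. norm (g n x) \<le> B * indicator (cball 0 (R + 1)) x" for n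
    proof (rule AE_I2)
      fix x
      have ti: "norm (t n *\<^sub>R i) = t n" using i t[of n] by simp
      show "norm (g n x) \<le> B * indicator (cball 0 (R + 1)) x"
      proof (cases "x \<in> cball 0 (R + 1)")
        case True
        have "\<bar>f (t n *\<^sub>R i + x) - f x\<bar> \<le> B * t n" using lip[of "t n *\<^sub>R i + x" x] ti by simp
        then show ?thesis using True t[of n] by (simp add: g_def field_simps)
      next
        case False
        then have n: "norm x > R + 1" by simp
        then have "norm (t n *\<^sub>R i + x) > R" using ti t[of n] norm_diff_ineq[of x "t n *\<^sub>R i"] by (simp add: add.commute)
        then have "t n *\<^sub>R i + x \<notin> K" "x \<notin> K" using R n by force+
        then show ?thesis using False by (simp add: g_def K(2))
      qed
    qed
  qed (auto simp: g_def)
  then show ?thesis by (simp add: g0 LIMSEQ_const_iff)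
qed

lemma integration_by_parts:
  fixes f g :: "'a::euclidean_space \<Rightarrow> real"
  assumes f: "times_cont_diff (Suc 0) f" and g: "times_cont_diff (Suc 0) g"
    and K: "compact K" "\<And>x. x \<notin> K \<Longrightarrow> g x = 0" and i: "i \<in> Basis"
  shows "(\<integral>x. f x * (cgrad g x \<bullet> i) \<partial>lborel) = - (\<integral>x. (cgrad f x \<bullet> i) * g x \<partial>lborel)"
proof -
  have prod: "cgrad (\<lambda>x. f x * g x) x = f x *\<^sub>R cgrad g x + g x *\<^sub>R cgrad f x" for x
    by (rule cgrad_unique)
       (use has_derivative_mult[OF cgrad_derivative[OF f] cgrad_derivative[OF g]] in \<open>simp add: inner_add_left algebra_simps\<close>)
  have i1: "integrable lborel (\<lambda>x. f x * (cgrad g x \<bullet> i))"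
    by (rule integrable_compact_support[OF _ K(1)])
       (auto intro!: continuous_intros tcd0_cont[OF f] cgrad_continuous[OF g] simp: cgrad_support[OF K])
  have i2: "integrable lborel (\<lambda>x. (cgrad f x \<bullet> i) * g x)"
    by (rule integrable_compact_support[OF _ K(1)])
       (auto intro!: continuous_intros tcd0_cont[OF g] cgrad_continuous[OF f] simp: K)
  have "0 = (\<integral>x. cgrad (\<lambda>x. f x * g x) x \<bullet> i \<partial>lborel)"
    by (rule integral_partial_derivative[symmetric, OF tcd_mult[OF f g] K(1) _ i]) (simp add: K)
  also have "\<dots> = (\<integral>x. f x * (cgrad g x \<bullet> i) + (cgrad f x \<bullet> i) * g x \<partial>lborel)"
    by (simp add: prod inner_add_left mult.commute)
  also have "\<dots> = (\<integral>x. f x * (cgrad g x \<bullet> i) \<partial>lborel) + (\<integral>x. (cgrad f x \<bullet> i) * g x \<partial>lborel)"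
    using i1 i2 by simp
  finally show ?thesis by simp
qed

section \<open>Weak gradients\<close>

lemma lebesgue_on_open [simp]: "open \<Omega> \<Longrightarrow> \<Omega> \<inter> space lebesgue \<in> sets lebesgue"
  by (simp add: borel_open)

lemma AE_lebesgue_on_iff:
  "open (\<Omega>::'a::euclidean_space set) \<Longrightarrow> (AE x in lebesgue_on \<Omega>. P x) \<longleftrightarrow> (AE x in lebesgue. x \<in> \<Omega> \<longrightarrow> P x)"
  by (rule AE_restrict_space_iff[OF lebesgue_on_open])

lemma borel_measurable_lebesgue_on:
  fixes f :: "'a::euclidean_space \<Rightarrow> 'b::topological_space"
  assumes "f \<in> borel_measurable borel" shows "f \<in> borel_measurable (lebesgue_on \<Omega>)"
  using assms by (intro measurable_restrict_space1 measurable_completion) simp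

lemma borel_measurable_AE_lebesgue_on:
  fixes f g :: "'a::euclidean_space \<Rightarrow> 'b::euclidean_space"
  assumes O: "open \<Omega>" and f: "f \<in> borel_measurable (lebesgue_on \<Omega>)" and ae: "AE x in lebesgue_on \<Omega>. f x = g x"
  shows "g \<in> borel_measurable (lebesgue_on \<Omega>)"
proof (rule measurableI)
  fix A :: "'b set" assume A: "A \<in> sets borel"
  have fA: "f -` A \<inter> \<Omega> \<in> sets lebesgue"
    using measurable_sets[OF f A] O by (simp add: space_restrict_space sets_restrict_space_iff)
  have "AE x in lebesgue. x \<in> f -` A \<inter> \<Omega> \<longleftrightarrow> x \<in> g -` A \<inter> \<Omega>"
    using ae unfolding AE_lebesgue_on_iff[OF O] by eventually_elim auto
  then have "g -` A \<inter> \<Omega> \<in> sets lebesgue"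
    by (rule completion.in_sets_AE[OF _ fA]) simp
  then show "g -` A \<inter> space (lebesgue_on \<Omega>) \<in> sets (lebesgue_on \<Omega>)"
    using O by (simp add: space_restrict_space sets_restrict_space_iff)
qed simp

lemma integral_lebesgue_on_support:
  fixes f :: "'a::euclidean_space \<Rightarrow> 'b::euclidean_space"
  assumes "open \<Omega>" "f \<in> borel_measurable borel" "\<And>x. x \<notin> \<Omega> \<Longrightarrow> f x = 0"
  shows "(\<integral>x. f x \<partial>lebesgue_on \<Omega>) = (\<integral>x. f x \<partial>lborel)"
proof -
  have "(\<lambda>x. indicator \<Omega> x *\<^sub>R f x) = f" using assms(3) by (auto simp: indicator_def)
  then have "(\<integral>x. f x \<partial>lebesgue_on \<Omega>) = (\<integral>x. f x \<partial>lebesgue)"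
    using assms(1) by (simp add: integral_restrict_space)
  also have "\<dots> = (\<integral>x. f x \<partial>lborel)" by (rule integral_completion) (use assms in simp)
  finally show ?thesis .
qed

lemma integrable_lebesgue_on_iff:
  fixes f :: "'a::euclidean_space \<Rightarrow> 'b::euclidean_space"
  assumes "S \<in> sets lebesgue"
  shows "integrable (lebesgue_on S) f \<longleftrightarrow> integrable lebesgue (\<lambda>x. indicator S x *\<^sub>R f x)"
  using assms by (subst integrable_restrict_space) (auto simp: set_integrable_def)

lemma integrable_mult_compact_support:
  fixes g :: "'a::euclidean_space \<Rightarrow> 'b::euclidean_space"
  assumes O: "open \<Omega>" and g: "locally_integrable \<Omega> g" and f: "continuous_on UNIV f"
    and K: "compact K" "K \<subseteq> \<Omega>" "\<And>x. x \<notin> K \<Longrightarrow> f x = 0"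
  shows "integrable (lebesgue_on \<Omega>) (\<lambda>x. f x *\<^sub>R g x)"
proof -
  obtain B where B: "B > 0" "\<And>x. norm (f x) \<le> B" using bounded_compact_support[OF f K(1,3)] by blast
  have "integrable (lebesgue_on K) g" using g K by (auto simp: locally_integrable_def)
  moreover have Ks: "K \<in> sets lebesgue" using K(1) by (simp add: borel_compact)
  ultimately have i: "integrable lebesgue (\<lambda>x. indicator K x *\<^sub>R g x)" by (simp add: integrable_lebesgue_on_iff)
  have fm: "f \<in> borel_measurable lebesgue"
    using borel_measurable_continuous_onI[OF f] by (intro measurable_completion) simp
  have "integrable lebesgue (\<lambda>x. f x *\<^sub>R (indicator K x *\<^sub>R g x))"
  proof (rule Bochner_Integration.integrable_bound[OF integrable_scaleR_right[OF i, of B]])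
    show "(\<lambda>x. f x *\<^sub>R (indicator K x *\<^sub>R g x)) \<in> borel_measurable lebesgue"
      using fm borel_measurable_integrable[OF i] by (rule borel_measurable_scaleR)
    show "AE x in lebesgue. norm (f x *\<^sub>R (indicator K x *\<^sub>R g x)) \<le> norm (B *\<^sub>R (indicator K x *\<^sub>R g x))"
      using B by (auto intro!: AE_I2 mult_right_mono simp: indicator_def)
  qed
  moreover have "(\<lambda>x. f x *\<^sub>R (indicator K x *\<^sub>R g x)) = (\<lambda>x. indicator \<Omega> x *\<^sub>R (f x *\<^sub>R g x))"
    using K by (auto simp: indicator_def fun_eq_iff)
  ultimately show ?thesis using O by (simp add: integrable_lebesgue_on_iff borel_open)
qed

text \<open>Boxes form an intersection-stable generator of the Borel sets, so the integral vanishes over all Borel sets; a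
  Lebesgue set differs from a Borel set by a null set.\<close>

lemma AE_zero_if_box_integrals_zero:
  fixes G :: "'a::euclidean_space \<Rightarrow> real"
  assumes G: "integrable lebesgue G" and z: "\<And>a b. (\<integral>x. indicator (box a b) x * G x \<partial>lebesgue) = 0"
    and tot: "(\<integral>x. G x \<partial>lebesgue) = 0"
  shows "AE x in lebesgue. G x = 0"
proof -
  have int: "integrable lebesgue (\<lambda>x. indicator A x * G x)" if "A \<in> sets lebesgue" for A
    using integrable_mult_indicator[OF that G] by simp
  have borel: "(\<integral>x. indicator A x * G x \<partial>lebesgue) = 0" if A: "A \<in> sets borel" for A
  proof -
    have "Int_stable  (range (\<lambda>(a, b). box a b :: 'a set))"
      by (auto simp: Int_stable_def box_Int_box)
    moreover have "(range (\<lambda>(a, b). box a b :: 'a set)) \<subseteq> Pow UNIV" by auto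
    moreover have "A \<in> sigma_sets UNIV (range (\<lambda>(a, b). box a b))" using A unfolding borel_eq_box by simp
    ultimately show ?thesis
    proof (induction rule: sigma_sets_induct_disjoint)
      case (basic A) then show ?case using z by auto
    next
      case (compl A)
      then have "A \<in> sets borel" by (simp add: borel_eq_box)
      then have A: "A \<in> sets lebesgue" by simp
      have "(\<lambda>x. indicator (UNIV - A) x * G x) = (\<lambda>x. G x - indicator A x * G x)" by (auto simp: indicator_def)
      then show ?case using compl int[OF A] G tot by simp
    next
      case (union F)
      then have "\<And>i. F i \<in> sets borel" by (simp add: borel_eq_box subset_eq)
      then have F: "F i \<in> sets lebesgue" for i by simp
      have "(\<lambda>n. \<integral>x. indicator (\<Union>i<n. F i) x * G x \<partial>lebesgue) \<longlonglongrightarrow> (\<integral>x. indicator (\<Union>i. F i) x * G x \<partial>lebesgue)"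
      proof (rule integral_dominated_convergence[where w="\<lambda>x. \<bar>G x\<bar>"])
        show "AE x in lebesgue. (\<lambda>n. indicator (\<Union>i<n. F i) x * G x) \<longlonglongrightarrow> indicator (\<Union>i. F i) x * G x"
          using LIMSEQ_indicator_UN[of F] by (intro AE_I2 tendsto_mult tendsto_const) auto
      qed (use G int F in \<open>auto simp: indicator_def intro!: AE_I2 sets.finite_UN borel_measurable_integrable\<close>)
      moreover have "(\<integral>x. indicator (\<Union>i<n. F i) x * G x \<partial>lebesgue) = 0" for n
      proof -
        have "(\<lambda>x. indicator (\<Union>i<n. F i) x * G x) = (\<lambda>x. \<Sum>i<n. indicator (F i) x * G x)"
          using union(1) by (subst indicator_UN_disjoint)
            (auto simp: sum_distrib_right disjoint_family_on_def)
        then have "(\<integral>x. indicator (\<Union>i<n. F i) x * G x \<partial>lebesgue) = (\<Sum>i<n. \<integral>x. indicator (F i) x * G x \<partial>lebesgue)"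
          by (simp only:) (rule Bochner_Integration.integral_sum[OF int[OF F]])
        then show ?thesis using union(3) by simp
      qed
      ultimately show ?case by (simp add: LIMSEQ_const_iff)
    qed simp
  qed
  have "AE x in lebesgue. G x = (\<lambda>_. 0) x"
  proof (rule density_unique_real[OF G])
    fix A :: "'a set" assume A: "A \<in> sets lebesgue"
    obtain C T where C: "fsigma C" "T \<in> null_sets lebesgue" "C \<union> T = A" "disjnt C T"
      using lebesgue_set_almost_fsigma[OF A] by blast
    have Cb: "C \<in> sets borel" using C(1) by (cases rule: fsigma.cases) auto
    have "AE x in lebesgue. x \<notin> T" using AE_not_in[OF C(2)] .
    then have "(\<integral>x. indicator A x * G x \<partial>lebesgue) = (\<integral>x. indicator C x * G x \<partial>lebesgue)"
      using int[OF A] int[of C] Cb C(3)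
      by (intro integral_cong_AE) (auto simp: indicator_def elim!: eventually_mono)
    also have "\<dots> = 0" by (rule borel[OF Cb])
    finally show "(\<integral>x\<in>A. G x \<partial>lebesgue) = (\<integral>x\<in>A. 0 \<partial>lebesgue)"
      by (simp add: set_lebesgue_integral_def)
  qed simp
  then show ?thesis by simp
qed

text \<open>Bumps approximate indicators of boxes, so the integrals over boxes inside \<open>\<Omega>\<close> vanish; countably many such
  boxes cover \<open>\<Omega>\<close>.\<close>

lemma fundamental_lemma:
  fixes g :: "'a::euclidean_space \<Rightarrow> real"
  assumes O: "open \<Omega>" and g: "locally_integrable \<Omega> g"
    and z: "\<And>\<phi>. \<phi> \<in> test_functions \<Omega> \<Longrightarrow> (\<integral>x. g x * \<phi> x \<partial>lebesgue_on \<Omega>) = 0"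
  shows "AE x in lebesgue_on \<Omega>. g x = 0"
proof -
  have box: "(\<integral>x. indicator (box a b) x * g x \<partial>lebesgue) = 0" if ab: "cbox a b \<subseteq> \<Omega>" for a b
  proof -
    have "integrable (lebesgue_on (cbox a b)) g" using g ab by (auto simp: locally_integrable_def)
    then have i: "integrable lebesgue (\<lambda>x. indicator (cbox a b) x * g x)" by (simp add: integrable_lebesgue_on_iff)
    have eq: "bump n a b x * (indicator (cbox a b) x * g x) = indicator \<Omega> x * (g x * bump n a b x)" for n x
      using bump_support[of n a b x] box_subset_cbox[of a b] ab by (auto simp: indicator_def)
    have bm: "bump n a b \<in> borel_measurable lebesgue" for n
      using borel_measurable_continuous_onI[OF tcd0_cont[OF tcd_bump[of 0 n a b]]] by (intro measurable_completion) simp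
    have "(\<lambda>n. \<integral>x. bump n a b x * (indicator (cbox a b) x * g x) \<partial>lebesgue) \<longlonglongrightarrow> (\<integral>x. indicator (box a b) x * g x \<partial>lebesgue)"
    proof (rule integral_dominated_convergence[where w="\<lambda>x. \<bar>indicator (cbox a b) x * g x\<bar>"])
      show "AE x in lebesgue. (\<lambda>n. bump n a b x * (indicator (cbox a b) x * g x)) \<longlonglongrightarrow> indicator (box a b) x * g x"
      proof (rule AE_I2)
        fix x
        show "(\<lambda>n. bump n a b x * (indicator (cbox a b) x * g x)) \<longlonglongrightarrow> indicator (box a b) x * g x"
        proof (cases "x \<in> box a b")
          case True
          then have "x \<in> cbox a b" using box_subset_cbox by blast
          then show ?thesis using True tendsto_mult[OF bump_tendsto[OF True] tendsto_const[of "g x"]] by simp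
        next
          case False
          then have "bump n a b x = 0" for n using bump_support by metis
          then show ?thesis using False by simp
        qed
      qed
      show "AE x in lebesgue. norm (bump n a b x * (indicator (cbox a b) x * g x)) \<le> \<bar>indicator (cbox a b) x * g x\<bar>" for n
        using bump_bounds[of n a b] by (auto intro!: AE_I2 mult_left_le_one_le simp: abs_mult)
      have "(\<lambda>x. indicator (box a b) x * (indicator (cbox a b) x * g x)) \<in> borel_measurable lebesgue"
        by (rule borel_measurable_times[OF borel_measurable_indicator borel_measurable_integrable[OF i]]) simp
      moreover have "(\<lambda>x. indicator (box a b) x * (indicator (cbox a b) x * g x)) = (\<lambda>x. indicator (box a b) x * g x)"
        using box_subset_cbox[of a b] by (auto simp: indicator_def fun_eq_iff)
      ultimately show "(\<lambda>x. indicator (box a b) x * g x) \<in> borel_measurable lebesgue" by simp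
    qed (use bm borel_measurable_integrable[OF i] i in auto)
    moreover have "(\<integral>x. bump n a b x * (indicator (cbox a b) x * g x) \<partial>lebesgue) = 0" for n
      unfolding eq using z[OF bump_test[OF ab, of n]] O by (simp add: integral_restrict_space)
    ultimately show ?thesis by (simp add: LIMSEQ_const_iff)
  qed
  \<comment> \<open>the intersection of two boxes is a box, so localising \<open>g\<close> to \<open>box c d\<close> keeps its integrals over boxes zero\<close>
  have cb: "AE x in lebesgue. x \<in> cbox c d \<longrightarrow> g x = 0" if cd: "cbox c d \<subseteq> \<Omega>" for c d
  proof -
    have "integrable (lebesgue_on (cbox c d)) g" using g cd by (auto simp: locally_integrable_def)
    then have i: "integrable lebesgue (\<lambda>x. indicator (cbox c d) x * g x)" by (simp add: integrable_lebesgue_on_iff)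
    define G where "G = (\<lambda>x. indicator (box c d) x * g x)"
    have "integrable lebesgue (\<lambda>x. indicator (box c d) x *\<^sub>R (indicator (cbox c d) x * g x))"
      by (rule integrable_mult_indicator[OF _ i]) simp
    moreover have "(\<lambda>x. indicator (box c d) x *\<^sub>R (indicator (cbox c d) x * g x)) = G"
      using box_subset_cbox[of c d] by (auto simp: G_def indicator_def fun_eq_iff)
    ultimately have G: "integrable lebesgue G" by simp
    have "AE x in lebesgue. G x = 0"
    proof (rule AE_zero_if_box_integrals_zero[OF G])
      show "(\<integral>x. G x \<partial>lebesgue) = 0" unfolding G_def by (rule box[OF cd])
      fix a b :: 'a
      obtain a' b' where ab: "box a b \<inter> box c d = box a' b'" using box_Int_box by blast
      have eq: "indicator (box a b) x * G x = indicator (box a' b') x * g x" for x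
        unfolding ab[symmetric] by (auto simp: G_def indicator_def)
      show "(\<integral>x. indicator (box a b) x * G x \<partial>lebesgue) = 0"
      proof (cases "box a' b' = {}")
        case True
        then show ?thesis by (simp add: eq)
      next
        case False
        have "closure (box a' b') \<subseteq> closure (box c d)" using ab by (intro closure_mono) auto
        also have "\<dots> \<subseteq> cbox c d" by (rule closure_minimal[OF box_subset_cbox closed_cbox])
        finally have "cbox a' b' \<subseteq> cbox c d" by (simp add: closure_box[OF False])
        then show ?thesis unfolding eq using cd by (intro box) auto
      qed
    qed
    moreover have "AE x in lebesgue. x \<notin> cbox c d - box c d"
      by (rule AE_not_in) (use negligible_frontier_interval[of c d] in \<open>simp add: negligible_iff_null_sets\<close>)
    ultimately show ?thesis by eventually_elim (auto simp: G_def indicator_def split: if_splits)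
  qed
  obtain DD where DD: "countable DD" "\<And>X. X \<in> DD \<Longrightarrow> X \<subseteq> \<Omega> \<and> (\<exists>a b. X = cbox a b)" "\<Union>DD = \<Omega>"
  proof (rule open_countable_Union_open_cbox[OF O])
    fix E :: "'a set set" assume "countable E" "E \<subseteq> Pow \<Omega>" "\<And>X. X \<in> E \<Longrightarrow> \<exists>a b. X = cbox a b" "\<Union>E = \<Omega>"
    then show thesis by (intro that[of E]) auto
  qed
  have "AE x in lebesgue. \<forall>X\<in>DD. x \<in> X \<longrightarrow> g x = 0"
    using DD cb by (intro AE_ball_countable'[of DD]) blast+
  then show ?thesis unfolding AE_lebesgue_on_iff[OF O] by eventually_elim (use DD(3) in blast)
qed

lemma locally_integrable_add:
  "locally_integrable \<Omega> f \<Longrightarrow> locally_integrable \<Omega> g \<Longrightarrow> locally_integrable \<Omega> (\<lambda>x. f x + g x)"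
  and locally_integrable_diff:
  "locally_integrable \<Omega> f \<Longrightarrow> locally_integrable \<Omega> g \<Longrightarrow> locally_integrable \<Omega> (\<lambda>x. f x - g x)"
  and locally_integrable_scaleR: "locally_integrable \<Omega> f \<Longrightarrow> locally_integrable \<Omega> (\<lambda>x. c *\<^sub>R f x)"
  by (auto simp: locally_integrable_def)

lemma locally_integrable_inner:
  "locally_integrable \<Omega> f \<Longrightarrow> locally_integrable \<Omega> (\<lambda>x. f x \<bullet> i)"
  by (auto simp: locally_integrable_def)

lemma weak_gradient_integrable:
  assumes O: "open \<Omega>" and w: "is_weak_gradient \<Omega> u G" and \<phi>: "\<phi> \<in> test_functions \<Omega>"
  shows "i \<in> Basis \<Longrightarrow> integrable (lebesgue_on \<Omega>) (\<lambda>x. u x * frechet_derivative \<phi> (at x) i)"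
    and "integrable (lebesgue_on \<Omega>) (\<lambda>x. (G x \<bullet> i) * \<phi> x)"
proof -
  obtain K where K: "compact K" "K \<subseteq> \<Omega>" "\<And>x. x \<notin> K \<Longrightarrow> \<phi> x = 0" using test_functions_support[OF \<phi>] by metis
  have l: "locally_integrable \<Omega> u" "locally_integrable \<Omega> (\<lambda>x. G x \<bullet> i)"
    using w by (auto simp: is_weak_gradient_def intro: locally_integrable_inner)
  show "integrable (lebesgue_on \<Omega>) (\<lambda>x. (G x \<bullet> i) * \<phi> x)"
    using integrable_mult_compact_support[OF O l(2) tcd0_cont[OF test_functions_tcd[OF \<phi>]] K] by (simp add: mult.commute)
  have 1: "times_cont_diff (Suc 0) \<phi>" by (rule test_functions_tcd[OF \<phi>])
  show "integrable (lebesgue_on \<Omega>) (\<lambda>x. u x * frechet_derivative \<phi> (at x) i)" if i: "i \<in> Basis"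
  proof -
    have "frechet_derivative \<phi> (at x) i = 0" if "x \<notin> K" for x
      using cgrad_support[OF K(1,3) that] cgrad_inner[OF i, of \<phi> x] by simp
    then show ?thesis
      using integrable_mult_compact_support[OF O l(1) _ K(1,2), of "\<lambda>x. frechet_derivative \<phi> (at x) i"] 1
      by (simp add: mult.commute)
  qed
qed

text \<open>The fundamental lemma for each component of the difference. It makes \<open>grad\<close> well defined almost everywhere,
  hence linear there.\<close>

lemma weak_gradient_unique:
  fixes G1 G2 :: "'a::euclidean_space \<Rightarrow> 'a"
  assumes O: "open \<Omega>" and 1: "is_weak_gradient \<Omega> u G1" and 2: "is_weak_gradient \<Omega> v G2"
    and uv: "AE x in lebesgue_on \<Omega>. u x = v x"
  shows "AE x in lebesgue_on \<Omega>. G1 x = G2 x"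
proof -
  have "AE x in lebesgue_on \<Omega>. (G1 x - G2 x) \<bullet> i = 0" if i: "i \<in> Basis" for i
  proof (rule fundamental_lemma[OF O])
    show "locally_integrable \<Omega> (\<lambda>x. (G1 x - G2 x) \<bullet> i)"
      using 1 2 by (intro locally_integrable_inner locally_integrable_diff) (auto simp: is_weak_gradient_def)
    fix \<phi> assume \<phi>: "\<phi> \<in> test_functions \<Omega>"
    note I = weak_gradient_integrable[OF O 1 \<phi>] weak_gradient_integrable[OF O 2 \<phi>]
    have "(\<integral>x. u x * frechet_derivative \<phi> (at x) i \<partial>lebesgue_on \<Omega>) = (\<integral>x. v x * frechet_derivative \<phi> (at x) i \<partial>lebesgue_on \<Omega>)"
    proof (rule integral_cong_AE)
      show "AE x in lebesgue_on \<Omega>. u x * frechet_derivative \<phi> (at x) i = v x * frechet_derivative \<phi> (at x) i"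
        using uv by eventually_elim simp
    qed (use I(1)[OF i] I(3)[OF i] in \<open>simp_all only: borel_measurable_integrable\<close>)
    then have "(\<integral>x. (G1 x \<bullet> i) * \<phi> x \<partial>lebesgue_on \<Omega>) = (\<integral>x. (G2 x \<bullet> i) * \<phi> x \<partial>lebesgue_on \<Omega>)"
      using 1 2 \<phi> i by (simp add: is_weak_gradient_def)
    then show "(\<integral>x. ((G1 x - G2 x) \<bullet> i) * \<phi> x \<partial>lebesgue_on \<Omega>) = 0"
      using I(2,4) by (simp add: inner_diff_left left_diff_distrib)
  qed
  then have "AE x in lebesgue_on \<Omega>. \<forall>i\<in>Basis. (G1 x - G2 x) \<bullet> i = 0" by (intro AE_finite_allI) auto
  then show ?thesis by eventually_elim (simp add: euclidean_eq_iff[where 'a='a] inner_diff_left)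
qed

lemma weak_gradient_add:
  fixes G H :: "'a::euclidean_space \<Rightarrow> 'a"
  assumes O: "open \<Omega>" and 1: "is_weak_gradient \<Omega> u G" and 2: "is_weak_gradient \<Omega> v H"
  shows "is_weak_gradient \<Omega> (\<lambda>x. u x + v x) (\<lambda>x. G x + H x)"
  unfolding is_weak_gradient_def
proof (intro conjI ballI)
  fix \<phi> and i :: 'a assume \<phi>: "\<phi> \<in> test_functions \<Omega>" and i: "i \<in> Basis"
  note I = weak_gradient_integrable[OF O 1 \<phi>] weak_gradient_integrable[OF O 2 \<phi>]
  have "(\<integral>x. u x * frechet_derivative \<phi> (at x) i \<partial>lebesgue_on \<Omega>) = - (\<integral>x. (G x \<bullet> i) * \<phi> x \<partial>lebesgue_on \<Omega>)"
    "(\<integral>x. v x * frechet_derivative \<phi> (at x) i \<partial>lebesgue_on \<Omega>) = - (\<integral>x. (H x \<bullet> i) * \<phi> x \<partial>lebesgue_on \<Omega>)"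
    using 1 2 \<phi> i by (auto simp: is_weak_gradient_def)
  then show "(\<integral>x. (u x + v x) * frechet_derivative \<phi> (at x) i \<partial>lebesgue_on \<Omega>) = - (\<integral>x. ((G x + H x) \<bullet> i) * \<phi> x \<partial>lebesgue_on \<Omega>)"
    using I(1)[OF i] I(3)[OF i] I(2,4) by (simp add: inner_add_left distrib_right)
qed (use 1 2 in \<open>auto simp: is_weak_gradient_def intro: locally_integrable_add\<close>)

lemma weak_gradient_scale:
  fixes G :: "'a::euclidean_space \<Rightarrow> 'a"
  assumes 1: "is_weak_gradient \<Omega> u G"
  shows "is_weak_gradient \<Omega> (\<lambda>x. c * u x) (\<lambda>x. c *\<^sub>R G x)"
  unfolding is_weak_gradient_def
proof (intro conjI ballI)
  show "locally_integrable \<Omega> (\<lambda>x. c * u x)" "locally_integrable \<Omega> (\<lambda>x. c *\<^sub>R G x)"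
    using 1 locally_integrable_scaleR[of \<Omega> u c] locally_integrable_scaleR[of \<Omega> G c]
    by (auto simp: is_weak_gradient_def)
  fix \<phi> and i :: 'a assume "\<phi> \<in> test_functions \<Omega>" "i \<in> Basis"
  then have "(\<integral>x. u x * frechet_derivative \<phi> (at x) i \<partial>lebesgue_on \<Omega>) = - (\<integral>x. (G x \<bullet> i) * \<phi> x \<partial>lebesgue_on \<Omega>)"
    using 1 by (simp add: is_weak_gradient_def)
  then show "(\<integral>x. c * u x * frechet_derivative \<phi> (at x) i \<partial>lebesgue_on \<Omega>) = - (\<integral>x. (c *\<^sub>R G x \<bullet> i) * \<phi> x \<partial>lebesgue_on \<Omega>)"
    by (simp add: mult.assoc)
qed

text \<open>Integration by parts; only the factor that is a test function needs compact support.\<close>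

lemma weak_gradient_cgrad:
  assumes O: "open \<Omega>" and u: "times_cont_diff (Suc 0) u"
  shows "is_weak_gradient \<Omega> u (cgrad u)"
  unfolding is_weak_gradient_def
proof (intro conjI ballI)
  note cu = tcd0_cont[OF u] cgrad_continuous[OF u]
  have loc: "locally_integrable \<Omega> f" if f: "continuous_on UNIV f" for f :: "'a \<Rightarrow> 'c::euclidean_space"
    unfolding locally_integrable_def
  proof (intro allI impI)
    fix K assume K: "compact K \<and> K \<subseteq> \<Omega>"
    then have "integrable lborel (\<lambda>x. indicator K x *\<^sub>R f x)"
      by (intro borel_integrable_compact continuous_on_subset[OF f]) auto
    then have "integrable lebesgue (\<lambda>x. indicator K x *\<^sub>R f x)"
      by (subst integrable_completion) (auto dest: borel_measurable_integrable)
    then show "integrable (lebesgue_on K) f" using K by (subst integrable_lebesgue_on_iff) (auto simp: borel_compact)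
  qed
  show "locally_integrable \<Omega> u" "locally_integrable \<Omega> (cgrad u)" by (rule loc cu)+
  fix \<phi> and i :: 'a assume \<phi>: "\<phi> \<in> test_functions \<Omega>" and i: "i \<in> Basis"
  obtain K where K: "compact K" "K \<subseteq> \<Omega>" "\<And>x. x \<notin> K \<Longrightarrow> \<phi> x = 0" using test_functions_support[OF \<phi>] by metis
  have p: "times_cont_diff (Suc 0) \<phi>" by (rule test_functions_tcd[OF \<phi>])
  note cp = tcd0_cont[OF p] cgrad_continuous[OF p]
  have z: "cgrad \<phi> x \<bullet> i = 0" "\<phi> x = 0" if "x \<notin> \<Omega>" for x
  proof -
    have "x \<notin> K" using that K by auto
    then show "cgrad \<phi> x \<bullet> i = 0" "\<phi> x = 0" using cgrad_support[OF K(1,3)] K(3) by auto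
  qed
  have m1: "(\<lambda>x. u x * (cgrad \<phi> x \<bullet> i)) \<in> borel_measurable borel" "(\<lambda>x. (cgrad u x \<bullet> i) * \<phi> x) \<in> borel_measurable borel"
    by (intro borel_measurable_continuous_onI continuous_on_mult continuous_on_inner continuous_on_const cu cp)+
  have "(\<integral>x. u x * (cgrad \<phi> x \<bullet> i) \<partial>lebesgue_on \<Omega>) = (\<integral>x. u x * (cgrad \<phi> x \<bullet> i) \<partial>lborel)"
    by (rule integral_lebesgue_on_support[OF O m1(1)]) (simp add: z)
  also have "\<dots> = - (\<integral>x. (cgrad u x \<bullet> i) * \<phi> x \<partial>lborel)"
    by (rule integration_by_parts[OF u p K(1,3) i])
  also have "(\<integral>x. (cgrad u x \<bullet> i) * \<phi> x \<partial>lborel) = (\<integral>x. (cgrad u x \<bullet> i) * \<phi> x \<partial>lebesgue_on \<Omega>)"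
    by (rule integral_lebesgue_on_support[OF O m1(2), symmetric]) (simp add: z)
  finally show "(\<integral>x. u x * frechet_derivative \<phi> (at x) i \<partial>lebesgue_on \<Omega>) = - (\<integral>x. (cgrad u x \<bullet> i) * \<phi> x \<partial>lebesgue_on \<Omega>)"
    using i by (simp add: cgrad_inner)
qed

lemma grad_weak_gradient:
  "is_weak_gradient \<Omega> u G \<Longrightarrow> is_weak_gradient \<Omega> u (grad \<Omega> u)"
  unfolding grad_def by (rule someI[of "is_weak_gradient \<Omega> u"])

lemma grad_AE_eq:
  "open \<Omega> \<Longrightarrow> is_weak_gradient \<Omega> u G \<Longrightarrow> AE x in lebesgue_on \<Omega>. grad \<Omega> u x = G x"
  by (rule weak_gradient_unique) (auto intro: grad_weak_gradient)

lemma grad_test: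
  assumes "open \<Omega>" "\<phi> \<in> test_functions \<Omega>"
  shows "AE x in lebesgue_on \<Omega>. grad \<Omega> \<phi> x = cgrad \<phi> x"
  by (rule grad_AE_eq[OF assms(1) weak_gradient_cgrad[OF assms(1) test_functions_tcd[OF assms(2)]]])

section \<open>The Gagliardo-Nirenberg-Sobolev inequality\<close>

text \<open>Real powers of extended nonnegative numbers. Working in this type lets the iterated integrals below be formed
  for every measurable function, whatever their size.\<close>

definition epow :: "real \<Rightarrow> ennreal \<Rightarrow> ennreal" where
  "epow p a = (if a = \<infinity> then \<infinity> else ennreal (enn2real a powr p))"

lemma epow_measurable [measurable]: "epow p \<in> borel_measurable borel"
  unfolding epow_def by measurable

lemma epow_ennreal: "0 \<le> r \<Longrightarrow> epow p (ennreal r) = ennreal (r powr p)"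
  by (simp add: epow_def)

lemma epow_top [simp]: "epow p \<infinity> = \<infinity>" "epow p Orderings.top = \<infinity>"
  by (simp_all add: epow_def)

lemma epow_0 [simp]: "epow p 0 = 0"
  by (simp add: epow_def)

lemma epow_mono: "p > 0 \<Longrightarrow> a \<le> b \<Longrightarrow> epow p a \<le> epow p b"
proof (cases "b = \<infinity>")
  case False
  assume p: "p > 0" and ab: "a \<le> b"
  have "b < Orderings.top" using False by (simp add: less_top)
  then have "a < Orderings.top" "enn2real a \<le> enn2real b" using ab by (auto intro: enn2real_mono)
  then show ?thesis using p False by (auto simp: epow_def intro!: ennreal_leI powr_mono2)
qed simp

lemma epow_eq_0: "epow p a = 0 \<longleftrightarrow> a = 0"
  by (auto simp: epow_def enn2real_eq_0_iff)

lemma prod_ennreal_eq_top: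
  "finite K \<Longrightarrow> (\<And>k. k \<in> K \<Longrightarrow> f k \<noteq> (0::ennreal)) \<Longrightarrow> k \<in> K \<Longrightarrow> f k = \<infinity> \<Longrightarrow> (\<Prod>k\<in>K. f k) = \<infinity>"
  by (subst prod.remove[of K k]) (auto simp: ennreal_top_mult)

text \<open>Hoelder's inequality for \<open>card K\<close> functions with equal exponents, from the inequality between
  the arithmetic and the geometric mean.\<close>

lemma nn_Hoelder_equal:
  assumes K: "finite K" "K \<noteq> {}" and h: "\<And>k. k \<in> K \<Longrightarrow> h k \<in> borel_measurable M"
  shows "(\<integral>\<^sup>+x. (\<Prod>k\<in>K. epow (1 / card K) (h k x)) \<partial>M) \<le> (\<Prod>k\<in>K. epow (1 / card K) (\<integral>\<^sup>+x. h k x \<partial>M))"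
proof -
  define p where "p = 1 / real (card K)"
  have m: "card K > 0" using K by (simp add: card_gt_0_iff)
  then have p: "p > 0" by (simp add: p_def)
  define I where "I = (\<lambda>k. \<integral>\<^sup>+x. h k x \<partial>M)"
  consider "\<exists>k\<in>K. I k = 0" | "\<forall>k\<in>K. I k \<noteq> 0" "\<exists>k\<in>K. I k = \<infinity>" | "\<forall>k\<in>K. I k \<noteq> 0 \<and> I k \<noteq> \<infinity>" by blast
  then have "(\<integral>\<^sup>+x. (\<Prod>k\<in>K. epow p (h k x)) \<partial>M) \<le> (\<Prod>k\<in>K. epow p (I k))"
  proof cases
    case 1
    then obtain k where k: "k \<in> K" "I k = 0" by blast
    then have "AE x in M. h k x = 0" using h by (simp add: I_def nn_integral_0_iff_AE)
    then have "AE x in M. (\<Prod>k\<in>K. epow p (h k x)) = 0"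
      by eventually_elim (use k K in \<open>auto simp: prod_zero_iff epow_eq_0\<close>)
    then have "(\<integral>\<^sup>+x. (\<Prod>k\<in>K. epow p (h k x)) \<partial>M) = (\<integral>\<^sup>+x. 0 \<partial>M)" by (rule nn_integral_cong_AE)
    then show ?thesis by simp
  next
    case 2
    then obtain k where k: "k \<in> K" "I k = \<infinity>" by blast
    have "(\<Prod>k\<in>K. epow p (I k)) = \<infinity>"
      by (rule prod_ennreal_eq_top[OF K(1) _ k(1)]) (use 2 k in \<open>auto simp: epow_eq_0\<close>)
    then show ?thesis by simp
  next
    case 3
    define a where "a = (\<lambda>k. enn2real (I k))"
    have a: "a k > 0" "I k = ennreal (a k)" if "k \<in> K" for k
      using 3 that by (auto simp: a_def enn2real_positive_iff less_top zero_less_iff_neq_zero)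
    define A where "A = (\<Prod>k\<in>K. a k powr p)"
    have A: "A > 0" unfolding A_def
    proof (intro prod_pos)
      fix k assume "k \<in> K" then show "a k powr p > 0" using a(1)[of k] by simp
    qed
    \<comment> \<open>pointwise inequality of the means for \<open>h k x\<close> divided by its integral\<close>
    have pt: "(\<Prod>k\<in>K. epow p (h k x)) \<le> ennreal A * (\<Sum>k\<in>K. ennreal (p / a k) * h k x)" for x
    proof (cases "\<exists>k\<in>K. h k x = \<infinity>")
      case True
      then obtain k where k: "k \<in> K" "h k x = \<infinity>" by blast
      have "ennreal (p / a k) * h k x = \<infinity>" using k a[OF k(1)] p by (simp add: ennreal_mult_top)
      then have "(\<Sum>k\<in>K. ennreal (p / a k) * h k x) = \<infinity>"
        using k(1) K(1) by (metis (no_types, lifting) ennreal_add_eq_top infinity_ennreal_def sum.remove)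
      then show ?thesis using A by (simp add: ennreal_mult_top)
    next
      case False
      define r where "r = (\<lambda>k. enn2real (h k x))"
      have r: "h k x = ennreal (r k)" "r k \<ge> 0" if "k \<in> K" for k
        using False that by (auto simp: r_def less_top)
      have "(\<Prod>k\<in>K. r k powr p) = A * (\<Prod>k\<in>K. (r k / a k) powr p)"
        unfolding A_def prod.distrib[symmetric]
      proof (intro prod.cong refl)
        fix k assume "k \<in> K"
        then show "r k powr p = a k powr p * (r k / a k) powr p"
          using r(2)[of k] a(1)[of k] by (simp add: powr_divide)
      qed
      also have "(\<Prod>k\<in>K. (r k / a k) powr p) = (\<Prod>k\<in>K. r k / a k) powr p"
        by (rule prod_powr_distrib[symmetric])
      also have "\<dots> \<le> (\<Sum>k\<in>K. (r k / a k) / card K)"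
        unfolding p_def by (rule arith_geom_mean[OF K]) (use r(2) a(1) in \<open>auto simp: less_imp_le\<close>)
      also have "\<dots> = (\<Sum>k\<in>K. (p / a k) * r k)" by (simp add: p_def mult.commute)
      finally have "(\<Prod>k\<in>K. r k powr p) \<le> A * (\<Sum>k\<in>K. (p / a k) * r k)" using A by simp
      then have "ennreal (\<Prod>k\<in>K. r k powr p) \<le> ennreal (A * (\<Sum>k\<in>K. (p / a k) * r k))" by (rule ennreal_leI)
      moreover have "(\<Prod>k\<in>K. epow p (h k x)) = ennreal (\<Prod>k\<in>K. r k powr p)"
        using r by (simp add: epow_ennreal prod_ennreal cong: prod.cong)
      moreover have "(\<Sum>k\<in>K. ennreal (p / a k) * h k x) = ennreal (\<Sum>k\<in>K. (p / a k) * r k)"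
      proof -
        have pa: "p / a k \<ge> 0" "r k \<ge> 0" if "k \<in> K" for k using a(1)[OF that] r(2)[OF that] p by auto
        have "(\<Sum>k\<in>K. ennreal (p / a k) * h k x) = (\<Sum>k\<in>K. ennreal ((p / a k) * r k))"
          using r(1) ennreal_mult[OF pa] by (intro sum.cong) auto
        also have "\<dots> = ennreal (\<Sum>k\<in>K. (p / a k) * r k)"
          by (rule sum_ennreal) (use pa in \<open>simp only: mult_nonneg_nonneg\<close>)
        finally show ?thesis .
      qed
      ultimately show ?thesis using A p a(1) r(2) by (simp add: ennreal_mult sum_nonneg less_imp_le)
    qed
    have "(\<integral>\<^sup>+x. (\<Prod>k\<in>K. epow p (h k x)) \<partial>M) \<le> (\<integral>\<^sup>+x. ennreal A * (\<Sum>k\<in>K. ennreal (p / a k) * h k x) \<partial>M)"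
      by (intro nn_integral_mono pt)
    also have "\<dots> = ennreal A * (\<Sum>k\<in>K. ennreal (p / a k) * I k)"
      using h by (simp add: nn_integral_cmult nn_integral_sum I_def)
    also have "(\<Sum>k\<in>K. ennreal (p / a k) * I k) = (\<Sum>k\<in>K. ennreal p)"
    proof (rule sum.cong)
      fix k assume k: "k \<in> K"
      have "ennreal (p / a k) * ennreal (a k) = ennreal (p / a k * a k)" using a[OF k] p by (intro ennreal_mult[symmetric]) auto
      then show "ennreal (p / a k) * I k = ennreal p" using a[OF k] by simp
    qed simp
    also have "\<dots> = ennreal (\<Sum>k\<in>K. p)" using p by (intro sum_ennreal) auto
    also have "(\<Sum>k\<in>K. p) = 1" using m by (simp add: p_def)
    also have "ennreal A * ennreal 1 = (\<Prod>k\<in>K. epow p (I k))"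
      unfolding A_def using a by (simp add: epow_ennreal prod_ennreal less_imp_le cong: prod.cong)
    finally show ?thesis .
  qed
  then show ?thesis by (simp add: p_def I_def)
qed

subsection \<open>Integration along coordinate lines\<close>

text \<open>The integral over the line through \<open>x\<close> in direction \<open>i\<close>; as a function of \<open>x\<close> it is constant along that line.\<close>

definition lint :: "'a::euclidean_space \<Rightarrow> ('a \<Rightarrow> ennreal) \<Rightarrow> 'a \<Rightarrow> ennreal" where
  "lint i g x = (\<integral>\<^sup>+t. g (x + t *\<^sub>R i) \<partial>lborel)"

lemma lint_measurable [measurable]:
  assumes [measurable]: "g \<in> borel_measurable borel"
  shows "lint i g \<in> borel_measurable borel"
  unfolding lint_def by measurable

lemma lint_mono: "(\<And>x. f x \<le> g x) \<Longrightarrow> lint i f x \<le> lint i g x"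
  unfolding lint_def by (intro nn_integral_mono)

lemma lint_invariant:
  assumes [measurable]: "g \<in> borel_measurable borel"
  shows "lint i g (x + s *\<^sub>R i) = lint i g x"
proof -
  have "lint i g x = (\<integral>\<^sup>+t. g (x + t *\<^sub>R i) \<partial>distr lborel borel ((+) s))" by (simp add: lint_def lborel_distr_plus)
  also have "\<dots> = (\<integral>\<^sup>+t. g (x + (s + t) *\<^sub>R i) \<partial>lborel)" by (rule nn_integral_distr) measurable
  finally show ?thesis by (simp add: lint_def scaleR_add_left add.assoc)
qed

lemma lint_commute:
  assumes [measurable]: "g \<in> borel_measurable borel"
  shows "lint i (lint j g) x = lint j (lint i g) x"
proof -
  have "(\<integral>\<^sup>+t. (\<integral>\<^sup>+s. g (x + t *\<^sub>R i + s *\<^sub>R j) \<partial>lborel) \<partial>lborel) = (\<integral>\<^sup>+s. (\<integral>\<^sup>+t. g (x + t *\<^sub>R i + s *\<^sub>R j) \<partial>lborel) \<partial>lborel)"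
    by (rule lborel_pair.Fubini') measurable
  then show ?thesis by (simp add: lint_def add.assoc add.left_commute add.commute)
qed

lemma foldr_lint_measurable [measurable]:
  "g \<in> borel_measurable borel \<Longrightarrow> foldr lint s g \<in> borel_measurable borel"
  by (induction s) (auto intro: lint_measurable)

text \<open>The induction behind the Loomis-Whitney inequality. When the integration in direction \<open>j\<close> is carried out, the
  factor with index \<open>j\<close> is constant along the line and comes out of the integral; the other \<open>N - 1\<close> factors are
  separated by Hoelder's inequality with equal exponents \<open>N - 1\<close>. A factor whose direction has been
  integrated has become the iterated integral of \<open>g\<close>; the others still carry their own line integral.\<close>

lemma Gagliardo_lines:
  fixes g :: "'a::euclidean_space \<Rightarrow> ennreal"
  assumes g[measurable]: "g \<in> borel_measurable borel" and n: "DIM('a) \<ge> 2"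
  defines "p \<equiv> 1 / real (DIM('a) - 1)"
  assumes "distinct s" "set s \<subseteq> Basis"
  shows "foldr lint s (\<lambda>x. \<Prod>i\<in>Basis. epow p (lint i g x)) x
    \<le> (\<Prod>i\<in>Basis. epow p (if i \<in> set s then foldr lint s g x else lint i (foldr lint s g) x))"
  using assms(4,5)
proof (induction s arbitrary: x)
  case (Cons j s)
  have p: "p > 0" using n by (simp add: p_def)
  have js: "j \<notin> set s" "j \<in> Basis" "distinct s" "set s \<subseteq> Basis" using Cons.prems by auto
  define G where "G = foldr lint s g"
  have [measurable]: "G \<in> borel_measurable borel" unfolding G_def by measurable
  define H where "H = (\<lambda>i. if i \<in> set s then G else lint i G)"
  have [measurable]: "H i \<in> borel_measurable borel" for i unfolding H_def by auto
  define c where "c = lint j G x"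
  have Hj: "H j (x + t *\<^sub>R j) = c" for t using js by (simp add: H_def c_def lint_invariant)
  have lH: "lint j (H i) x = (if i \<in> set s then c else lint i (lint j G) x)" for i
    by (simp add: H_def c_def lint_commute)
  let ?K = "Basis - {j} :: 'a set"
  have cK: "1 / real (card ?K) = p" using js by (simp add: p_def card_Diff_singleton)
  have K: "finite ?K" "?K \<noteq> {}"
  proof -
    have "card ?K > 0" using js n by (simp add: card_Diff_singleton)
    then show "?K \<noteq> {}" by (metis card.empty less_irrefl)
  qed simp
  have "foldr lint (j # s) (\<lambda>x. \<Prod>i\<in>Basis. epow p (lint i g x)) x
      \<le> lint j (\<lambda>x. \<Prod>i\<in>Basis. epow p (H i x)) x"
    using Cons.IH[OF js(3,4)] by (auto simp: H_def G_def if_distrib[of "\<lambda>f. f _"] intro!: lint_mono cong: if_cong)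
  also have "\<dots> = (\<integral>\<^sup>+t. epow p c * (\<Prod>i\<in>?K. epow p (H i (x + t *\<^sub>R j))) \<partial>lborel)"
    unfolding lint_def by (subst prod.remove[OF _ js(2)]) (simp_all add: Hj)
  also have "\<dots> = epow p c * (\<integral>\<^sup>+t. (\<Prod>i\<in>?K. epow p (H i (x + t *\<^sub>R j))) \<partial>lborel)"
    by (rule nn_integral_cmult) measurable
  also have "\<dots> \<le> epow p c * (\<Prod>i\<in>?K. epow p (\<integral>\<^sup>+t. H i (x + t *\<^sub>R j) \<partial>lborel))"
    using nn_Hoelder_equal[OF K, of "\<lambda>i t. H i (x + t *\<^sub>R j)" lborel] unfolding cK by (intro mult_left_mono) auto
  also have "\<dots> = epow p c * (\<Prod>i\<in>?K. epow p (if i \<in> set s then c else lint i (lint j G) x))"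
    by (simp add: lint_def[symmetric] lH)
  also have "\<dots> = (\<Prod>i\<in>Basis. epow p (if i \<in> set (j # s) then c else lint i (lint j G) x))"
    by (subst prod.remove[OF _ js(2)]) (auto intro!: arg_cong2[where f="(*)"] prod.cong)
  moreover have "foldr lint (j # s) g = lint j G" by (simp add: G_def)
  ultimately show ?case by (simp only: c_def)
qed simp

lemma foldr_lint_eq_integral:
  fixes h :: "'a::euclidean_space \<Rightarrow> ennreal"
  assumes h[measurable]: "h \<in> borel_measurable borel" and "distinct s"
  shows "foldr lint s h x = (\<integral>\<^sup>+f. h (x + (\<Sum>b\<in>set s. f b *\<^sub>R b)) \<partial>(\<Pi>\<^sub>M b\<in>set s. lborel))"
  using assms(2)
proof (induction s arbitrary: x)
  case Nil
  show ?case by (simp add: PiM_empty nn_integral_count_space_finite)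
next
  case (Cons j s)
  interpret product_sigma_finite "\<lambda>_::'a. lborel :: real measure" by standard
  have j: "j \<notin> set s" using Cons.prems by simp
  have "(\<integral>\<^sup>+f. h (x + (\<Sum>b\<in>insert j (set s). f b *\<^sub>R b)) \<partial>(\<Pi>\<^sub>M b\<in>insert j (set s). lborel))
     = (\<integral>\<^sup>+t. (\<integral>\<^sup>+f. h (x + (\<Sum>b\<in>insert j (set s). (f(j := t)) b *\<^sub>R b)) \<partial>(\<Pi>\<^sub>M b\<in>set s. lborel)) \<partial>lborel)"
    by (rule product_nn_integral_insert_rev[OF _ j]) (simp_all, measurable)
  also have "(\<lambda>f t. \<Sum>b\<in>insert j (set s). (f(j := t)) b *\<^sub>R b) = (\<lambda>f t. t *\<^sub>R j + (\<Sum>b\<in>set s. f b *\<^sub>R b))"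
    using j by (auto simp: fun_eq_iff intro!: sum.cong)
  finally show ?case using Cons by (simp add: lint_def add.assoc fun_eq_iff)
qed

text \<open>After all directions have been integrated, every factor is the full integral of \<open>g\<close>.\<close>

theorem Gagliardo:
  fixes g U :: "'a::euclidean_space \<Rightarrow> ennreal"
  assumes g[measurable]: "g \<in> borel_measurable borel" and n: "DIM('a) \<ge> 2"
    and U: "\<And>x i. i \<in> Basis \<Longrightarrow> U x \<le> lint i g x"
  defines "p \<equiv> 1 / real (DIM('a) - 1)"
  shows "(\<integral>\<^sup>+x. epow p (U x) ^ DIM('a) \<partial>lborel) \<le> epow p (\<integral>\<^sup>+x. g x \<partial>lborel) ^ DIM('a)"
proof -
  obtain s where s: "set s = (Basis :: 'a set)" "distinct s" using finite_distinct_list[OF finite_Basis] by blast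
  have p: "p > 0" using n by (simp add: p_def)
  have full: "foldr lint s h 0 = (\<integral>\<^sup>+x. h x \<partial>lborel)" if [measurable]: "h \<in> borel_measurable borel" for h :: "'a \<Rightarrow> ennreal"
  proof -
    have "(\<integral>\<^sup>+x. h x \<partial>lborel) = (\<integral>\<^sup>+f. h (\<Sum>b\<in>Basis. f b *\<^sub>R b) \<partial>(\<Pi>\<^sub>M b\<in>(Basis::'a set). lborel))"
      by (subst lborel_eq, subst nn_integral_distr) (simp_all, measurable)
    then show ?thesis using foldr_lint_eq_integral[OF that s(2), of 0] s by simp
  qed
  have "(\<integral>\<^sup>+x. epow p (U x) ^ DIM('a) \<partial>lborel) \<le> (\<integral>\<^sup>+x. (\<Prod>i\<in>Basis. epow p (lint i g x)) \<partial>lborel)"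
  proof (rule nn_integral_mono)
    fix x
    have "(\<Prod>i\<in>(Basis::'a set). epow p (U x)) \<le> (\<Prod>i\<in>Basis. epow p (lint i g x))"
    proof -
      have "(\<Prod>i\<in>B. epow p (U x)) \<le> (\<Prod>i\<in>B. epow p (lint i g x))" if "B \<subseteq> Basis" for B :: "'a set"
        using finite_subset[OF that finite_Basis] that
        by (induction B rule: finite_induct) (auto intro!: mult_mono epow_mono p U)
      then show ?thesis by blast
    qed
    then show "epow p (U x) ^ DIM('a) \<le> (\<Prod>i\<in>Basis. epow p (lint i g x))" by simp
  qed
  also have "\<dots> = foldr lint s (\<lambda>x. \<Prod>i\<in>Basis. epow p (lint i g x)) 0" by (rule full[symmetric]) measurable
  also have "\<dots> \<le> (\<Prod>i\<in>(Basis::'a set). epow p (foldr lint s g 0))"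
    using Gagliardo_lines[OF g n s(2), of 0] s by (simp add: p_def)
  also have "\<dots> = epow p (\<integral>\<^sup>+x. g x \<partial>lborel) ^ DIM('a)" by (simp add: full)
  finally show ?thesis .
qed

text \<open>At \<open>y = 0\<close> the difference quotient of \<open>\<bar>y\<bar> powr c\<close> is itself \<open>flux c\<close>, which is continuous.\<close>

lemma DERIV_abs_powr:
  assumes c: "c > (1::real)"
  shows "((\<lambda>y. \<bar>y\<bar> powr c) has_real_derivative (c * flux c y)) (at y)"
proof -
  consider "y > 0" | "y < 0" | "y = 0" by linarith
  then show ?thesis
  proof cases
    case 1
    have "y powr (c - 1) = y powr (c - 2) * y powr 1" by (simp only: powr_add[symmetric]) simp
    then have eq: "c * flux c y = c * y powr (c - 1)" using 1 by (simp add: flux_def)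
    have "((\<lambda>y. y powr c) has_real_derivative (c * y powr (c - 1))) (at y)" by (rule has_real_derivative_powr[OF 1])
    then show ?thesis unfolding eq
      by (rule has_field_derivative_transform_within_open[where S="{0<..}"]) (use 1 in auto)
  next
    case 2
    have "(- y) powr (c - 1) = (- y) powr (c - 2) * (- y) powr 1" by (simp only: powr_add[symmetric]) simp
    then have eq: "c * flux c y = c * (- y) powr (c - 1) * (- 1)" using 2 by (simp add: flux_def)
    have "((\<lambda>y. (- y) powr c) has_real_derivative (c * (- y) powr (c - 1) * (- 1))) (at y)"
      by (rule DERIV_chain2[where f="\<lambda>z. z powr c" and g=uminus, OF has_real_derivative_powr]) (use 2 in \<open>auto intro!: derivative_eq_intros\<close>)
    then show ?thesis unfolding eq
      by (rule has_field_derivative_transform_within_open[where S="{..<0}"]) (use 2 in auto)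
  next
    case 3
    have "isCont (flux c) (0::real)" using continuous_flux[OF c] by (auto simp: continuous_on_eq_continuous_at)
    then have "((\<lambda>h::real. flux c h) \<longlongrightarrow> 0) (at 0)" by (simp add: isCont_def)
    moreover have "eventually (\<lambda>h::real. flux c h = (\<bar>0 + h\<bar> powr c - \<bar>0\<bar> powr c) / h) (at 0)"
      unfolding eventually_at_filter
    proof (rule always_eventually, intro allI impI)
      fix h :: real assume h: "h \<noteq> 0"
      have "flux c h * h = \<bar>h\<bar> powr c" using flux_inner_self[of c h] by simp
      then show "flux c h = (\<bar>0 + h\<bar> powr c - \<bar>0\<bar> powr c) / h" using h by (simp add: field_simps)
    qed
    ultimately have "((\<lambda>h. (\<bar>0 + h\<bar> powr c - \<bar>0\<bar> powr c) / h) \<longlongrightarrow> 0) (at 0)"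
      by (rule Lim_transform_eventually)
    then show ?thesis using 3 by (simp add: DERIV_def)
  qed
qed

text \<open>The fundamental theorem of calculus along the half line through \<open>x\<close> that starts outside the support.\<close>

lemma line_integral_bound:
  fixes \<phi> :: "'a::euclidean_space \<Rightarrow> real"
  assumes c: "c > 1" and \<phi>: "times_cont_diff (Suc 0) \<phi>" and K: "compact K" "\<And>x. x \<notin> K \<Longrightarrow> \<phi> x = 0" and i: "i \<in> Basis"
  shows "ennreal (\<bar>\<phi> x\<bar> powr c) \<le> lint i (\<lambda>x. ennreal (c * (\<bar>\<phi> x\<bar> powr (c - 1) * norm (cgrad \<phi> x)))) x"
proof -
  define F where "F = (\<lambda>t. \<bar>\<phi> (x + t *\<^sub>R i)\<bar> powr c)"
  define f where "f = (\<lambda>t. c * flux c (\<phi> (x + t *\<^sub>R i)) * (cgrad \<phi> (x + t *\<^sub>R i) \<bullet> i))"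
  have der: "(F has_real_derivative f t) (at t)" for t
  proof -
    have "((\<lambda>s. \<phi> (x + s *\<^sub>R i)) has_derivative (\<lambda>s. cgrad \<phi> (x + t *\<^sub>R i) \<bullet> (s *\<^sub>R i))) (at t)"
      by (rule has_derivative_compose[of "\<lambda>s. x + s *\<^sub>R i" "\<lambda>s. s *\<^sub>R i" t UNIV \<phi>])
         (use cgrad_derivative[OF \<phi>, of "x + t *\<^sub>R i"] in \<open>auto intro!: derivative_eq_intros\<close>)
    then have "((\<lambda>s. \<phi> (x + s *\<^sub>R i)) has_real_derivative (cgrad \<phi> (x + t *\<^sub>R i) \<bullet> i)) (at t)"
      unfolding has_field_derivative_def by (rule has_derivative_eq_rhs) (auto simp: fun_eq_iff)
    from DERIV_chain2[OF DERIV_abs_powr[OF c] this] show ?thesis by (simp add: F_def f_def)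
  qed
  have contf: "continuous_on UNIV f" unfolding f_def
    by (intro continuous_on_mult continuous_on_inner continuous_on_const
        continuous_on_compose2[OF continuous_flux[OF c]] continuous_on_compose2[OF tcd0_cont[OF \<phi>]]
        continuous_on_compose2[OF cgrad_continuous[OF \<phi>]] continuous_intros) auto
  then have isc: "isCont f t" for t by (simp add: continuous_on_eq_continuous_at)
  obtain R where R: "R > 0" "\<And>y. y \<in> K \<Longrightarrow> norm y \<le> R" using compact_imp_bounded[OF K(1)] by (auto simp: bounded_pos)
  define T where "T = R + norm x + 1"
  have T: "T > 0" using R by (simp add: T_def add_nonneg_pos add_pos_nonneg)
  have "norm (x + (-T) *\<^sub>R i) \<ge> norm ((-T) *\<^sub>R i) - norm x" by (metis add.commute norm_diff_ineq)
  then have "norm (x + (-T) *\<^sub>R i) > R" using i T by (simp add: T_def)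
  then have "x + (-T) *\<^sub>R i \<notin> K" using R(2) by force
  then have F0: "F (-T) = 0" using K(2) by (simp add: F_def)
  have "(\<integral>t. f t * indicator {-T..0} t \<partial>lborel) = F 0 - F (-T)"
    by (rule integral_FTC_Icc_real) (use der isc T in auto)
  then have eq: "(\<integral>t. f t * indicator {-T..0} t \<partial>lborel) = \<bar>\<phi> x\<bar> powr c" using F0 by (simp add: F_def)
  have int: "integrable lborel (\<lambda>t. f t * indicator {-T..0} t)"
    using borel_integrable_atLeastAtMost[of "-T" 0 f] isc by (simp add: indicator_def if_distrib mult.commute cong: if_cong)
  have "ennreal (\<bar>\<phi> x\<bar> powr c) = ennreal (norm (\<integral>t. f t * indicator {-T..0} t \<partial>lborel))" by (simp add: eq)
  also have "\<dots> \<le> (\<integral>\<^sup>+t. norm (f t * indicator {-T..0} t) \<partial>lborel)" by (rule integral_norm_bound_ennreal[OF int])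
  also have "\<dots> \<le> lint i (\<lambda>x. ennreal (c * (\<bar>\<phi> x\<bar> powr (c - 1) * norm (cgrad \<phi> x)))) x"
    unfolding lint_def
  proof (intro nn_integral_mono ennreal_leI)
    fix t
    have "norm (f t * indicator {-T..0} t) \<le> \<bar>f t\<bar>" by (auto simp: indicator_def)
    also have "\<dots> = c * (\<bar>\<phi> (x + t *\<^sub>R i)\<bar> powr (c - 1) * \<bar>cgrad \<phi> (x + t *\<^sub>R i) \<bullet> i\<bar>)"
      using c norm_flux[of c "\<phi> (x + t *\<^sub>R i)"] by (simp add: f_def abs_mult)
    also have "\<dots> \<le> c * (\<bar>\<phi> (x + t *\<^sub>R i)\<bar> powr (c - 1) * norm (cgrad \<phi> (x + t *\<^sub>R i)))"
      using c Basis_le_norm[OF i] by (intro mult_left_mono) auto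
    finally show "norm (f t * indicator {-T..0} t) \<le> \<dots>" .
  qed
  finally show ?thesis .
qed

text \<open>Gagliardo's inequality for \<open>\<bar>\<phi>\<bar> powr c\<close>, followed by Hoelder's inequality for the gradient of this power. The
  exponent \<open>c\<close> is chosen so that the powers of \<open>\<phi>\<close> on both sides have the integral \<open>I\<close> of \<open>\<bar>\<phi>\<bar> powr r\<close> in
  common; dividing by the lower power of \<open>I\<close> leaves the norm of the gradient.\<close>

theorem Sobolev_test:
  fixes \<phi> :: "'a::euclidean_space \<Rightarrow> real" and p :: real
  assumes n: "DIM('a) \<ge> 2" and p: "1 < p" "p < DIM('a)" and \<phi>: "\<phi> \<in> test_functions \<Omega>"
  defines "r \<equiv> sobolev_exp DIM('a) p" and "c \<equiv> p * (real DIM('a) - 1) / (real DIM('a) - p)"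
  shows "pmod lborel r \<phi> \<le> (c * Lp_norm lborel p (cgrad \<phi>)) powr r"
proof -
  define N where "N = real DIM('a)"
  have N: "N \<ge> 2" "p < N" using n p by (auto simp: N_def)
  have c_alt: "c = p * (N - 1) / (N - p)" and r_alt: "r = N * p / (N - p)" by (simp_all add: c_def r_def sobolev_exp_def N_def)
  have "N - p < p * (N - 1)"
  proof -
    have "1 * N < p * N" using p N by (intro mult_strict_right_mono) auto
    then show ?thesis by (simp add: algebra_simps)
  qed
  then have c: "c > 1" using N by (simp add: c_alt)
  have r: "r > 0" using N p by (simp add: r_alt)
  \<comment> \<open>the two identities that determine \<open>c\<close>\<close>
  have cr: "c * N / (N - 1) = r" using N by (simp add: c_alt r_alt divide_simps mult_ac)
  have cr2: "(c - 1) * conj_exp p = r" 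
  proof -
    have "c - 1 = N * (p - 1) / (N - p)" using N by (simp add: c_alt field_simps)
    then show ?thesis using p N by (simp add: conj_exp_def r_alt)
  qed
  obtain K where K: "compact K" "\<And>x. x \<notin> K \<Longrightarrow> \<phi> x = 0" using test_functions_support[OF \<phi>] by metis
  have \<phi>1: "times_cont_diff (Suc 0) \<phi>" by (rule test_functions_tcd[OF \<phi>])
  note cont = tcd0_cont[OF \<phi>1] cgrad_continuous[OF \<phi>1]
  note [measurable] = borel_measurable_continuous_onI[OF cont(1)] borel_measurable_continuous_onI[OF cont(2)]
  define g where "g = (\<lambda>x. c * (\<bar>\<phi> x\<bar> powr (c - 1) * norm (cgrad \<phi> x)))"
  have g0: "g x \<ge> 0" for x using c by (simp add: g_def)
  have powi: "integrable lborel (\<lambda>x. norm (h x) powr s)" if s: "s > 0" and h: "continuous_on UNIV h" "\<And>x. x \<notin> K \<Longrightarrow> h x = 0"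
    for h :: "'a \<Rightarrow> 'c::euclidean_space" and s
    by (rule integrable_compact_support[OF continuous_norm_powr[OF h(1) s] K(1)]) (use h s in auto)
  have I1: "(\<lambda>x. \<bar>\<phi> x\<bar> powr (c - 1)) \<in> Lp_space lborel (conj_exp p)"
    using powi[OF r cont(1) K(2)] by (simp add: Lp_space_def powr_powr cr2)
  have I2: "cgrad \<phi> \<in> Lp_space lborel p"
    using powi[OF _ cont(2) cgrad_support[OF K]] p by (simp add: Lp_space_def)
  define I where "I = pmod lborel r \<phi>"
  define G where "G = Lp_norm lborel p (cgrad \<phi>)"
  have Hint: "integrable lborel g" using Hoelder(1)[OF p(1) I2 I1] by (simp add: g_def mult.commute)
  have gb: "(\<integral>x. g x \<partial>lborel) \<le> c * (I powr (1 / conj_exp p) * G)"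
  proof -
    have "(\<integral>x. g x \<partial>lborel) = c * (\<integral>x. norm (cgrad \<phi> x) * norm (\<bar>\<phi> x\<bar> powr (c - 1)) \<partial>lborel)" by (simp add: g_def mult.commute)
    also have "\<dots> \<le> c * (G * Lp_norm lborel (conj_exp p) (\<lambda>x. \<bar>\<phi> x\<bar> powr (c - 1)))"
      using Hoelder(2)[OF p(1) I2 I1] c by (intro mult_left_mono) (auto simp: G_def)
    also have "Lp_norm lborel (conj_exp p) (\<lambda>x. \<bar>\<phi> x\<bar> powr (c - 1)) = I powr (1 / conj_exp p)"
      by (simp add: Lp_norm_pmod pmod_def I_def powr_powr cr2)
    finally show ?thesis by (simp add: mult.commute)
  qed
  define q where "q = 1 / real (DIM('a) - 1)"
  have q: "q = 1 / (N - 1)" using n by (simp add: q_def N_def of_nat_diff)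
  have "(\<integral>\<^sup>+x. epow q (ennreal (\<bar>\<phi> x\<bar> powr c)) ^ DIM('a) \<partial>lborel) \<le> epow q (\<integral>\<^sup>+x. ennreal (g x) \<partial>lborel) ^ DIM('a)"
    unfolding q_def
    by (rule Gagliardo[OF _ n]) (use line_integral_bound[OF c \<phi>1 K] in \<open>auto simp: g_def\<close>)
  also have "(\<integral>\<^sup>+x. ennreal (g x) \<partial>lborel) = ennreal (\<integral>x. g x \<partial>lborel)"
    by (rule nn_integral_eq_integral[OF Hint]) (use g0 in auto)
  also have "epow q \<dots> ^ DIM('a) = ennreal ((\<integral>x. g x \<partial>lborel) powr (N / (N - 1)))"
  proof -
    have "0 \<le> (\<integral>x. g x \<partial>lborel)" using g0 by simp
    moreover have "((\<integral>x. g x \<partial>lborel) powr q) ^ DIM('a) = ((\<integral>x. g x \<partial>lborel) powr q) powr N"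
      unfolding N_def by (rule powr_realpow'[symmetric]) (use n in auto)
    ultimately show ?thesis by (simp add: epow_ennreal ennreal_power powr_powr q)
  qed
  also have "(\<lambda>x. epow q (ennreal (\<bar>\<phi> x\<bar> powr c)) ^ DIM('a)) = (\<lambda>x. ennreal (norm (\<phi> x) powr r))"
  proof
    fix x
    have "((\<bar>\<phi> x\<bar> powr c) powr q) ^ DIM('a) = \<bar>\<phi> x\<bar> powr r"
    proof -
      have "((\<bar>\<phi> x\<bar> powr c) powr q) ^ DIM('a) = (\<bar>\<phi> x\<bar> powr (c * q)) powr N"
        using powr_realpow'[of "\<bar>\<phi> x\<bar> powr (c * q)" "DIM('a)"] n powr_powr[of "\<bar>\<phi> x\<bar>" c q] by (simp add: N_def del: powr_powr)
      also have "\<dots> = \<bar>\<phi> x\<bar> powr (c * q * N)" by (rule powr_powr)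
      also have "c * q * N = r" unfolding q using cr by simp
      finally show ?thesis .
    qed
    then show "epow q (ennreal (\<bar>\<phi> x\<bar> powr c)) ^ DIM('a) = ennreal (norm (\<phi> x) powr r)"
      by (simp add: epow_ennreal ennreal_power)
  qed
  finally have "(\<integral>\<^sup>+x. ennreal (norm (\<phi> x) powr r) \<partial>lborel) \<le> ennreal ((\<integral>x. g x \<partial>lborel) powr (N / (N - 1)))" .
  moreover have "(\<integral>\<^sup>+x. ennreal (norm (\<phi> x) powr r) \<partial>lborel) = ennreal I"
    unfolding I_def pmod_def by (rule nn_integral_eq_integral[OF powi[OF r cont(1) K(2)]]) auto
  ultimately have "I \<le> (\<integral>x. g x \<partial>lborel) powr (N / (N - 1))" by simp
  also have "\<dots> \<le> (c * (I powr (1 / conj_exp p) * G)) powr (N / (N - 1))"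
    using gb g0 N by (intro powr_mono2) auto
  finally have main: "I \<le> (c * (I powr (1 / conj_exp p) * G)) powr (N / (N - 1))" .
  show ?thesis unfolding I_def[symmetric] G_def[symmetric]
  proof (cases "I = 0")
    case False
    then have I: "I > 0" by (simp add: I_def less_le)
    have G0: "G \<ge> 0" by (simp add: G_def)
    have "I powr ((N - 1) / N) \<le> ((c * (I powr (1 / conj_exp p) * G)) powr (N / (N - 1))) powr ((N - 1) / N)"
      using main N I by (intro powr_mono2) auto
    also have "\<dots> = c * (I powr (1 / conj_exp p) * G)" using c G0 N by (simp add: powr_powr)
    finally have "I powr ((N - 1) / N) \<le> I powr (1 / conj_exp p) * (c * G)" by (simp add: algebra_simps)
    then have "I powr ((N - 1) / N) / I powr (1 / conj_exp p) \<le> c * G"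
      using I by (simp add: divide_le_eq mult.commute)
    also have "I powr ((N - 1) / N) / I powr (1 / conj_exp p) = I powr (1 / r)"
    proof -
      have "(N - 1) / N - 1 / conj_exp p = 1 / r" using N p by (simp add: conj_exp_def r_alt field_simps)
      then show ?thesis by (simp add: powr_diff[symmetric])
    qed
    finally have "(I powr (1 / r)) powr r \<le> (c * G) powr r" using r by (intro powr_mono2) auto
    then show "I \<le> (c * G) powr r" using r I by (simp add: powr_powr)
  qed simp
qed

section \<open>The spaces of functions vanishing on the boundary\<close>

locale bounded_open =
  fixes \<Omega> :: "'a::euclidean_space set"
  assumes O: "open \<Omega>" and bd: "bounded \<Omega>" and ne: "\<Omega> \<noteq> {}" and dim2: "DIM('a) \<ge> 2"
begin

abbreviation "M \<equiv> lebesgue_on \<Omega>"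

sublocale finite_measure M
  by (rule finite_measure_lebesgue_on) (rule lmeasurable_open[OF bd O])

lemma test_props:
  assumes "\<phi> \<in> test_functions \<Omega>"
  shows "continuous_on UNIV \<phi>" "continuous_on UNIV (cgrad \<phi>)"
    "\<phi> \<in> borel_measurable borel" "cgrad \<phi> \<in> borel_measurable borel"
    "\<phi> \<in> borel_measurable M" "cgrad \<phi> \<in> borel_measurable M"
    "x \<notin> \<Omega> \<Longrightarrow> \<phi> x = 0" "x \<notin> \<Omega> \<Longrightarrow> cgrad \<phi> x = 0"
    "\<exists>B>0. \<forall>x. \<bar>\<phi> x\<bar> \<le> B" "\<exists>B>0. \<forall>x. norm (cgrad \<phi> x) \<le> B"
proof -
  obtain K where K: "compact K" "K \<subseteq> \<Omega>" "\<And>x. x \<notin> K \<Longrightarrow> \<phi> x = 0" using test_functions_support[OF assms] by metis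
  have 1: "times_cont_diff (Suc 0) \<phi>" by (rule test_functions_tcd[OF assms])
  show c: "continuous_on UNIV \<phi>" "continuous_on UNIV (cgrad \<phi>)"
    by (rule tcd0_cont[OF 1] cgrad_continuous[OF 1])+
  then show m: "\<phi> \<in> borel_measurable borel" "cgrad \<phi> \<in> borel_measurable borel"
    by (auto intro: borel_measurable_continuous_onI)
  then show "\<phi> \<in> borel_measurable M" "cgrad \<phi> \<in> borel_measurable M"
    by (auto intro: borel_measurable_lebesgue_on)
  show "x \<notin> \<Omega> \<Longrightarrow> \<phi> x = 0" using K by blast
  show "x \<notin> \<Omega> \<Longrightarrow> cgrad \<phi> x = 0" by (rule cgrad_support[OF K(1,3)]) (use K(2) in auto)
  show "\<exists>B>0. \<forall>x. \<bar>\<phi> x\<bar> \<le> B" using bounded_compact_support[OF c(1) K(1,3)] by simp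
  show "\<exists>B>0. \<forall>x. norm (cgrad \<phi> x) \<le> B" by (rule bounded_compact_support[OF c(2) K(1) cgrad_support[OF K(1,3)]])
qed

lemma bounded_Lp:
  fixes f :: "'a \<Rightarrow> 'b::euclidean_space"
  assumes "f \<in> borel_measurable M" "\<And>x. norm (f x) \<le> B" "s \<ge> 0"
  shows "f \<in> Lp_space M s" "pmod M s f \<le> B powr s * measure M \<Omega>"
proof -
  have i: "integrable M (\<lambda>x. B powr s)" by simp
  have ae: "AE x in M. norm (f x) powr s \<le> B powr s" using assms by (intro AE_I2 powr_mono2) auto
  show "f \<in> Lp_space M s" by (rule Lp_bound(1)[OF assms(1) i ae])
  have "pmod M s f \<le> (\<integral>x. B powr s \<partial>M)" by (rule Lp_bound(2)[OF assms(1) i ae])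
  then show "pmod M s f \<le> B powr s * measure M \<Omega>" using O by (simp add: space_restrict_space mult.commute)
qed

lemma test_Lp:
  assumes "\<phi> \<in> test_functions \<Omega>" "s \<ge> 0"
  shows "\<phi> \<in> Lp_space M s" "cgrad \<phi> \<in> Lp_space M s"
proof -
  obtain B B' where "\<forall>x. \<bar>\<phi> x\<bar> \<le> B" "\<forall>x. norm (cgrad \<phi> x) \<le> B'"
    using test_props(9,10)[OF assms(1)] by blast
  then show "\<phi> \<in> Lp_space M s" "cgrad \<phi> \<in> Lp_space M s"
    using bounded_Lp(1)[OF test_props(5)[OF assms(1)] _ assms(2)] bounded_Lp(1)[OF test_props(6)[OF assms(1)] _ assms(2)] by auto
qed

lemma pmod_lborel:
  fixes f :: "'a \<Rightarrow> 'b::euclidean_space"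
  assumes [measurable]: "f \<in> borel_measurable borel" and "\<And>x. x \<notin> \<Omega> \<Longrightarrow> f x = 0"
  shows "pmod lborel s f = pmod M s f"
  unfolding pmod_def by (rule integral_lebesgue_on_support[OF O, symmetric]) (use assms(2) in auto)

lemma measurable_AE: "f \<in> borel_measurable M \<Longrightarrow> AE x in M. f x = g x \<Longrightarrow> g \<in> borel_measurable M"
  for f g :: "'a \<Rightarrow> 'b::euclidean_space"
  by (rule borel_measurable_AE_lebesgue_on[OF O])

lemma grad_test_AE: "\<phi> \<in> test_functions \<Omega> \<Longrightarrow> AE x in M. cgrad \<phi> x = grad \<Omega> \<phi> x"
  using grad_test[OF O, of \<phi>] by (auto elim!: eventually_mono)

lemma grad_test_measurable: "\<phi> \<in> test_functions \<Omega> \<Longrightarrow> grad \<Omega> \<phi> \<in> borel_measurable M"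
  by (rule measurable_AE[OF test_props(6) grad_test_AE])

text \<open>Separability of the space of continuous gradients with the uniform norm. Each test function fits one of countably many
  coarse descriptions of its gradient, and two functions with the same description have close gradients; so one representative
  per description suffices.\<close>

lemma countable_dense_gradients:
  "\<exists>S. countable S \<and> S \<subseteq> test_functions \<Omega> \<and>
     (\<forall>\<phi>\<in>test_functions \<Omega>. \<forall>e>0. \<exists>s\<in>S. \<forall>x\<in>\<Omega>. norm (cgrad \<phi> x - cgrad s x) < e)"
proof -
  obtain BB :: "'a set set" where BB: "countable BB" "topological_basis BB" using ex_countable_basis by blast
  obtain V :: "'a set" where V: "countable V" "\<And>X. open X \<Longrightarrow> X \<noteq> {} \<Longrightarrow> \<exists>d\<in>V. d \<in> X" using countable_dense_setE by blast
  \<comment> \<open>\<open>L\<close> prescribes approximate values of the gradient on finitely many basic open sets covering \<open>\<Omega>\<close>\<close>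
  define fits where "fits = (\<lambda>(n::nat) L \<phi>. \<phi> \<in> test_functions \<Omega> \<and> closure \<Omega> \<subseteq> \<Union>(fst ` L) \<and>
    (\<forall>(B,v)\<in>L. \<forall>x\<in>B. norm (cgrad \<phi> x - v) < 1 / real (Suc n)))"
  define LL where "LL = {L. finite L \<and> L \<subseteq> BB \<times> V}"
  define S where "S = (\<lambda>(n,L). SOME \<phi>. fits n L \<phi>) ` {(n,L). L \<in> LL \<and> (\<exists>\<phi>. fits n L \<phi>)}"
  have "countable LL" unfolding LL_def
    using countable_Collect_finite_subset[of "BB \<times> V"] BB V by (simp add: countable_SIGMA)
  then have "countable ((UNIV :: nat set) \<times> LL)" by (intro countable_SIGMA) simp_all
  moreover have "{(n::nat,L). L \<in> LL \<and> (\<exists>\<phi>. fits n L \<phi>)} \<subseteq> UNIV \<times> LL" by blast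
  ultimately have "countable {(n::nat,L). L \<in> LL \<and> (\<exists>\<phi>. fits n L \<phi>)}" by (rule countable_subset[rotated])
  then have cS: "countable S" unfolding S_def by (rule countable_image)
  have some: "fits n L (SOME \<phi>. fits n L \<phi>)" if "\<exists>\<phi>. fits n L \<phi>" for n L using that by (rule someI_ex)
  have ST: "S \<subseteq> test_functions \<Omega>" using some by (auto simp: S_def fits_def)
  \<comment> \<open>the gradient of a test function is continuous on the compact closure of \<open>\<Omega>\<close>\<close>
  have ex: "\<exists>L\<in>LL. fits n L \<phi>" if \<phi>: "\<phi> \<in> test_functions \<Omega>" for n \<phi>
  proof -
    have "\<exists>B v. B \<in> BB \<and> v \<in> V \<and> x \<in> B \<and> (\<forall>y\<in>B. norm (cgrad \<phi> y - v) < 1 / real (Suc n))" for x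
    proof -
      define e where "e = 1 / real (Suc n)"
      have e: "e > 0" by (simp add: e_def)
      obtain v where v: "v \<in> V" "v \<in> ball (cgrad \<phi> x) (e / 2)" using V(2)[of "ball (cgrad \<phi> x) (e/2)"] e by auto
      have "open {y. norm (cgrad \<phi> y - v) < e}"
        by (intro open_Collect_less continuous_intros test_props(2)[OF \<phi>])
      moreover have "x \<in> {y. norm (cgrad \<phi> y - v) < e}" using v e by (simp add: dist_norm)
      ultimately obtain B where "B \<in> BB" "x \<in> B" "B \<subseteq> {y. norm (cgrad \<phi> y - v) < e}"
        using topological_basisE[OF BB(2)] by metis
      then show ?thesis using v(1) by (auto simp: e_def)
    qed
    then obtain B v where Bv: "\<And>x. B x \<in> BB" "\<And>x. v x \<in> V" "\<And>x. x \<in> B x"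
      "\<And>x y. y \<in> B x \<Longrightarrow> norm (cgrad \<phi> y - v x) < 1 / real (Suc n)" by metis
    have comp: "compact (closure \<Omega>)" using bd by (simp add: compact_closure)
    have Bo: "open (B x)" for x using topological_basis_open[OF BB(2) Bv(1)] .
    obtain C where C: "C \<subseteq> closure \<Omega>" "finite C" "closure \<Omega> \<subseteq> (\<Union>c\<in>C. B c)"
    proof (rule  compactE_image[OF comp, of "closure \<Omega>" B])
      show "closure \<Omega> \<subseteq> (\<Union>c\<in>closure \<Omega>. B c)" using Bv(3) by auto
    qed (rule Bo)
    have "(\<lambda>c. (B c, v c)) ` C \<in> LL" using C Bv by (auto simp: LL_def)
    moreover have "fits n ((\<lambda>c. (B c, v c)) ` C) \<phi>" using C(3) Bv(4) \<phi> by (force simp: fits_def image_image)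
    ultimately show ?thesis by blast
  qed
  have "\<exists>s\<in>S. \<forall>x\<in>\<Omega>. norm (cgrad \<phi> x - cgrad s x) < e" if \<phi>: "\<phi> \<in> test_functions \<Omega>" and e: "e > 0" for \<phi> e
  proof -
    obtain n where n: "2 / e < real n" using reals_Archimedean2 by blast
    have n': "2 * (1 / real (Suc n)) < e"
    proof -
      have "2 < e * real n" using n e by (simp add: field_simps)
      also have "\<dots> \<le> e * real (Suc n)" using e by simp
      finally show ?thesis by (simp add: field_simps)
    qed
    obtain L where L: "L \<in> LL" "fits n L \<phi>" using ex[OF \<phi>] by blast
    define s where "s = (SOME \<phi>. fits n L \<phi>)"
    have s: "fits n L s" unfolding s_def by (rule some) (use L in blast)
    have "s \<in> S" unfolding S_def s_def using L by (intro image_eqI[of _ _ "(n,L)"]) auto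
    moreover have "norm (cgrad \<phi> x - cgrad s x) < e" if "x \<in> \<Omega>" for x
    proof -
      have "x \<in> closure \<Omega>" using that closure_subset by blast
      moreover have "closure \<Omega> \<subseteq> \<Union>(fst ` L)" using L(2) by (simp add: fits_def)
      ultimately obtain B v where Bv: "(B,v) \<in> L" "x \<in> B" by auto
      have "\<forall>(B,v)\<in>L. \<forall>x\<in>B. norm (cgrad \<phi> x - v) < 1 / real (Suc n)"
        using L(2) unfolding fits_def by (elim conjE)
      moreover have "\<forall>(B,v)\<in>L. \<forall>x\<in>B. norm (cgrad s x - v) < 1 / real (Suc n)"
        using s unfolding fits_def by (elim conjE)
      ultimately have "norm (cgrad \<phi> x - v) < 1 / real (Suc n)" "norm (cgrad s x - v) < 1 / real (Suc n)"
        using Bv by auto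
      then have "norm (cgrad \<phi> x - cgrad s x) < 2 * (1 / real (Suc n))"
        using norm_triangle_ineq4[of "cgrad \<phi> x - v" "cgrad s x - v"] by simp
      then show ?thesis using n' by linarith
    qed
    ultimately show ?thesis by blast
  qed
  then show ?thesis using cS ST by blast
qed

end

locale sobolev_space = bounded_open \<Omega> for \<Omega> :: "'a::euclidean_space set" +
  fixes p r :: real
  assumes p1: "1 < p" and pN: "p < DIM('a)" and r_eq: "r = sobolev_exp DIM('a) p"
begin

lemma p0: "p > 0" "p \<ge> 0" using p1 by auto



lemma r_gt: "r > p"
proof -
  have "real DIM('a) * p > (real DIM('a) - p) * p" using p1 by (intro mult_strict_right_mono) auto
  then show ?thesis using pN by (simp add: r_eq sobolev_exp_def less_divide_eq mult.commute)
qed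

lemma r0: "r > 1" "r > 0" "r \<ge> 0" using r_gt p1 by auto

lemma Lp_norm_tendsto_iff: "(\<lambda>n. Lp_norm M p (f n)) \<longlonglongrightarrow> 0 \<longleftrightarrow> (\<lambda>n. pmod M p (f n)) \<longlonglongrightarrow> 0"
  for f :: "nat \<Rightarrow> 'a \<Rightarrow> 'b::euclidean_space"
proof
  assume "(\<lambda>n. Lp_norm M p (f n)) \<longlonglongrightarrow> 0"
  then have "(\<lambda>n. Lp_norm M p (f n) powr p) \<longlonglongrightarrow> 0 powr p"
    using p0 by (intro tendsto_powr2 tendsto_const) auto
  then show "(\<lambda>n. pmod M p (f n)) \<longlonglongrightarrow> 0" using p0 by (simp add: Lp_norm_powr)
next
  assume "(\<lambda>n. pmod M p (f n)) \<longlonglongrightarrow> 0"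
  then have "(\<lambda>n. pmod M p (f n) powr (1/p)) \<longlonglongrightarrow> 0 powr (1/p)"
    using p0 by (intro tendsto_powr2 tendsto_const) auto
  then show "(\<lambda>n. Lp_norm M p (f n)) \<longlonglongrightarrow> 0" by (simp add: Lp_norm_pmod)
qed

lemma W10I:
  assumes u: "u \<in> Lp_space M p" and G: "G \<in> Lp_space M p" and w: "is_weak_gradient \<Omega> u G"
    and \<phi>: "\<And>n. \<phi> n \<in> test_functions \<Omega>"
    and l: "(\<lambda>n. pmod M p (\<lambda>x. u x - \<phi> n x)) \<longlonglongrightarrow> 0" "(\<lambda>n. pmod M p (\<lambda>x. G x - cgrad (\<phi> n) x)) \<longlonglongrightarrow> 0"
  shows "u \<in> W10 \<Omega> p"
proof -
  have ae: "AE x in M. G x = grad \<Omega> u x" using grad_AE_eq[OF O w] by (auto elim!: eventually_mono)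
  have m: "grad \<Omega> u \<in> borel_measurable M" by (rule measurable_AE[OF Lp_measurable[OF G] ae])
  have "pmod M p (\<lambda>x. grad \<Omega> u x - grad \<Omega> (\<phi> n) x) = pmod M p (\<lambda>x. G x - cgrad (\<phi> n) x)" for n
  proof (rule pmod_cong_AE)
    show "AE x in M. grad \<Omega> u x - grad \<Omega> (\<phi> n) x = G x - cgrad (\<phi> n) x"
      using ae grad_test_AE[OF \<phi>[of n]] by eventually_elim simp
  qed (intro borel_measurable_diff m grad_test_measurable \<phi> Lp_measurable[OF G] test_props(6))+
  then show ?thesis using u G w \<phi> l
    by (auto simp: W10_def W1_def Lp_norm_tendsto_iff intro!: exI[of _ \<phi>])
qed

lemma W10D:
  assumes "u \<in> W10 \<Omega> p"
  shows "u \<in> Lp_space M p" "grad \<Omega> u \<in> Lp_space M p" "is_weak_gradient \<Omega> u (grad \<Omega> u)"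
    "\<exists>\<phi>. (\<forall>n. \<phi> n \<in> test_functions \<Omega>) \<and> (\<lambda>n. pmod M p (\<lambda>x. u x - \<phi> n x)) \<longlonglongrightarrow> 0 \<and>
       (\<lambda>n. pmod M p (\<lambda>x. grad \<Omega> u x - cgrad (\<phi> n) x)) \<longlonglongrightarrow> 0"
proof -
  show u: "u \<in> Lp_space M p" using assms by (simp add: W10_def W1_def)
  obtain G where G: "G \<in> Lp_space M p" "is_weak_gradient \<Omega> u G" using assms by (auto simp: W10_def W1_def)
  show "is_weak_gradient \<Omega> u (grad \<Omega> u)" by (rule grad_weak_gradient[OF G(2)])
  have ae: "AE x in M. G x = grad \<Omega> u x" using grad_AE_eq[OF O G(2)] by (auto elim!: eventually_mono)
  have m: "grad \<Omega> u \<in> borel_measurable M" by (rule measurable_AE[OF Lp_measurable[OF G(1)] ae])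
  show "grad \<Omega> u \<in> Lp_space M p" by (rule Lp_cong_AE[OF G(1) m ae])
  obtain \<phi> where \<phi>: "\<And>n. \<phi> n \<in> test_functions \<Omega>" "(\<lambda>n. pmod M p (\<lambda>x. u x - \<phi> n x)) \<longlonglongrightarrow> 0"
      "(\<lambda>n. pmod M p (\<lambda>x. grad \<Omega> u x - grad \<Omega> (\<phi> n) x)) \<longlonglongrightarrow> 0"
    using assms by (auto simp: W10_def Lp_norm_tendsto_iff)
  have "pmod M p (\<lambda>x. grad \<Omega> u x - grad \<Omega> (\<phi> n) x) = pmod M p (\<lambda>x. grad \<Omega> u x - cgrad (\<phi> n) x)" for n
  proof (rule pmod_cong_AE)
    show "AE x in M. grad \<Omega> u x - grad \<Omega> (\<phi> n) x = grad \<Omega> u x - cgrad (\<phi> n) x"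
      using grad_test_AE[OF \<phi>(1)[of n]] by eventually_elim simp
  qed (intro borel_measurable_diff m grad_test_measurable \<phi> test_props(6))+
  then show "\<exists>\<phi>. (\<forall>n. \<phi> n \<in> test_functions \<Omega>) \<and> (\<lambda>n. pmod M p (\<lambda>x. u x - \<phi> n x)) \<longlonglongrightarrow> 0 \<and>
       (\<lambda>n. pmod M p (\<lambda>x. grad \<Omega> u x - cgrad (\<phi> n) x)) \<longlonglongrightarrow> 0"
    using \<phi> by (intro exI[of _ \<phi>]) simp
qed

lemma test_W10: "\<phi> \<in> test_functions \<Omega> \<Longrightarrow> \<phi> \<in> W10 \<Omega> p"
  using test_Lp[of \<phi> p] p0
  by (intro W10I[where G="cgrad \<phi>" and \<phi>="\<lambda>n. \<phi>"] weak_gradient_cgrad[OF O test_functions_tcd]) (auto simp: pmod_def)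

text \<open>The inequality for test functions passes to the closure by Fatou's lemma.\<close>

lemma Sobolev: "\<exists>S>0. \<forall>u\<in>W10 \<Omega> p. u \<in> Lp_space M r \<and> pmod M r u \<le> S * pmod M p (grad \<Omega> u) powr (r / p)"
proof -
  define c where "c = p * (real DIM('a) - 1) / (real DIM('a) - p)"
  have c: "c > 0" using p1 pN by (simp add: c_def)
  define S where "S = c powr r * (2 powr p) powr (r / p)"
  have main: "u \<in> Lp_space M r \<and> pmod M r u \<le> S * pmod M p (grad \<Omega> u) powr (r / p)" if u: "u \<in> W10 \<Omega> p" for u
  proof -
    obtain \<phi> where \<phi>: "\<And>n. \<phi> n \<in> test_functions \<Omega>" "(\<lambda>n. pmod M p (\<lambda>x. u x - \<phi> n x)) \<longlonglongrightarrow> 0"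
       "(\<lambda>n. pmod M p (\<lambda>x. grad \<Omega> u x - cgrad (\<phi> n) x)) \<longlonglongrightarrow> 0" using W10D(4)[OF u] by blast
    have "(\<lambda>n. pmod M p (\<lambda>x. \<phi> n x - u x)) \<longlonglongrightarrow> 0" using \<phi>(2) by (subst pmod_minus_commute)
    then obtain k where k: "strict_mono k" "AE x in M. (\<lambda>n. \<phi> (k n) x) \<longlonglongrightarrow> u x"
      using pmod_tendsto_AE_subseq[of \<phi>, OF test_Lp(1)[OF \<phi>(1) p0(2)] W10D(1)[OF u] _ p0(1)] by blast
    define d where "d = (\<lambda>n. pmod M p (\<lambda>x. grad \<Omega> u x - cgrad (\<phi> n) x))"
    define b where "b = (\<lambda>n. c powr r * (2 powr p * (pmod M p (grad \<Omega> u) + d n)) powr (r / p))"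
    have pb: "pmod M r (\<phi> n) \<le> b n" for n
    proof -
      have "pmod M r (\<phi> n) = pmod lborel r (\<phi> n)"
        by (rule pmod_lborel[symmetric]) (use test_props(3,7)[OF \<phi>(1)] in auto)
      also have "\<dots> \<le> (c * Lp_norm lborel p (cgrad (\<phi> n))) powr r"
        unfolding c_def r_eq by (rule Sobolev_test[OF dim2 p1 pN \<phi>(1)])
      also have "\<dots> = c powr r * pmod lborel p (cgrad (\<phi> n)) powr (r / p)"
        using c by (simp add: powr_mult Lp_norm_pmod powr_powr)
      also have "pmod lborel p (cgrad (\<phi> n)) = pmod M p (cgrad (\<phi> n))"
        by (rule pmod_lborel) (use test_props(4,8)[OF \<phi>(1)] in auto)
      also have "c powr r * pmod M p (cgrad (\<phi> n)) powr (r / p) \<le> b n"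
      proof -
        have "pmod M p (cgrad (\<phi> n)) \<le> 2 powr p * (pmod M p (grad \<Omega> u) + d n)"
          using Lp_diff(2)[OF W10D(2)[OF u] Lp_diff(1)[OF W10D(2)[OF u] test_Lp(2)[OF \<phi>(1)[of n] p0(2)] p0(2)] p0(2)]
          by (simp add: d_def)
        then show ?thesis unfolding b_def using r0 p0 by (intro mult_left_mono powr_mono2) auto
      qed
      finally show ?thesis .
    qed
    have "b \<longlonglongrightarrow> c powr r * (2 powr p * (pmod M p (grad \<Omega> u) + 0)) powr (r / p)"
      unfolding b_def using \<phi>(3) r0 p0 by (intro tendsto_intros tendsto_powr2) (auto simp: d_def intro!: always_eventually add_nonneg_nonneg)
    then have lb: "(\<lambda>n. b (k n)) \<longlonglongrightarrow> S * pmod M p (grad \<Omega> u) powr (r / p)"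
      using LIMSEQ_subseq_LIMSEQ[OF _ k(1), of b] by (simp add: comp_def S_def powr_mult mult.assoc)
    show ?thesis
      using pmod_Fatou[where f="\<lambda>n. \<phi> (k n)" and b="\<lambda>n. b (k n)", OF test_Lp(1)[OF \<phi>(1) r0(3)] Lp_measurable[OF W10D(1)[OF u]] k(2) pb lb r0(2)]
      by blast
  qed
  show ?thesis by (rule exI[of _ S]) (use main c in \<open>auto simp: S_def\<close>)
qed

text \<open>Scale \<open>u\<close> by \<open>t\<close> to a gradient of norm one. Then \<open>y powr p \<le> 1 + y powr r\<close> bounds the \<open>p\<close>-modular by the measure
  of \<open>\<Omega>\<close> plus the \<open>r\<close>-modular, and the latter is bounded by Sobolev's inequality.\<close>

lemma Poincare: "\<exists>C>0. \<forall>u\<in>W10 \<Omega> p. pmod M p u \<le> C * pmod M p (grad \<Omega> u)"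
proof -
  obtain S where S: "S > 0" "\<And>u. u \<in> W10 \<Omega> p \<Longrightarrow> u \<in> Lp_space M r"
    "\<And>u. u \<in> W10 \<Omega> p \<Longrightarrow> pmod M r u \<le> S * pmod M p (grad \<Omega> u) powr (r / p)" using Sobolev by blast
  define C where "C = measure M \<Omega> + S"
  have C: "C > 0" using S by (simp add: C_def add_nonneg_pos)
  have "pmod M p u \<le> C * pmod M p (grad \<Omega> u)" if u: "u \<in> W10 \<Omega> p" for u
  proof (cases "pmod M p (grad \<Omega> u) = 0")
    case True
    then have "pmod M r u = 0" using S(3)[OF u] pmod_nonneg[of M r u] r0 p0 by simp
    then have "AE x in M. u x = 0" by (rule pmod_eq_0[OF S(2)[OF u]])
    then have "pmod M p u = pmod M p (\<lambda>x. 0 :: real)"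
      using Lp_measurable[OF W10D(1)[OF u]] by (intro pmod_cong_AE) auto
    then show ?thesis using True by (simp add: pmod_def)
  next
    case False
    define g where "g = pmod M p (grad \<Omega> u)"
    have g: "g > 0" using False by (simp add: g_def less_le)
    define t where "t = g powr (- (1 / p))"
    have t: "t > 0" using g by (simp add: t_def)
    have "t powr p = g powr (- (1 / p) * p)" unfolding t_def by (rule powr_powr)
    also have "- (1 / p) * p = - 1" using p0 by simp
    finally have tp: "t powr p = 1 / g" using g by (simp add: powr_minus_divide)
    have tr: "t powr r * g powr (r / p) = 1" using g by (simp add: t_def powr_powr powr_add[symmetric])
    have iu: "integrable M (\<lambda>x. norm (u x) powr p)" "integrable M (\<lambda>x. norm (u x) powr r)"
      using Lp_integrable[OF W10D(1)[OF u]] Lp_integrable[OF S(2)[OF u]] by auto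
    have "t powr p * pmod M p u = (\<integral>x. t powr p * norm (u x) powr p \<partial>M)" by (simp add: pmod_def)
    also have "\<dots> \<le> (\<integral>x. 1 + t powr r * norm (u x) powr r \<partial>M)"
    proof (rule integral_mono)
      fix x
      have "(t * norm (u x)) powr p \<le> 1 + (t * norm (u x)) powr r"
      proof (cases "t * norm (u x) \<le> 1")
        case True
        then have "(t * norm (u x)) powr p \<le> 1" using t p0 by (intro powr_le1) auto
        then show ?thesis by (simp add: add_increasing2)
      next
        case False
        then have "(t * norm (u x)) powr p \<le> (t * norm (u x)) powr r" using r_gt by (intro powr_mono) auto
        then show ?thesis by simp
      qed
      then show "t powr p * norm (u x) powr p \<le> 1 + t powr r * norm (u x) powr r" using t by (simp add: powr_mult)
    qed (use iu in auto)
    also have "\<dots> = measure M \<Omega> + t powr r * pmod M r u"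
      using iu O by (simp add: pmod_def space_restrict_space)
    also have "t powr r * pmod M r u \<le> t powr r * (S * g powr (r / p))"
      using S(3)[OF u] by (intro mult_left_mono) (auto simp: g_def)
    also have "\<dots> = S" using tr by (simp add: mult.left_commute)
    finally have "pmod M p u / g \<le> C" by (simp add: tp C_def)
    then show ?thesis using g by (simp add: g_def[symmetric] divide_le_eq)
  qed
  then show ?thesis using C by blast
qed

lemma W10_add:
  assumes u: "u \<in> W10 \<Omega> p" and v: "v \<in> W10 \<Omega> p"
  shows "(\<lambda>x. u x + v x) \<in> W10 \<Omega> p" "AE x in M. grad \<Omega> (\<lambda>x. u x + v x) x = grad \<Omega> u x + grad \<Omega> v x"
proof -
  have w: "is_weak_gradient \<Omega> (\<lambda>x. u x + v x) (\<lambda>x. grad \<Omega> u x + grad \<Omega> v x)"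
    by (rule weak_gradient_add[OF O W10D(3)[OF u] W10D(3)[OF v]])
  show "AE x in M. grad \<Omega> (\<lambda>x. u x + v x) x = grad \<Omega> u x + grad \<Omega> v x" by (rule grad_AE_eq[OF O w])
  obtain \<phi> where \<phi>: "\<And>n. \<phi> n \<in> test_functions \<Omega>" "(\<lambda>n. pmod M p (\<lambda>x. u x - \<phi> n x)) \<longlonglongrightarrow> 0"
       "(\<lambda>n. pmod M p (\<lambda>x. grad \<Omega> u x - cgrad (\<phi> n) x)) \<longlonglongrightarrow> 0" using W10D(4)[OF u] by blast
  obtain \<psi> where \<psi>: "\<And>n. \<psi> n \<in> test_functions \<Omega>" "(\<lambda>n. pmod M p (\<lambda>x. v x - \<psi> n x)) \<longlonglongrightarrow> 0"
       "(\<lambda>n. pmod M p (\<lambda>x. grad \<Omega> v x - cgrad (\<psi> n) x)) \<longlonglongrightarrow> 0" using W10D(4)[OF v] by blast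
  have lim: "(\<lambda>n. pmod M p (\<lambda>x. f n x + g n x)) \<longlonglongrightarrow> 0"
    if "\<And>n. f n \<in> Lp_space M p" "\<And>n. g n \<in> Lp_space M p" "(\<lambda>n. pmod M p (f n)) \<longlonglongrightarrow> 0" "(\<lambda>n. pmod M p (g n)) \<longlonglongrightarrow> 0"
    for f g :: "nat \<Rightarrow> 'a \<Rightarrow> 'b::euclidean_space"
  proof (rule tendsto_sandwich[OF _ _ tendsto_const])
    show "(\<lambda>n. 2 powr p * (pmod M p (f n) + pmod M p (g n))) \<longlonglongrightarrow> 0"
      using tendsto_mult[OF tendsto_const tendsto_add[OF that(3,4)], of "2 powr p"] by simp
  qed (auto intro!: always_eventually Lp_add(2) that p0)
  show "(\<lambda>x. u x + v x) \<in> W10 \<Omega> p"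
  proof (rule W10I[OF Lp_add(1)[OF W10D(1)[OF u] W10D(1)[OF v] p0(2)] Lp_add(1)[OF W10D(2)[OF u] W10D(2)[OF v] p0(2)] w test_add[OF \<phi>(1) \<psi>(1)]])
    show "(\<lambda>n. pmod M p (\<lambda>x. u x + v x - (\<phi> n x + \<psi> n x))) \<longlonglongrightarrow> 0"
      using lim[OF Lp_diff(1)[OF W10D(1)[OF u] test_Lp(1)[OF \<phi>(1) p0(2)] p0(2)] Lp_diff(1)[OF W10D(1)[OF v] test_Lp(1)[OF \<psi>(1) p0(2)] p0(2)] \<phi>(2) \<psi>(2)]
      by (simp add: algebra_simps)
    show "(\<lambda>n. pmod M p (\<lambda>x. grad \<Omega> u x + grad \<Omega> v x - cgrad (\<lambda>x. \<phi> n x + \<psi> n x) x)) \<longlonglongrightarrow> 0"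
      using lim[OF Lp_diff(1)[OF W10D(2)[OF u] test_Lp(2)[OF \<phi>(1) p0(2)] p0(2)] Lp_diff(1)[OF W10D(2)[OF v] test_Lp(2)[OF \<psi>(1) p0(2)] p0(2)] \<phi>(3) \<psi>(3)]
      by (simp add: cgrad_add[OF test_functions_tcd[OF \<phi>(1)] test_functions_tcd[OF \<psi>(1)]] algebra_simps)
  qed
qed

lemma W10_scale:
  assumes u: "u \<in> W10 \<Omega> p"
  shows "(\<lambda>x. c * u x) \<in> W10 \<Omega> p" "AE x in M. grad \<Omega> (\<lambda>x. c * u x) x = c *\<^sub>R grad \<Omega> u x"
proof -
  have w: "is_weak_gradient \<Omega> (\<lambda>x. c * u x) (\<lambda>x. c *\<^sub>R grad \<Omega> u x)"
    by (rule weak_gradient_scale[OF W10D(3)[OF u]])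
  show "AE x in M. grad \<Omega> (\<lambda>x. c * u x) x = c *\<^sub>R grad \<Omega> u x" by (rule grad_AE_eq[OF O w])
  obtain \<phi> where \<phi>: "\<And>n. \<phi> n \<in> test_functions \<Omega>" "(\<lambda>n. pmod M p (\<lambda>x. u x - \<phi> n x)) \<longlonglongrightarrow> 0"
       "(\<lambda>n. pmod M p (\<lambda>x. grad \<Omega> u x - cgrad (\<phi> n) x)) \<longlonglongrightarrow> 0" using W10D(4)[OF u] by blast
  have sc: "pmod M p (\<lambda>x. c *\<^sub>R f x - c *\<^sub>R g x) = \<bar>c\<bar> powr p * pmod M p (\<lambda>x. f x - g x)" for f g :: "'a \<Rightarrow> 'b::euclidean_space"
    by (simp add: pmod_def powr_mult scaleR_diff_right[symmetric])
  show "(\<lambda>x. c * u x) \<in> W10 \<Omega> p"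
  proof (rule W10I[OF _ Lp_scaleR(1)[OF W10D(2)[OF u]] w test_scale[OF \<phi>(1)]])
    show "(\<lambda>x. c * u x) \<in> Lp_space M p" using Lp_scaleR(1)[OF W10D(1)[OF u], of c] by simp
    show "(\<lambda>n. pmod M p (\<lambda>x. c * u x - c * \<phi> n x)) \<longlonglongrightarrow> 0"
      using tendsto_mult[OF tendsto_const \<phi>(2), of "\<bar>c\<bar> powr p"] sc[of u] by simp
    show "(\<lambda>n. pmod M p (\<lambda>x. c *\<^sub>R grad \<Omega> u x - cgrad (\<lambda>x. c * \<phi> n x) x)) \<longlonglongrightarrow> 0"
      using tendsto_mult[OF tendsto_const \<phi>(3), of "\<bar>c\<bar> powr p"]
      by (simp add: cgrad_scale[OF test_functions_tcd[OF \<phi>(1)]] sc)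
  qed
qed

lemma W10_diff:
  assumes u: "u \<in> W10 \<Omega> p" and v: "v \<in> W10 \<Omega> p"
  shows "(\<lambda>x. u x - v x) \<in> W10 \<Omega> p" "AE x in M. grad \<Omega> (\<lambda>x. u x - v x) x = grad \<Omega> u x - grad \<Omega> v x"
proof -
  note v' = W10_scale[OF v, of "-1"]
  show "(\<lambda>x. u x - v x) \<in> W10 \<Omega> p" using W10_add(1)[OF u v'(1)] by simp
  show "AE x in M. grad \<Omega> (\<lambda>x. u x - v x) x = grad \<Omega> u x - grad \<Omega> v x"
    using W10_add(2)[OF u v'(1)] v'(2) by eventually_elim simp
qed

lemma pmod_grad_diff:
  assumes u: "u \<in> W10 \<Omega> p" and v: "v \<in> W10 \<Omega> p"
  shows "pmod M p (grad \<Omega> (\<lambda>x. u x - v x)) = pmod M p (\<lambda>x. grad \<Omega> u x - grad \<Omega> v x)"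
  using Lp_measurable[OF W10D(2)] u v W10_diff[OF u v] by (intro pmod_cong_AE borel_measurable_diff) auto

lemma Cauchy_weaken:
  assumes C: "C > 0" "\<And>m n. a m n \<le> C * b m n" and b: "\<And>e. e > 0 \<Longrightarrow> \<exists>N. \<forall>m\<ge>N. \<forall>n\<ge>N. b m n < e" and e: "(e::real) > 0"
  shows "\<exists>N. \<forall>m\<ge>N. \<forall>n\<ge>(N::nat). a m n < e"
proof -
  obtain N where N: "\<forall>m\<ge>N. \<forall>n\<ge>N. b m n < e / C" using b[of "e / C"] C e by auto
  have "a m n < e" if "m \<ge> N" "n \<ge> N" for m n
  proof -
    have "C * b m n < C * (e / C)" using N that C by (intro mult_strict_left_mono) auto
    then show ?thesis using C(1) C(2)[of m n] by simp
  qed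
  then show ?thesis by blast
qed

text \<open>By Poincare's inequality the functions converge along with their gradients. The limit of the gradients is the
  weak gradient of the limit, since both sides of the defining identity are continuous in \<open>L\<^sup>p\<close>, and a diagonal
  choice of test functions approximates it.\<close>

lemma W10_complete:
  assumes s: "\<And>n. s n \<in> W10 \<Omega> p"
    and c: "\<And>e. e > 0 \<Longrightarrow> \<exists>N. \<forall>m\<ge>N. \<forall>n\<ge>N. pmod M p (\<lambda>x. grad \<Omega> (s m) x - grad \<Omega> (s n) x) < e"
  shows "\<exists>v\<in>W10 \<Omega> p. (\<lambda>n. pmod M p (\<lambda>x. grad \<Omega> (s n) x - grad \<Omega> v x)) \<longlonglongrightarrow> 0"
proof -
  obtain C where C: "C > 0" "\<And>u. u \<in> W10 \<Omega> p \<Longrightarrow> pmod M p u \<le> C * pmod M p (grad \<Omega> u)" using Poincare by blast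
  have "pmod M p (\<lambda>x. s m x - s n x) \<le> C * pmod M p (\<lambda>x. grad \<Omega> (s m) x - grad \<Omega> (s n) x)" for m n
    using C(2)[OF W10_diff(1)[OF s s]] by (simp add: pmod_grad_diff[OF s s])
  note cs = Cauchy_weaken[OF C(1) this c]
  obtain u where u: "u \<in> Lp_space M p" "(\<lambda>n. pmod M p (\<lambda>x. s n x - u x)) \<longlonglongrightarrow> 0"
    using Lp_complete[OF W10D(1)[OF s] p0(1) cs] by blast
  obtain G where G: "G \<in> Lp_space M p" "(\<lambda>n. pmod M p (\<lambda>x. grad \<Omega> (s n) x - G x)) \<longlonglongrightarrow> 0"
    using Lp_complete[OF W10D(2)[OF s] p0(1) c] by blast
  have loc: "locally_integrable \<Omega> f" if f: "f \<in> Lp_space M p" for f :: "'a \<Rightarrow> 'b::euclidean_space"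
    unfolding locally_integrable_def
  proof (intro allI impI)
    fix K assume K: "compact K \<and> K \<subseteq> \<Omega>"
    have "integrable M (\<lambda>x. norm (f x) * norm (1::real))"
      by (rule Hoelder(1)[OF p1 f]) (simp add: Lp_space_def)
    then have "integrable M f" using integrable_norm_iff[OF Lp_measurable[OF f]] by simp
    then have i: "integrable lebesgue (\<lambda>x. indicator \<Omega> x *\<^sub>R f x)" using O by (simp add: integrable_lebesgue_on_iff borel_open)
    have Ks: "K \<in> sets lebesgue" using K by (simp add: borel_compact)
    have "integrable lebesgue (\<lambda>x. indicator K x *\<^sub>R (indicator \<Omega> x *\<^sub>R f x))"
      by (rule integrable_mult_indicator[OF Ks i])
    moreover have "(\<lambda>x. indicator K x *\<^sub>R (indicator \<Omega> x *\<^sub>R f x)) = (\<lambda>x. indicator K x *\<^sub>R f x)"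
      using K by (auto simp: indicator_def fun_eq_iff)
    ultimately show "integrable (lebesgue_on K) f" using Ks by (simp add: integrable_lebesgue_on_iff)
  qed
  have limit: "(\<lambda>n. \<integral>x. f n x * h x \<partial>M) \<longlonglongrightarrow> (\<integral>x. g x * h x \<partial>M)"
    if f: "\<And>n. f n \<in> Lp_space M p" and g: "g \<in> Lp_space M p" and l: "(\<lambda>n. pmod M p (\<lambda>x. f n x - g x)) \<longlonglongrightarrow> 0"
      and h: "h \<in> Lp_space M (conj_exp p)" for f and g h :: "'a \<Rightarrow> real"
  proof -
    have "(\<lambda>n. Lp_norm M (conj_exp p) h * Lp_norm M p (\<lambda>x. f n x - g x)) \<longlonglongrightarrow> Lp_norm M (conj_exp p) h * 0"
      using l by (intro tendsto_intros) (simp add: Lp_norm_tendsto_iff)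
    then have to0: "(\<lambda>n. Lp_norm M (conj_exp p) h * Lp_norm M p (\<lambda>x. f n x - g x)) \<longlonglongrightarrow> 0" by simp
    have "norm (\<integral>x. h x \<bullet> (f n x - g x) \<partial>M) \<le> Lp_norm M (conj_exp p) h * Lp_norm M p (\<lambda>x. f n x - g x)" for n
      unfolding real_norm_def by (rule Hoelder_inner(2)[OF p1 Lp_diff(1)[OF f g p0(2)] h])
    then have "(\<lambda>n. \<integral>x. h x \<bullet> (f n x - g x) \<partial>M) \<longlonglongrightarrow> 0"
      by (intro Lim_null_comparison[OF always_eventually to0] allI)
    moreover have "(\<integral>x. h x \<bullet> (f n x - g x) \<partial>M) = (\<integral>x. f n x * h x \<partial>M) - (\<integral>x. g x * h x \<partial>M)" for n
      using Hoelder_inner(1)[OF p1 f h, of n] Hoelder_inner(1)[OF p1 g h] by (simp add: algebra_simps)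
    ultimately show ?thesis by (simp add: LIM_zero_iff)
  qed
  \<comment> \<open>the defining identity holds for every \<open>s n\<close> and passes to the limit by Hoelder\<close>
  have w: "is_weak_gradient \<Omega> u G"
    unfolding is_weak_gradient_def
  proof (intro conjI ballI loc u G)
    fix \<phi> and i :: 'a assume \<phi>: "\<phi> \<in> test_functions \<Omega>" and i: "i \<in> Basis"
    have q: "conj_exp p \<ge> 0" using conj_exp_props[OF p1] by simp
    have h: "(\<lambda>x. frechet_derivative \<phi> (at x) i) \<in> Lp_space M (conj_exp p)"
    proof -
      obtain B where B: "\<forall>x. norm (cgrad \<phi> x) \<le> B" using test_props(10)[OF \<phi>] by blast
      have "(\<lambda>x. cgrad \<phi> x \<bullet> i) \<in> Lp_space M (conj_exp p)"
        by (rule bounded_Lp(1)[of _ B, OF _ _ q])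
           (use B Basis_le_norm[OF i] test_props(6)[OF \<phi>] in \<open>auto intro: order_trans\<close>)
      then show ?thesis by (simp add: cgrad_inner[OF i])
    qed
    have Gi: "(\<lambda>x. f x \<bullet> i) \<in> Lp_space M p" if "f \<in> Lp_space M p" for f :: "'a \<Rightarrow> 'a"
      using that Lp_measurable[OF that] Basis_le_norm[OF i]
      by (intro Lp_bound(1)[OF _ Lp_integrable[OF that]]) (auto intro!: AE_I2 powr_mono2 p0)
    have l2: "(\<lambda>n. pmod M p (\<lambda>x. grad \<Omega> (s n) x \<bullet> i - G x \<bullet> i)) \<longlonglongrightarrow> 0"
    proof (rule tendsto_sandwich[OF _ _ tendsto_const G(2)])
      show "\<forall>\<^sub>F n in sequentially. pmod M p (\<lambda>x. grad \<Omega> (s n) x \<bullet> i - G x \<bullet> i) \<le> pmod M p (\<lambda>x. grad \<Omega> (s n) x - G x)"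
      proof (intro always_eventually allI)
        fix n
        have D: "(\<lambda>x. grad \<Omega> (s n) x - G x) \<in> Lp_space M p" by (intro Lp_diff(1) W10D(2) s G p0)
        have "norm (grad \<Omega> (s n) x \<bullet> i - G x \<bullet> i) powr p \<le> norm (grad \<Omega> (s n) x - G x) powr p" for x
          using Basis_le_norm[OF i, of "grad \<Omega> (s n) x - G x"] p0 by (intro powr_mono2) (auto simp: inner_diff_left)
        then show "pmod M p (\<lambda>x. grad \<Omega> (s n) x \<bullet> i - G x \<bullet> i) \<le> pmod M p (\<lambda>x. grad \<Omega> (s n) x - G x)"
          unfolding pmod_def using Lp_integrable[OF D] Lp_integrable[OF Gi[OF D]]
          by (intro integral_mono) (auto simp: inner_diff_left)
      qed
    qed simp
    have 1: "(\<lambda>n. \<integral>x. s n x * frechet_derivative \<phi> (at x) i \<partial>M) \<longlonglongrightarrow> (\<integral>x. u x * frechet_derivative \<phi> (at x) i \<partial>M)"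
      by (rule limit[OF W10D(1)[OF s] u h])
    have 2: "(\<lambda>n. \<integral>x. (grad \<Omega> (s n) x \<bullet> i) * \<phi> x \<partial>M) \<longlonglongrightarrow> (\<integral>x. (G x \<bullet> i) * \<phi> x \<partial>M)"
      by (rule limit[OF Gi[OF W10D(2)[OF s]] Gi[OF G(1)] l2 test_Lp(1)[OF \<phi> q]])
    have "(\<integral>x. s n x * frechet_derivative \<phi> (at x) i \<partial>M) = - (\<integral>x. (grad \<Omega> (s n) x \<bullet> i) * \<phi> x \<partial>M)" for n
      using W10D(3)[OF s[of n]] \<phi> i by (simp add: is_weak_gradient_def)
    then have "(\<lambda>n. \<integral>x. s n x * frechet_derivative \<phi> (at x) i \<partial>M) \<longlonglongrightarrow> - (\<integral>x. (G x \<bullet> i) * \<phi> x \<partial>M)"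
      using tendsto_minus[OF 2] by simp
    then show "(\<integral>x. u x * frechet_derivative \<phi> (at x) i \<partial>M) = - (\<integral>x. (G x \<bullet> i) * \<phi> x \<partial>M)"
      using 1 LIMSEQ_unique by blast
  qed
  have "\<exists>\<phi>. \<phi> \<in> test_functions \<Omega> \<and> pmod M p (\<lambda>x. s n x - \<phi> x) < 1 / real (Suc n) \<and> pmod M p (\<lambda>x. grad \<Omega> (s n) x - cgrad \<phi> x) < 1 / real (Suc n)" for n
  proof -
    obtain \<phi> where \<phi>: "\<And>k. \<phi> k \<in> test_functions \<Omega>" "(\<lambda>k. pmod M p (\<lambda>x. s n x - \<phi> k x)) \<longlonglongrightarrow> 0"
       "(\<lambda>k. pmod M p (\<lambda>x. grad \<Omega> (s n) x - cgrad (\<phi> k) x)) \<longlonglongrightarrow> 0" using W10D(4)[OF s[of n]] by blast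
    have "eventually (\<lambda>k. pmod M p (\<lambda>x. s n x - \<phi> k x) < 1 / real (Suc n)) sequentially"
      "eventually (\<lambda>k. pmod M p (\<lambda>x. grad \<Omega> (s n) x - cgrad (\<phi> k) x) < 1 / real (Suc n)) sequentially"
      by (rule order_tendstoD(2)[OF \<phi>(2)] order_tendstoD(2)[OF \<phi>(3)], simp)+
    from eventually_happens[OF eventually_conj[OF this]] show ?thesis using \<phi>(1) by auto
  qed
  then obtain \<phi> where \<phi>: "\<And>n. \<phi> n \<in> test_functions \<Omega>" "\<And>n. pmod M p (\<lambda>x. s n x - \<phi> n x) < 1 / real (Suc n)"
    "\<And>n. pmod M p (\<lambda>x. grad \<Omega> (s n) x - cgrad (\<phi> n) x) < 1 / real (Suc n)" by metis
  have lim: "(\<lambda>n. pmod M p (\<lambda>x. g x - t n x)) \<longlonglongrightarrow> 0"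
    if f: "\<And>n. f n \<in> Lp_space M p" and t: "\<And>n. t n \<in> Lp_space M p" and g: "g \<in> Lp_space M p"
      and l: "(\<lambda>n. pmod M p (\<lambda>x. f n x - g x)) \<longlonglongrightarrow> 0" and b: "\<And>n. pmod M p (\<lambda>x. f n x - t n x) < 1 / real (Suc n)"
    for f t and g :: "'a \<Rightarrow> 'b::euclidean_space"
  proof (rule tendsto_sandwich[OF _ _ tendsto_const])
    have "(\<lambda>n. 2 powr p * (1 / real (Suc n) + pmod M p (\<lambda>x. f n x - g x))) \<longlonglongrightarrow> 2 powr p * (0 + 0)"
      using LIMSEQ_inverse_real_of_nat l by (intro tendsto_intros) (auto simp: divide_inverse)
    then show "(\<lambda>n. 2 powr p * (1 / real (Suc n) + pmod M p (\<lambda>x. f n x - g x))) \<longlonglongrightarrow> 0" by simp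
    show "\<forall>\<^sub>F n in sequentially. pmod M p (\<lambda>x. g x - t n x) \<le> 2 powr p * (1 / real (Suc n) + pmod M p (\<lambda>x. f n x - g x))"
    proof (intro always_eventually allI)
      fix n
      have "pmod M p (\<lambda>x. (f n x - t n x) - (f n x - g x)) \<le> 2 powr p * (pmod M p (\<lambda>x. f n x - t n x) + pmod M p (\<lambda>x. f n x - g x))"
        by (intro Lp_diff f t g p0)
      also have "\<dots> \<le> 2 powr p * (1 / real (Suc n) + pmod M p (\<lambda>x. f n x - g x))"
        using b[of n] by (intro mult_left_mono) auto
      finally show "pmod M p (\<lambda>x. g x - t n x) \<le> 2 powr p * (1 / real (Suc n) + pmod M p (\<lambda>x. f n x - g x))" by simp
    qed
  qed simp
  have uW: "u \<in> W10 \<Omega> p"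
    by (rule W10I[OF u(1) G(1) w \<phi>(1)
        lim[OF W10D(1)[OF s] test_Lp(1)[OF \<phi>(1) p0(2)] u(1) u(2) \<phi>(2)]
        lim[OF W10D(2)[OF s] test_Lp(2)[OF \<phi>(1) p0(2)] G(1) G(2) \<phi>(3)]])
  have "pmod M p (\<lambda>x. grad \<Omega> (s n) x - grad \<Omega> u x) = pmod M p (\<lambda>x. grad \<Omega> (s n) x - G x)" for n
  proof (rule pmod_cong_AE)
    show "AE x in M. grad \<Omega> (s n) x - grad \<Omega> u x = grad \<Omega> (s n) x - G x"
      using grad_AE_eq[OF O w] by eventually_elim simp
  qed (intro borel_measurable_diff Lp_measurable[OF W10D(2)] Lp_measurable[OF G(1)] s uW)+
  then show ?thesis using G(2) by (intro bexI[OF _ uW]) simp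
qed

sublocale W: Lp_model M p "W10 \<Omega> p" "grad \<Omega>"
proof
  show "0 \<in> W10 \<Omega> p" using test_W10[OF test_zero] by (simp add: zero_fun_def)
qed (use W10_add W10_scale W10D p1 W10_complete in \<open>auto simp: plus_fun_def scaleR_fun_def\<close>)

lemma nrm_eq: "W.nrm = W10_norm \<Omega> p"
  by (auto simp: W.nrm_def W10_norm_def)

text \<open>Poincare's constant bounds the Rayleigh quotients from below. A bump shows that the infimum ranges over a nonempty
  set; it would carry no information otherwise.\<close>

lemma eigenvalue:
  "first_eigenvalue \<Omega> p > 0" "u \<in> W10 \<Omega> p \<Longrightarrow> first_eigenvalue \<Omega> p * pmod M p u \<le> pmod M p (grad \<Omega> u)"
proof -
  obtain C where C: "C > 0" "\<And>u. u \<in> W10 \<Omega> p \<Longrightarrow> pmod M p u \<le> C * pmod M p (grad \<Omega> u)" using Poincare by blast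
  define Q where "Q = {W10_norm \<Omega> p u powr p / Lp_norm M p u powr p | u. u \<in> W10 \<Omega> p \<and> \<not> (AE x in M. u x = 0)}"
  have ev: "first_eigenvalue \<Omega> p = Inf Q" by (simp add: first_eigenvalue_def Q_def)
  have Q: "W10_norm \<Omega> p u powr p / Lp_norm M p u powr p = pmod M p (grad \<Omega> u) / pmod M p u" for u
    using p0 by (simp add: W10_norm_def Lp_norm_powr)
  have pos: "pmod M p u > 0" if "u \<in> W10 \<Omega> p" "\<not> (AE x in M. u x = 0)" for u
    using pmod_eq_0[OF W10D(1)[OF that(1)]] that(2) by (auto simp: less_le)
  have Qge: "1 / C \<le> y" if y: "y \<in> Q" for y
  proof -
    obtain u where u: "u \<in> W10 \<Omega> p" "\<not> (AE x in M. u x = 0)" "y = pmod M p (grad \<Omega> u) / pmod M p u"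
      using y unfolding Q_def mem_Collect_eq Q by blast
    show ?thesis using C(2)[OF u(1)] C(1) pos[OF u(1,2)] by (simp add: u(3) field_simps)
  qed
  have "Q \<noteq> {}"
  proof -
    obtain x0 where "x0 \<in> \<Omega>" using ne by blast
    then obtain a b where ab: "x0 \<in> box a b" "cbox a b \<subseteq> \<Omega>" using open_contains_cbox[of \<Omega>] O by (metis)
    have "\<not> (AE x in M. bump 0 a b x = 0)"
    proof
      assume "AE x in M. bump 0 a b x = 0"
      then have "AE x in lebesgue. x \<notin> box a b"
        unfolding AE_lebesgue_on_iff[OF O] by eventually_elim (use bump_support box_subset_cbox ab in blast)
      then have "AE x in lborel. x \<notin> box a b" by (simp add: AE_completion_iff)
      then have "emeasure lborel (box a b) = 0" by (subst (asm) AE_iff_measurable[of "box a b"]) auto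
      moreover have "emeasure lborel (box a b) = ennreal (\<Prod>i\<in>Basis. (b - a) \<bullet> i)"
        using ab(1) by (auto simp: emeasure_lborel_box_eq mem_box intro: less_imp_le less_trans)
      moreover have "(\<Prod>i\<in>Basis. (b - a) \<bullet> i) > 0"
        using ab(1) by (intro prod_pos) (auto simp: mem_box inner_diff_left intro: less_trans)
      ultimately show False by (metis ennreal_eq_0_iff not_le)
    qed
    then show ?thesis using test_W10[OF bump_test[OF ab(2), of 0]] by (auto simp: Q_def)
  qed
  then have "1 / C \<le> Inf Q" by (intro cInf_greatest) (auto intro: Qge)
  moreover have "1 / C > 0" using C(1) by simp
  ultimately show "first_eigenvalue \<Omega> p > 0" unfolding ev by linarith
  assume u: "u \<in> W10 \<Omega> p"
  show "first_eigenvalue \<Omega> p * pmod M p u \<le> pmod M p (grad \<Omega> u)"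
  proof (cases "AE x in M. u x = 0")
    case True
    then have "pmod M p u = pmod M p (\<lambda>x. 0 :: real)"
      using Lp_measurable[OF W10D(1)[OF u]] by (intro pmod_cong_AE) auto
    then have "pmod M p u = 0" by (simp add: pmod_def)
    then show ?thesis by simp
  next
    case False
    have "bdd_below Q" using Qge by (rule bdd_belowI)
    moreover have "pmod M p (grad \<Omega> u) / pmod M p u \<in> Q" using u False Q[of u] unfolding Q_def by force
    ultimately have "first_eigenvalue \<Omega> p \<le> pmod M p (grad \<Omega> u) / pmod M p u" unfolding ev by (intro cInf_lower)
    then show ?thesis using pos[OF u False] by (simp add: le_divide_eq)
  qed
qed

end

section \<open>Superposition operators\<close>

text \<open>Replace the inner functions by simple functions converging to them pointwise. The compositions are then measurable
  as countable case distinctions, and they converge almost everywhere by continuity in the last variables.\<close>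

lemma caratheodory_measurable:
  fixes f :: "'a::euclidean_space \<Rightarrow> real \<Rightarrow> real \<Rightarrow> 'a \<Rightarrow> 'a \<Rightarrow> real"
  assumes O: "open \<Omega>" and f: "caratheodory \<Omega> f"
    and m: "u \<in> borel_measurable (lebesgue_on \<Omega>)" "v \<in> borel_measurable (lebesgue_on \<Omega>)"
      "g \<in> borel_measurable (lebesgue_on \<Omega>)" "h \<in> borel_measurable (lebesgue_on \<Omega>)"
  shows "(\<lambda>x. f x (u x) (v x) (g x) (h x)) \<in> borel_measurable (lebesgue_on \<Omega>)"
proof -
  define M where "M = lebesgue_on \<Omega>"
  define w where "w = (\<lambda>x. (u x, v x, g x, h x))"
  define k where "k = (\<lambda>(s, t, \<xi>, \<nu>) x. f x s t \<xi> \<nu>)"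
  have w: "w \<in> borel_measurable M" unfolding w_def M_def using m
    by (intro borel_measurable_Pair) auto
  obtain F where F: "\<And>i. simple_function M (F i)" "\<And>x. x \<in> space M \<Longrightarrow> (\<lambda>i. F i x) \<longlonglongrightarrow> w x"
    using borel_measurable_implies_sequence_metric[OF w] by blast
  have kF [measurable]: "(\<lambda>x. k (F i x) x) \<in> borel_measurable M" for i
  proof (rule measurable_compose_countable'[where I="F i ` space M"])
    show "(\<lambda>x. k z x) \<in> borel_measurable M" for z
      using f by (cases z) (auto simp: k_def M_def caratheodory_def)
    show "F i \<in> measurable M (count_space (F i ` space M))"
      using F(1)[of i] by (subst measurable_count_space_eq2) (auto simp: simple_function_def)
    show "countable (F i ` space M)" using F(1)[of i] by (auto simp: simple_function_def countable_finite)
  qed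
  have lm: "(\<lambda>x. lim (\<lambda>i. k (F i x) x)) \<in> borel_measurable M" by measurable
  have "AE x in M. continuous_on UNIV (\<lambda>(s, t, \<xi>, \<nu>). f x s t \<xi> \<nu>)" using f unfolding caratheodory_def M_def by (rule conjunct2)
  then have "AE x in M. lim (\<lambda>i. k (F i x) x) = f x (u x) (v x) (g x) (h x)"
  proof (rule AE_mp, intro AE_I2 impI)
    fix x assume x: "x \<in> space M" and c: "continuous_on UNIV (\<lambda>(s, t, \<xi>, \<nu>). f x s t \<xi> \<nu>)"
    have "continuous_on UNIV (\<lambda>z. k z x)" using c by (simp add: k_def case_prod_unfold)
    then have "isCont (\<lambda>z. k z x) (w x)" using continuous_on_eq_continuous_at[OF open_UNIV, of "\<lambda>z. k z x"] by blast
    then have "(\<lambda>i. k (F i x) x) \<longlonglongrightarrow> k (w x) x" using F(2)[OF x] by (rule isCont_tendsto_compose)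
    then show "lim (\<lambda>i. k (F i x) x) = f x (u x) (v x) (g x) (h x)" by (simp add: limI k_def w_def)
  qed
  then show ?thesis using borel_measurable_AE_lebesgue_on[OF O lm[unfolded M_def]] unfolding M_def by simp
qed

lemma powr_sum5:
  fixes a b c d e s :: real
  assumes "a \<ge> 0" "b \<ge> 0" "c \<ge> 0" "d \<ge> 0" "e \<ge> 0" "s \<ge> 0"
  shows "(a + b + c + d + e) powr s \<le> 5 powr s * (a powr s + b powr s + c powr s + d powr s + e powr s)"
proof -
  define m where "m = max a (max b (max c (max d e)))"
  have "(a + b + c + d + e) powr s \<le> (5 * m) powr s"
    using assms by (intro powr_mono2) (auto simp: m_def)
  also have "\<dots> = 5 powr s * m powr s" using assms by (simp add: powr_mult m_def)
  also have "m \<in> {a, b, c, d, e}" unfolding m_def max_def by auto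
  then have "m powr s \<le> a powr s + b powr s + c powr s + d powr s + e powr s" by auto
  finally show ?thesis by simp
qed

text \<open>A growth bound whose exponents are \<open>1/q\<close> times those at which the arguments are integrable
  yields a superposition operator into the space with exponent \<open>q\<close>.\<close>

lemma superposition_Lp:
  fixes f :: "'a::euclidean_space \<Rightarrow> real \<Rightarrow> real \<Rightarrow> 'a \<Rightarrow> 'a \<Rightarrow> real"
  assumes O: "open \<Omega>" and f: "caratheodory \<Omega> f" and q: "q > 1" and C: "C > 0"
    and \<sigma>: "\<sigma> \<in> Lp_space (lebesgue_on \<Omega>) q"
    and growth: "AE x in lebesgue_on \<Omega>. \<forall>s t \<xi> \<nu>. \<bar>f x s t \<xi> \<nu>\<bar> \<le>
        C * (\<bar>s\<bar> powr (e1 / q) + \<bar>t\<bar> powr (e2 / q) + norm \<xi> powr (e3 / q) + norm \<nu> powr (e4 / q)) + \<sigma> x"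
    and L: "u \<in> Lp_space (lebesgue_on \<Omega>) e1" "v \<in> Lp_space (lebesgue_on \<Omega>) e2"
      "g \<in> Lp_space (lebesgue_on \<Omega>) e3" "h \<in> Lp_space (lebesgue_on \<Omega>) e4"
  defines "M \<equiv> lebesgue_on \<Omega>" and "N \<equiv> (\<lambda>x. f x (u x) (v x) (g x) (h x))"
  shows "N \<in> Lp_space M q"
    and "pmod M q N \<le> 5 powr q * (C powr q * (pmod M e1 u + pmod M e2 v + pmod M e3 g + pmod M e4 h) + pmod M q \<sigma>)"
proof -
  define H where "H = (\<lambda>x. 5 powr q * (C powr q * (norm (u x) powr e1 + norm (v x) powr e2 + norm (g x) powr e3 + norm (h x) powr e4) + norm (\<sigma> x) powr q))"
  note I = L[THEN Lp_integrable, folded M_def] Lp_integrable[OF \<sigma>, folded M_def]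
  have N: "N \<in> borel_measurable M" unfolding N_def M_def
    by (rule caratheodory_measurable[OF O f L[THEN Lp_measurable]])
  have Hi: "integrable M H" unfolding H_def using I by simp
  have ae: "AE x in M. norm (N x) powr q \<le> H x"
    using growth unfolding M_def[symmetric]
  proof eventually_elim
    fix x assume *: "\<forall>s t \<xi> \<nu>. \<bar>f x s t \<xi> \<nu>\<bar> \<le>
        C * (\<bar>s\<bar> powr (e1 / q) + \<bar>t\<bar> powr (e2 / q) + norm \<xi> powr (e3 / q) + norm \<nu> powr (e4 / q)) + \<sigma> x"
    have "norm (N x) \<le> C * \<bar>u x\<bar> powr (e1 / q) + C * \<bar>v x\<bar> powr (e2 / q) + C * norm (g x) powr (e3 / q) + C * norm (h x) powr (e4 / q) + \<bar>\<sigma> x\<bar>"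
      using *[rule_format, of "u x" "v x" "g x" "h x"] by (simp add: N_def distrib_left)
    then have "norm (N x) powr q \<le> (C * \<bar>u x\<bar> powr (e1 / q) + C * \<bar>v x\<bar> powr (e2 / q) + C * norm (g x) powr (e3 / q) + C * norm (h x) powr (e4 / q) + \<bar>\<sigma> x\<bar>) powr q"
      using q by (intro powr_mono2) auto
    also have "\<dots> \<le> 5 powr q * ((C * \<bar>u x\<bar> powr (e1 / q)) powr q + (C * \<bar>v x\<bar> powr (e2 / q)) powr q
        + (C * norm (g x) powr (e3 / q)) powr q + (C * norm (h x) powr (e4 / q)) powr q + \<bar>\<sigma> x\<bar> powr q)"
      using C q by (intro powr_sum5) auto
    also have "\<dots> = H x" using C q by (simp add: H_def powr_mult powr_powr algebra_simps)
    finally show "norm (N x) powr q \<le> H x" .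
  qed
  show "N \<in> Lp_space M q" by (rule Lp_bound(1)[OF N Hi ae])
  have "pmod M q N \<le> (\<integral>x. H x \<partial>M)" by (rule Lp_bound(2)[OF N Hi ae])
  also have "\<dots> = 5 powr q * (C powr q * (pmod M e1 u + pmod M e2 v + pmod M e3 g + pmod M e4 h) + pmod M q \<sigma>)"
    unfolding H_def pmod_def using I by simp
  finally show "pmod M q N \<le> 5 powr q * (C powr q * (pmod M e1 u + pmod M e2 v + pmod M e3 g + pmod M e4 h) + pmod M q \<sigma>)" .
qed

section \<open>Functionals on the product space\<close>

context sobolev_space
begin

text \<open>The test function enters with exponent \<open>r\<close> in the second integral, where Sobolev's inequality bounds it by the
  norm of its gradient. The constant is the same for all \<open>h\<close> and \<open>k\<close>.\<close>

lemma divergence_functional: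
  "\<exists>S>0. \<forall>h\<in>Lp_space M (conj_exp p). \<forall>k\<in>Lp_space M (conj_exp r).
     (\<lambda>\<phi>. (\<integral>x. h x \<bullet> grad \<Omega> \<phi> x \<partial>M) - (\<integral>x. k x * \<phi> x \<partial>M)) \<in> dual_space (W10 \<Omega> p) (W10_norm \<Omega> p) \<and>
     (\<forall>\<phi>\<in>W10 \<Omega> p. \<bar>(\<integral>x. h x \<bullet> grad \<Omega> \<phi> x \<partial>M) - (\<integral>x. k x * \<phi> x \<partial>M)\<bar> \<le>
        (Lp_norm M (conj_exp p) h + S * Lp_norm M (conj_exp r) k) * W10_norm \<Omega> p \<phi>)"
proof -
  obtain S where S: "S > 0" "\<And>u. u \<in> W10 \<Omega> p \<Longrightarrow> u \<in> Lp_space M r"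
    "\<And>u. u \<in> W10 \<Omega> p \<Longrightarrow> pmod M r u \<le> S * pmod M p (grad \<Omega> u) powr (r / p)" using Sobolev by blast
  define S' where "S' = S powr (1 / r)"
  have S'b: "Lp_norm M r u \<le> S' * W10_norm \<Omega> p u" if u: "u \<in> W10 \<Omega> p" for u
  proof -
    have "pmod M r u powr (1 / r) \<le> (S * pmod M p (grad \<Omega> u) powr (r / p)) powr (1 / r)"
      using r0 by (intro powr_mono2 S(3)[OF u]) auto
    also have "\<dots> = S' * pmod M p (grad \<Omega> u) powr (1 / p)"
      using S(1) r0 by (simp add: S'_def powr_mult powr_powr)
    finally show ?thesis by (simp add: Lp_norm_pmod W10_norm_def)
  qed
  have "(\<lambda>\<phi>. (\<integral>x. h x \<bullet> grad \<Omega> \<phi> x \<partial>M) - (\<integral>x. k x * \<phi> x \<partial>M)) \<in> dual_space (W10 \<Omega> p) (W10_norm \<Omega> p) \<and>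
     (\<forall>\<phi>\<in>W10 \<Omega> p. \<bar>(\<integral>x. h x \<bullet> grad \<Omega> \<phi> x \<partial>M) - (\<integral>x. k x * \<phi> x \<partial>M)\<bar> \<le>
        (Lp_norm M (conj_exp p) h + S' * Lp_norm M (conj_exp r) k) * W10_norm \<Omega> p \<phi>)"
    if h: "h \<in> Lp_space M (conj_exp p)" and k: "k \<in> Lp_space M (conj_exp r)" for h and k :: "'a \<Rightarrow> real"
  proof -
    note hd = W.pairing_dual[OF h]
    have hp: "W.pairing h u = (\<integral>x. h x \<bullet> grad \<Omega> u x \<partial>M)" if "u \<in> W10 \<Omega> p" for u using that by (simp add: W.pairing_def)
    have ki: "integrable M (\<lambda>x. k x * u x)" "\<bar>\<integral>x. k x * u x \<partial>M\<bar> \<le> Lp_norm M (conj_exp r) k * Lp_norm M r u" if "u \<in> W10 \<Omega> p" for u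
      using Hoelder_inner[OF r0(1) S(2)[OF that] k] by simp_all
    have bnd: "\<bar>(\<integral>x. h x \<bullet> grad \<Omega> u x \<partial>M) - (\<integral>x. k x * u x \<partial>M)\<bar> \<le>
        (Lp_norm M (conj_exp p) h + S' * Lp_norm M (conj_exp r) k) * W10_norm \<Omega> p u" if u: "u \<in> W10 \<Omega> p" for u
    proof -
      have "\<bar>\<integral>x. h x \<bullet> grad \<Omega> u x \<partial>M\<bar> \<le> Lp_norm M (conj_exp p) h * W10_norm \<Omega> p u"
        using W.pairing_bound[OF h u] by (simp add: hp[OF u] nrm_eq)
      moreover have "\<bar>\<integral>x. k x * u x \<partial>M\<bar> \<le> Lp_norm M (conj_exp r) k * (S' * W10_norm \<Omega> p u)"
        by (rule order_trans[OF ki(2)[OF u] mult_left_mono[OF S'b[OF u]]]) simp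
      ultimately show ?thesis by (simp add: algebra_simps)
    qed
    have "(\<lambda>\<phi>. (\<integral>x. h x \<bullet> grad \<Omega> \<phi> x \<partial>M) - (\<integral>x. k x * \<phi> x \<partial>M)) \<in> dual_space (W10 \<Omega> p) (W10_norm \<Omega> p)"
    proof (rule dual_spaceI[OF _ _ bnd])
      fix u v assume u: "u \<in> W10 \<Omega> p" and v: "v \<in> W10 \<Omega> p"
      then show "(\<integral>x. h x \<bullet> grad \<Omega> (u + v) x \<partial>M) - (\<integral>x. k x * (u + v) x \<partial>M)
        = (\<integral>x. h x \<bullet> grad \<Omega> u x \<partial>M) - (\<integral>x. k x * u x \<partial>M) + ((\<integral>x. h x \<bullet> grad \<Omega> v x \<partial>M) - (\<integral>x. k x * v x \<partial>M))"
        using dual_spaceD(1)[OF hd u v] ki(1)[OF u] ki(1)[OF v] by (simp add: hp W.Uadd distrib_left)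
    next
      fix c u assume u: "u \<in> W10 \<Omega> p"
      then show "(\<integral>x. h x \<bullet> grad \<Omega> (c *\<^sub>R u) x \<partial>M) - (\<integral>x. k x * (c *\<^sub>R u) x \<partial>M)
        = c * ((\<integral>x. h x \<bullet> grad \<Omega> u x \<partial>M) - (\<integral>x. k x * u x \<partial>M))"
        unfolding hp[OF W.Uscale[OF u], symmetric] hp[OF u, symmetric] dual_spaceD(2)[OF hd u]
        by (simp add: scaleR_fun_def right_diff_distrib mult.left_commute)
    qed
    then show ?thesis using bnd by blast
  qed
  then show ?thesis using S(1) by (intro exI[of _ S']) (auto simp: S'_def)
qed

end

locale product_space = bounded_open \<Omega> for \<Omega> :: "'a::euclidean_space set" +
  fixes p1 p2 r1 r2 :: real
  assumes p: "1 < p1" "p1 < DIM('a)" "1 < p2" "p2 < DIM('a)"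
    and r: "r1 = sobolev_exp DIM('a) p1" "r2 = sobolev_exp DIM('a) p2"
begin

sublocale X1: sobolev_space \<Omega> p1 r1 by unfold_locales (use p r in auto)
sublocale X2: sobolev_space \<Omega> p2 r2 by unfold_locales (use p r in auto)

abbreviation "X \<equiv> X_space \<Omega> p1 p2"
abbreviation "nX \<equiv> X_norm \<Omega> p1 p2"
abbreviation "W1d \<equiv> dual_space (W10 \<Omega> p1) (W10_norm \<Omega> p1)"
abbreviation "W2d \<equiv> dual_space (W10 \<Omega> p2) (W10_norm \<Omega> p2)"

lemma Xmem: "(u, v) \<in> X \<longleftrightarrow> u \<in> W10 \<Omega> p1 \<and> v \<in> W10 \<Omega> p2"
  by (simp add: X_space_def)

lemma nX_eq: "nX (u, v) = W10_norm \<Omega> p1 u + W10_norm \<Omega> p2 v"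
  by (simp add: X_norm_def)

lemma norm_nn: "W10_norm \<Omega> p1 u \<ge> 0" "W10_norm \<Omega> p2 u \<ge> 0"
  by (simp_all add: W10_norm_def)

lemma norm0: "W10_norm \<Omega> p1 0 = 0" "W10_norm \<Omega> p2 0 = 0"
  using X1.W.nrm_0 X2.W.nrm_0 by (simp_all add: X1.nrm_eq X2.nrm_eq)

lemma dual_join:
  assumes F: "F \<in> W1d" and G: "G \<in> W2d"
  shows "(\<lambda>(u,v). F u + G v) \<in> dual_space X nX"
proof -
  obtain C where C: "C \<ge> 0" "\<forall>u\<in>W10 \<Omega> p1. W10_norm \<Omega> p1 u \<ge> 0 \<longrightarrow> \<bar>F u\<bar> \<le> C * W10_norm \<Omega> p1 u" using dual_spaceD(3)[OF F] by blast
  obtain C' where C': "C' \<ge> 0" "\<forall>u\<in>W10 \<Omega> p2. W10_norm \<Omega> p2 u \<ge> 0 \<longrightarrow> \<bar>G u\<bar> \<le> C' * W10_norm \<Omega> p2 u" using dual_spaceD(3)[OF G] by blast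
  show ?thesis
  proof (rule dual_spaceI[where C="C + C'"])
    fix x y assume "x \<in> X" "y \<in> X"
    then show "(case x + y of (u, v) \<Rightarrow> F u + G v) = (case x of (u, v) \<Rightarrow> F u + G v) + (case y of (u, v) \<Rightarrow> F u + G v)"
      using dual_spaceD(1)[OF F] dual_spaceD(1)[OF G] by (cases x; cases y) (simp add: Xmem)
  next
    fix c x assume "x \<in> X"
    then show "(case c *\<^sub>R x of (u, v) \<Rightarrow> F u + G v) = c * (case x of (u, v) \<Rightarrow> F u + G v)"
      using dual_spaceD(2)[OF F] dual_spaceD(2)[OF G] by (cases x) (simp add: Xmem distrib_left)
  next
    fix x assume x: "x \<in> X"
    obtain u v where uv: "x = (u,v)" "u \<in> W10 \<Omega> p1" "v \<in> W10 \<Omega> p2" using x by (cases x) (simp add: Xmem)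
    have "\<bar>F u\<bar> \<le> C * W10_norm \<Omega> p1 u" "\<bar>G v\<bar> \<le> C' * W10_norm \<Omega> p2 v" using C C' uv norm_nn by auto
    moreover have "0 \<le> C * W10_norm \<Omega> p2 v" "0 \<le> C' * W10_norm \<Omega> p1 u" using C C' norm_nn by auto
    ultimately have "\<bar>F u + G v\<bar> \<le> (C + C') * (W10_norm \<Omega> p1 u + W10_norm \<Omega> p2 v)"
      by (simp add: algebra_simps)
    then show "\<bar>case x of (u, v) \<Rightarrow> F u + G v\<bar> \<le> (C + C') * nX x" by (simp add: uv nX_eq)
  qed
qed

lemma zero_dual: "(\<lambda>_. 0) \<in> dual_space V n"
  by (rule dual_spaceI[where C=0]) auto

lemma dual_split:
  assumes F: "F \<in> dual_space X nX"
  shows "(\<lambda>u. F (u, 0)) \<in> W1d" "(\<lambda>v. F (0, v)) \<in> W2d"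
    "u \<in> W10 \<Omega> p1 \<Longrightarrow> v \<in> W10 \<Omega> p2 \<Longrightarrow> F (u, v) = F (u, 0) + F (0, v)"
proof -
  have z: "(0::'a \<Rightarrow> real) \<in> W10 \<Omega> p1" "(0::'a \<Rightarrow> real) \<in> W10 \<Omega> p2" by (rule X1.W.U0 X2.W.U0)+
  obtain C where C: "\<forall>x\<in>X. \<bar>F x\<bar> \<le> C * nX x" using F unfolding dual_space_def by blast
  show "(\<lambda>u. F (u, 0)) \<in> W1d"
  proof (rule dual_spaceI[where C=C])
    show "F (x + y, 0) = F (x, 0) + F (y, 0)" if "x \<in> W10 \<Omega> p1" "y \<in> W10 \<Omega> p1" for x y
      using dual_spaceD(1)[OF F, of "(x,0)" "(y,0)"] that z by (simp add: Xmem)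
    show "F (c *\<^sub>R x, 0) = c * F (x, 0)" if "x \<in> W10 \<Omega> p1" for x c
      using dual_spaceD(2)[OF F, of "(x,0)" c] that z by (simp add: Xmem)
    show "\<bar>F (x, 0)\<bar> \<le> C * W10_norm \<Omega> p1 x" if "x \<in> W10 \<Omega> p1" for x
      using C[rule_format, of "(x,0)"] that z by (simp add: Xmem nX_eq norm0)
  qed
  show "(\<lambda>v. F (0, v)) \<in> W2d"
  proof (rule dual_spaceI[where C=C])
    show "F (0, x + y) = F (0, x) + F (0, y)" if "x \<in> W10 \<Omega> p2" "y \<in> W10 \<Omega> p2" for x y
      using dual_spaceD(1)[OF F, of "(0,x)" "(0,y)"] that z by (simp add: Xmem)
    show "F (0, c *\<^sub>R x) = c * F (0, x)" if "x \<in> W10 \<Omega> p2" for x c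
      using dual_spaceD(2)[OF F, of "(0,x)" c] that z by (simp add: Xmem)
    show "\<bar>F (0, x)\<bar> \<le> C * W10_norm \<Omega> p2 x" if "x \<in> W10 \<Omega> p2" for x
      using C[rule_format, of "(0,x)"] that z by (simp add: Xmem nX_eq norm0)
  qed
  assume "u \<in> W10 \<Omega> p1" "v \<in> W10 \<Omega> p2"
  then show "F (u, v) = F (u, 0) + F (0, v)"
    using dual_spaceD(1)[OF F, of "(u,0)" "(0,v)"] z by (simp add: Xmem)
qed

lemma dual_norm_X_le:
  assumes "\<And>x. x \<in> X \<Longrightarrow> nX x \<le> 1 \<Longrightarrow> \<bar>F x\<bar> \<le> B"
  shows "dual_norm X nX F \<le> B" "0 \<le> dual_norm X nX F"
proof -
  have z: "(0,0) \<in> X" "nX (0,0) \<le> 1" using X1.W.U0 X2.W.U0 by (auto simp: Xmem nX_eq norm0)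
  show "dual_norm X nX F \<le> B" unfolding dual_norm_def
    by (rule cSup_least) (use assms z in blast)+
  have "\<bar>F (0,0)\<bar> \<le> dual_norm X nX F" unfolding dual_norm_def
    by (rule cSup_upper) (use assms z in \<open>auto intro!: bdd_aboveI[of _ B]\<close>)
  then show "0 \<le> dual_norm X nX F" by linarith
qed

text \<open>The sum of the norms of the factors is not uniformly convex, so reflexivity is inherited factor by factor: a functional
  on the dual of the product is the sum of its restrictions to the duals of the factors.\<close>

lemma reflexive_X:
  assumes L: "L \<in> dual_space (dual_space X nX) (dual_norm X nX)"
  shows "\<exists>u v. (u, v) \<in> X \<and> (\<forall>F\<in>dual_space X nX. L F = F (u, v))"
proof -
  obtain C where C: "C \<ge> 0" "\<forall>F\<in>dual_space X nX. dual_norm X nX F \<ge> 0 \<longrightarrow> \<bar>L F\<bar> \<le> C * dual_norm X nX F"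
    using dual_spaceD(3)[OF L] by blast
  \<comment> \<open>the duals of the factors sit in the dual of the product\<close>
  define J1 where "J1 = (\<lambda>F :: ('a \<Rightarrow> real) \<Rightarrow> real. (\<lambda>(u::'a \<Rightarrow> real, v::'a \<Rightarrow> real). F u))"
  define J2 where "J2 = (\<lambda>F :: ('a \<Rightarrow> real) \<Rightarrow> real. (\<lambda>(u::'a \<Rightarrow> real, v::'a \<Rightarrow> real). F v))"
  have J1: "J1 F \<in> dual_space X nX" if "F \<in> W1d" for F
    using dual_join[OF that zero_dual] by (simp add: J1_def)
  have J2: "J2 F \<in> dual_space X nX" if "F \<in> W2d" for F
    using dual_join[OF zero_dual that] by (simp add: J2_def)
  have lin: "J1 (F + G) = J1 F + J1 G" "J1 (c *\<^sub>R F) = c *\<^sub>R J1 F" "J2 (F + G) = J2 F + J2 G" "J2 (c *\<^sub>R F) = c *\<^sub>R J2 F" for F G c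
    by (auto simp: J1_def J2_def fun_eq_iff scaleR_fun_def)
  have le1: "a \<le> b \<Longrightarrow> b \<le> 1 \<Longrightarrow> 0 \<le> d \<Longrightarrow> y \<le> d * a \<Longrightarrow> y \<le> d" for a b d y :: real
    using mult_left_mono[of a 1 d] by linarith
  have b1: "dual_norm X nX (J1 F) \<le> dual_norm (W10 \<Omega> p1) (W10_norm \<Omega> p1) F" "0 \<le> dual_norm X nX (J1 F)" if F: "F \<in> W1d" for F
  proof -
    have d0: "0 \<le> dual_norm (W10 \<Omega> p1) (W10_norm \<Omega> p1) F"
      unfolding dual_norm_def
      by (rule cSup_upper2[OF _ _ X1.W.dual_norm_bdd[unfolded X1.nrm_eq, OF F]]) (use X1.W.U0 norm0 in \<open>auto intro!: exI[of _ 0]\<close>)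
    have "\<bar>J1 F x\<bar> \<le> dual_norm (W10 \<Omega> p1) (W10_norm \<Omega> p1) F" if x: "x \<in> X" "nX x \<le> 1" for x
    proof -
      obtain u v where uv: "x = (u,v)" "u \<in> W10 \<Omega> p1" using x by (cases x) (simp add: Xmem)
      show ?thesis
        using le1[OF _ _ d0 X1.W.dual_norm_bound[unfolded X1.nrm_eq, OF F uv(2)], of 1] x(2) norm_nn(2)[of v] by (simp add: uv nX_eq J1_def)
    qed
    from dual_norm_X_le[OF this] show "dual_norm X nX (J1 F) \<le> dual_norm (W10 \<Omega> p1) (W10_norm \<Omega> p1) F" "0 \<le> dual_norm X nX (J1 F)" by auto
  qed
  have b2: "dual_norm X nX (J2 F) \<le> dual_norm (W10 \<Omega> p2) (W10_norm \<Omega> p2) F" "0 \<le> dual_norm X nX (J2 F)" if F: "F \<in> W2d" for F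
  proof -
    have d0: "0 \<le> dual_norm (W10 \<Omega> p2) (W10_norm \<Omega> p2) F"
      unfolding dual_norm_def
      by (rule cSup_upper2[OF _ _ X2.W.dual_norm_bdd[unfolded X2.nrm_eq, OF F]]) (use X2.W.U0 norm0 in \<open>auto intro!: exI[of _ 0]\<close>)
    have "\<bar>J2 F x\<bar> \<le> dual_norm (W10 \<Omega> p2) (W10_norm \<Omega> p2) F" if x: "x \<in> X" "nX x \<le> 1" for x
    proof -
      obtain u v where uv: "x = (u,v)" "v \<in> W10 \<Omega> p2" using x by (cases x) (simp add: Xmem)
      show ?thesis
        using le1[OF _ _ d0 X2.W.dual_norm_bound[unfolded X2.nrm_eq, OF F uv(2)], of 1] x(2) norm_nn(1)[of u] by (simp add: uv nX_eq J2_def)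
    qed
    from dual_norm_X_le[OF this] show "dual_norm X nX (J2 F) \<le> dual_norm (W10 \<Omega> p2) (W10_norm \<Omega> p2) F" "0 \<le> dual_norm X nX (J2 F)" by auto
  qed
  have "(\<lambda>F. L (J1 F)) \<in> dual_space W1d (dual_norm (W10 \<Omega> p1) (W10_norm \<Omega> p1))"
  proof (rule dual_spaceI)
    fix F assume F: "F \<in> W1d"
    show "\<bar>L (J1 F)\<bar> \<le> C * dual_norm (W10 \<Omega> p1) (W10_norm \<Omega> p1) F"
      using C(2) J1[OF F] b1[OF F] mult_left_mono[OF b1(1)[OF F] C(1)] by force
  qed (auto simp: lin dual_spaceD(1)[OF L J1 J1] dual_spaceD(2)[OF L J1])
  from X1.W.reflexive[unfolded X1.nrm_eq, OF this]
  obtain u where u: "u \<in> W10 \<Omega> p1" "\<And>F. F \<in> W1d \<Longrightarrow> L (J1 F) = F u" by blast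
  have "(\<lambda>F. L (J2 F)) \<in> dual_space W2d (dual_norm (W10 \<Omega> p2) (W10_norm \<Omega> p2))"
  proof (rule dual_spaceI)
    fix F assume F: "F \<in> W2d"
    show "\<bar>L (J2 F)\<bar> \<le> C * dual_norm (W10 \<Omega> p2) (W10_norm \<Omega> p2) F"
      using C(2) J2[OF F] b2[OF F] mult_left_mono[OF b2(1)[OF F] C(1)] by force
  qed (auto simp: lin dual_spaceD(1)[OF L J2 J2] dual_spaceD(2)[OF L J2])
  from X2.W.reflexive[unfolded X2.nrm_eq, OF this]
  obtain v where v: "v \<in> W10 \<Omega> p2" "\<And>F. F \<in> W2d \<Longrightarrow> L (J2 F) = F v" by blast
  have "L F = F (u, v)" if F: "F \<in> dual_space X nX" for F
  proof -
    note s = dual_split[OF F]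
    have "L F = L (J1 (\<lambda>u. F (u, 0)) + J2 (\<lambda>v. F (0, v)))"
    proof (rule bidual_cong[OF L F dual_space_add[OF J1[OF s(1)] J2[OF s(2)]]])
      show "0 \<in> X" "nX 0 \<le> 1" using X1.W.U0 X2.W.U0 by (auto simp: zero_prod_def Xmem nX_eq norm0)
      fix x assume "x \<in> X"
      then show "F x = (J1 (\<lambda>u. F (u, 0)) + J2 (\<lambda>v. F (0, v))) x"
        using s(3) by (cases x) (simp add: J1_def J2_def Xmem)
    qed
    also have "\<dots> = F (u, 0) + F (0, v)"
      by (simp add: dual_spaceD(1)[OF L J1[OF s(1)] J2[OF s(2)]] u(2)[OF s(1)] v(2)[OF s(2)])
    finally show ?thesis using s(3)[OF u(1) v(1)] by simp
  qed
  then show ?thesis using u(1) v(1) Xmem by blast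
qed

text \<open>On a set of finite measure uniform closeness controls the modular for every exponent, so one countable set of test functions
  is dense in both factors.\<close>

lemma uniform_gradient_close:
  assumes S: "S \<subseteq> test_functions \<Omega>"
    "\<And>\<phi> e. \<phi> \<in> test_functions \<Omega> \<Longrightarrow> e > 0 \<Longrightarrow> \<exists>s\<in>S. \<forall>x\<in>\<Omega>. norm (cgrad \<phi> x - cgrad s x) < e"
    and W: "sobolev_space \<Omega> p r" and u: "u \<in> W10 \<Omega> p" and e: "e > 0"
  shows "\<exists>s\<in>S. pmod M p (\<lambda>x. grad \<Omega> u x - grad \<Omega> s x) < e"
proof -
  interpret W: sobolev_space \<Omega> p r by (rule W)
  define e' where "e' = e / (2 * 2 powr p)"
  have e': "e' > 0" using e by (simp add: e'_def)
  obtain \<phi> where \<phi>: "\<And>n. \<phi> n \<in> test_functions \<Omega>" "(\<lambda>n. pmod M p (\<lambda>x. grad \<Omega> u x - cgrad (\<phi> n) x)) \<longlonglongrightarrow> 0"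
    using W.W10D(4)[OF u] by blast
  obtain n where n: "pmod M p (\<lambda>x. grad \<Omega> u x - cgrad (\<phi> n) x) < e'"
    using eventually_happens[OF order_tendstoD(2)[OF \<phi>(2) e']] by auto
  define m where "m = measure M \<Omega>"
  have m: "m \<ge> 0" by (simp add: m_def)
  define d where "d = (e' / (m + 1)) powr (1 / p)"
  have d: "d > 0" using e' m by (simp add: d_def)
  obtain s where s: "s \<in> S" "\<And>x. x \<in> \<Omega> \<Longrightarrow> norm (cgrad (\<phi> n) x - cgrad s x) < d" using S(2)[OF \<phi>(1) d] by blast
  have st: "s \<in> test_functions \<Omega>" using s S by blast
  have close: "pmod M p (\<lambda>x. cgrad (\<phi> n) x - cgrad s x) \<le> d powr p * m"
  proof -
    have bm: "(\<lambda>x. cgrad (\<phi> n) x - cgrad s x) \<in> borel_measurable M" by (intro borel_measurable_diff test_props(6) \<phi> st)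
    have "norm (cgrad (\<phi> n) x - cgrad s x) \<le> d" for x
    proof (cases "x \<in> \<Omega>")
      case False then show ?thesis using test_props(8)[OF \<phi>(1)] test_props(8)[OF st] d by simp
    qed (use s in \<open>auto intro: less_imp_le\<close>)
    from bounded_Lp(2)[OF bm this W.p0(2)] show ?thesis by (simp add: m_def)
  qed
  also have "d powr p * m = e' / (m + 1) * m" using W.p0 e' m by (simp add: d_def powr_powr)
  also have "\<dots> < e'" using e' m by (simp add: field_simps)
  finally have 2: "pmod M p (\<lambda>x. cgrad (\<phi> n) x - cgrad s x) < e'" .
  have "pmod M p (\<lambda>x. grad \<Omega> u x - grad \<Omega> s x) = pmod M p (\<lambda>x. (grad \<Omega> u x - cgrad (\<phi> n) x) + (cgrad (\<phi> n) x - cgrad s x))"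
  proof (rule pmod_cong_AE)
    show "AE x in M. grad \<Omega> u x - grad \<Omega> s x = (grad \<Omega> u x - cgrad (\<phi> n) x) + (cgrad (\<phi> n) x - cgrad s x)"
      using grad_test_AE[OF st] by eventually_elim simp
  qed (intro borel_measurable_diff borel_measurable_add Lp_measurable[OF W.W10D(2)[OF u]] grad_test_measurable st test_props(6) \<phi>)+
  also have "\<dots> \<le> 2 powr p * (pmod M p (\<lambda>x. grad \<Omega> u x - cgrad (\<phi> n) x) + pmod M p (\<lambda>x. cgrad (\<phi> n) x - cgrad s x))"
    by (intro Lp_add(2) Lp_diff(1) W.W10D(2)[OF u] test_Lp(2) \<phi> st W.p0)
  also have "\<dots> < 2 powr p * (e' + e')" using n 2 by (intro mult_strict_left_mono add_strict_mono) auto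
  also have "\<dots> = e" by (simp add: e'_def)
  finally show ?thesis using s(1) by blast
qed

text \<open>A subsequence for the first component, and of that a further one for the second.\<close>

theorem weak_compactness_X:
  assumes s: "\<And>n. u n \<in> W10 \<Omega> p1" "\<And>n. v n \<in> W10 \<Omega> p2"
    and R: "\<And>n. W10_norm \<Omega> p1 (u n) \<le> R" "\<And>n. W10_norm \<Omega> p2 (v n) \<le> (R::real)"
  shows "\<exists>k w. strict_mono (k::nat\<Rightarrow>nat) \<and> weakly_converges X nX (\<lambda>n. (u (k n), v (k n))) w"
proof -
  obtain S where S: "countable S" "S \<subseteq> test_functions \<Omega>"
    "\<And>\<phi> e. \<phi> \<in> test_functions \<Omega> \<Longrightarrow> e > 0 \<Longrightarrow> \<exists>s\<in>S. \<forall>x\<in>\<Omega>. norm (cgrad \<phi> x - cgrad s x) < e"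
    using countable_dense_gradients by blast
  have S12: "S \<subseteq> W10 \<Omega> p1" "S \<subseteq> W10 \<Omega> p2" using S(2) X1.test_W10 X2.test_W10 by auto
  have cl1: "\<exists>s\<in>S. pmod M p1 (\<lambda>x. grad \<Omega> u x - grad \<Omega> s x) < e" if "u \<in> W10 \<Omega> p1" "e > 0" for u e
    by (rule uniform_gradient_close[OF S(2) _ X1.sobolev_space_axioms that]) (rule S(3))
  have cl2: "\<exists>s\<in>S. pmod M p2 (\<lambda>x. grad \<Omega> u x - grad \<Omega> s x) < e" if "u \<in> W10 \<Omega> p2" "e > 0" for u e
    by (rule uniform_gradient_close[OF S(2) _ X2.sobolev_space_axioms that]) (rule S(3))
  obtain k1 u0 where k1: "strict_mono k1" "u0 \<in> W10 \<Omega> p1" "\<And>F. F \<in> W1d \<Longrightarrow> (\<lambda>n. F (u (k1 n))) \<longlonglongrightarrow> F u0"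
    using X1.W.weak_compactness[OF S(1) S12(1) cl1, of u R, unfolded X1.nrm_eq, OF _ _ s(1) R(1)] by blast
  obtain k2 v0 where k2: "strict_mono k2" "v0 \<in> W10 \<Omega> p2" "\<And>F. F \<in> W2d \<Longrightarrow> (\<lambda>n. F (v (k1 (k2 n)))) \<longlonglongrightarrow> F v0"
    using X2.W.weak_compactness[OF S(1) S12(2) cl2, of "\<lambda>n. v (k1 n)" R, unfolded X2.nrm_eq, OF _ _ s(2) R(2)] by blast
  have "weakly_converges X nX (\<lambda>n. (u (k1 (k2 n)), v (k1 (k2 n)))) (u0, v0)"
    unfolding weakly_converges_def
  proof (intro conjI allI ballI)
    fix F assume F: "F \<in> dual_space X nX"
    note d = dual_split[OF F]
    have "(\<lambda>n. F (u (k1 (k2 n)), 0)) \<longlonglongrightarrow> F (u0, 0)"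
      using LIMSEQ_subseq_LIMSEQ[OF k1(3)[OF d(1)] k2(1)] by (simp add: comp_def)
    from tendsto_add[OF this k2(3)[OF d(2)]]
    show "(\<lambda>n. F (u (k1 (k2 n)), v (k1 (k2 n)))) \<longlonglongrightarrow> F (u0, v0)"
      using d(3)[OF s] d(3)[OF k1(2) k2(2)] d(3) s by simp
  qed (use s k1 k2 in \<open>auto simp: Xmem\<close>)
  moreover have "strict_mono (\<lambda>n. k1 (k2 n))" using k1(1) k2(1) by (simp add: strict_mono_def)
  ultimately show ?thesis by blast
qed

end

section \<open>Zeros of vector fields pointing outwards\<close>

text \<open>If \<open>g\<close> had no zero, two homotopies of nonvanishing fields on the unit sphere, normalised to unit length, would join the
  identity to a constant map: first the segment from \<open>x\<close> to \<open>g (R x)\<close>, which avoids \<open>0\<close> because both have a positive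
  inner product with \<open>x\<close>, then \<open>g (R t x)\<close> as \<open>t\<close> decreases to \<open>0\<close>. But spheres are not contractible.\<close>

lemma finite_dim_zero:
  fixes g :: "(nat \<Rightarrow> real) \<Rightarrow> nat \<Rightarrow> real" and m :: nat
  defines "E \<equiv> {x :: nat \<Rightarrow> real. \<forall>i\<ge>m. x i = 0}"
  assumes m: "m > 0" and R: "R > 0"
    and cont: "\<And>k. k < m \<Longrightarrow> continuous_on E (\<lambda>x. g x k)"
    and pos: "\<And>x. x \<in> E \<Longrightarrow> (\<Sum>i<m. (x i)\<^sup>2) = R\<^sup>2 \<Longrightarrow> (\<Sum>i<m. g x i * x i) > 0"
  shows "\<exists>x\<in>E. \<forall>k<m. g x k = 0"
proof (rule ccontr)
  assume "\<not> ?thesis"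
  then have nz: "\<And>x. x \<in> E \<Longrightarrow> \<exists>k<m. g x k \<noteq> 0" by auto
  define S where "S = {x \<in> E. (\<Sum>i<m. (x i)\<^sup>2) = 1}"
  \<comment> \<open>the sphere of dimension \<open>m - 1\<close> lives in the sequences that vanish from index \<open>m\<close> on\<close>
  have sph: "nsphere (m - 1) = top_of_set S"
    using m unfolding nsphere S_def E_def euclidean_product_topology
    by (intro arg_cong2[where f=subtopology])
       (auto simp: euclidean_product_topology lessThan_Suc_atMost[symmetric] Suc_le_eq)
  define Nm where "Nm = (\<lambda>x :: nat \<Rightarrow> real. \<lambda>i. x i / sqrt (\<Sum>j<m. (x j)\<^sup>2))"
  define Gg where "Gg = (\<lambda>x i. if i < m then g x i else 0)"
  have GE: "Gg x \<in> E" for x unfolding Gg_def E_def by auto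
  have Gnz: "\<exists>k<m. Gg x k \<noteq> 0" if "x \<in> E" for x using nz[OF that] by (auto simp: Gg_def)
  have Npos: "(\<Sum>j<m. (x j)\<^sup>2) > 0" if "\<exists>k<m. x k \<noteq> 0" for x :: "nat \<Rightarrow> real"
    using that by (auto intro!: sum_pos2)
  have NS: "Nm x \<in> S" if "x \<in> E" "\<exists>k<m. x k \<noteq> 0" for x
  proof -
    have "(\<Sum>i<m. (Nm x i)\<^sup>2) = (\<Sum>i<m. (x i)\<^sup>2) / (\<Sum>j<m. (x j)\<^sup>2)"
      unfolding Nm_def using Npos[OF that(2)] by (simp add: power_divide flip: sum_divide_distrib)
    then show ?thesis using that(1) Npos[OF that(2)] by (auto simp: S_def E_def Nm_def)
  qed
  have contG: "continuous_on E (\<lambda>x. Gg x i)" for i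
    by (cases "i < m") (auto simp: Gg_def cont)
  \<comment> \<open>a family of nonvanishing vectors is normalised to a homotopy of the sphere\<close>
  have hom: "homotopic_with (\<lambda>x. True) (nsphere (m - 1)) (nsphere (m - 1)) (\<lambda>x. h (0,x)) (\<lambda>x. h (1,x))"
    if h: "h = (\<lambda>z. Nm (h' z))" and c: "\<And>i. continuous_on ({0..1} \<times> S) (\<lambda>z. h' z i)"
      and hE: "\<And>t x. t \<in> {0..1} \<Longrightarrow> x \<in> S \<Longrightarrow> h' (t,x) \<in> E \<and> (\<exists>k<m. h' (t,x) k \<noteq> 0)"
    for h :: "real \<times> (nat \<Rightarrow> real) \<Rightarrow> (nat \<Rightarrow> real)" and h'
  proof -
    have nn: "(\<Sum>j<m. (h' z j)\<^sup>2) \<noteq> 0" if "z \<in> {0..1} \<times> S" for z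
      using Npos[of "h' z"] hE[of "fst z" "snd z"] that by (auto simp: less_le)
    have "continuous_on ({0..1} \<times> S) h"
      unfolding h Nm_def
      by (intro continuous_on_coordinatewise_then_product continuous_intros c)
         (use nn in \<open>auto\<close>)
    moreover have "h \<in> ({0..1} \<times> S) \<rightarrow> S" using NS hE by (auto simp: h)
    ultimately show ?thesis unfolding homotopic_with_def sph
      by (intro exI[of _ h]) (simp add: prod_topology_subtopology_eu)
  qed
  have cc: "continuous_on A (\<lambda>z. snd z i)" for i and A :: "(real \<times> (nat \<Rightarrow> real)) set"
    by (rule continuous_on_product_then_coordinatewise) (intro continuous_intros)
  have scE: "(\<lambda>i. c * x i) \<in> E" if "x \<in> E" for x c using that by (auto simp: E_def)
  have cs: "continuous_on ({0..1} \<times> S) (\<lambda>z i. f (fst z) * snd z i)" if "continuous_on UNIV f" for f :: "real \<Rightarrow> real"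
    by (intro continuous_on_coordinatewise_then_product continuous_intros cc
        continuous_on_compose2[OF that]) auto
  have cGs: "continuous_on ({0..1} \<times> S) (\<lambda>z. Gg (\<lambda>j. f (fst z) * snd z j) i)" if "continuous_on UNIV f" for i and f :: "real \<Rightarrow> real"
    by (rule continuous_on_compose2[OF contG cs[OF that]]) (auto simp: S_def intro: scE)
  define h1' where "h1' = (\<lambda>z :: real \<times> (nat \<Rightarrow> real). \<lambda>i. (1 - fst z) * snd z i + fst z * Gg (\<lambda>j. R * snd z j) i)"
  define h2' where "h2' = (\<lambda>z :: real \<times> (nat \<Rightarrow> real). Gg (\<lambda>j. (R * fst z) * snd z j))"
  have 1: "homotopic_with (\<lambda>x. True) (nsphere (m - 1)) (nsphere (m - 1)) (\<lambda>x. Nm (h1' (0,x))) (\<lambda>x. Nm (h1' (1,x)))"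
  proof (rule hom[OF refl])
    show "continuous_on ({0..1} \<times> S) (\<lambda>z. h1' z i)" for i
      unfolding h1'_def by (intro continuous_intros cc cGs[of "\<lambda>_. R"])
    fix t :: real and x assume t: "t \<in> {0..1}" and x: "x \<in> S"
    have xE: "x \<in> E" and x1: "(\<Sum>i<m. (x i)\<^sup>2) = 1" using x by (auto simp: S_def)
    have p: "(\<Sum>i<m. Gg (\<lambda>j. R * x j) i * (R * x i)) > 0"
      using pos[OF scE[OF xE, of R]] x1 by (simp add: Gg_def power_mult_distrib flip: sum_distrib_left)
    have p': "(\<Sum>i<m. Gg (\<lambda>j. R * x j) i * x i) > 0"
      using p R by (simp add: sum_distrib_left[symmetric] mult.left_commute[of _ R] zero_less_mult_iff)
    have "(\<Sum>i<m. h1' (t,x) i * x i) = (1 - t) * (\<Sum>i<m. (x i)\<^sup>2) + t * (\<Sum>i<m. Gg (\<lambda>j. R * x j) i * x i)"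
      by (simp add: h1'_def algebra_simps sum.distrib sum_distrib_left power2_eq_square sum_subtractf)
    also have "\<dots> > 0" using t p' x1 by (cases "t = 1") (auto intro!: add_pos_nonneg)
    finally have "\<exists>k<m. h1' (t,x) k \<noteq> 0" by (intro ccontr[of "\<exists>k<m. _ k"]) auto
    moreover have "h1' (t,x) \<in> E" using xE GE[of "\<lambda>j. R * x j"] by (auto simp: h1'_def E_def)
    ultimately show "h1' (t, x) \<in> E \<and> (\<exists>k<m. h1' (t,x) k \<noteq> 0)" by blast
  qed
  have 2: "homotopic_with (\<lambda>x. True) (nsphere (m - 1)) (nsphere (m - 1)) (\<lambda>x. Nm (h2' (0,x))) (\<lambda>x. Nm (h2' (1,x)))"
  proof (rule hom[OF refl])
    show "continuous_on ({0..1} \<times> S) (\<lambda>z. h2' z i)" for i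
      unfolding h2'_def by (rule cGs) (intro continuous_intros)
    fix t :: real and x assume x: "x \<in> S"
    then show "h2' (t, x) \<in> E \<and> (\<exists>k<m. h2' (t,x) k \<noteq> 0)"
      using Gnz[OF scE] GE by (auto simp: h2'_def S_def)
  qed
  have "homotopic_with (\<lambda>x. True) (nsphere (m - 1)) (nsphere (m - 1)) (\<lambda>x. Nm (h1' (0,x))) (\<lambda>x. Nm (h2' (0,x)))"
    using homotopic_with_trans[OF 1] homotopic_with_symD[OF 2]
    by (simp add: h1'_def h2'_def)
  then have "homotopic_with (\<lambda>x. True) (nsphere (m - 1)) (nsphere (m - 1)) id (\<lambda>x. Nm (Gg (\<lambda>_. 0)))"
    by (rule homotopic_with_eq) (auto simp: h1'_def h2'_def Nm_def sph S_def simp del: One_nat_def)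
  then show False using non_contractible_space_nsphere unfolding contractible_space_def by blast
qed

section \<open>Finite combinations of test functions\<close>

definition comb :: "(nat \<Rightarrow> 'a \<Rightarrow> real) \<Rightarrow> nat \<Rightarrow> (nat \<Rightarrow> real) \<Rightarrow> 'a \<Rightarrow> real" where
  "comb b k x = (\<Sum>j<k. x j *\<^sub>R b j)"

lemma comb_simps: "comb b 0 x = (\<lambda>z. 0)" "comb b (Suc k) x = (\<lambda>z. comb b k x z + x k * b k z)"
  by (auto simp: comb_def scaleR_fun_def zero_fun_def plus_fun_def)

lemma comb_apply: "comb b k x z = (\<Sum>j<k. x j * b j z)"
  by (induction k) (auto simp: comb_simps)

lemma comb_test:
  assumes "\<And>j. j < k \<Longrightarrow> b j \<in> test_functions \<Omega>"
  shows "comb b k x \<in> test_functions \<Omega>" "cgrad (comb b k x) z = (\<Sum>j<k. x j *\<^sub>R cgrad (b j) z)"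
proof -
  have "comb b k x \<in> test_functions \<Omega> \<and> cgrad (comb b k x) z = (\<Sum>j<k. x j *\<^sub>R cgrad (b j) z)"
    using assms
  proof (induction k)
    case 0
    have "cgrad (\<lambda>z. 0) z = 0" by (rule cgrad_unique) simp
    then show ?case using test_zero by (simp add: comb_simps)
  next
    case (Suc k)
    have t: "comb b k x \<in> test_functions \<Omega>" "(\<lambda>z. x k * b k z) \<in> test_functions \<Omega>" "b k \<in> test_functions \<Omega>"
      using Suc by (auto intro: test_scale)
    show ?case
      unfolding comb_simps
      using test_add[OF t(1,2)] cgrad_add[OF test_functions_tcd[OF t(1)] test_functions_tcd[OF t(2)], of z]
        cgrad_scale[OF test_functions_tcd[OF t(3)], of "x k" z] Suc
      by simp
  qed
  then show "comb b k x \<in> test_functions \<Omega>" "cgrad (comb b k x) z = (\<Sum>j<k. x j *\<^sub>R cgrad (b j) z)" by auto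
qed

lemma dual_comb:
  assumes F: "F \<in> dual_space V n" and V: "0 \<in> V" "\<And>x y. x \<in> V \<Longrightarrow> y \<in> V \<Longrightarrow> x + y \<in> V" "\<And>c x. x \<in> V \<Longrightarrow> c *\<^sub>R x \<in> V"
    and b: "\<And>j. j < k \<Longrightarrow> b j \<in> V"
  shows "F (comb b k x) = (\<Sum>j<k. x j * F (b j))"
proof -
  have "comb b k x \<in> V \<and> F (comb b k x) = (\<Sum>j<k. x j * F (b j))"
    using b
  proof (induction k)
    case 0
    have c0: "comb b 0 x = 0" by (simp only: comb_def lessThan_0 sum.empty)
    have "F (0 *\<^sub>R 0) = 0 * F 0" by (rule dual_spaceD(2)[OF F V(1)])
    then have "F 0 = 0" by (simp only: scaleR_zero_left mult_zero_left)
    then show ?case unfolding c0 using V(1) by (simp only: lessThan_0 sum.empty simp_thms)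
  next
    case (Suc k)
    have eq: "comb b (Suc k) x = comb b k x + x k *\<^sub>R b k" by (simp only: comb_def sum.lessThan_Suc)
    have IH: "comb b k x \<in> V" "F (comb b k x) = (\<Sum>j<k. x j * F (b j))" using Suc by auto
    have bk: "b k \<in> V" "x k *\<^sub>R b k \<in> V" using Suc.prems[of k] V(3) by auto
    have "comb b (Suc k) x \<in> V" unfolding eq by (rule V(2)[OF IH(1) bk(2)])
    moreover have "F (comb b (Suc k) x) = (\<Sum>j<Suc k. x j * F (b j))"
      unfolding eq dual_spaceD(1)[OF F IH(1) bk(2)] dual_spaceD(2)[OF F bk(1)] IH(2) by simp
    ultimately show ?case by blast
  qed
  then show ?thesis by simp
qed

lemma comb_in_span: "(\<And>j. j < k \<Longrightarrow> b j \<in> F) \<Longrightarrow> comb b k x \<in> span F"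
  unfolding comb_def by (intro span_sum span_scale span_base) auto

lemma independent_comb_zero:
  assumes inj: "inj_on b {..<k}" and ind: "independent (b ` {..<k})" and z: "comb b k x = 0" and j: "j < k"
  shows "x j = 0"
proof (rule ccontr)
  assume nz: "x j \<noteq> 0"
  define c where "c = (\<lambda>f. x (the_inv_into {..<k} b f))"
  have cb: "c (b i) = x i" if "i < k" for i using the_inv_into_f_f[OF inj] that by (simp add: c_def)
  have "(\<Sum>f\<in>b ` {..<k}. c f *\<^sub>R f) = (\<Sum>i<k. x i *\<^sub>R b i)"
    using cb by (subst sum.reindex[OF inj]) (auto intro!: sum.cong)
  then have "(\<Sum>f\<in>b ` {..<k}. c f *\<^sub>R f) = 0" using z by (simp add: comb_def)
  moreover have "c (b j) \<noteq> 0" using cb[OF j] nz by simp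
  ultimately have "dependent (b ` {..<k})" using j by (subst dependent_finite) (auto intro!: exI[of _ c])
  then show False using ind by simp
qed

context sobolev_space
begin

lemma pmod_grad_test: "\<phi> \<in> test_functions \<Omega> \<Longrightarrow> pmod M s (grad \<Omega> \<phi>) = pmod M s (cgrad \<phi>)"
  using grad_test_AE[of \<phi>] by (intro pmod_cong_AE grad_test_measurable test_props(6)) (auto elim!: eventually_mono)

text \<open>By Poincare's inequality the function vanishes almost everywhere, and its support is open.\<close>

lemma test_zero_if_grad_zero:
  assumes t: "\<phi> \<in> test_functions \<Omega>" and z: "pmod M p (cgrad \<phi>) = 0"
  shows "\<phi> = 0"
proof
  fix x
  obtain C where "pmod M p \<phi> \<le> C * pmod M p (grad \<Omega> \<phi>)" using Poincare test_W10[OF t] by blast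
  then have "pmod M p \<phi> = 0" using z pmod_grad_test[OF t] pmod_nonneg[of M p \<phi>] by simp
  then have "AE x in M. \<phi> x = 0" by (rule pmod_eq_0[OF test_Lp(1)[OF t p0(2)]])
  then have ae: "AE x in lebesgue. x \<notin> {x. \<phi> x \<noteq> 0}"
    unfolding AE_lebesgue_on_iff[OF O] by eventually_elim (use test_props(7)[OF t] in auto)
  have op: "open {x. \<phi> x \<noteq> 0}" using test_props(1)[OF t] by (intro open_Collect_neq continuous_intros)
  have "{x. \<phi> x \<noteq> 0} \<in> null_sets lebesgue" using ae op by (simp add: AE_iff_null_sets borel_open)
  then have "negligible {x. \<phi> x \<noteq> 0}" by (simp add: negligible_iff_null_sets)
  then have "{x. \<phi> x \<noteq> 0} = {}" using open_not_negligible[OF op] by blast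
  then show "\<phi> x = 0 x" by auto
qed

text \<open>Otherwise unit vectors \<open>y n\<close> would have gradients tending to zero. A limit point would be a unit vector whose
  combination has gradient zero, hence is zero, contrary to independence.\<close>

lemma coordinate_bound:
  assumes b: "\<And>j. j < k \<Longrightarrow> b j \<in> test_functions \<Omega>" and inj: "inj_on b {..<k}" and ind: "independent (b ` {..<k})"
  shows "\<exists>R\<ge>0. \<forall>x. pmod M p (grad \<Omega> (comb b k x)) \<le> T \<longrightarrow> (\<Sum>j<k. (x j)\<^sup>2) \<le> R"
proof (rule ccontr)
  assume "\<not> ?thesis"
  then have "\<forall>n::nat. \<exists>x. pmod M p (grad \<Omega> (comb b k x)) \<le> T \<and> (\<Sum>j<k. (x j)\<^sup>2) > real (Suc n)"
    by (metis not_le of_nat_0_le_iff)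
  then obtain x where x: "\<And>n::nat. pmod M p (grad \<Omega> (comb b k (x n))) \<le> T" "\<And>n. (\<Sum>j<k. (x n j)\<^sup>2) > real (Suc n)" by metis
  define N where "N = (\<lambda>n. sqrt (\<Sum>j<k. (x n j)\<^sup>2))"
  have N2: "(N n)\<^sup>2 = (\<Sum>j<k. (x n j)\<^sup>2)" for n unfolding N_def by (simp add: sum_nonneg)
  have Nn: "N n > 0" for n using x(2)[of n] by (simp add: N_def)
  define y where "y = (\<lambda>n j. if j < k then x n j / N n else 0)"
  have y1: "(\<Sum>j<k. (y n j)\<^sup>2) = 1" for n
  proof -
    have "(\<Sum>j<k. (y n j)\<^sup>2) = (\<Sum>j<k. (x n j)\<^sup>2) / (N n)\<^sup>2"
      by (simp add: y_def power_divide sum_divide_distrib)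
    then show ?thesis using Nn[of n] N2[of n, symmetric] by simp
  qed
  have "\<bar>y n j\<bar> \<le> 1" for n j
  proof (cases "j < k")
    case True
    then have "(y n j)\<^sup>2 \<le> (\<Sum>j<k. (y n j)\<^sup>2)" by (intro member_le_sum) auto
    then show ?thesis using y1[of n] by (simp add: abs_square_le_1)
  qed (simp add: y_def)
  from diagonal_subsequence[of y "\<lambda>_. 1", OF this] obtain r where r: "strict_mono r" "\<And>j. convergent (\<lambda>n. y (r n) j)" by blast
  define z where "z = (\<lambda>j. lim (\<lambda>n. y (r n) j))"
  have z: "(\<lambda>n. y (r n) j) \<longlonglongrightarrow> z j" for j using r(2)[of j] by (simp add: z_def convergent_LIMSEQ_iff)
  have "(\<lambda>n. \<Sum>j<k. (y (r n) j)\<^sup>2) \<longlonglongrightarrow> (\<Sum>j<k. (z j)\<^sup>2)" by (intro tendsto_intros z)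
  then have z1: "(\<Sum>j<k. (z j)\<^sup>2) = 1" by (simp add: y1 LIMSEQ_const_iff)
  have ct: "comb b k x \<in> test_functions \<Omega>" "cgrad (comb b k x) w = (\<Sum>j<k. x j *\<^sub>R cgrad (b j) w)" for x w
    by (rule comb_test, rule b, assumption)+
  have small: "pmod M p (cgrad (comb b k (y n))) \<le> T * (1 / real (Suc n)) powr (p / 2)" for n
  proof -
    have "cgrad (comb b k (y n)) = (\<lambda>w. (1 / N n) *\<^sub>R cgrad (comb b k (x n)) w)"
      by (rule ext) (simp add: ct(2) y_def scaleR_sum_right)
    then have "pmod M p (cgrad (comb b k (y n))) = \<bar>1 / N n\<bar> powr p * pmod M p (cgrad (comb b k (x n)))"
      using Lp_scaleR(2)[OF test_Lp(2)[OF ct(1)[of "x n"] p0(2)], of "1 / N n"] by (simp only:)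
    also have "\<dots> \<le> (1 / real (Suc n)) powr (p / 2) * T"
    proof (rule mult_mono)
      have "1 / N n \<le> (1 / real (Suc n)) powr (1 / 2)"
      proof -
        have "sqrt (real (Suc n)) \<le> N n" unfolding N_def using x(2)[of n] by (intro real_sqrt_le_mono) simp
        then have "1 / N n \<le> 1 / sqrt (real (Suc n))" by (intro divide_left_mono) (auto simp: Nn)
        then show ?thesis by (simp add: powr_half_sqrt real_sqrt_divide)
      qed
      then have "\<bar>1 / N n\<bar> powr p \<le> ((1 / real (Suc n)) powr (1 / 2)) powr p"
        using Nn[of n] p0 by (intro powr_mono2) auto
      then show "\<bar>1 / N n\<bar> powr p \<le> (1 / real (Suc n)) powr (p / 2)" by (simp add: powr_powr)
      show "pmod M p (cgrad (comb b k (x n))) \<le> T" using x(1)[of n] pmod_grad_test[OF ct(1)] by simp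
    qed auto
    finally show ?thesis by (simp add: mult.commute)
  qed
  have bl: "(\<lambda>n. T * (1 / real (Suc n)) powr (p / 2)) \<longlonglongrightarrow> 0"
  proof -
    have i: "(\<lambda>n. 1 / real (Suc n)) \<longlonglongrightarrow> 0" using LIMSEQ_inverse_real_of_nat by (simp only: divide_inverse mult_1)
    have "(\<lambda>n. (1 / real (Suc n)) powr (p / 2)) \<longlonglongrightarrow> 0 powr (p / 2)"
      by (rule tendsto_powr2[OF i tendsto_const]) (use p0 in auto)
    from tendsto_mult[OF tendsto_const this, of T] show ?thesis by simp
  qed
  have "pmod M p (cgrad (comb b k z)) \<le> 0"
  proof (rule pmod_Fatou(2)[where f="\<lambda>n. cgrad (comb b k (y (r n)))" and b="\<lambda>n. T * (1 / real (Suc (r n))) powr (p / 2)"])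
    show "AE w in M. (\<lambda>n. cgrad (comb b k (y (r n))) w) \<longlonglongrightarrow> cgrad (comb b k z) w"
      unfolding ct(2) by (intro AE_I2 tendsto_intros z)
    show "(\<lambda>n. T * (1 / real (Suc (r n))) powr (p / 2)) \<longlonglongrightarrow> 0"
      using LIMSEQ_subseq_LIMSEQ[OF bl r(1)] by (simp add: comp_def)
    show "cgrad (comb b k (y (r n))) \<in> Lp_space M p" for n by (rule test_Lp(2)[OF ct(1) p0(2)])
    show "cgrad (comb b k z) \<in> borel_measurable M" by (rule test_props(6)[OF ct(1)])
  qed (use small p0 in auto)
  then have "comb b k z = 0" using pmod_nonneg[of M p "cgrad (comb b k z)"] by (intro test_zero_if_grad_zero ct(1)) auto
  then have "z j = 0" if "j < k" for j using independent_comb_zero[OF inj ind _ that] by blast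
  then show False using z1 by simp
qed

end

section \<open>The operator of the system\<close>

context bounded_open
begin

lemma Lp_imp_integrable:
  fixes f :: "'a \<Rightarrow> 'b::euclidean_space"
  assumes q: "q > 1" and f: "f \<in> Lp_space M q" shows "integrable M f"
proof -
  have "integrable M (\<lambda>x. norm (f x) * norm (1::real))"
    by (rule Hoelder(1)[OF q f]) (simp add: Lp_space_def)
  then show ?thesis using integrable_norm_iff[OF Lp_measurable[OF f]] by simp
qed

lemma perturbed_flux_norm:
  assumes "1 < q" "q < p"
  shows "norm (flux p \<xi> - \<mu> *\<^sub>R flux q \<xi>) \<le> (1 + \<bar>\<mu>\<bar>) * (norm \<xi> powr (p - 1) + 1)"
proof -
  have "norm \<xi> powr (q - 1) \<le> norm \<xi> powr (p - 1) + 1"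
  proof (cases "norm \<xi> \<le> 1")
    case True
    then have "norm \<xi> powr (q - 1) \<le> 1" using assms by (intro powr_le1) auto
    then show ?thesis by (simp add: add_increasing)
  next
    case False
    then have "norm \<xi> powr (q - 1) \<le> norm \<xi> powr (p - 1)" using assms by (intro powr_mono) auto
    then show ?thesis by simp
  qed
  then have "\<bar>\<mu>\<bar> * norm \<xi> powr (q - 1) \<le> \<bar>\<mu>\<bar> * (norm \<xi> powr (p - 1) + 1)" by (intro mult_left_mono) auto
  moreover have "norm (flux p \<xi> - \<mu> *\<^sub>R flux q \<xi>) \<le> norm \<xi> powr (p - 1) + \<bar>\<mu>\<bar> * norm \<xi> powr (q - 1)"
    using norm_triangle_ineq4[of "flux p \<xi>" "\<mu> *\<^sub>R flux q \<xi>"] by (simp add: norm_flux)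
  ultimately show ?thesis by (simp add: algebra_simps)
qed

text \<open>Since \<open>q < p\<close> and the measure is finite, the lower order flux is integrable with the same exponent.\<close>

lemma perturbed_flux_Lp:
  assumes q: "1 < q" "q < p" and g: "g \<in> Lp_space M p"
  shows "(\<lambda>x. flux p (g x) - \<mu> *\<^sub>R flux q (g x)) \<in> Lp_space M (conj_exp p)"
    "pmod M (conj_exp p) (\<lambda>x. flux p (g x) - \<mu> *\<^sub>R flux q (g x)) \<le>
       (1 + \<bar>\<mu>\<bar>) powr conj_exp p * 2 powr conj_exp p * (pmod M p g + measure M \<Omega>)"
proof -
  have p: "p > 1" using q by simp
  note c = conj_exp_props[OF p]
  note [measurable] = Lp_measurable[OF g] flux_measurable[OF p] flux_measurable[OF q(1)]
  define h where "h = (\<lambda>x. (1 + \<bar>\<mu>\<bar>) powr conj_exp p * 2 powr conj_exp p * (norm (g x) powr p + 1))"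
  have h: "integrable M h" unfolding h_def using Lp_integrable[OF g] by simp
  have m: "(\<lambda>x. flux p (g x) - \<mu> *\<^sub>R flux q (g x)) \<in> borel_measurable M" by measurable
  have ae: "AE x in M. norm (flux p (g x) - \<mu> *\<^sub>R flux q (g x)) powr conj_exp p \<le> h x"
  proof (rule AE_I2)
    fix x
    have "norm (flux p (g x) - \<mu> *\<^sub>R flux q (g x)) powr conj_exp p \<le> ((1 + \<bar>\<mu>\<bar>) * (norm (g x) powr (p - 1) + 1)) powr conj_exp p"
      using c by (intro powr_mono2 perturbed_flux_norm q) auto
    also have "\<dots> = (1 + \<bar>\<mu>\<bar>) powr conj_exp p * (norm (g x) powr (p - 1) + 1) powr conj_exp p" by (simp add: powr_mult)
    also have "\<dots> \<le> (1 + \<bar>\<mu>\<bar>) powr conj_exp p * (2 powr conj_exp p * ((norm (g x) powr (p - 1)) powr conj_exp p + 1 powr conj_exp p))"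
      using c by (intro mult_left_mono powr_sum_le) auto
    also have "\<dots> = h x" by (simp add: h_def powr_powr c)
    finally show "norm (flux p (g x) - \<mu> *\<^sub>R flux q (g x)) powr conj_exp p \<le> h x" .
  qed
  show "(\<lambda>x. flux p (g x) - \<mu> *\<^sub>R flux q (g x)) \<in> Lp_space M (conj_exp p)" by (rule Lp_bound(1)[OF m h ae])
  have "pmod M (conj_exp p) (\<lambda>x. flux p (g x) - \<mu> *\<^sub>R flux q (g x)) \<le> (\<integral>x. h x \<partial>M)" by (rule Lp_bound(2)[OF m h ae])
  also have "\<dots> = (1 + \<bar>\<mu>\<bar>) powr conj_exp p * 2 powr conj_exp p * (pmod M p g + measure M \<Omega>)"
    unfolding h_def pmod_def using Lp_integrable[OF g] O by (simp add: space_restrict_space)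
  finally show "pmod M (conj_exp p) (\<lambda>x. flux p (g x) - \<mu> *\<^sub>R flux q (g x)) \<le>
       (1 + \<bar>\<mu>\<bar>) powr conj_exp p * 2 powr conj_exp p * (pmod M p g + measure M \<Omega>)" .
qed

lemma all_grads_AE:
  assumes "\<And>n. s n \<in> test_functions \<Omega>"
  shows "AE x in M. \<forall>n::nat. grad \<Omega> (s n) x = cgrad (s n) x"
  unfolding AE_all_countable using grad_test[OF O assms] by blast

text \<open>Bounded pointwise convergence of gradients; weak gradients agree with classical ones off one null set for the whole
  sequence.\<close>

lemma flux_term_continuous:
  assumes q: "1 < q" "q < p"
    and s: "\<And>n. s n \<in> test_functions \<Omega>" "u \<in> test_functions \<Omega>" and \<phi>: "\<phi> \<in> test_functions \<Omega>"
    and B: "\<And>n x. norm (cgrad (s n) x) \<le> B" and l: "\<And>x. (\<lambda>n. cgrad (s n) x) \<longlonglongrightarrow> cgrad u x"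
  shows "(\<lambda>n. \<integral>x. (flux p (grad \<Omega> (s n) x) - \<mu> *\<^sub>R flux q (grad \<Omega> (s n) x)) \<bullet> grad \<Omega> \<phi> x \<partial>M)
    \<longlonglongrightarrow> (\<integral>x. (flux p (grad \<Omega> u x) - \<mu> *\<^sub>R flux q (grad \<Omega> u x)) \<bullet> grad \<Omega> \<phi> x \<partial>M)"
proof -
  have p: "p > 1" using q by simp
  obtain B' where B': "B' > 0" "\<And>x. norm (cgrad \<phi> x) \<le> B'" using test_props(10)[OF \<phi>] by blast
  note [measurable] = grad_test_measurable[OF s(1)] grad_test_measurable[OF s(2)] grad_test_measurable[OF \<phi>] flux_measurable[OF p] flux_measurable[OF q(1)]
  define w where "w = (1 + \<bar>\<mu>\<bar>) * (B powr (p - 1) + 1) * B'"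
  show ?thesis
  proof (rule integral_dominated_convergence[where w="\<lambda>_. w"])
    show "AE x in M. (\<lambda>n. (flux p (grad \<Omega> (s n) x) - \<mu> *\<^sub>R flux q (grad \<Omega> (s n) x)) \<bullet> grad \<Omega> \<phi> x)
      \<longlonglongrightarrow> (flux p (grad \<Omega> u x) - \<mu> *\<^sub>R flux q (grad \<Omega> u x)) \<bullet> grad \<Omega> \<phi> x"
      using all_grads_AE[OF s(1)] grad_test[OF O s(2)]
    proof eventually_elim
      fix x assume g: "\<forall>n. grad \<Omega> (s n) x = cgrad (s n) x" "grad \<Omega> u x = cgrad u x"
      have "isCont (flux p) (cgrad u x)" "isCont (flux q) (cgrad u x)"
        using continuous_on_eq_continuous_at[OF open_UNIV] continuous_flux[OF p] continuous_flux[OF q(1)] by blast+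
      then have "(\<lambda>n. flux p (cgrad (s n) x)) \<longlonglongrightarrow> flux p (cgrad u x)" "(\<lambda>n. flux q (cgrad (s n) x)) \<longlonglongrightarrow> flux q (cgrad u x)"
        using isCont_tendsto_compose l by blast+
      then show "(\<lambda>n. (flux p (grad \<Omega> (s n) x) - \<mu> *\<^sub>R flux q (grad \<Omega> (s n) x)) \<bullet> grad \<Omega> \<phi> x)
        \<longlonglongrightarrow> (flux p (grad \<Omega> u x) - \<mu> *\<^sub>R flux q (grad \<Omega> u x)) \<bullet> grad \<Omega> \<phi> x"
        unfolding g(2) g(1)[rule_format] by (intro tendsto_intros)
    qed
    show "AE x in M. norm ((flux p (grad \<Omega> (s n) x) - \<mu> *\<^sub>R flux q (grad \<Omega> (s n) x)) \<bullet> grad \<Omega> \<phi> x) \<le> w" for n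
      using grad_test[OF O s(1)[of n]] grad_test[OF O \<phi>]
    proof eventually_elim
      fix x assume g: "grad \<Omega> (s n) x = cgrad (s n) x" "grad \<Omega> \<phi> x = cgrad \<phi> x"
      have "norm ((flux p (cgrad (s n) x) - \<mu> *\<^sub>R flux q (cgrad (s n) x)) \<bullet> cgrad \<phi> x) \<le>
        norm (flux p (cgrad (s n) x) - \<mu> *\<^sub>R flux q (cgrad (s n) x)) * norm (cgrad \<phi> x)"
        unfolding real_norm_def by (rule Cauchy_Schwarz_ineq2)
      also have "\<dots> \<le> (1 + \<bar>\<mu>\<bar>) * (norm (cgrad (s n) x) powr (p - 1) + 1) * B'"
        using B'(1) by (intro mult_mono perturbed_flux_norm q B'(2)) auto
      also have "\<dots> \<le> w" unfolding w_def using B'(1) p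
        by (intro mult_right_mono mult_left_mono add_right_mono powr_mono2 B) auto
      finally show "norm ((flux p (grad \<Omega> (s n) x) - \<mu> *\<^sub>R flux q (grad \<Omega> (s n) x)) \<bullet> grad \<Omega> \<phi> x) \<le> w"
        unfolding g .
    qed
  qed (simp_all, measurable)
qed

text \<open>Dominated convergence: on bounded arguments the growth condition gives the integrable bound \<open>E + \<bar>\<sigma> x\<bar>\<close>.\<close>

lemma superposition_term_continuous:
  fixes f :: "'a \<Rightarrow> real \<Rightarrow> real \<Rightarrow> 'a \<Rightarrow> 'a \<Rightarrow> real"
  assumes f: "caratheodory \<Omega> f" and q: "q > 1" and C: "C > 0" and e: "e1 > 0" "e2 > 0" "e3 > 0" "e4 > 0"
    and \<sigma>: "\<sigma> \<in> Lp_space M q"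
    and growth: "AE x in M. \<forall>s t \<xi> \<nu>. \<bar>f x s t \<xi> \<nu>\<bar> \<le>
        C * (\<bar>s\<bar> powr (e1 / q) + \<bar>t\<bar> powr (e2 / q) + norm \<xi> powr (e3 / q) + norm \<nu> powr (e4 / q)) + \<sigma> x"
    and s: "\<And>n. s n \<in> test_functions \<Omega>" "u \<in> test_functions \<Omega>" and t: "\<And>n. t n \<in> test_functions \<Omega>" "v \<in> test_functions \<Omega>"
    and \<phi>: "\<phi> \<in> test_functions \<Omega>"
    and B: "\<And>n x. \<bar>s n x\<bar> \<le> B" "\<And>n x. \<bar>t n x\<bar> \<le> B" "\<And>n x. norm (cgrad (s n) x) \<le> B" "\<And>n x. norm (cgrad (t n) x) \<le> B"
    and l: "\<And>x. (\<lambda>n. s n x) \<longlonglongrightarrow> u x" "\<And>x. (\<lambda>n. t n x) \<longlonglongrightarrow> v x"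
      "\<And>x. (\<lambda>n. cgrad (s n) x) \<longlonglongrightarrow> cgrad u x" "\<And>x. (\<lambda>n. cgrad (t n) x) \<longlonglongrightarrow> cgrad v x"
  shows "(\<lambda>n. \<integral>x. f x (s n x) (t n x) (grad \<Omega> (s n) x) (grad \<Omega> (t n) x) * \<phi> x \<partial>M)
    \<longlonglongrightarrow> (\<integral>x. f x (u x) (v x) (grad \<Omega> u x) (grad \<Omega> v x) * \<phi> x \<partial>M)"
proof -
  obtain B' where B': "B' > 0" "\<And>x. \<bar>\<phi> x\<bar> \<le> B'" using test_props(9)[OF \<phi>] by blast
  have m: "(\<lambda>x. f x (a x) (b x) (grad \<Omega> a x) (grad \<Omega> b x) * \<phi> x) \<in> borel_measurable M"
    if "a \<in> test_functions \<Omega>" "b \<in> test_functions \<Omega>" for a b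
    by (intro borel_measurable_times caratheodory_measurable[OF O f] test_props(5) grad_test_measurable that \<phi>)
  define E where "E = C * (B powr (e1 / q) + B powr (e2 / q) + B powr (e3 / q) + B powr (e4 / q))"
  have \<sigma>i: "integrable M \<sigma>" by (rule Lp_imp_integrable[OF q \<sigma>])
  show ?thesis
  proof (rule integral_dominated_convergence[where w="\<lambda>x. (E + \<bar>\<sigma> x\<bar>) * B'"])
    show "integrable M (\<lambda>x. (E + \<bar>\<sigma> x\<bar>) * B')" using \<sigma>i by simp
    have "AE x in M. continuous_on UNIV (\<lambda>(s, t, \<xi>, \<nu>). f x s t \<xi> \<nu>)" using f unfolding caratheodory_def by (rule conjunct2)
    then show "AE x in M. (\<lambda>n. f x (s n x) (t n x) (grad \<Omega> (s n) x) (grad \<Omega> (t n) x) * \<phi> x)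
      \<longlonglongrightarrow> f x (u x) (v x) (grad \<Omega> u x) (grad \<Omega> v x) * \<phi> x"
      using all_grads_AE[OF s(1)] all_grads_AE[OF t(1)] grad_test[OF O s(2)] grad_test[OF O t(2)]
    proof eventually_elim
      fix x assume c: "continuous_on UNIV (\<lambda>(s, t, \<xi>, \<nu>). f x s t \<xi> \<nu>)"
        and g: "\<forall>n. grad \<Omega> (s n) x = cgrad (s n) x" "\<forall>n. grad \<Omega> (t n) x = cgrad (t n) x"
          "grad \<Omega> u x = cgrad u x" "grad \<Omega> v x = cgrad v x"
      have "isCont (\<lambda>(s, t, \<xi>, \<nu>). f x s t \<xi> \<nu>) (u x, v x, cgrad u x, cgrad v x)"
        using c continuous_on_eq_continuous_at[OF open_UNIV] by blast
      moreover have "(\<lambda>n. (s n x, t n x, cgrad (s n) x, cgrad (t n) x)) \<longlonglongrightarrow> (u x, v x, cgrad u x, cgrad v x)"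
        by (intro tendsto_Pair l)
      ultimately have "(\<lambda>n. f x (s n x) (t n x) (cgrad (s n) x) (cgrad (t n) x)) \<longlonglongrightarrow> f x (u x) (v x) (cgrad u x) (cgrad v x)"
        using isCont_tendsto_compose[of _ "\<lambda>(s, t, \<xi>, \<nu>). f x s t \<xi> \<nu>"] by fastforce
      then show "(\<lambda>n. f x (s n x) (t n x) (grad \<Omega> (s n) x) (grad \<Omega> (t n) x) * \<phi> x)
        \<longlonglongrightarrow> f x (u x) (v x) (grad \<Omega> u x) (grad \<Omega> v x) * \<phi> x"
        unfolding g(3,4) g(1)[rule_format] g(2)[rule_format] by (intro tendsto_intros)
    qed
    show "AE x in M. norm (f x (s n x) (t n x) (grad \<Omega> (s n) x) (grad \<Omega> (t n) x) * \<phi> x) \<le> (E + \<bar>\<sigma> x\<bar>) * B'" for n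
      using growth grad_test[OF O s(1)[of n]] grad_test[OF O t(1)[of n]]
    proof eventually_elim
      fix x assume *: "\<forall>s t \<xi> \<nu>. \<bar>f x s t \<xi> \<nu>\<bar> \<le>
        C * (\<bar>s\<bar> powr (e1 / q) + \<bar>t\<bar> powr (e2 / q) + norm \<xi> powr (e3 / q) + norm \<nu> powr (e4 / q)) + \<sigma> x"
        and g: "grad \<Omega> (s n) x = cgrad (s n) x" "grad \<Omega> (t n) x = cgrad (t n) x"
      have "\<bar>f x (s n x) (t n x) (cgrad (s n) x) (cgrad (t n) x)\<bar> \<le>
        C * (\<bar>s n x\<bar> powr (e1 / q) + \<bar>t n x\<bar> powr (e2 / q) + norm (cgrad (s n) x) powr (e3 / q) + norm (cgrad (t n) x) powr (e4 / q)) + \<sigma> x"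
        using * by blast
      also have "\<dots> \<le> E + \<bar>\<sigma> x\<bar>" unfolding E_def using C q e
        by (intro add_mono mult_left_mono powr_mono2 B) auto
      finally have "\<bar>f x (s n x) (t n x) (cgrad (s n) x) (cgrad (t n) x)\<bar> \<le> E + \<bar>\<sigma> x\<bar>" .
      then show "norm (f x (s n x) (t n x) (grad \<Omega> (s n) x) (grad \<Omega> (t n) x) * \<phi> x) \<le> (E + \<bar>\<sigma> x\<bar>) * B'"
        unfolding g real_norm_def abs_mult using B' by (intro mult_mono) auto
    qed
  qed (intro m s t)+
qed

end

text \<open>Beyond \<open>Y\<close> the power with exponent \<open>p\<close> alone dominates.\<close>

lemma lower_order_absorb:
  fixes p q e \<mu> :: real
  assumes q: "0 < q" "q < p" and e: "e > 0"
  shows "\<exists>K\<ge>0. \<forall>y\<ge>0. \<bar>\<mu>\<bar> * y powr q \<le> e * y powr p + K"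
proof -
  define Y where "Y = (\<bar>\<mu>\<bar> / e) powr (1 / (p - q))"
  have "\<bar>\<mu>\<bar> * y powr q \<le> e * y powr p + \<bar>\<mu>\<bar> * Y powr q" if y: "y \<ge> 0" for y
  proof (cases "y \<le> Y")
    case True
    then have "\<bar>\<mu>\<bar> * y powr q \<le> \<bar>\<mu>\<bar> * Y powr q" using y q by (intro mult_left_mono powr_mono2) auto
    moreover have "e * y powr p \<ge> 0" using e by simp
    ultimately show ?thesis by linarith
  next
    case False
    then have "Y powr (p - q) \<le> y powr (p - q)" using q by (intro powr_mono2) (auto simp: Y_def)
    moreover have "Y powr (p - q) = \<bar>\<mu>\<bar> / e" using q e by (simp add: Y_def powr_powr)
    ultimately have "\<bar>\<mu>\<bar> \<le> e * y powr (p - q)" using e by (simp add: divide_le_eq mult.commute)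
    then have "\<bar>\<mu>\<bar> * y powr q \<le> e * y powr (p - q) * y powr q" by (intro mult_right_mono) auto
    also have "\<dots> = e * y powr p" by (simp add: mult.assoc powr_add[symmetric])
    finally show ?thesis by (simp add: add_increasing2)
  qed
  then show ?thesis by (intro exI[of _ "\<bar>\<mu>\<bar> * Y powr q"]) auto
qed

section \<open>Galerkin approximation\<close>

text \<open>The growth conditions are written with the exponents \<open>r / conj_exp r\<close> in place of \<open>r - 1\<close>, so that all terms have the form
  that superposition operators require.\<close>

locale dirichlet_system = product_space \<Omega> p1 p2 r1 r2 for \<Omega> :: "'a::euclidean_space set" and p1 p2 r1 r2 :: real +
  fixes q1 q2 C1 C2 c1 c2 d1 d2 \<mu>1 \<mu>2 :: real
    and f1 f2 :: "'a \<Rightarrow> real \<Rightarrow> real \<Rightarrow> 'a \<Rightarrow> 'a \<Rightarrow> real"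
    and \<sigma>1 \<sigma>2 \<gamma>1 \<gamma>2 :: "'a \<Rightarrow> real"
  assumes q: "1 < q1" "q1 < p1" "1 < q2" "q2 < p2"
    and caratheodory: "caratheodory \<Omega> f1" "caratheodory \<Omega> f2"
    and C_pos: "C1 > 0" "C2 > 0"
    and \<sigma>: "\<sigma>1 \<in> Lp_space M (conj_exp r1)" "\<sigma>2 \<in> Lp_space M (conj_exp r2)"
    and growth1: "AE x in M. \<forall>s t \<xi> \<nu>. \<bar>f1 x s t \<xi> \<nu>\<bar> \<le>
        C1 * (\<bar>s\<bar> powr (r1 / conj_exp r1) + \<bar>t\<bar> powr (r2 / conj_exp r1)
            + norm \<xi> powr (p1 / conj_exp r1) + norm \<nu> powr (p2 / conj_exp r1)) + \<sigma>1 x"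
    and growth2: "AE x in M. \<forall>s t \<xi> \<nu>. \<bar>f2 x s t \<xi> \<nu>\<bar> \<le>
        C2 * (\<bar>s\<bar> powr (r1 / conj_exp r2) + \<bar>t\<bar> powr (r2 / conj_exp r2)
            + norm \<xi> powr (p1 / conj_exp r2) + norm \<nu> powr (p2 / conj_exp r2)) + \<sigma>2 x"
    and cd_pos: "c1 > 0" "c2 > 0" "d1 > 0" "d2 > 0"
    and cd_small: "c1 + c2 + (d1 + d2) * (1 / min (first_eigenvalue \<Omega> p1) (first_eigenvalue \<Omega> p2)) < 1"
    and \<gamma>: "\<gamma>1 \<in> Lp_space M 1" "\<gamma>2 \<in> Lp_space M 1"
    and sign1: "AE x in M. \<forall>s t \<xi> \<nu>. f1 x s t \<xi> \<nu> * s \<le>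
        c1 * (norm \<xi> powr p1 + norm \<nu> powr p2) + d1 * (\<bar>s\<bar> powr p1 + \<bar>t\<bar> powr p2) + \<gamma>1 x"
    and sign2: "AE x in M. \<forall>s t \<xi> \<nu>. f2 x s t \<xi> \<nu> * t \<le>
        c2 * (norm \<xi> powr p1 + norm \<nu> powr p2) + d2 * (\<bar>s\<bar> powr p1 + \<bar>t\<bar> powr p2) + \<gamma>2 x"
begin

abbreviation "A \<equiv> system_operator \<Omega> p1 p2 q1 q2 f1 f2 \<mu>1 \<mu>2"

text \<open>The fluxes \<open>h1\<close>, \<open>h2\<close> and the right hand sides \<open>N1\<close>, \<open>N2\<close> of the two equations; the former are paired with
  gradients, the latter with functions.\<close>

definition "h1 u x = flux p1 (grad \<Omega> u x) - \<mu>1 *\<^sub>R flux q1 (grad \<Omega> u x)"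
definition "h2 v x = flux p2 (grad \<Omega> v x) - \<mu>2 *\<^sub>R flux q2 (grad \<Omega> v x)"
definition "N1 u v x = f1 x (u x) (v x) (grad \<Omega> u x) (grad \<Omega> v x)"
definition "N2 u v x = f2 x (u x) (v x) (grad \<Omega> u x) (grad \<Omega> v x)"

lemma A_eq: "A (u, v) = (\<lambda>(\<phi>, \<psi>). ((\<integral>x. h1 u x \<bullet> grad \<Omega> \<phi> x \<partial>M) - (\<integral>x. N1 u v x * \<phi> x \<partial>M))
    + ((\<integral>x. h2 v x \<bullet> grad \<Omega> \<psi> x \<partial>M) - (\<integral>x. N2 u v x * \<psi> x \<partial>M)))"
  by (auto simp: system_operator_def h1_def h2_def N1_def N2_def fun_eq_iff)

lemma rq: "conj_exp r1 > 1" "conj_exp r2 > 1"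
  using conj_exp_props X1.r0 X2.r0 by auto

lemma h_Lp: "u \<in> W10 \<Omega> p1 \<Longrightarrow> h1 u \<in> Lp_space M (conj_exp p1)" "v \<in> W10 \<Omega> p2 \<Longrightarrow> h2 v \<in> Lp_space M (conj_exp p2)"
  unfolding h1_def h2_def
  by (rule perturbed_flux_Lp(1)[OF q(1,2) X1.W10D(2)], assumption)
     (rule perturbed_flux_Lp(1)[OF q(3,4) X2.W10D(2)], assumption)

lemma W10_Lr: "u \<in> W10 \<Omega> p1 \<Longrightarrow> u \<in> Lp_space M r1" "v \<in> W10 \<Omega> p2 \<Longrightarrow> v \<in> Lp_space M r2"
  using X1.Sobolev X2.Sobolev by blast+

lemma N_Lp:
  assumes "u \<in> W10 \<Omega> p1" "v \<in> W10 \<Omega> p2"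
  shows "N1 u v \<in> Lp_space M (conj_exp r1)" "N2 u v \<in> Lp_space M (conj_exp r2)"
    "pmod M (conj_exp r1) (N1 u v) \<le> 5 powr conj_exp r1 * (C1 powr conj_exp r1 *
      (pmod M r1 u + pmod M r2 v + pmod M p1 (grad \<Omega> u) + pmod M p2 (grad \<Omega> v)) + pmod M (conj_exp r1) \<sigma>1)"
    "pmod M (conj_exp r2) (N2 u v) \<le> 5 powr conj_exp r2 * (C2 powr conj_exp r2 *
      (pmod M r1 u + pmod M r2 v + pmod M p1 (grad \<Omega> u) + pmod M p2 (grad \<Omega> v)) + pmod M (conj_exp r2) \<sigma>2)"
  unfolding N1_def N2_def
  using superposition_Lp[OF O caratheodory(1) rq(1) C_pos(1) \<sigma>(1) growth1 W10_Lr(1)[OF assms(1)] W10_Lr(2)[OF assms(2)] X1.W10D(2)[OF assms(1)] X2.W10D(2)[OF assms(2)]]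
    superposition_Lp[OF O caratheodory(2) rq(2) C_pos(2) \<sigma>(2) growth2 W10_Lr(1)[OF assms(1)] W10_Lr(2)[OF assms(2)] X1.W10D(2)[OF assms(1)] X2.W10D(2)[OF assms(2)]]
  by simp_all

lemma A_dual:
  assumes "u \<in> W10 \<Omega> p1" "v \<in> W10 \<Omega> p2"
  shows "A (u, v) \<in> dual_space X nX"
proof -
  have "(\<lambda>\<phi>. (\<integral>x. h1 u x \<bullet> grad \<Omega> \<phi> x \<partial>M) - (\<integral>x. N1 u v x * \<phi> x \<partial>M)) \<in> W1d"
    using X1.divergence_functional h_Lp(1)[OF assms(1)] N_Lp(1)[OF assms] by blast
  moreover have "(\<lambda>\<phi>. (\<integral>x. h2 v x \<bullet> grad \<Omega> \<phi> x \<partial>M) - (\<integral>x. N2 u v x * \<phi> x \<partial>M)) \<in> W2d"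
    using X2.divergence_functional h_Lp(2)[OF assms(2)] N_Lp(2)[OF assms] by blast
  ultimately show ?thesis unfolding A_eq by (rule dual_join)
qed

text \<open>The exponents in the growth conditions are those for which Sobolev's inequality bounds the superposition terms, on
  bounded sets, in the Lebesgue spaces with exponents conjugate to \<open>r1\<close> and \<open>r2\<close>.\<close>

lemma A_bounded:
  assumes "R \<ge> 0"
  shows "\<exists>K\<ge>0. \<forall>u\<in>W10 \<Omega> p1. \<forall>v\<in>W10 \<Omega> p2. pmod M p1 (grad \<Omega> u) \<le> R \<longrightarrow> pmod M p2 (grad \<Omega> v) \<le> R \<longrightarrow>
     (\<forall>\<phi>\<in>W10 \<Omega> p1. \<forall>\<psi>\<in>W10 \<Omega> p2. \<bar>A (u, v) (\<phi>, \<psi>)\<bar> \<le> K * (W10_norm \<Omega> p1 \<phi> + W10_norm \<Omega> p2 \<psi>))"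
proof -
  obtain S1 where S1: "S1 > 0" "\<And>u. u \<in> W10 \<Omega> p1 \<Longrightarrow> pmod M r1 u \<le> S1 * pmod M p1 (grad \<Omega> u) powr (r1 / p1)" using X1.Sobolev by blast
  obtain S2 where S2: "S2 > 0" "\<And>u. u \<in> W10 \<Omega> p2 \<Longrightarrow> pmod M r2 u \<le> S2 * pmod M p2 (grad \<Omega> u) powr (r2 / p2)" using X2.Sobolev by blast
  obtain T1 where T1: "T1 > 0" "\<And>h k \<phi>. h \<in> Lp_space M (conj_exp p1) \<Longrightarrow> k \<in> Lp_space M (conj_exp r1) \<Longrightarrow> \<phi> \<in> W10 \<Omega> p1 \<Longrightarrow>
     \<bar>(\<integral>x. h x \<bullet> grad \<Omega> \<phi> x \<partial>M) - (\<integral>x. k x * \<phi> x \<partial>M)\<bar> \<le> (Lp_norm M (conj_exp p1) h + T1 * Lp_norm M (conj_exp r1) k) * W10_norm \<Omega> p1 \<phi>"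
    using X1.divergence_functional by blast
  obtain T2 where T2: "T2 > 0" "\<And>h k \<phi>. h \<in> Lp_space M (conj_exp p2) \<Longrightarrow> k \<in> Lp_space M (conj_exp r2) \<Longrightarrow> \<phi> \<in> W10 \<Omega> p2 \<Longrightarrow>
     \<bar>(\<integral>x. h x \<bullet> grad \<Omega> \<phi> x \<partial>M) - (\<integral>x. k x * \<phi> x \<partial>M)\<bar> \<le> (Lp_norm M (conj_exp p2) h + T2 * Lp_norm M (conj_exp r2) k) * W10_norm \<Omega> p2 \<phi>"
    using X2.divergence_functional by blast
  define H1 where "H1 = (1 + \<bar>\<mu>1\<bar>) powr conj_exp p1 * 2 powr conj_exp p1 * (R + measure M \<Omega>)"
  define H2 where "H2 = (1 + \<bar>\<mu>2\<bar>) powr conj_exp p2 * 2 powr conj_exp p2 * (R + measure M \<Omega>)"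
  define Z where "Z = S1 * R powr (r1 / p1) + S2 * R powr (r2 / p2) + R + R"
  define G1 where "G1 = 5 powr conj_exp r1 * (C1 powr conj_exp r1 * Z + pmod M (conj_exp r1) \<sigma>1)"
  define G2 where "G2 = 5 powr conj_exp r2 * (C2 powr conj_exp r2 * Z + pmod M (conj_exp r2) \<sigma>2)"
  define K1 where "K1 = H1 powr (1 / conj_exp p1) + T1 * G1 powr (1 / conj_exp r1)"
  define K2 where "K2 = H2 powr (1 / conj_exp p2) + T2 * G2 powr (1 / conj_exp r2)"
  have K: "K1 \<ge> 0" "K2 \<ge> 0" using T1(1) T2(1) by (auto simp: K1_def K2_def)
  have root: "Lp_norm M s f \<le> B powr (1 / s)" if "pmod M s f \<le> B" "s > 1" for s B and f :: "'a \<Rightarrow> 'c::euclidean_space"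
    unfolding Lp_norm_pmod using that by (intro powr_mono2) auto
  note cp = conj_exp_props(1)[OF p(1)] conj_exp_props(1)[OF p(3)]
  have main: "\<bar>A (u, v) (\<phi>, \<psi>)\<bar> \<le> (K1 + K2) * (W10_norm \<Omega> p1 \<phi> + W10_norm \<Omega> p2 \<psi>)"
    if u: "u \<in> W10 \<Omega> p1" and v: "v \<in> W10 \<Omega> p2" and uR: "pmod M p1 (grad \<Omega> u) \<le> R" and vR: "pmod M p2 (grad \<Omega> v) \<le> R"
      and \<phi>: "\<phi> \<in> W10 \<Omega> p1" and \<psi>: "\<psi> \<in> W10 \<Omega> p2" for u v \<phi> \<psi>
  proof -
    have "pmod M r1 u \<le> S1 * R powr (r1 / p1)"
      by (rule order_trans[OF S1(2)[OF u]]) (use S1(1) uR X1.r0 X1.p0 in \<open>auto intro!: mult_left_mono powr_mono2\<close>)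
    moreover have "pmod M r2 v \<le> S2 * R powr (r2 / p2)"
      by (rule order_trans[OF S2(2)[OF v]]) (use S2(1) vR X2.r0 X2.p0 in \<open>auto intro!: mult_left_mono powr_mono2\<close>)
    ultimately have Zb: "pmod M r1 u + pmod M r2 v + pmod M p1 (grad \<Omega> u) + pmod M p2 (grad \<Omega> v) \<le> Z"
      using uR vR by (simp add: Z_def)
    have "pmod M (conj_exp p1) (h1 u) \<le> H1"
      unfolding h1_def H1_def
      by (rule order_trans[OF perturbed_flux_Lp(2)[OF q(1,2) X1.W10D(2)[OF u]]]) (use uR in \<open>auto intro!: mult_left_mono\<close>)
    note e1 = root[OF this cp(1)]
    have "pmod M (conj_exp p2) (h2 v) \<le> H2"
      unfolding h2_def H2_def
      by (rule order_trans[OF perturbed_flux_Lp(2)[OF q(3,4) X2.W10D(2)[OF v]]]) (use vR in \<open>auto intro!: mult_left_mono\<close>)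
    note e2 = root[OF this cp(2)]
    have "pmod M (conj_exp r1) (N1 u v) \<le> G1" unfolding G1_def
      by (rule order_trans[OF N_Lp(3)[OF u v]]) (use Zb in \<open>auto intro!: mult_left_mono\<close>)
    note e3 = root[OF this rq(1)]
    have "pmod M (conj_exp r2) (N2 u v) \<le> G2" unfolding G2_def
      by (rule order_trans[OF N_Lp(4)[OF u v]]) (use Zb in \<open>auto intro!: mult_left_mono\<close>)
    note e4 = root[OF this rq(2)]
    have a1: "\<bar>(\<integral>x. h1 u x \<bullet> grad \<Omega> \<phi> x \<partial>M) - (\<integral>x. N1 u v x * \<phi> x \<partial>M)\<bar> \<le> K1 * W10_norm \<Omega> p1 \<phi>"
      by (rule order_trans[OF T1(2)[OF h_Lp(1)[OF u] N_Lp(1)[OF u v] \<phi>]])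
         (unfold K1_def, intro mult_right_mono add_mono mult_left_mono e1 e3 norm_nn less_imp_le[OF T1(1)])
    have a2: "\<bar>(\<integral>x. h2 v x \<bullet> grad \<Omega> \<psi> x \<partial>M) - (\<integral>x. N2 u v x * \<psi> x \<partial>M)\<bar> \<le> K2 * W10_norm \<Omega> p2 \<psi>"
      by (rule order_trans[OF T2(2)[OF h_Lp(2)[OF v] N_Lp(2)[OF u v] \<psi>]])
         (unfold K2_def, intro mult_right_mono add_mono mult_left_mono e2 e4 norm_nn less_imp_le[OF T2(1)])
    have "\<bar>A (u, v) (\<phi>, \<psi>)\<bar> \<le> K1 * W10_norm \<Omega> p1 \<phi> + K2 * W10_norm \<Omega> p2 \<psi>"
      unfolding A_eq prod.case by (rule order_trans[OF abs_triangle_ineq add_mono[OF a1 a2]])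
    moreover have "K1 * W10_norm \<Omega> p2 \<psi> \<ge> 0" "K2 * W10_norm \<Omega> p1 \<phi> \<ge> 0" using K norm_nn by auto
    ultimately show ?thesis by (simp add: algebra_simps)
  qed
  show ?thesis by (rule exI[of _ "K1 + K2"]) (use K main in auto)
qed

text \<open>The leading terms give the modular \<open>P\<close> of the gradients. By the sign conditions the nonlinear terms take away at most
  \<open>c + d / l\<close> times \<open>P\<close>, where \<open>l\<close> is the smaller eigenvalue, and the terms with \<open>\<mu>1\<close>, \<open>\<mu>2\<close> at most \<open>e P\<close> up to a constant.\<close>

lemma coercive:
  "\<exists>\<kappa>>0. \<exists>K. \<forall>u\<in>W10 \<Omega> p1. \<forall>v\<in>W10 \<Omega> p2.
     A (u, v) (u, v) \<ge> \<kappa> * (pmod M p1 (grad \<Omega> u) + pmod M p2 (grad \<Omega> v)) - K"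
proof -
  define l where "l = min (first_eigenvalue \<Omega> p1) (first_eigenvalue \<Omega> p2)"
  have l: "l > 0" using X1.eigenvalue(1) X2.eigenvalue(1) by (simp add: l_def)
  define c d where "c = c1 + c2" and "d = d1 + d2"
  have d: "d > 0" using cd_pos by (simp add: d_def)
  \<comment> \<open>half of the gap in the smallness condition pays for the lower order terms, the other half remains\<close>
  define e where "e = (1 - c - d / l) / 2"
  have e: "e > 0" using cd_small by (simp add: e_def c_def d_def l_def)
  obtain K1 where K1: "\<And>y. y \<ge> 0 \<Longrightarrow> \<bar>\<mu>1\<bar> * y powr q1 \<le> e * y powr p1 + K1"
    using lower_order_absorb[of q1 p1 e \<mu>1] q e by auto
  obtain K2 where K2: "\<And>y. y \<ge> 0 \<Longrightarrow> \<bar>\<mu>2\<bar> * y powr q2 \<le> e * y powr p2 + K2"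
    using lower_order_absorb[of q2 p2 e \<mu>2] q e by auto
  have \<gamma>i: "integrable M \<gamma>1" "integrable M \<gamma>2"
    using Lp_integrable[OF \<gamma>(1)] Lp_integrable[OF \<gamma>(2)] integrable_norm_iff[OF Lp_measurable[OF \<gamma>(1)]] integrable_norm_iff[OF Lp_measurable[OF \<gamma>(2)]]
    by simp_all
  define K where "K = (\<integral>x. \<gamma>1 x \<partial>M) + (\<integral>x. \<gamma>2 x \<partial>M) + (K1 + K2) * measure M \<Omega>"
  have main: "A (u, v) (u, v) \<ge> e * (pmod M p1 (grad \<Omega> u) + pmod M p2 (grad \<Omega> v)) - K"
    if u: "u \<in> W10 \<Omega> p1" and v: "v \<in> W10 \<Omega> p2" for u v
  proof -
    define P where "P = pmod M p1 (grad \<Omega> u) + pmod M p2 (grad \<Omega> v)"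
    define L where "L = (\<lambda>x. (1 - c - e) * (norm (grad \<Omega> u x) powr p1 + norm (grad \<Omega> v x) powr p2)
      - d * (norm (u x) powr p1 + norm (v x) powr p2) - \<gamma>1 x - \<gamma>2 x - (K1 + K2))"
    note I = Lp_integrable[OF X1.W10D(2)[OF u]] Lp_integrable[OF X2.W10D(2)[OF v]] Lp_integrable[OF X1.W10D(1)[OF u]] Lp_integrable[OF X2.W10D(1)[OF v]]
    have J: "integrable M (\<lambda>x. h1 u x \<bullet> grad \<Omega> u x)" "integrable M (\<lambda>x. h2 v x \<bullet> grad \<Omega> v x)"
      by (rule Hoelder_inner(1)[OF p(1) X1.W10D(2)[OF u] h_Lp(1)[OF u]] Hoelder_inner(1)[OF p(3) X2.W10D(2)[OF v] h_Lp(2)[OF v]])+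
    have J': "integrable M (\<lambda>x. N1 u v x * u x)" "integrable M (\<lambda>x. N2 u v x * v x)"
      using Hoelder_inner(1)[OF X1.r0(1) W10_Lr(1)[OF u] N_Lp(1)[OF u v]] Hoelder_inner(1)[OF X2.r0(1) W10_Lr(2)[OF v] N_Lp(2)[OF u v]] by simp_all
    have Li: "integrable M L" unfolding L_def using I \<gamma>i by simp
    have "(\<integral>x. L x \<partial>M) = (1 - c - e) * P - d * (pmod M p1 u + pmod M p2 v) - K"
      unfolding L_def P_def K_def pmod_def using I \<gamma>i O by (simp add: space_restrict_space algebra_simps)
    moreover have "(\<integral>x. L x \<partial>M) \<le> (\<integral>x. (h1 u x \<bullet> grad \<Omega> u x - N1 u v x * u x) + (h2 v x \<bullet> grad \<Omega> v x - N2 u v x * v x) \<partial>M)"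
    proof (rule integral_mono_AE[OF Li])
      show "AE x in M. L x \<le> (h1 u x \<bullet> grad \<Omega> u x - N1 u v x * u x) + (h2 v x \<bullet> grad \<Omega> v x - N2 u v x * v x)"
        using sign1 sign2
      proof eventually_elim
        fix x
        assume s1: "\<forall>s t \<xi> \<nu>. f1 x s t \<xi> \<nu> * s \<le> c1 * (norm \<xi> powr p1 + norm \<nu> powr p2) + d1 * (\<bar>s\<bar> powr p1 + \<bar>t\<bar> powr p2) + \<gamma>1 x"
          and s2: "\<forall>s t \<xi> \<nu>. f2 x s t \<xi> \<nu> * t \<le> c2 * (norm \<xi> powr p1 + norm \<nu> powr p2) + d2 * (\<bar>s\<bar> powr p1 + \<bar>t\<bar> powr p2) + \<gamma>2 x"
        have n1: "N1 u v x * u x \<le> c1 * (norm (grad \<Omega> u x) powr p1 + norm (grad \<Omega> v x) powr p2) + d1 * (\<bar>u x\<bar> powr p1 + \<bar>v x\<bar> powr p2) + \<gamma>1 x"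
          unfolding N1_def using s1 by blast
        have n2: "N2 u v x * v x \<le> c2 * (norm (grad \<Omega> u x) powr p1 + norm (grad \<Omega> v x) powr p2) + d2 * (\<bar>u x\<bar> powr p1 + \<bar>v x\<bar> powr p2) + \<gamma>2 x"
          unfolding N2_def using s2 by blast
        have g1: "h1 u x \<bullet> grad \<Omega> u x \<ge> norm (grad \<Omega> u x) powr p1 - (e * norm (grad \<Omega> u x) powr p1 + K1)"
        proof -
          have "\<mu>1 * norm (grad \<Omega> u x) powr q1 \<le> \<bar>\<mu>1\<bar> * norm (grad \<Omega> u x) powr q1" by (intro mult_right_mono) auto
          then show ?thesis using K1[of "norm (grad \<Omega> u x)"] by (simp add: h1_def inner_diff_left flux_inner_self)
        qed
        have g2: "h2 v x \<bullet> grad \<Omega> v x \<ge> norm (grad \<Omega> v x) powr p2 - (e * norm (grad \<Omega> v x) powr p2 + K2)"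
        proof -
          have "\<mu>2 * norm (grad \<Omega> v x) powr q2 \<le> \<bar>\<mu>2\<bar> * norm (grad \<Omega> v x) powr q2" by (intro mult_right_mono) auto
          then show ?thesis using K2[of "norm (grad \<Omega> v x)"] by (simp add: h2_def inner_diff_left flux_inner_self)
        qed
        show "L x \<le> (h1 u x \<bullet> grad \<Omega> u x - N1 u v x * u x) + (h2 v x \<bullet> grad \<Omega> v x - N2 u v x * v x)"
          using n1 n2 g1 g2 unfolding L_def c_def d_def by (simp add: algebra_simps)
      qed
    qed (use J J' in auto)
    moreover have "(\<integral>x. (h1 u x \<bullet> grad \<Omega> u x - N1 u v x * u x) + (h2 v x \<bullet> grad \<Omega> v x - N2 u v x * v x) \<partial>M) = A (u, v) (u, v)"
      unfolding A_eq using J J' by simp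
    moreover have "d * (pmod M p1 u + pmod M p2 v) \<le> d / l * P"
    proof -
      have "l * pmod M p1 u \<le> pmod M p1 (grad \<Omega> u)" "l * pmod M p2 v \<le> pmod M p2 (grad \<Omega> v)"
        by (rule order_trans[OF mult_right_mono X1.eigenvalue(2)[OF u]], auto simp: l_def)
           (rule order_trans[OF mult_right_mono X2.eigenvalue(2)[OF v]], auto simp: l_def)
      then have "l * (pmod M p1 u + pmod M p2 v) \<le> P" by (simp add: P_def distrib_left)
      then have "d / l * (l * (pmod M p1 u + pmod M p2 v)) \<le> d / l * P" using l d by (intro mult_left_mono) auto
      then show ?thesis using l by simp
    qed
    ultimately have "A (u, v) (u, v) \<ge> (1 - c - e) * P - d / l * P - K" by linarith
    also have "(1 - c - e) * P - d / l * P - K = e * P - K"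
    proof -
      have "1 - c - e - d / l = e" by (simp add: e_def field_simps)
      then show ?thesis by (simp only: left_diff_distrib[symmetric])
    qed
    finally show ?thesis by (simp add: P_def)
  qed
  show ?thesis by (rule exI[of _ e]) (use e main in blast)
qed

lemma comb_tendsto:
  assumes b: "\<And>j. j < k \<Longrightarrow> b j \<in> test_functions \<Omega>" and x: "\<And>j. j < k \<Longrightarrow> (\<lambda>n. x n j) \<longlonglongrightarrow> y j"
  shows "(\<lambda>n. comb b k (x n) z) \<longlonglongrightarrow> comb b k y z" "(\<lambda>n. cgrad (comb b k (x n)) z) \<longlonglongrightarrow> cgrad (comb b k y) z"
    "\<exists>B. \<forall>n z. \<bar>comb b k (x n) z\<bar> \<le> B \<and> norm (cgrad (comb b k (x n)) z) \<le> B"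
proof -
  have ct: "cgrad (comb b k x) w = (\<Sum>j<k. x j *\<^sub>R cgrad (b j) w)" for x w
    by (rule comb_test(2), rule b)
  show "(\<lambda>n. comb b k (x n) z) \<longlonglongrightarrow> comb b k y z" unfolding comb_apply by (intro tendsto_sum tendsto_mult tendsto_const x) simp
  show "(\<lambda>n. cgrad (comb b k (x n)) z) \<longlonglongrightarrow> cgrad (comb b k y) z" unfolding ct by (intro tendsto_sum tendsto_scaleR tendsto_const x) simp
  have "\<forall>j. \<exists>B. j < k \<longrightarrow> (\<forall>z. \<bar>b j z\<bar> \<le> B \<and> norm (cgrad (b j) z) \<le> B)"
  proof (intro allI)
    fix j
    show "\<exists>B. j < k \<longrightarrow> (\<forall>z. \<bar>b j z\<bar> \<le> B \<and> norm (cgrad (b j) z) \<le> B)"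
    proof (cases "j < k")
      case True
      obtain B1 B2 where "\<forall>z. \<bar>b j z\<bar> \<le> B1" "\<forall>z. norm (cgrad (b j) z) \<le> B2" using test_props(9,10)[OF b[OF True]] by blast
      then show ?thesis by (intro exI[of _ "max B1 B2"]) (simp add: le_max_iff_disj)
    qed simp
  qed
  from choice[OF this] obtain B where "\<forall>j. j < k \<longrightarrow> (\<forall>z. \<bar>b j z\<bar> \<le> B j \<and> norm (cgrad (b j) z) \<le> B j)" ..
  then have B: "\<And>j z. j < k \<Longrightarrow> \<bar>b j z\<bar> \<le> B j" "\<And>j z. j < k \<Longrightarrow> norm (cgrad (b j) z) \<le> B j" by simp_all
  have "\<forall>j. \<exists>D. j < k \<longrightarrow> (\<forall>n. \<bar>x n j\<bar> \<le> D)"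
  proof (intro allI)
    fix j
    show "\<exists>D. j < k \<longrightarrow> (\<forall>n. \<bar>x n j\<bar> \<le> D)"
      using convergent_imp_Bseq[OF convergentI[OF x[of j]]] by (cases "j < k") (auto simp: Bseq_def)
  qed
  from choice[OF this] obtain D where "\<forall>j. j < k \<longrightarrow> (\<forall>n. \<bar>x n j\<bar> \<le> D j)" ..
  then have D: "\<And>j n. j < k \<Longrightarrow> \<bar>x n j\<bar> \<le> D j" by simp
  define BB where "BB = (\<Sum>j<k. D j * B j)"
  have "\<bar>comb b k (x n) z\<bar> \<le> BB" "norm (cgrad (comb b k (x n)) z) \<le> BB" for n z
  proof -
    have D0: "D j \<ge> 0" if "j < k" for j using D[OF that, of 0] by linarith
    show "\<bar>comb b k (x n) z\<bar> \<le> BB" unfolding comb_apply BB_def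
      by (rule order_trans[OF sum_abs sum_mono]) (auto simp: abs_mult intro!: mult_mono D B D0)
    show "norm (cgrad (comb b k (x n)) z) \<le> BB" unfolding ct BB_def
      by (rule order_trans[OF norm_sum sum_mono]) (auto intro!: mult_mono D B D0)
  qed
  then show "\<exists>B. \<forall>n z. \<bar>comb b k (x n) z\<bar> \<le> B \<and> norm (cgrad (comb b k (x n)) z) \<le> B" by blast
qed

text \<open>On combinations of fixed test functions, convergence of coefficients is uniform convergence of functions and gradients, so
  the operator is continuous term by term.\<close>

lemma A_continuous_comb:
  assumes b: "\<And>j. j < k \<Longrightarrow> b j \<in> test_functions \<Omega>"
    and x: "\<And>j. j < k \<Longrightarrow> (\<lambda>n. x n j) \<longlonglongrightarrow> x0 j" and y: "\<And>j. j < k \<Longrightarrow> (\<lambda>n. y n j) \<longlonglongrightarrow> y0 j"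
    and \<phi>: "\<phi> \<in> test_functions \<Omega>" "\<psi> \<in> test_functions \<Omega>"
  shows "(\<lambda>n. A (comb b k (x n), comb b k (y n)) (\<phi>, \<psi>)) \<longlonglongrightarrow> A (comb b k x0, comb b k y0) (\<phi>, \<psi>)"
proof -
  have ct: "comb b k x \<in> test_functions \<Omega>" for x by (rule comb_test(1), rule b)
  have X: "(\<lambda>n. comb b k (x n) z) \<longlonglongrightarrow> comb b k x0 z" "(\<lambda>n. cgrad (comb b k (x n)) z) \<longlonglongrightarrow> cgrad (comb b k x0) z"
    "\<exists>B. \<forall>n z. \<bar>comb b k (x n) z\<bar> \<le> B \<and> norm (cgrad (comb b k (x n)) z) \<le> B" for z
    by (rule comb_tendsto, erule b, erule x)+
  have Y: "(\<lambda>n. comb b k (y n) z) \<longlonglongrightarrow> comb b k y0 z" "(\<lambda>n. cgrad (comb b k (y n)) z) \<longlonglongrightarrow> cgrad (comb b k y0) z"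
    "\<exists>B. \<forall>n z. \<bar>comb b k (y n) z\<bar> \<le> B \<and> norm (cgrad (comb b k (y n)) z) \<le> B" for z
    by (rule comb_tendsto, erule b, erule y)+
  obtain B1 where B1: "\<And>n z. \<bar>comb b k (x n) z\<bar> \<le> B1" "\<And>n z. norm (cgrad (comb b k (x n)) z) \<le> B1" using X(3) by blast
  obtain B2 where B2: "\<And>n z. \<bar>comb b k (y n) z\<bar> \<le> B2" "\<And>n z. norm (cgrad (comb b k (y n)) z) \<le> B2" using Y(3) by blast
  define B where "B = max B1 B2"
  have B: "\<And>n z. \<bar>comb b k (x n) z\<bar> \<le> B" "\<And>n z. \<bar>comb b k (y n) z\<bar> \<le> B"
     "\<And>n z. norm (cgrad (comb b k (x n)) z) \<le> B" "\<And>n z. norm (cgrad (comb b k (y n)) z) \<le> B"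
    using B1 B2 by (auto simp: B_def le_max_iff_disj)
  have pos: "r1 > 0" "r2 > 0" "p1 > 0" "p2 > 0" using X1.r0 X2.r0 X1.p0 X2.p0 by auto
  show ?thesis unfolding A_eq h1_def h2_def N1_def N2_def prod.case
    by (intro tendsto_add tendsto_diff
        flux_term_continuous[OF q(1,2) ct ct \<phi>(1) B(3) X(2)] flux_term_continuous[OF q(3,4) ct ct \<phi>(2) B(4) Y(2)]
        superposition_term_continuous[OF caratheodory(1) rq(1) C_pos(1) pos \<sigma>(1) growth1 ct ct ct ct \<phi>(1) B X(1) Y(1) X(2) Y(2)]
        superposition_term_continuous[OF caratheodory(2) rq(2) C_pos(2) pos \<sigma>(2) growth2 ct ct ct ct \<phi>(2) B X(1) Y(1) X(2) Y(2)])
qed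

lemma A_zero_on_span:
  assumes uv: "u \<in> W10 \<Omega> p1" "v \<in> W10 \<Omega> p2" and F: "F \<subseteq> test_functions \<Omega>"
    and z: "\<And>f. f \<in> F \<Longrightarrow> A (u, v) (f, 0) = 0" "\<And>f. f \<in> F \<Longrightarrow> A (u, v) (0, f) = 0"
    and \<phi>: "\<phi> \<in> span F" "\<psi> \<in> span F"
  shows "A (u, v) (\<phi>, \<psi>) = 0"
proof -
  note D = A_dual[OF uv] and s = dual_split[OF A_dual[OF uv]]
  have sub1: "subspace {f \<in> W10 \<Omega> p1. A (u, v) (f, 0) = 0}"
    unfolding subspace_def using X1.W.U0 X1.W.Uadd X1.W.Uscale dual_spaceD(1)[OF s(1)] dual_spaceD(2)[OF s(1)] dual_spaceD(2)[OF s(1) X1.W.U0, of 0]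
    by auto
  have sub2: "subspace {f \<in> W10 \<Omega> p2. A (u, v) (0, f) = 0}"
    unfolding subspace_def using X2.W.U0 X2.W.Uadd X2.W.Uscale dual_spaceD(1)[OF s(2)] dual_spaceD(2)[OF s(2)] dual_spaceD(2)[OF s(2) X2.W.U0, of 0]
    by auto
  have "span F \<subseteq> {f \<in> W10 \<Omega> p1. A (u, v) (f, 0) = 0}"
    by (rule span_minimal[OF _ sub1]) (use F z X1.test_W10 in blast)
  moreover have "span F \<subseteq> {f \<in> W10 \<Omega> p2. A (u, v) (0, f) = 0}"
    by (rule span_minimal[OF _ sub2]) (use F z X2.test_W10 in blast)
  ultimately have "\<phi> \<in> W10 \<Omega> p1" "A (u, v) (\<phi>, 0) = 0" "\<psi> \<in> W10 \<Omega> p2" "A (u, v) (0, \<psi>) = 0" using \<phi> by blast+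
  then show ?thesis using s(3) by simp
qed

lemma sum_lessThan_double: "(\<Sum>i<k + k. g i) = (\<Sum>i<k. g i) + (\<Sum>i<k. g (k + i))" for g :: "nat \<Rightarrow> real"
proof -
  have "(\<Sum>i<k + m. g i) = (\<Sum>i<k. g i) + (\<Sum>i<m. g (k + i))" for m by (induction m) auto
  then show ?thesis .
qed

text \<open>Testing with the approximation itself, coercivity bounds every zero by a constant independent of \<open>F\<close>. Coordinates
  with respect to the independent functions in \<open>F\<close> turn the restricted operator into a continuous vector field; where it
  does not point outwards, coercivity bounds the gradients and thereby the coordinates, so a large sphere is free of
  such points.\<close>

lemma Galerkin_step:
  "\<exists>T\<ge>0. \<forall>F. finite F \<longrightarrow> F \<subseteq> test_functions \<Omega> \<longrightarrow> independent F \<longrightarrow>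
    (\<exists>u\<in>span F. \<exists>v\<in>span F. u \<in> W10 \<Omega> p1 \<and> v \<in> W10 \<Omega> p2 \<and> pmod M p1 (grad \<Omega> u) \<le> T \<and> pmod M p2 (grad \<Omega> v) \<le> T \<and>
      (\<forall>\<phi>\<in>span F. \<forall>\<psi>\<in>span F. A (u, v) (\<phi>, \<psi>) = 0))"
proof -
  obtain \<kappa> K where \<kappa>: "\<kappa> > 0" and co: "\<And>u v. u \<in> W10 \<Omega> p1 \<Longrightarrow> v \<in> W10 \<Omega> p2 \<Longrightarrow>
     A (u, v) (u, v) \<ge> \<kappa> * (pmod M p1 (grad \<Omega> u) + pmod M p2 (grad \<Omega> v)) - K"
    using coercive by blast
  define T where "T = \<bar>K\<bar> / \<kappa>"
  have T: "T \<ge> 0" using \<kappa> by (simp add: T_def)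
  have small: "pmod M p1 (grad \<Omega> u) \<le> T \<and> pmod M p2 (grad \<Omega> v) \<le> T"
    if uv: "u \<in> W10 \<Omega> p1" "v \<in> W10 \<Omega> p2" and le: "A (u, v) (u, v) \<le> 0" for u v
  proof -
    have "\<kappa> * (pmod M p1 (grad \<Omega> u) + pmod M p2 (grad \<Omega> v)) \<le> \<bar>K\<bar>" using co[OF uv] le by linarith
    then have "pmod M p1 (grad \<Omega> u) + pmod M p2 (grad \<Omega> v) \<le> T" using \<kappa> by (simp add: T_def le_divide_eq mult.commute)
    then show ?thesis using pmod_nonneg[of M p1 "grad \<Omega> u"] pmod_nonneg[of M p2 "grad \<Omega> v"] by linarith
  qed
  have "\<exists>u\<in>span F. \<exists>v\<in>span F. u \<in> W10 \<Omega> p1 \<and> v \<in> W10 \<Omega> p2 \<and> pmod M p1 (grad \<Omega> u) \<le> T \<and> pmod M p2 (grad \<Omega> v) \<le> T \<and>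
      (\<forall>\<phi>\<in>span F. \<forall>\<psi>\<in>span F. A (u, v) (\<phi>, \<psi>) = 0)"
    if F: "finite F" "F \<subseteq> test_functions \<Omega>" "independent F" for F
  proof -
    have concl: ?thesis if u: "u \<in> span F" "u \<in> test_functions \<Omega>" and v: "v \<in> span F" "v \<in> test_functions \<Omega>"
      and z: "\<And>f. f \<in> F \<Longrightarrow> A (u, v) (f, 0) = 0" "\<And>f. f \<in> F \<Longrightarrow> A (u, v) (0, f) = 0" for u v
    proof -
      note w = X1.test_W10[OF u(2)] X2.test_W10[OF v(2)]
      have zs: "A (u, v) (\<phi>, \<psi>) = 0" if "\<phi> \<in> span F" "\<psi> \<in> span F" for \<phi> \<psi>
        by (rule A_zero_on_span[OF w F(2) _ _ that]) (rule z, assumption)+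
      show ?thesis using u v w zs small[OF w] zs[OF u(1) v(1)] by (intro bexI[of _ u] bexI[of _ v]) auto
    qed
    show ?thesis
    proof (cases "F = {}")
      case True
      then show ?thesis using concl[of 0 0] test_zero[of \<Omega>] by (simp add: span_zero zero_fun_def)
    next
      case False
      define k where "k = card F"
      have k: "k > 0" using F(1) False by (simp add: k_def card_gt_0_iff)
      obtain b where "bij_betw b {0..<card F} F" using ex_bij_betw_nat_finite[OF F(1)] by blast
      then have b: "inj_on b {..<k}" "b ` {..<k} = F" by (auto simp: bij_betw_def k_def atLeast0LessThan)
      have bF: "b j \<in> F" if "j < k" for j using b that by blast
      have bt: "b j \<in> test_functions \<Omega>" if "j < k" for j using bF[OF that] F(2) by blast
      have indep: "independent (b ` {..<k})" using F(3) b by simp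
      \<comment> \<open>the first \<open>k\<close> coordinates describe the first component, the next \<open>k\<close> the second\<close>
      define u v where "u = (\<lambda>x. comb b k x)" and "v = (\<lambda>x :: nat \<Rightarrow> real. comb b k (\<lambda>j. x (k + j)))"
      have ut: "u x \<in> test_functions \<Omega>" "v x \<in> test_functions \<Omega>" for x
        unfolding u_def v_def by (rule comb_test(1), rule bt, assumption)+
      note uW = X1.test_W10[OF ut(1)] and vW = X2.test_W10[OF ut(2)]
      define g where "g = (\<lambda>x i. if i < k then A (u x, v x) (b i, 0) else A (u x, v x) (0, b (i - k)))"
      obtain R1 where R1: "R1 \<ge> 0" "\<And>x. pmod M p1 (grad \<Omega> (comb b k x)) \<le> T \<Longrightarrow> (\<Sum>j<k. (x j)\<^sup>2) \<le> R1"
        using X1.coordinate_bound[OF bt b(1) indep] by blast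
      obtain R2 where R2: "R2 \<ge> 0" "\<And>x. pmod M p2 (grad \<Omega> (comb b k x)) \<le> T \<Longrightarrow> (\<Sum>j<k. (x j)\<^sup>2) \<le> R2"
        using X2.coordinate_bound[OF bt b(1) indep] by blast
      define R where "R = R1 + R2 + 1"
      have R: "R > 0" "R\<^sup>2 > R1 + R2"
      proof -
        show "R > 0" using R1 R2 by (simp add: R_def)
        have "R * 1 \<le> R * R" using R1 R2 by (intro mult_left_mono) (auto simp: R_def)
        then show "R\<^sup>2 > R1 + R2" by (simp add: R_def power2_eq_square)
      qed
      have "\<exists>x\<in>{x. \<forall>i\<ge>k + k. x i = 0}. \<forall>i<k + k. g x i = 0"
      proof (rule finite_dim_zero[OF _ R(1)])
        show "0 < k + k" using k by simp
        fix i assume i: "i < k + k"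
        show "continuous_on {x. \<forall>i\<ge>k + k. x i = 0} (\<lambda>x. g x i)"
        proof (rule continuous_on_sequentiallyI)
          fix s and x0 :: "nat \<Rightarrow> real" assume s: "s \<longlonglongrightarrow> x0"
          have cs: "(\<lambda>n. s n j) \<longlonglongrightarrow> x0 j" for j
            by (rule continuous_on_tendsto_compose[of UNIV "\<lambda>x. x j", OF continuous_on_product_coordinates s]) simp_all
          have z: "(0 :: 'a \<Rightarrow> real) \<in> test_functions \<Omega>" using test_zero[of \<Omega>] by (simp add: zero_fun_def)
          show "(\<lambda>n. g (s n) i) \<longlonglongrightarrow> g x0 i"
          proof (cases "i < k")
            case True
            then show ?thesis unfolding g_def u_def v_def
              using A_continuous_comb[OF bt cs cs bt[OF True] z] by simp
          next
            case False
            then have "i - k < k" using i by linarith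
            then show ?thesis unfolding g_def u_def v_def
              using False A_continuous_comb[OF bt cs cs z bt[OF \<open>i - k < k\<close>]] by simp
          qed
        qed
      next
        fix x assume x: "x \<in> {x. \<forall>i\<ge>k + k. x i = 0}" and xR: "(\<Sum>i<k + k. (x i)\<^sup>2) = R\<^sup>2"
        note s = dual_split[OF A_dual[OF uW[of x] vW[of x]]]
        have "A (u x, v x) (u x, 0) = (\<Sum>j<k. x j * A (u x, v x) (b j, 0))"
          using dual_comb[OF s(1) X1.W.U0 X1.W.Uadd X1.W.Uscale, of k b x] X1.test_W10[OF bt] by (simp add: u_def)
        moreover have "A (u x, v x) (0, v x) = (\<Sum>j<k. x (k + j) * A (u x, v x) (0, b j))"
          using dual_comb[OF s(2) X2.W.U0 X2.W.Uadd X2.W.Uscale, of k b "\<lambda>j. x (k + j)"] X2.test_W10[OF bt] by (simp add: v_def)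
        ultimately have eq: "(\<Sum>i<k + k. g x i * x i) = A (u x, v x) (u x, v x)"
          using s(3)[OF uW vW] by (simp add: sum_lessThan_double g_def mult.commute)
        show "(\<Sum>i<k + k. g x i * x i) > 0"
        proof (rule ccontr)
          assume "\<not> ?thesis"
          then have "A (u x, v x) (u x, v x) \<le> 0" by (simp add: eq)
          from small[OF uW vW this] have "(\<Sum>j<k. (x j)\<^sup>2) \<le> R1" "(\<Sum>j<k. (x (k + j))\<^sup>2) \<le> R2"
            using R1(2)[of x] R2(2)[of "\<lambda>j. x (k + j)"] by (auto simp: u_def v_def)
          then show False using xR R(2) by (simp add: sum_lessThan_double)
        qed
      qed
      then obtain x where x: "\<And>i. i < k + k \<Longrightarrow> g x i = 0" by blast
      show ?thesis
      proof (rule concl[of "u x" "v x"])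
        show "u x \<in> span F" "v x \<in> span F" unfolding u_def v_def by (rule comb_in_span, rule bF, assumption)+
        fix f assume "f \<in> F"
        then obtain j where j: "j < k" "f = b j" using b by blast
        show "A (u x, v x) (f, 0) = 0" using x[of j] j by (simp add: g_def)
        show "A (u x, v x) (0, f) = 0" using x[of "k + j"] j by (simp add: g_def)
      qed (rule ut)+
    qed
  qed
  then show ?thesis using T by blast
qed

text \<open>Bounded functionals that vanish on an increasing sequence of subspaces with dense union tend to zero at every point, and
  reflexivity turns this into weak convergence in the dual. The energy condition follows, as the operator at an approximation
  vanishes on that approximation.\<close>

theorem generalized_solution_exists:
  "\<exists>u v. (u, v) \<in> X \<and> generalized_solution \<Omega> p1 p2 q1 q2 f1 f2 \<mu>1 \<mu>2 (u, v)"
proof -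
  obtain T where T: "T \<ge> 0" and step: "\<And>F. finite F \<Longrightarrow> F \<subseteq> test_functions \<Omega> \<Longrightarrow> independent F \<Longrightarrow>
    \<exists>u\<in>span F. \<exists>v\<in>span F. u \<in> W10 \<Omega> p1 \<and> v \<in> W10 \<Omega> p2 \<and> pmod M p1 (grad \<Omega> u) \<le> T \<and> pmod M p2 (grad \<Omega> v) \<le> T \<and>
      (\<forall>\<phi>\<in>span F. \<forall>\<psi>\<in>span F. A (u, v) (\<phi>, \<psi>) = 0)"
    using Galerkin_step by blast
  obtain S where S: "countable S" "S \<subseteq> test_functions \<Omega>"
    "\<And>\<phi> e. \<phi> \<in> test_functions \<Omega> \<Longrightarrow> e > 0 \<Longrightarrow> \<exists>s\<in>S. \<forall>x\<in>\<Omega>. norm (cgrad \<phi> x - cgrad s x) < e"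
    using countable_dense_gradients by blast
  obtain B where B: "B \<subseteq> S" "independent B" "S \<subseteq> span B" using maximal_independent_subset[of S] by blast
  have cB: "countable B" using B(1) S(1) countable_subset by blast
  \<comment> \<open>finite independent sets exhausting the family, so each member is in some span\<close>
  define F where "F = (\<lambda>n. {b \<in> B. to_nat_on B b \<le> n})"
  have finF: "finite (F n)" for n
  proof (rule inj_on_finite[of "to_nat_on B" _ "{..n}"])
    show "inj_on (to_nat_on B) (F n)" using inj_on_to_nat_on[OF cB] by (rule inj_on_subset) (auto simp: F_def)
  qed (auto simp: F_def)
  have FB: "F n \<subseteq> B" for n by (auto simp: F_def)
  have Fmono: "F m \<subseteq> F n" if "m \<le> n" for m n using that by (auto simp: F_def)
  have cover: "\<exists>m. s \<in> span (F m)" if s: "s \<in> S" for s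
  proof -
    have "s \<in> span B" using s B(3) by blast
    then obtain t c where t: "finite t" "t \<subseteq> B" "s = (\<Sum>a\<in>t. c a *\<^sub>R a)" unfolding span_explicit by blast
    obtain m where "\<forall>i\<in>to_nat_on B ` t. i \<le> m" using t(1) finite_nat_set_iff_bounded_le[of "to_nat_on B ` t"] by auto
    then have "t \<subseteq> F m" using t(2) by (auto simp: F_def)
    then have "s \<in> span (F m)" unfolding t(3) by (intro span_sum span_scale span_base) auto
    then show ?thesis by blast
  qed
  have "\<exists>u v. u \<in> span (F n) \<and> v \<in> span (F n) \<and> u \<in> W10 \<Omega> p1 \<and> v \<in> W10 \<Omega> p2 \<and> pmod M p1 (grad \<Omega> u) \<le> T \<and> pmod M p2 (grad \<Omega> v) \<le> T \<and>
      (\<forall>\<phi>\<in>span (F n). \<forall>\<psi>\<in>span (F n). A (u, v) (\<phi>, \<psi>) = 0)" for n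
  proof -
    have "F n \<subseteq> test_functions \<Omega>" using FB B(1) S(2) by blast
    moreover have "independent (F n)" by (rule independent_mono[OF B(2) FB])
    ultimately show ?thesis using step[OF finF[of n]] by blast
  qed
  then obtain u v where uv: "\<And>n. u n \<in> span (F n)" "\<And>n. v n \<in> span (F n)" "\<And>n. u n \<in> W10 \<Omega> p1" "\<And>n. v n \<in> W10 \<Omega> p2"
    "\<And>n. pmod M p1 (grad \<Omega> (u n)) \<le> T" "\<And>n. pmod M p2 (grad \<Omega> (v n)) \<le> T"
    "\<And>n \<phi> \<psi>. \<phi> \<in> span (F n) \<Longrightarrow> \<psi> \<in> span (F n) \<Longrightarrow> A (u n, v n) (\<phi>, \<psi>) = 0" by metis
  obtain K where K: "K \<ge> 0" and Kb: "\<And>n \<phi> \<psi>. \<phi> \<in> W10 \<Omega> p1 \<Longrightarrow> \<psi> \<in> W10 \<Omega> p2 \<Longrightarrow>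
      \<bar>A (u n, v n) (\<phi>, \<psi>)\<bar> \<le> K * (W10_norm \<Omega> p1 \<phi> + W10_norm \<Omega> p2 \<psi>)"
    using A_bounded[OF T] uv(3-6) by meson
  have dense1: "\<exists>s\<in>S. s \<in> W10 \<Omega> p1 \<and> W10_norm \<Omega> p1 (\<phi> - s) \<le> e" if \<phi>: "\<phi> \<in> W10 \<Omega> p1" and e: "e > 0" for \<phi> e
  proof -
    have "\<exists>s\<in>S. pmod M p1 (\<lambda>x. grad \<Omega> \<phi> x - grad \<Omega> s x) < e powr p1"
      by (rule uniform_gradient_close[OF S(2) _ X1.sobolev_space_axioms \<phi>]) (use S(3) e in auto)
    then obtain s where s: "s \<in> S" "pmod M p1 (\<lambda>x. grad \<Omega> \<phi> x - grad \<Omega> s x) < e powr p1" by blast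
    have sW: "s \<in> W10 \<Omega> p1" using s(1) S(2) X1.test_W10 by blast
    have "pmod M p1 (grad \<Omega> (\<phi> - s)) powr (1 / p1) \<le> (e powr p1) powr (1 / p1)"
      using s(2) X1.p0 by (intro powr_mono2) (auto simp: X1.W.pmod_D_diff[OF \<phi> sW])
    then show ?thesis using s(1) sW e X1.p0 by (intro bexI[of _ s]) (auto simp: W10_norm_def Lp_norm_pmod powr_powr)
  qed
  have dense2: "\<exists>s\<in>S. s \<in> W10 \<Omega> p2 \<and> W10_norm \<Omega> p2 (\<phi> - s) \<le> e" if \<phi>: "\<phi> \<in> W10 \<Omega> p2" and e: "e > 0" for \<phi> e
  proof -
    have "\<exists>s\<in>S. pmod M p2 (\<lambda>x. grad \<Omega> \<phi> x - grad \<Omega> s x) < e powr p2"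
      by (rule uniform_gradient_close[OF S(2) _ X2.sobolev_space_axioms \<phi>]) (use S(3) e in auto)
    then obtain s where s: "s \<in> S" "pmod M p2 (\<lambda>x. grad \<Omega> \<phi> x - grad \<Omega> s x) < e powr p2" by blast
    have sW: "s \<in> W10 \<Omega> p2" using s(1) S(2) X2.test_W10 by blast
    have "pmod M p2 (grad \<Omega> (\<phi> - s)) powr (1 / p2) \<le> (e powr p2) powr (1 / p2)"
      using s(2) X2.p0 by (intro powr_mono2) (auto simp: X2.W.pmod_D_diff[OF \<phi> sW])
    then show ?thesis using s(1) sW e X2.p0 by (intro bexI[of _ s]) (auto simp: W10_norm_def Lp_norm_pmod powr_powr)
  qed
  \<comment> \<open>approximate the point from the dense span, where the operator vanishes for large \<open>n\<close>\<close>
  have to0: "(\<lambda>n. A (u n, v n) (\<phi>, \<psi>)) \<longlonglongrightarrow> 0" if \<phi>: "\<phi> \<in> W10 \<Omega> p1" and \<psi>: "\<psi> \<in> W10 \<Omega> p2" for \<phi> \<psi>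
  proof (rule LIMSEQ_I)
    fix e :: real assume e: "e > 0"
    define e' where "e' = e / 4 / (K + 1)"
    have e': "e' > 0" using e K by (simp add: e'_def)
    obtain s1 where s1: "s1 \<in> S" "s1 \<in> W10 \<Omega> p1" "W10_norm \<Omega> p1 (\<phi> - s1) \<le> e'" using dense1[OF \<phi> e'] by blast
    obtain s2 where s2: "s2 \<in> S" "s2 \<in> W10 \<Omega> p2" "W10_norm \<Omega> p2 (\<psi> - s2) \<le> e'" using dense2[OF \<psi> e'] by blast
    obtain m1 m2 where m: "s1 \<in> span (F m1)" "s2 \<in> span (F m2)" using cover s1(1) s2(1) by blast
    show "\<exists>no. \<forall>n\<ge>no. norm (A (u n, v n) (\<phi>, \<psi>) - 0) < e"
    proof (intro exI[of _ "max m1 m2"] allI impI)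
      fix n assume n: "n \<ge> max m1 m2"
      have "s1 \<in> span (F n)" "s2 \<in> span (F n)" using m n span_mono[OF Fmono, of m1 n] span_mono[OF Fmono, of m2 n] by auto
      then have z: "A (u n, v n) (s1, s2) = 0" by (rule uv(7))
      have d: "(\<phi> - s1, \<psi> - s2) \<in> X" "(s1, s2) \<in> X"
        using X1.W.Udiff[OF \<phi> s1(2)] X2.W.Udiff[OF \<psi> s2(2)] s1(2) s2(2) by (auto simp: Xmem)
      have "A (u n, v n) ((\<phi> - s1, \<psi> - s2) + (s1, s2)) = A (u n, v n) (\<phi> - s1, \<psi> - s2)"
        using dual_spaceD(1)[OF A_dual[OF uv(3,4)] d] z by simp
      moreover have "(\<phi> - s1, \<psi> - s2) + (s1, s2) = (\<phi>, \<psi>)" by simp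
      ultimately have "\<bar>A (u n, v n) (\<phi>, \<psi>)\<bar> \<le> K * (W10_norm \<Omega> p1 (\<phi> - s1) + W10_norm \<Omega> p2 (\<psi> - s2))"
        using Kb[of "\<phi> - s1" "\<psi> - s2" n] d(1) by (simp only: Xmem)
      also have "\<dots> \<le> (K + 1) * (e' + e')" using s1(3) s2(3) K e' norm_nn by (intro mult_mono add_mono) auto
      also have "(K + 1) * (e' + e') = 2 * ((K + 1) * e')" by simp
      also have "(K + 1) * e' = e / 4" proof -
        have "K + 1 \<noteq> 0" using K by simp
        then show ?thesis unfolding e'_def by (metis nonzero_mult_div_cancel_left times_divide_eq_right)
      qed
      also have "2 * (e / 4) < e" using e by simp
      finally show "norm (A (u n, v n) (\<phi>, \<psi>) - 0) < e" by simp
    qed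
  qed
  define R where "R = max (T powr (1 / p1)) (T powr (1 / p2))"
  have R1: "W10_norm \<Omega> p1 (u n) \<le> R" for n
  proof -
    have "W10_norm \<Omega> p1 (u n) \<le> T powr (1 / p1)" unfolding W10_norm_def Lp_norm_pmod
      using uv(5)[of n] X1.p0 by (intro powr_mono2) auto
    then show ?thesis by (simp add: R_def)
  qed
  have R2: "W10_norm \<Omega> p2 (v n) \<le> R" for n
  proof -
    have "W10_norm \<Omega> p2 (v n) \<le> T powr (1 / p2)" unfolding W10_norm_def Lp_norm_pmod
      using uv(6)[of n] X2.p0 by (intro powr_mono2) auto
    then show ?thesis by (simp add: R_def)
  qed
  obtain k w where k: "strict_mono k" and w: "weakly_converges X nX (\<lambda>n. (u (k n), v (k n))) w"
    using weak_compactness_X[of u v R, OF uv(3,4) R1 R2] by blast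
  obtain w1 w2 where w12: "w = (w1, w2)" by (cases w)
  have wX: "w1 \<in> W10 \<Omega> p1" "w2 \<in> W10 \<Omega> p2" using w by (auto simp: weakly_converges_def w12 Xmem)
  have to0': "(\<lambda>n. A (u (k n), v (k n)) (\<phi>, \<psi>)) \<longlonglongrightarrow> 0" if "\<phi> \<in> W10 \<Omega> p1" "\<psi> \<in> W10 \<Omega> p2" for \<phi> \<psi>
    using LIMSEQ_subseq_LIMSEQ[OF to0[OF that] k] by (simp add: comp_def)
  have weak_dual: "weakly_converges (dual_space X nX) (dual_norm X nX) (\<lambda>n. A (u (k n), v (k n))) 0"
    unfolding weakly_converges_def
  proof (intro conjI allI ballI)
    show "A (u (k n), v (k n)) \<in> dual_space X nX" for n by (rule A_dual[OF uv(3,4)])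
    show z: "0 \<in> dual_space X nX" using zero_dual by (simp add: zero_fun_def)
    fix L assume L: "L \<in> dual_space (dual_space X nX) (dual_norm X nX)"
    obtain \<phi> \<psi> where pp: "(\<phi>, \<psi>) \<in> X" "\<And>G. G \<in> dual_space X nX \<Longrightarrow> L G = G (\<phi>, \<psi>)" using reflexive_X[OF L] by blast
    have "L (A (u (k n), v (k n))) = A (u (k n), v (k n)) (\<phi>, \<psi>)" for n by (rule pp(2)[OF A_dual[OF uv(3,4)]])
    moreover have "L 0 = 0" using pp(2)[OF z] by (simp add: zero_fun_def)
    ultimately show "(\<lambda>n. L (A (u (k n), v (k n)))) \<longlonglongrightarrow> L 0" using to0' pp(1) by (simp add: Xmem)
  qed
  have energy: "(\<lambda>n. A (u (k n), v (k n)) ((u (k n), v (k n)) - w)) \<longlonglongrightarrow> 0"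
  proof -
    have "A (u m, v m) ((u m, v m) - w) = - A (u m, v m) (w1, w2)" for m
    proof -
      have wX': "(w1, w2) \<in> X" "(-1) *\<^sub>R (w1, w2) \<in> X" "(u m, v m) \<in> X"
        using wX uv(3,4) X1.W.Uscale[OF wX(1), of "-1"] X2.W.Uscale[OF wX(2), of "-1"] by (auto simp: Xmem)
      have "(u m, v m) - w = (u m, v m) + (-1) *\<^sub>R (w1, w2)" by (simp add: w12)
      then have "A (u m, v m) ((u m, v m) - w) = A (u m, v m) (u m, v m) + A (u m, v m) ((-1) *\<^sub>R (w1, w2))"
        using dual_spaceD(1)[OF A_dual[OF uv(3,4)] wX'(3,2)] by simp
      also have "A (u m, v m) ((-1) *\<^sub>R (w1, w2)) = (-1) * A (u m, v m) (w1, w2)"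
        by (rule dual_spaceD(2)[OF A_dual[OF uv(3,4)] wX'(1)])
      also have "A (u m, v m) (u m, v m) = 0" by (rule uv(7)[OF uv(1,2)])
      finally show ?thesis by simp
    qed
    then show ?thesis using tendsto_minus[OF to0'[OF wX]] by simp
  qed
  have "generalized_solution \<Omega> p1 p2 q1 q2 f1 f2 \<mu>1 \<mu>2 w"
    unfolding generalized_solution_def Let_def
    using w weak_dual energy wX uv(3,4)
    by (intro conjI exI[of _ "\<lambda>n. (u (k n), v (k n))"]) (auto simp: w12 Xmem)
  then show ?thesis using wX by (auto simp: w12 Xmem)
qed

end

theorem theorem4p1:
  fixes \<Omega> :: "(real ^ 'n) set"
    and p1 p2 q1 q2 C1 C2 c1 c2 d1 d2 :: real
    and f1 f2 :: "real ^ 'n \<Rightarrow> real \<Rightarrow> real \<Rightarrow> real ^ 'n \<Rightarrow> real ^ 'n \<Rightarrow> real"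
    and \<sigma>1 \<sigma>2 \<gamma>1 \<gamma>2 :: "real ^ 'n \<Rightarrow> real"
  assumes dim: "CARD('n) \<ge> 2"
    and domain: "bounded_domain \<Omega>" "lipschitz_boundary \<Omega>"
    and exponents: "1 < q1" "q1 < p1" "p1 < CARD('n)" "1 < q2" "q2 < p2" "p2 < CARD('n)"
    and caratheodory: "caratheodory \<Omega> f1" "caratheodory \<Omega> f2"
    and C_pos: "C1 > 0" "C2 > 0"
    and \<sigma>1: "\<sigma>1 \<in> Lp_space (lebesgue_on \<Omega>) (conj_exp (sobolev_exp CARD('n) p1))"
    and \<sigma>2: "\<sigma>2 \<in> Lp_space (lebesgue_on \<Omega>) (conj_exp (sobolev_exp CARD('n) p2))"
    and growth1: "AE x in lebesgue_on \<Omega>. \<forall>s t \<xi> \<nu>. \<bar>f1 x s t \<xi> \<nu>\<bar> \<le>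
        C1 * (\<bar>s\<bar> powr (sobolev_exp CARD('n) p1 - 1)
            + \<bar>t\<bar> powr (sobolev_exp CARD('n) p2 / conj_exp (sobolev_exp CARD('n) p1))
            + norm \<xi> powr (p1 / conj_exp (sobolev_exp CARD('n) p1))
            + norm \<nu> powr (p2 / conj_exp (sobolev_exp CARD('n) p1))) + \<sigma>1 x"
    and growth2: "AE x in lebesgue_on \<Omega>. \<forall>s t \<xi> \<nu>. \<bar>f2 x s t \<xi> \<nu>\<bar> \<le>
        C2 * (\<bar>s\<bar> powr (sobolev_exp CARD('n) p1 / conj_exp (sobolev_exp CARD('n) p2))
            + \<bar>t\<bar> powr (sobolev_exp CARD('n) p2 - 1)
            + norm \<xi> powr (p1 / conj_exp (sobolev_exp CARD('n) p2))
            + norm \<nu> powr (p2 / conj_exp (sobolev_exp CARD('n) p2))) + \<sigma>2 x"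
    and cd_pos: "c1 > 0" "c2 > 0" "d1 > 0" "d2 > 0"
    and cd_small: "c1 + c2 + (d1 + d2) * (1 / min (first_eigenvalue \<Omega> p1) (first_eigenvalue \<Omega> p2)) < 1"
    and \<gamma>: "\<gamma>1 \<in> Lp_space (lebesgue_on \<Omega>) 1" "\<gamma>2 \<in> Lp_space (lebesgue_on \<Omega>) 1"
    and sign1: "AE x in lebesgue_on \<Omega>. \<forall>s t \<xi> \<nu>. f1 x s t \<xi> \<nu> * s \<le>
        c1 * (norm \<xi> powr p1 + norm \<nu> powr p2) + d1 * (\<bar>s\<bar> powr p1 + \<bar>t\<bar> powr p2) + \<gamma>1 x"
    and sign2: "AE x in lebesgue_on \<Omega>. \<forall>s t \<xi> \<nu>. f2 x s t \<xi> \<nu> * t \<le>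
        c2 * (norm \<xi> powr p1 + norm \<nu> powr p2) + d2 * (\<bar>s\<bar> powr p1 + \<bar>t\<bar> powr p2) + \<gamma>2 x"
  shows "\<forall>\<mu>1 \<mu>2. \<exists>u v. (u, v) \<in> X_space \<Omega> p1 p2 \<and>
           generalized_solution \<Omega> p1 p2 q1 q2 f1 f2 \<mu>1 \<mu>2 (u, v)"
proof (intro allI)
  fix \<mu>1 \<mu>2 :: real
  let ?r1 = "sobolev_exp CARD('n) p1" and ?r2 = "sobolev_exp CARD('n) p2"
  have N: "DIM(real ^ 'n) = CARD('n)" by simp
  \<comment> \<open>the diagonal exponents of the growth condition fit the pattern of the others\<close>
  have conj: "r - 1 = r / conj_exp r" if "r > 1" for r using that by (simp add: conj_exp_def)
  interpret PS: product_space \<Omega> p1 p2 ?r1 ?r2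
    using domain(1) dim exponents by unfold_locales (auto simp: bounded_domain_def)
  have r: "?r1 > 1" "?r2 > 1" using PS.X1.r0 PS.X2.r0 by auto
  interpret dirichlet_system \<Omega> p1 p2 ?r1 ?r2 q1 q2 C1 C2 c1 c2 d1 d2 \<mu>1 \<mu>2 f1 f2 \<sigma>1 \<sigma>2 \<gamma>1 \<gamma>2
  proof unfold_locales
    show "AE x in lebesgue_on \<Omega>. \<forall>s t \<xi> \<nu>. \<bar>f1 x s t \<xi> \<nu>\<bar> \<le>
        C1 * (\<bar>s\<bar> powr (?r1 / conj_exp ?r1) + \<bar>t\<bar> powr (?r2 / conj_exp ?r1)
            + norm \<xi> powr (p1 / conj_exp ?r1) + norm \<nu> powr (p2 / conj_exp ?r1)) + \<sigma>1 x"
      using growth1 unfolding conj[OF r(1)] .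
    show "AE x in lebesgue_on \<Omega>. \<forall>s t \<xi> \<nu>. \<bar>f2 x s t \<xi> \<nu>\<bar> \<le>
        C2 * (\<bar>s\<bar> powr (?r1 / conj_exp ?r2) + \<bar>t\<bar> powr (?r2 / conj_exp ?r2)
            + norm \<xi> powr (p1 / conj_exp ?r2) + norm \<nu> powr (p2 / conj_exp ?r2)) + \<sigma>2 x"
      using growth2 unfolding conj[OF r(2)] .
  qed (fact exponents caratheodory C_pos \<sigma>1 \<sigma>2 cd_pos cd_small \<gamma> sign1 sign2)+
  show "\<exists>u v. (u, v) \<in> X_space \<Omega> p1 p2 \<and> generalized_solution \<Omega> p1 p2 q1 q2 f1 f2 \<mu>1 \<mu>2 (u, v)"
    by (rule generalized_solution_exists)
qed

end
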